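(* Let $s>\frac32$ and $\mu\in(0,1)$. Consider the Cauchy problem $$\partial_t\zeta+\partial_x v+\varepsilon\partial_x(\zeta v)=0,\qquad \partial_t v+\mathcal T_\mu(D)\partial_x\zeta+\varepsilon v\partial_x v=0,\qquad (\zeta,v)(0)=(\zeta_0,v_0),$$ with $(\zeta_0,v_0)\in V^s_{\sqrt\mu}(\mathbb R)$ and assume there is $h_0\in(0,1)$ with $1+\varepsilon\zeta_0(x)\ge h_0$ for all $x\in\mathbb R$. Then there is a constant $c>0$ independent of $\varepsilon,\mu$ such that, if $0<\varepsilon\le c\,\|(\zeta_0,v_0)\|^{-1}_{V^s_{\sqrt\mu}}$ and $T=c\,\|(\zeta_0,v_0)\|^{-1}_{V^s_{\sqrt\mu}}$, the problem admits a unique solution $$(\zeta,v)\in C([0,T/\varepsilon];V^s_{\sqrt\mu}(\mathbb R))\cap C^1([0,T/\varepsilon];V^{s-1}_{\sqrt\mu}(\mathbb R)),$$ satisfying $\sup_{t\in[0,T/\varepsilon]}\|(\zeta,v)(t)\|_{V^s_{\sqrt\mu}}\lesssim\|(\zeta_0,v_0)\|_{V^s_{\sqrt\mu}}$. Moreover, the solution depends continuously on the initial data (in $V^s_{\sqrt\mu}$).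
   Context: Notation. For a function $m:\mathbb R\to\mathbb R$, $m(D)$ denotes the Fourier multiplier defined by $\widehat{m(D)f}(\xi)=m(\xi)\hat f(\xi)$. We write $\langle\xi\rangle=(1+\xi^2)^{1/2}$, $J^s=\langle D\rangle^s$, and $H^s(\mathbb R)$ for the Sobolev space with norm $\|f\|_{H^s}=\|J^sf\|_{L^2}$. $D^s$ is the multiplier with symbol $|\xi|^s$. For $\mu>0$ set $T_\mu(\xi)=\frac{\tanh(\sqrt\mu|\xi|)}{\sqrt\mu|\xi|}$ (with $T_\mu(0)=1$), and $\mathcal T_\mu(D)$ is the multiplier with symbol $T_\mu$. $a\lesssim b$ means $a\le Cb$ with $C$ independent of $\mu,\varepsilon$. The space $V^s_{\sqrt\mu}(\mathbb R)$ consists of pairs $(\zeta,v)$ with finite norm $\|(\zeta,v)\|^2_{V^s_{\sqrt\mu}}=\|\zeta\|_{H^s}^2+\|v\|_{H^s}^2+\sqrt\mu\|D^{1/2}v\|_{H^s}^2$. *)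

theory Defs
  imports "HOL-Analysis.Analysis"
begin

definition jbr :: "real \<Rightarrow> real" where
  "jbr \<xi> = sqrt (1 + \<xi>\<^sup>2)"

definition sq_int :: "(real \<Rightarrow> real) \<Rightarrow> bool" where
  "sq_int f \<longleftrightarrow> f \<in> borel_measurable lborel \<and> integrable lborel (\<lambda>x. (f x)\<^sup>2)"

definition csq_int :: "(real \<Rightarrow> complex) \<Rightarrow> bool" where
  "csq_int g \<longleftrightarrow> g \<in> borel_measurable lborel \<and> integrable lborel (\<lambda>x. (cmod (g x))\<^sup>2)"

text \<open>Fourier transform of the truncation f 1_[-R,R] (unitary convention,
  f(x) = (2 pi)^(-1/2) int e^(i x xi) hat f(xi) d xi, so that D = -i d/dx has symbol xi).\<close>
definition trunc_ft :: "(real \<Rightarrow> real) \<Rightarrow> real \<Rightarrow> real \<Rightarrow> complex" where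
  "trunc_ft f R \<xi> = complex_of_real (1 / sqrt (2 * pi)) *
     (LINT x:{-R..R}|lborel. complex_of_real (f x) * cis (- (x * \<xi>)))"

definition is_FT :: "(real \<Rightarrow> real) \<Rightarrow> (real \<Rightarrow> complex) \<Rightarrow> bool" where
  "is_FT f g \<longleftrightarrow> sq_int f \<and> csq_int g \<and>
     ((\<lambda>R. \<integral>\<^sup>+\<xi>. ennreal ((cmod (trunc_ft f R \<xi> - g \<xi>))\<^sup>2) \<partial>lborel) \<longlongrightarrow> 0) at_top"

definition FT :: "(real \<Rightarrow> real) \<Rightarrow> real \<Rightarrow> complex" where
  "FT f = (SOME g. is_FT f g)"

definition wint :: "(real \<Rightarrow> real) \<Rightarrow> (real \<Rightarrow> real) \<Rightarrow> ennreal" where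
  "wint w f = (\<integral>\<^sup>+\<xi>. ennreal (w \<xi> * (cmod (FT f \<xi>))\<^sup>2) \<partial>lborel)"

definition Hs :: "real \<Rightarrow> (real \<Rightarrow> real) \<Rightarrow> bool" where
  "Hs s f \<longleftrightarrow> (\<exists>g. is_FT f g) \<and> wint (\<lambda>\<xi>. jbr \<xi> powr (2 * s)) f < \<infinity>"

definition Hs_norm :: "real \<Rightarrow> (real \<Rightarrow> real) \<Rightarrow> real" where
  "Hs_norm s f = sqrt (enn2real (wint (\<lambda>\<xi>. jbr \<xi> powr (2 * s)) f))"

definition Dhalf_Hs_norm :: "real \<Rightarrow> (real \<Rightarrow> real) \<Rightarrow> real" where
  "Dhalf_Hs_norm s f = sqrt (enn2real (wint (\<lambda>\<xi>. jbr \<xi> powr (2 * s) * \<bar>\<xi>\<bar>) f))"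

definition V_space :: "real \<Rightarrow> real \<Rightarrow> (real \<Rightarrow> real) \<Rightarrow> (real \<Rightarrow> real) \<Rightarrow> bool" where
  "V_space s \<mu> \<zeta> v \<longleftrightarrow> Hs s \<zeta> \<and> Hs s v \<and>
     wint (\<lambda>\<xi>. jbr \<xi> powr (2 * s) * \<bar>\<xi>\<bar>) v < \<infinity>"

definition V_norm :: "real \<Rightarrow> real \<Rightarrow> (real \<Rightarrow> real) \<Rightarrow> (real \<Rightarrow> real) \<Rightarrow> real" where
  "V_norm s \<mu> \<zeta> v = sqrt ((Hs_norm s \<zeta>)\<^sup>2 + (Hs_norm s v)\<^sup>2 + sqrt \<mu> * (Dhalf_Hs_norm s v)\<^sup>2)"

definition Tmu :: "real \<Rightarrow> real \<Rightarrow> real" where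
  "Tmu \<mu> \<xi> = (if \<xi> = 0 then 1 else tanh (sqrt \<mu> * \<bar>\<xi>\<bar>) / (sqrt \<mu> * \<bar>\<xi>\<bar>))"

definition test_fun :: "(real \<Rightarrow> real) \<Rightarrow> (real \<Rightarrow> real) \<Rightarrow> bool" where
  "test_fun \<phi> \<phi>' \<longleftrightarrow> (\<forall>x. (\<phi> has_real_derivative \<phi>' x) (at x)) \<and> continuous_on UNIV \<phi>' \<and>
     (\<exists>R. \<forall>x. \<bar>x\<bar> > R \<longrightarrow> \<phi> x = 0)"

text \<open>(zeta, v) in C([0,Tf]; V^s) \<inter> C^1([0,Tf]; V^{s-1}) solves the system on [0,Tf],
  the equations holding in V^{s-1} (tested against test functions; the nonlinear
  term v v_x is written as (v^2/2)_x), with initial datum (zeta0, v0).\<close>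
definition is_solution :: "real \<Rightarrow> real \<Rightarrow> real \<Rightarrow> real \<Rightarrow> (real \<Rightarrow> real) \<Rightarrow> (real \<Rightarrow> real)
    \<Rightarrow> (real \<Rightarrow> real \<Rightarrow> real) \<Rightarrow> (real \<Rightarrow> real \<Rightarrow> real) \<Rightarrow> bool" where
  "is_solution s \<mu> \<epsilon> Tf \<zeta>0 v0 \<zeta> v \<longleftrightarrow>
     \<zeta> 0 = \<zeta>0 \<and> v 0 = v0 \<and>
     (\<forall>t\<in>{0..Tf}. V_space s \<mu> (\<zeta> t) (v t)) \<and>
     (\<forall>t\<in>{0..Tf}. ((\<lambda>t'. V_norm s \<mu> (\<lambda>x. \<zeta> t' x - \<zeta> t x) (\<lambda>x. v t' x - v t x)) \<longlongrightarrow> 0)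
                      (at t within {0..Tf})) \<and>
     (\<exists>\<zeta>' v'.
        (\<forall>t\<in>{0..Tf}. V_space (s - 1) \<mu> (\<zeta>' t) (v' t)) \<and>
        (\<forall>t\<in>{0..Tf}. ((\<lambda>t'. V_norm (s - 1) \<mu> (\<lambda>x. \<zeta>' t' x - \<zeta>' t x) (\<lambda>x. v' t' x - v' t x)) \<longlongrightarrow> 0)
                      (at t within {0..Tf})) \<and>
        (\<forall>t\<in>{0..Tf}. ((\<lambda>t'. V_norm (s - 1) \<mu>
                          (\<lambda>x. (\<zeta> t' x - \<zeta> t x) / (t' - t) - \<zeta>' t x)
                          (\<lambda>x. (v t' x - v t x) / (t' - t) - v' t x)) \<longlongrightarrow> 0)
                      (at t within {0..Tf})) \<and>
        (\<forall>t\<in>{0..Tf}. \<exists>w. is_FT w (\<lambda>\<xi>. \<i> * complex_of_real (\<xi> * Tmu \<mu> \<xi>) * FT (\<zeta> t) \<xi>) \<and>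
           (\<forall>\<phi> \<phi>'. test_fun \<phi> \<phi>' \<longrightarrow>
              (\<integral>x. \<zeta>' t x * \<phi> x \<partial>lborel) =
                (\<integral>x. (v t x + \<epsilon> * \<zeta> t x * v t x) * \<phi>' x \<partial>lborel) \<and>
              (\<integral>x. v' t x * \<phi> x \<partial>lborel) =
                - (\<integral>x. w x * \<phi> x \<partial>lborel) + \<epsilon> * (\<integral>x. ((v t x)\<^sup>2 / 2) * \<phi>' x \<partial>lborel))))"

end

theory Submission
  imports Defs "HOL-Probability.Probability"
begin

text \<open>After scaling by \<open>\<epsilon>\<close> the claim concerns data of small size \<open>\<delta>\<close> on times of order \<open>1/\<delta>\<close>.
  Writing \<open>\<zeta> = q + q\<^sup>2/4\<close>, so that \<open>1 + \<zeta> = (1 + q/2)\<^sup>2\<close>, turns the system into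
  \<open>q\<^sub>t = - v\<^sub>x - q v\<^sub>x/2 - v q\<^sub>x\<close>, \<open>v\<^sub>t = - T \<partial>\<^sub>x (q + q\<^sup>2/4) - v v\<^sub>x\<close>, which is quadratic and
  symmetric for the norm of \<open>(\<langle>D\<rangle>\<^sup>s q, \<langle>D\<rangle>\<^sup>s T\<^sup>-\<^sup>1\<^sup>/\<^sup>2 v)\<close>, equivalent to the \<open>V\<^sup>s\<close> norm uniformly in \<open>\<mu>\<close>.
  On the Fourier side every nonlinearity is a bilinear integral operator. The commutator structure
  gives an energy inequality \<open>d/dt \<parallel>w X\<parallel>\<^sup>2 \<le> C \<parallel>X\<parallel> \<parallel>w X\<parallel>\<^sup>2\<close> for all slowly varying weights \<open>w\<close>, uniformly under
  frequency truncation, and an \<open>L\<^sup>2\<close> inequality for differences of solutions. Truncated solutions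
  therefore converge; weights concentrating at high frequencies control the tails uniformly and give
  convergence and continuous dependence in the strong norm. Uniqueness follows from the \<open>L\<^sup>2\<close>
  inequality after a continuity argument that keeps \<open>\<zeta>\<close> in the range where \<open>\<zeta> \<mapsto> q\<close> is defined.\<close>

abbreviation "cx \<equiv> complex_of_real"
abbreviation "meas \<equiv> borel_measurable borel"
abbreviation "meas2 \<equiv> borel_measurable (borel \<Otimes>\<^sub>M borel)"
abbreviation NNL :: "(real => ennreal) => ennreal" (binder "NN " 10) where
  "NNL f \<equiv> nn_integral lborel f"

section \<open>Square integrable functions\<close>

lemma cnj_measurable [measurable]: "cnj \<in> meas"
  by (intro borel_measurable_continuous_onI continuous_intros)

lemma csq_intD [measurable_dest]: "csq_int f ==> f \<in> borel_measurable lborel"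
  by (simp add: csq_int_def)

lemma csq_int_iff_nn_integral:
  "csq_int f \<longleftrightarrow> f \<in> borel_measurable lborel \<and> (NN x. ennreal ((cmod (f x))^2)) < \<infinity>"
  by (auto simp: csq_int_def integrable_iff_bounded)

lemma csq_int_bound:
  assumes "integrable lborel h" "f \<in> borel_measurable lborel" "\<And>x. (cmod (f x))^2 <= h x"
  shows "csq_int f"
  unfolding csq_int_def
proof (intro conjI Bochner_Integration.integrable_bound[OF assms(1)])
  show "AE x in lborel. norm ((cmod (f x))^2) <= norm (h x)"
    using assms(3) by (intro AE_I2) (auto intro: order_trans[OF _ abs_ge_self])
qed (use assms(2) in measurable)

lemma cmod_add_sq_le: "(cmod (a + b))^2 <= 2 * (cmod a)^2 + 2 * (cmod b)^2"
proof -
  have "(cmod (a + b))^2 <= (cmod a + cmod b)^2"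
    by (intro power_mono norm_triangle_ineq) auto
  also have "... <= 2 * (cmod a)^2 + 2 * (cmod b)^2"
    using sum_squares_bound[of "cmod a" "cmod b"] by (simp add: power2_sum)
  finally show ?thesis .
qed

lemma csq_int_add: "csq_int f ==> csq_int g ==> csq_int (\<lambda>x. f x + g x)"
  by (rule csq_int_bound[where h = "\<lambda>x. 2 * (cmod (f x))^2 + 2 * (cmod (g x))^2"])
     (auto simp: csq_int_def intro: cmod_add_sq_le)

lemma csq_int_mult_bounded:
  assumes "csq_int f" "m \<in> borel_measurable lborel" "\<And>x. cmod (m x) <= C"
  shows "csq_int (\<lambda>x. m x * f x)"
proof -
  have "(cmod (m x * f x))^2 <= C^2 * (cmod (f x))^2" for x
    unfolding norm_mult power_mult_distrib by (intro mult_right_mono power_mono assms) auto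
  then show ?thesis
    using assms(1,2) by (intro csq_int_bound[where h = "\<lambda>x. C^2 * (cmod (f x))^2"]) (auto simp: csq_int_def)
qed

lemma csq_int_cmult: "csq_int f ==> csq_int (\<lambda>x. c * f x)"
  by (rule csq_int_mult_bounded[where C = "cmod c"]) auto

lemma csq_int_uminus: "csq_int f ==> csq_int (\<lambda>x. - f x)"
  using csq_int_cmult[of f "-1"] by simp

lemma csq_int_diff: "csq_int f ==> csq_int g ==> csq_int (\<lambda>x. f x - g x)"
  using csq_int_add[OF _ csq_int_uminus, of f g] by simp

lemma csq_int_0 [simp]: "csq_int (\<lambda>x. 0)"
  by (auto simp: csq_int_def)

lemma csq_int_cnj: "csq_int f ==> csq_int (\<lambda>x. cnj (f x))"
  by (auto simp: csq_int_def)

lemma csq_int_cong_AE: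
  assumes "csq_int f" "g \<in> borel_measurable lborel" "AE x in lborel. f x = g x"
  shows "csq_int g"
proof -
  have "(NN x. ennreal ((cmod (f x))^2)) = (NN x. ennreal ((cmod (g x))^2))"
    using assms(3) by (intro nn_integral_cong_AE) auto
  then show ?thesis using assms by (simp add: csq_int_iff_nn_integral)
qed

lemma csq_int_mult_integrable:
  assumes "csq_int f" "csq_int g"
  shows "integrable lborel (\<lambda>x. f x * g x)"
proof (rule Bochner_Integration.integrable_bound)
  show "integrable lborel (\<lambda>x. (cmod (f x))^2 + (cmod (g x))^2)"
    using assms by (auto simp: csq_int_def)
  have "cmod (f x * g x) <= (cmod (f x))^2 + (cmod (g x))^2" for x
    using sum_squares_bound[of "cmod (f x)" "cmod (g x)"] mult_nonneg_nonneg[OF norm_ge_zero norm_ge_zero, of "f x" "g x"]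
    unfolding norm_mult mult.assoc by linarith
  then show "AE x in lborel. cmod (f x * g x) <= norm ((cmod (f x))^2 + (cmod (g x))^2)"
    by (intro AE_I2) auto
qed (use assms in \<open>auto simp: csq_int_def\<close>)

definition L2norm :: "(real => complex) => real" where
  "L2norm f = sqrt (LBINT x. (cmod (f x))^2)"

lemma L2norm_nonneg [simp]: "0 <= L2norm f"
  by (simp add: L2norm_def)

lemma L2norm_sq: "(L2norm f)^2 = (LBINT x. (cmod (f x))^2)"
  by (simp add: L2norm_def)

lemma L2norm_minus_commute: "L2norm (\<lambda>x. f x - g x) = L2norm (\<lambda>x. g x - f x)"
  by (simp add: L2norm_def norm_minus_commute)

lemma nn_integral_csq: "csq_int f ==> (NN x. ennreal ((cmod (f x))^2)) = ennreal ((L2norm f)^2)"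
  unfolding L2norm_sq by (intro nn_integral_eq_integral) (auto simp: csq_int_def)

lemma ennreal_sq_le_imp_le:
  assumes "a^2 <= (ennreal b)^2" "b \<ge> 0" shows "a <= ennreal b"
proof (cases a)
  case (real r)
  then have "r^2 <= b^2" using assms by (simp add: ennreal_power ennreal_le_iff del: power_mono_iff)
  then show ?thesis using real assms(2) by (auto intro: ennreal_leI power2_le_imp_le)
next
  case top
  have "a^2 < \<top>" using assms(2) by (intro le_less_trans[OF assms(1)]) (simp add: ennreal_power)
  then show ?thesis using top by (simp add: power2_eq_square)
qed

lemma nn_integral_csq_mult_le:
  assumes "csq_int f" "csq_int g"
  shows "(NN x. ennreal (cmod (f x)) * ennreal (cmod (g x))) <= ennreal (L2norm f * L2norm g)"
proof (rule ennreal_sq_le_imp_le)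
  note [measurable] = csq_intD[OF assms(1)] csq_intD[OF assms(2)]
  have "(NN x. ennreal (cmod (f x)) * ennreal (cmod (g x)))^2
      <= (NN x. (ennreal (cmod (f x)))^2) * (NN x. (ennreal (cmod (g x)))^2)"
    by (rule Cauchy_Schwarz_nn_integral) measurable
  then show "(NN x. ennreal (cmod (f x)) * ennreal (cmod (g x)))^2 <= (ennreal (L2norm f * L2norm g))^2"
    by (simp add: ennreal_power nn_integral_csq assms ennreal_mult'[symmetric] power_mult_distrib)
qed simp

lemma integral_norm_mult_le_L2norm:
  assumes "csq_int f" "csq_int g"
  shows "(LBINT x. cmod (f x * g x)) <= L2norm f * L2norm g"
proof -
  have nn_integral_eq: "ennreal (LBINT x. cmod (f x * g x)) = (NN x. ennreal (cmod (f x)) * ennreal (cmod (g x)))"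
    by (subst nn_integral_eq_integral[OF integrable_norm[OF csq_int_mult_integrable[OF assms]], symmetric])
      (auto simp: norm_mult ennreal_mult')
  show ?thesis
    using nn_integral_csq_mult_le[OF assms] unfolding nn_integral_eq[symmetric] by (subst (asm) ennreal_le_iff) simp_all
qed

lemma L2norm_Cauchy_Schwarz:
  "csq_int f ==> csq_int g ==> cmod (LBINT x. f x * g x) <= L2norm f * L2norm g"
  by (rule order_trans[OF integral_norm_bound integral_norm_mult_le_L2norm])

lemma L2norm_triangle:
  assumes f: "csq_int f" and g: "csq_int g"
  shows "L2norm (\<lambda>x. f x + g x) <= L2norm f + L2norm g"
proof (rule power2_le_imp_le)
  have integrable_sq: "integrable lborel (\<lambda>x. (cmod (f x))^2)" "integrable lborel (\<lambda>x. (cmod (g x))^2)"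
    using f g by (simp_all add: csq_int_def)
  note integrable_sq = integrable_sq integrable_norm[OF csq_int_mult_integrable[OF f g]]
  have "(L2norm (\<lambda>x. f x + g x))^2 <= (LBINT x. (cmod (f x))^2 + (cmod (g x))^2 + 2 * cmod (f x * g x))"
    unfolding L2norm_sq
  proof (rule integral_mono)
    show "(cmod (f x + g x))^2 <= (cmod (f x))^2 + (cmod (g x))^2 + 2 * cmod (f x * g x)" for x
      using power_mono[OF norm_triangle_ineq norm_ge_zero, of "f x" "g x" 2] by (simp add: power2_sum norm_mult)
  qed (use integrable_sq csq_int_add[OF f g] in \<open>auto simp: csq_int_def\<close>)
  also have "... = (L2norm f)^2 + (L2norm g)^2 + 2 * (LBINT x. cmod (f x * g x))"
    using integrable_sq by (simp add: L2norm_sq)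
  also have "... <= (L2norm f + L2norm g)^2"
    using integral_norm_mult_le_L2norm[OF f g] by (simp add: power2_sum)
  finally show "(L2norm (\<lambda>x. f x + g x))^2 <= (L2norm f + L2norm g)^2" .
qed simp

lemma L2norm_triangle_diff:
  assumes "csq_int f" "csq_int g" "csq_int h"
  shows "L2norm (\<lambda>x. f x - h x) <= L2norm (\<lambda>x. f x - g x) + L2norm (\<lambda>x. g x - h x)"
  using L2norm_triangle[OF csq_int_diff[OF assms(1,2)] csq_int_diff[OF assms(2,3)]] by simp

lemma L2norm_eq_0:
  assumes "csq_int f" "L2norm f = 0" shows "AE x in lborel. f x = 0"
proof -
  have "AE x in lborel. (cmod (f x))^2 = 0"
    using assms by (subst integral_nonneg_eq_0_iff_AE[symmetric]) (auto simp: csq_int_def L2norm_def)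
  then show ?thesis by eventually_elim simp
qed

subsection \<open>Completeness\<close>

lemma L2norm_Fatou:
  assumes f: "\<And>k. csq_int (f k)" and g: "g \<in> borel_measurable lborel"
    and lim: "AE x in lborel. (\<lambda>k. f k x) \<longlonglongrightarrow> g x"
    and C: "\<forall>\<^sub>F k in sequentially. L2norm (f k) <= C" "0 <= C"
  shows "csq_int g" "L2norm g <= C"
proof -
  note [measurable] = csq_intD[OF f]
  have "(NN x. ennreal ((cmod (g x))^2)) = (NN x. liminf (\<lambda>k. ennreal ((cmod (f k x))^2)))"
  proof (rule nn_integral_cong_AE)
    show "AE x in lborel. ennreal ((cmod (g x))^2) = liminf (\<lambda>k. ennreal ((cmod (f k x))^2))"
      using lim
      by eventually_elim (intro lim_imp_Liminf[symmetric] tendsto_ennrealI tendsto_intros, auto)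
  qed
  also have "... <= liminf (\<lambda>k. NN x. ennreal ((cmod (f k x))^2))"
    by (rule nn_integral_liminf) simp
  also have "... <= ennreal (C^2)"
  proof (rule Liminf_le)
    show "\<forall>\<^sub>F k in sequentially. (NN x. ennreal ((cmod (f k x))^2)) <= ennreal (C^2)"
      using C(1) by eventually_elim (auto simp: nn_integral_csq f intro!: ennreal_leI power_mono)
  qed simp
  finally have bound: "(NN x. ennreal ((cmod (g x))^2)) <= ennreal (C^2)" .
  then show csq: "csq_int g" using g by (auto simp: csq_int_iff_nn_integral intro: le_less_trans)
  show "L2norm g <= C"
    using bound unfolding nn_integral_csq[OF csq] by (intro power2_le_imp_le[OF _ C(2)]) simp
qed

lemma csq_int_std_normal_density: "csq_int (\<lambda>x. cx (std_normal_density x))"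
proof (rule csq_int_bound[where h = std_normal_density])
  fix x
  have "1 / sqrt (2 * pi) <= 1" using pi_ge_two by simp
  then have "std_normal_density x <= 1" unfolding std_normal_density_def by (intro mult_le_one) auto
  then show "(cmod (cx (std_normal_density x)))^2 <= std_normal_density x"
    by (simp add: power2_eq_square mult_left_le)
qed auto

text \<open>Multiplication by a square integrable weight reduces this to the corresponding statement in \<open>L\<^sup>1\<close>.\<close>
lemma L2_Cauchy_AE_convergent_subseq:
  assumes f: "\<And>n. csq_int (f n)"
    and Cauchy: "\<And>e. e > 0 ==> \<exists>N. \<forall>m\<ge>N. \<forall>n\<ge>N. L2norm (\<lambda>x. f m x - f n x) < e"
  obtains r :: "nat => nat" where "strict_mono r" "AE x in lborel. convergent (\<lambda>k. f (r k) x)"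
proof -
  let ?w = "\<lambda>x. cx (std_normal_density x)"
  note w = csq_int_std_normal_density
  have small: "\<exists>N. \<forall>m\<ge>N. \<forall>n\<ge>N. (LBINT x. cmod (?w x * f m x - ?w x * f n x)) < e" if "e > 0" for e
  proof -
    define d where "d = e / (L2norm ?w + 1)"
    have "L2norm ?w + 1 > 0" by (simp add: add_nonneg_pos)
    then have d: "d > 0" "L2norm ?w * d < e"
      using \<open>e > 0\<close> by (simp_all add: d_def pos_divide_less_eq mult.commute)
    obtain N where N: "\<And>m n. m \<ge> N ==> n \<ge> N ==> L2norm (\<lambda>x. f m x - f n x) < d"
      using Cauchy[OF d(1)] by blast
    have "(LBINT x. cmod (?w x * f m x - ?w x * f n x)) < e" if "m \<ge> N" "n \<ge> N" for m n
    proof -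
      have "(LBINT x. cmod (?w x * (f m x - f n x))) <= L2norm ?w * d"
        using mult_left_mono[OF less_imp_le[OF N[OF that]], of "L2norm ?w"]
        by (intro order_trans[OF integral_norm_mult_le_L2norm] w csq_int_diff f) simp_all
      then show ?thesis using d(2) by (simp only: right_diff_distrib)
    qed
    then show ?thesis by blast
  qed
  obtain r where r: "strict_mono r" "AE x in lborel. Cauchy (\<lambda>k. ?w x * f (r k) x)"
    by (rule cauchy_L1_AE_cauchy_subseq[OF csq_int_mult_integrable[OF w f] small])
  have "AE x in lborel. convergent (\<lambda>k. f (r k) x)"
    using r(2)
  proof eventually_elim
    case (elim x)
    have "?w x \<noteq> 0" using normal_density_pos[of 1 0 x] by simp
    moreover from elim obtain l where "(\<lambda>k. ?w x * f (r k) x) \<longlonglongrightarrow> l"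
      by (auto simp: Cauchy_convergent_iff convergent_def)
    ultimately have "(\<lambda>k. f (r k) x) \<longlonglongrightarrow> l / ?w x"
      using tendsto_divide[OF _ tendsto_const, of _ l sequentially "?w x"] by fastforce
    then show ?case by (rule convergentI)
  qed
  with r(1) show thesis by (rule that)
qed

definition pointwise_lim :: "(nat => real => complex) => real => complex" where
  "pointwise_lim f x = (if convergent (\<lambda>k. f k x) then lim (\<lambda>k. f k x) else 0)"

lemma tendsto_pointwise_lim: "convergent (\<lambda>k. f k x) ==> (\<lambda>k. f k x) \<longlonglongrightarrow> pointwise_lim f x"
  by (simp add: pointwise_lim_def convergent_LIMSEQ_iff)

lemma pointwise_lim_measurable:
  assumes [measurable]: "\<And>k. f k \<in> borel_measurable lborel"
  shows "pointwise_lim f \<in> borel_measurable lborel"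
proof -
  have "{x\<in>space lborel. convergent (\<lambda>k. f k x)} \<in> sets lborel"
    unfolding Cauchy_convergent_iff[symmetric] by (intro sets_Collect_Cauchy assms)
  then show ?thesis
    unfolding pointwise_lim_def[abs_def] by (intro measurable_If borel_measurable_lim_metric assms) auto
qed

lemma pointwise_lim_cnj:
  assumes "\<And>k. f k (- x) = cnj (f k x)"
  shows "pointwise_lim f (- x) = cnj (pointwise_lim f x)"
proof (cases "convergent (\<lambda>k. f k x)")
  case True
  then have "(\<lambda>k. f k (- x)) \<longlonglongrightarrow> cnj (pointwise_lim f x)"
    unfolding assms by (intro tendsto_cnj tendsto_pointwise_lim)
  then show ?thesis by (auto simp: pointwise_lim_def[of f "- x"] intro: limI convergentI)
next
  case False
  then have "\<not> convergent (\<lambda>k. f k (- x))"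
    unfolding convergent_def assms lim_cnj by (metis complex_cnj_cnj lim_cnj)
  then show ?thesis using False by (simp add: pointwise_lim_def)
qed

theorem Riesz_Fischer:
  assumes f: "\<And>n. csq_int (f n)"
    and Cauchy: "\<And>e. e > 0 ==> \<exists>N. \<forall>m\<ge>N. \<forall>n\<ge>N. L2norm (\<lambda>x. f m x - f n x) < e"
  obtains r :: "nat => nat" and g where "strict_mono r" "g = pointwise_lim (\<lambda>k. f (r k))" "csq_int g"
    "AE x in lborel. (\<lambda>k. f (r k) x) \<longlonglongrightarrow> g x" "(\<lambda>n. L2norm (\<lambda>x. f n x - g x)) \<longlonglongrightarrow> 0"
proof -
  obtain r :: "nat => nat" where r: "strict_mono r" and conv: "AE x in lborel. convergent (\<lambda>k. f (r k) x)"
    by (rule L2_Cauchy_AE_convergent_subseq[OF f Cauchy])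
  define g where "g = pointwise_lim (\<lambda>k. f (r k))"
  have g_meas: "g \<in> borel_measurable lborel"
    unfolding g_def by (intro pointwise_lim_measurable csq_intD f)
  have lim: "AE x in lborel. (\<lambda>k. f (r k) x) \<longlonglongrightarrow> g x"
    using conv unfolding g_def by eventually_elim (rule tendsto_pointwise_lim)
  have dist: "\<exists>N. \<forall>n\<ge>N. csq_int (\<lambda>x. f n x - g x) \<and> L2norm (\<lambda>x. f n x - g x) <= e" if "e > 0" for e
  proof -
    obtain N where N: "\<And>m n. m \<ge> N ==> n \<ge> N ==> L2norm (\<lambda>x. f m x - f n x) < e"
      using Cauchy[OF \<open>e > 0\<close>] by blast
    have "csq_int (\<lambda>x. f n x - g x) \<and> L2norm (\<lambda>x. f n x - g x) <= e" if n: "n \<ge> N" for n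
    proof -
      have "AE x in lborel. (\<lambda>k. f n x - f (r k) x) \<longlonglongrightarrow> f n x - g x"
        using lim by eventually_elim (intro tendsto_intros)
      moreover have "\<forall>\<^sub>F k in sequentially. L2norm (\<lambda>x. f n x - f (r k) x) <= e"
        using eventually_ge_at_top[of N]
        by eventually_elim
          (use n in \<open>auto intro!: less_imp_le N order_trans[OF _ strict_mono_imp_increasing[OF r]]\<close>)
      ultimately show ?thesis
        using L2norm_Fatou[OF csq_int_diff[OF f f]] csq_intD[OF f] g_meas \<open>e > 0\<close> by auto
    qed
    then show ?thesis by blast
  qed
  obtain n where "csq_int (\<lambda>x. f n x - g x)" using dist[of 1] by auto
  from csq_int_diff[OF f this, of n] have "csq_int g" by simp
  moreover have "(\<lambda>n. L2norm (\<lambda>x. f n x - g x)) \<longlonglongrightarrow> 0"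
  proof (rule LIMSEQ_I)
    fix e :: real assume "e > 0"
    then obtain N where "\<forall>n\<ge>N. L2norm (\<lambda>x. f n x - g x) <= e / 2" using dist[of "e / 2"] by auto
    with \<open>e > 0\<close> show "\<exists>N. \<forall>n\<ge>N. norm (L2norm (\<lambda>x. f n x - g x) - 0) < e"
      by (intro exI[of _ N]) force
  qed
  ultimately show thesis using that[OF r g_def _ lim] by blast
qed

subsection \<open>The Hilbert space of Hermitian square integrable functions\<close>

definition herm_sq_int :: "(real => complex) => bool" where
  "herm_sq_int f \<longleftrightarrow> csq_int f \<and> (\<forall>x. f (- x) = cnj (f x))"

text \<open>Fourier transforms of real square integrable functions: Hermitian functions modulo null sets.\<close>
quotient_type hl2 = "real => complex" / partial: "\<lambda>f g. herm_sq_int f \<and> herm_sq_int g \<and> (AE x in lborel. f x = g x)"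
proof (rule part_equivpI)
  show "\<exists>x. herm_sq_int x \<and> herm_sq_int x \<and> (AE xa in lborel. x xa = x xa)"
    by (rule exI[of _ "\<lambda>_. 0"]) (simp add: herm_sq_int_def)
  show "symp (\<lambda>f g. herm_sq_int f \<and> herm_sq_int g \<and> (AE x in lborel. f x = g x))"
    by (auto intro!: sympI)
  show "transp (\<lambda>f g. herm_sq_int f \<and> herm_sq_int g \<and> (AE x in lborel. f x = g x))"
    by (intro transpI) (auto elim!: eventually_elim2)
qed

instantiation hl2 :: real_vector
begin

lift_definition zero_hl2 :: hl2 is "\<lambda>_. 0" by (simp add: herm_sq_int_def)

lift_definition plus_hl2 :: "hl2 => hl2 => hl2" is "\<lambda>f g x. f x + g x"
  by (auto simp: herm_sq_int_def csq_int_add)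

lift_definition minus_hl2 :: "hl2 => hl2 => hl2" is "\<lambda>f g x. f x - g x"
  by (auto simp: herm_sq_int_def csq_int_diff)

lift_definition uminus_hl2 :: "hl2 => hl2" is "\<lambda>f x. - f x"
  by (auto simp: herm_sq_int_def csq_int_uminus)

lift_definition scaleR_hl2 :: "real => hl2 => hl2" is "\<lambda>c f x. cx c * f x"
  by (auto simp: herm_sq_int_def csq_int_cmult)

instance
proof
  fix x y z :: hl2 and a b :: real
  show "x + y + z = x + (y + z)" by transfer (auto simp: herm_sq_int_def csq_int_add algebra_simps)
  show "x + y = y + x" by transfer (auto simp: herm_sq_int_def csq_int_add algebra_simps)
  show "0 + x = x" by transfer (auto simp: herm_sq_int_def)
  show "- x + x = 0" by transfer (auto simp: herm_sq_int_def)
  show "x - y = x + - y" by transfer (auto simp: herm_sq_int_def csq_int_diff)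
  show "a *\<^sub>R (x + y) = a *\<^sub>R x + a *\<^sub>R y"
    by transfer (auto simp: herm_sq_int_def ring_distribs intro!: csq_int_add csq_int_cmult)
  show "(a + b) *\<^sub>R x = a *\<^sub>R x + b *\<^sub>R x"
    by transfer (auto simp: herm_sq_int_def ring_distribs intro!: csq_int_add csq_int_cmult)
  show "a *\<^sub>R b *\<^sub>R x = (a * b) *\<^sub>R x" by transfer (auto simp: herm_sq_int_def mult.assoc intro!: csq_int_cmult)
  show "1 *\<^sub>R x = x" by transfer (auto simp: herm_sq_int_def)
qed

end

instantiation hl2 :: real_inner
begin

lift_definition inner_hl2 :: "hl2 => hl2 => real" is "\<lambda>f g. Re (LBINT x. f x * cnj (g x))"
proof -
  fix f f' g g' :: "real => complex"
  assume related: "herm_sq_int f \<and> herm_sq_int f' \<and> (AE x in lborel. f x = f' x)"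
    "herm_sq_int g \<and> herm_sq_int g' \<and> (AE x in lborel. g x = g' x)"
  have "(LBINT x. f x * cnj (g x)) = (LBINT x. f' x * cnj (g' x))"
    using related by (intro integral_cong_AE borel_measurable_integrable csq_int_mult_integrable csq_int_cnj)
      (auto simp: herm_sq_int_def)
  then show "Re (LBINT x. f x * cnj (g x)) = Re (LBINT x. f' x * cnj (g' x))" by simp
qed

definition "norm_hl2 (x::hl2) = sqrt (inner x x)"
definition "dist_hl2 (x::hl2) y = norm (x - y)"
definition "sgn_hl2 (x::hl2) = x /\<^sub>R norm x"
definition [code del]: "(uniformity :: (hl2 \<times> hl2) filter) = (INF e\<in>{0 <..}. principal {(x, y). dist x y < e})"
definition [code del]: "open (U :: hl2 set) = (\<forall>x\<in>U. eventually (\<lambda>(x', y). x' = x \<longrightarrow> y \<in> U) uniformity)"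

instance
proof
  fix x y z :: hl2 and r :: real and U :: "hl2 set"
  show "dist x y = norm (x - y)" by (simp add: dist_hl2_def)
  show "sgn x = x /\<^sub>R norm x" by (simp add: sgn_hl2_def)
  show "(uniformity :: (hl2 \<times> hl2) filter) = (INF e\<in>{0 <..}. principal {(x, y). dist x y < e})"
    by (simp add: uniformity_hl2_def)
  show "open U = (\<forall>x\<in>U. eventually (\<lambda>(x', y). x' = x \<longrightarrow> y \<in> U) uniformity)"
    by (simp add: open_hl2_def)
  show "inner x y = inner y x"
  proof transfer
    fix f g :: "real => complex"
    have "(LBINT x. g x * cnj (f x)) = cnj (LBINT x. f x * cnj (g x))"
      by (subst Bochner_Integration.integral_cnj[symmetric]) (simp add: mult.commute)
    then show "Re (LBINT x. f x * cnj (g x)) = Re (LBINT x. g x * cnj (f x))"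
      by simp
  qed
  show "inner (x + y) z = inner x z + inner y z"
    by transfer (auto simp: ring_distribs csq_int_mult_integrable csq_int_cnj herm_sq_int_def)
  show "inner (r *\<^sub>R x) y = r * inner x y"
    by transfer (auto simp: mult.assoc)
  have self_inner: "(LBINT x. f x * cnj (f x)) = of_real (LBINT x. (cmod (f x))^2)" for f :: "real => complex"
    by (subst integral_complex_of_real[symmetric]) (simp add: complex_norm_square del: of_real_power)
  show "0 <= inner x x" by transfer (simp add: self_inner)
  show "(inner x x = 0) = (x = 0)"
    by transfer (auto simp: self_inner integral_nonneg_eq_0_iff_AE csq_int_def herm_sq_int_def)
  show "norm x = sqrt (inner x x)" by (simp add: norm_hl2_def)
qed

end

lift_definition L2_of :: "(real => complex) => hl2" is "\<lambda>f. if herm_sq_int f then f else (\<lambda>_. 0)"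
  by (auto simp: herm_sq_int_def)

definition fun_of :: "hl2 => real => complex" where "fun_of x = rep_hl2 x"

lemma herm_sq_int_fun_of: "herm_sq_int (fun_of x)"
  unfolding fun_of_def using Quotient3_rel_rep[OF Quotient3_hl2, of x x] by auto

lemma csq_int_fun_of: "csq_int (fun_of x)" using herm_sq_int_fun_of by (simp add: herm_sq_int_def)
lemma fun_of_minus [simp]: "fun_of x (- t) = cnj (fun_of x t)" using herm_sq_int_fun_of by (simp add: herm_sq_int_def)
lemma fun_of_measurable [measurable]: "fun_of x \<in> meas"
  using csq_int_fun_of[of x] by (simp add: csq_int_def)

lemma L2_of_fun_of [simp]: "L2_of (fun_of x) = x"
proof -
  have "abs_hl2 (rep_hl2 x) = x" using Quotient3_abs_rep[OF Quotient3_hl2] .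
  then show ?thesis using herm_sq_int_fun_of[of x] by (simp add: L2_of_def fun_of_def)
qed

lemma fun_of_L2_of: "herm_sq_int f ==> AE x in lborel. fun_of (L2_of f) x = f x"
  using Quotient3_rep_abs[OF Quotient3_hl2, of f] by (simp add: L2_of_def fun_of_def)

lemma L2_of_eqI: "herm_sq_int f ==> herm_sq_int g ==> (AE x in lborel. f x = g x) ==> L2_of f = L2_of g"
  by transfer auto

lemma hl2_eqI: "(AE t in lborel. fun_of x t = fun_of y t) ==> x = y"
  using L2_of_eqI[OF herm_sq_int_fun_of herm_sq_int_fun_of, of x y] by simp

lemma herm_sq_int_add: "herm_sq_int f ==> herm_sq_int g ==> herm_sq_int (\<lambda>x. f x + g x)"
  by (auto simp: herm_sq_int_def csq_int_add)
lemma herm_sq_int_diff: "herm_sq_int f ==> herm_sq_int g ==> herm_sq_int (\<lambda>x. f x - g x)"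
  by (auto simp: herm_sq_int_def csq_int_diff)
lemma herm_sq_int_scale: "herm_sq_int f ==> herm_sq_int (\<lambda>x. cx c * f x)"
  by (auto simp: herm_sq_int_def csq_int_cmult)

lemma L2_of_add: "herm_sq_int f ==> herm_sq_int g ==> L2_of f + L2_of g = L2_of (\<lambda>x. f x + g x)"
  by transfer (auto simp: herm_sq_int_add)
lemma L2_of_diff: "herm_sq_int f ==> herm_sq_int g ==> L2_of f - L2_of g = L2_of (\<lambda>x. f x - g x)"
  by transfer (auto simp: herm_sq_int_diff)
lemma L2_of_scale: "herm_sq_int f ==> c *\<^sub>R L2_of f = L2_of (\<lambda>x. cx c * f x)"
  by transfer (auto simp: herm_sq_int_scale)

lemma fun_of_add: "AE t in lborel. fun_of (x + y) t = fun_of x t + fun_of y t"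
  using fun_of_L2_of[OF herm_sq_int_add[OF herm_sq_int_fun_of herm_sq_int_fun_of, of x y]] L2_of_add[OF herm_sq_int_fun_of herm_sq_int_fun_of, of x y] by simp
lemma fun_of_diff: "AE t in lborel. fun_of (x - y) t = fun_of x t - fun_of y t"
  using fun_of_L2_of[OF herm_sq_int_diff[OF herm_sq_int_fun_of herm_sq_int_fun_of, of x y]] L2_of_diff[OF herm_sq_int_fun_of herm_sq_int_fun_of, of x y] by simp
lemma fun_of_scale: "AE t in lborel. fun_of (c *\<^sub>R x) t = cx c * fun_of x t"
  using fun_of_L2_of[OF herm_sq_int_scale[OF herm_sq_int_fun_of, of c x]] L2_of_scale[OF herm_sq_int_fun_of, of c x] by simp
lemma fun_of_zero: "AE t in lborel. fun_of 0 t = 0"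
proof -
  have "herm_sq_int (\<lambda>_. 0)" by (simp add: herm_sq_int_def)
  moreover from this have "L2_of (\<lambda>_. 0) = 0" by transfer auto
  ultimately show ?thesis using fun_of_L2_of[of "\<lambda>_. 0"] by simp
qed

lemma inner_L2_of: "herm_sq_int f ==> herm_sq_int g ==> inner (L2_of f) (L2_of g) = Re (LBINT x. f x * cnj (g x))"
  by transfer auto
lemma inner_fun_of: "inner x y = Re (LBINT t. fun_of x t * cnj (fun_of y t))"
  using inner_L2_of[OF herm_sq_int_fun_of herm_sq_int_fun_of, of x y] by simp

lemma norm_fun_of: "norm x = L2norm (fun_of x)"
proof -
  have "(LBINT t. fun_of x t * cnj (fun_of x t)) = of_real (LBINT t. (cmod (fun_of x t))^2)"
    by (subst integral_complex_of_real[symmetric]) (simp add: complex_norm_square del: of_real_power)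
  then show ?thesis by (simp add: norm_eq_sqrt_inner inner_fun_of L2norm_def)
qed

lemma norm_sq_fun_of: "(norm x)^2 = (LBINT t. (cmod (fun_of x t))^2)"
  by (simp add: norm_fun_of L2norm_sq)

lemma nn_norm_fun_of: "(NN t. ennreal ((cmod (fun_of x t))^2)) = ennreal ((norm x)^2)"
  by (simp add: nn_integral_csq[OF csq_int_fun_of] norm_fun_of)

lemma norm_L2_of: assumes "herm_sq_int f" shows "norm (L2_of f) = L2norm f"
proof -
  have "(LBINT t. (cmod (fun_of (L2_of f) t))^2) = (LBINT t. (cmod (f t))^2)"
    using assms fun_of_L2_of[OF assms]
    by (intro integral_cong_AE) (auto simp: herm_sq_int_def csq_int_def elim: eventually_mono)
  then show ?thesis by (simp add: norm_fun_of L2norm_def)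
qed

lemma norm_L2_of_le:
  assumes f: "herm_sq_int f" and bound: "(NN t. ennreal ((cmod (f t))^2)) <= ennreal (C^2)" and C: "C \<ge> 0"
  shows "norm (L2_of f) <= C"
  using bound C f by (intro power2_le_imp_le[OF _ C]) (simp add: norm_L2_of nn_integral_csq herm_sq_int_def)

instance hl2 :: complete_space
proof
  fix X :: "nat => hl2" assume X: "Cauchy X"
  have dist: "dist x y = L2norm (\<lambda>t. fun_of x t - fun_of y t)" for x y
    using norm_L2_of[OF herm_sq_int_diff[OF herm_sq_int_fun_of herm_sq_int_fun_of]]
      L2_of_diff[OF herm_sq_int_fun_of herm_sq_int_fun_of, of x y] by (simp add: dist_norm)
  obtain r :: "nat => nat" and g where g: "g = pointwise_lim (\<lambda>k. fun_of (X (r k)))" "csq_int g"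
    and lim: "(\<lambda>n. L2norm (\<lambda>t. fun_of (X n) t - g t)) \<longlonglongrightarrow> 0"
    by (rule Riesz_Fischer[OF csq_int_fun_of metric_CauchyD[OF X, unfolded dist]])
  have herm: "herm_sq_int g"
    using g(2) unfolding herm_sq_int_def g(1) by (simp add: pointwise_lim_cnj)
  have "X n - L2_of g = L2_of (\<lambda>t. fun_of (X n) t - g t)" for n
    using L2_of_diff[OF herm_sq_int_fun_of herm, of "X n"] by simp
  then have "(\<lambda>n. norm (X n - L2_of g)) \<longlonglongrightarrow> 0"
    using lim by (simp add: norm_L2_of herm_sq_int_diff herm_sq_int_fun_of herm)
  then show "convergent X" by (intro convergentI[of _ "L2_of g"]) (simp add: tendsto_norm_zero_iff LIM_zero_iff)
qed

instance hl2 :: banach ..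

section \<open>Fourier multipliers\<close>

definition herm_sym :: "real => (real => complex) => bool" where
  "herm_sym C m \<longleftrightarrow> m \<in> meas \<and> (\<forall>x. m (- x) = cnj (m x)) \<and> (\<forall>x. cmod (m x) <= C)"

definition fmult :: "(real => complex) => hl2 => hl2" where
  "fmult m x = L2_of (\<lambda>t. m t * fun_of x t)"

lemma herm_sym_nonneg: "herm_sym C m ==> 0 <= C"
  using norm_ge_zero order_trans unfolding herm_sym_def by blast

lemma herm_sym_measurable: "herm_sym C m ==> m \<in> meas" by (simp add: herm_sym_def)

lemma herm_sym_mult: "herm_sym C m ==> herm_sym D l ==> herm_sym (C * D) (\<lambda>t. m t * l t)"
  using herm_sym_nonneg[of C m] by (auto simp: herm_sym_def norm_mult intro!: mult_mono)

lemma herm_sym_cnj: "herm_sym C m ==> herm_sym C (\<lambda>t. cnj (m t))"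
  by (auto simp: herm_sym_def)

lemma herm_sq_int_herm_sym: "herm_sym C m ==> herm_sq_int f ==> herm_sq_int (\<lambda>t. m t * f t)"
  by (auto simp: herm_sym_def herm_sq_int_def intro!: csq_int_mult_bounded[where C = C])

lemma fun_of_fmult: "herm_sym C m ==> AE t in lborel. fun_of (fmult m x) t = m t * fun_of x t"
  unfolding fmult_def by (rule fun_of_L2_of[OF herm_sq_int_herm_sym[OF _ herm_sq_int_fun_of]])

lemma fmult_L2_of: assumes "herm_sym C m" "herm_sq_int f" shows "fmult m (L2_of f) = L2_of (\<lambda>t. m t * f t)"
  unfolding fmult_def
  by (rule L2_of_eqI) (use assms in \<open>auto intro!: herm_sq_int_herm_sym herm_sq_int_fun_of eventually_mono[OF fun_of_L2_of[OF assms(2)]]\<close>)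

lemma norm_fmult_le: assumes "herm_sym C m" shows "norm (fmult m x) <= C * norm x"
  unfolding fmult_def
proof (rule norm_L2_of_le)
  have "(NN t. ennreal ((cmod (m t * fun_of x t))^2)) <= (NN t. ennreal (C^2) * ennreal ((cmod (fun_of x t))^2))"
    using assms by (intro nn_integral_mono)
      (auto simp: ennreal_mult'[symmetric] norm_mult power_mult_distrib herm_sym_def intro!: ennreal_leI mult_right_mono power_mono)
  also have "... = ennreal ((C * norm x)^2)"
    by (subst nn_integral_cmult) (auto simp: nn_norm_fun_of ennreal_mult'[symmetric] power_mult_distrib)
  finally show "(NN t. ennreal ((cmod (m t * fun_of x t))^2)) <= ennreal ((C * norm x)^2)" .
qed (use assms herm_sym_nonneg herm_sq_int_herm_sym herm_sq_int_fun_of in auto)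

lemma fmult_add: assumes "herm_sym C m" shows "fmult m (x + y) = fmult m x + fmult m y"
  unfolding fmult_def L2_of_add[OF herm_sq_int_herm_sym[OF assms herm_sq_int_fun_of] herm_sq_int_herm_sym[OF assms herm_sq_int_fun_of]]
  by (rule L2_of_eqI) (auto intro!: herm_sq_int_herm_sym[OF assms] herm_sq_int_add herm_sq_int_fun_of eventually_mono[OF fun_of_add[of x y]] simp: ring_distribs)

lemma fmult_scale: assumes "herm_sym C m" shows "fmult m (c *\<^sub>R x) = c *\<^sub>R fmult m x"
  unfolding fmult_def L2_of_scale[OF herm_sq_int_herm_sym[OF assms herm_sq_int_fun_of]]
  by (rule L2_of_eqI) (auto intro!: herm_sq_int_herm_sym[OF assms] herm_sq_int_scale herm_sq_int_fun_of eventually_mono[OF fun_of_scale[of c x]])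

lemma bounded_linear_fmult: "herm_sym C m ==> bounded_linear (fmult m)"
  by (rule bounded_linear_intro[where K = C]) (auto simp: fmult_add fmult_scale mult.commute norm_fmult_le)

lemma fmult_fmult: assumes "herm_sym C m" "herm_sym D l" shows "fmult m (fmult l x) = fmult (\<lambda>t. m t * l t) x"
  unfolding fmult_def[of l] fmult_L2_of[OF assms(1) herm_sq_int_herm_sym[OF assms(2) herm_sq_int_fun_of]]
  by (simp add: fmult_def mult.assoc)

lemma fmult_one: "fmult (\<lambda>t. 1) x = x"
  by (simp add: fmult_def)

lemma inner_fmult: assumes "herm_sym C m" shows "inner (fmult m x) y = inner x (fmult (\<lambda>t. cnj (m t)) y)"
proof -
  have "inner (fmult m x) (L2_of (fun_of y)) = Re (LBINT t. (m t * fun_of x t) * cnj (fun_of y t))"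
    unfolding fmult_def by (intro inner_L2_of herm_sq_int_herm_sym[OF assms] herm_sq_int_fun_of)
  moreover have "inner (L2_of (fun_of x)) (fmult (\<lambda>t. cnj (m t)) y) = Re (LBINT t. fun_of x t * cnj (cnj (m t) * fun_of y t))"
    unfolding fmult_def by (intro inner_L2_of herm_sq_int_herm_sym[OF herm_sym_cnj[OF assms]] herm_sq_int_fun_of)
  ultimately show ?thesis by (simp add: mult_ac)
qed

lemma fmult_eq_0D:
  assumes "herm_sym C m" "\<And>t. m t \<noteq> 0" "fmult m x = 0" shows "x = 0"
proof (rule hl2_eqI)
  have "AE t in lborel. fun_of (fmult m x) t = 0" using assms(3) fun_of_zero by simp
  with fun_of_fmult[OF assms(1), of x] fun_of_zero show "AE t in lborel. fun_of x t = fun_of 0 t"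
    by eventually_elim (use assms(2) in auto)
qed

definition even_sym :: "real => (real => real) => bool" where
  "even_sym C a \<longleftrightarrow> a \<in> meas \<and> (\<forall>x. a (- x) = a x) \<and> (\<forall>x. \<bar>a x\<bar> <= C)"

definition rmult :: "(real => real) => hl2 => hl2" where
  "rmult a = fmult (\<lambda>t. cx (a t))"

lemma even_sym_herm_sym: "even_sym C a ==> herm_sym C (\<lambda>t. cx (a t))"
  by (auto simp: even_sym_def herm_sym_def)

lemma even_sym_measurable: "even_sym C a ==> a \<in> meas" by (simp add: even_sym_def)
lemma even_sym_minus: "even_sym C a ==> a (- x) = a x" by (simp add: even_sym_def)
lemma even_sym_abs_le: "even_sym C a ==> \<bar>a x\<bar> <= C" by (simp add: even_sym_def)
lemma even_sym_nonneg: "even_sym C a ==> 0 <= C" using abs_ge_zero order_trans unfolding even_sym_def by blast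

lemma even_sym_const: "even_sym \<bar>c\<bar> (\<lambda>_. c)" by (simp add: even_sym_def)
lemma even_sym_one: "even_sym 1 (\<lambda>_. 1)" by (simp add: even_sym_def)
lemma even_sym_mult: "even_sym C a ==> even_sym D b ==> even_sym (C * D) (\<lambda>t. a t * b t)"
  unfolding even_sym_def abs_mult by (auto intro!: mult_mono intro: order_trans[OF abs_ge_zero])
lemma even_sym_diff: "even_sym C a ==> even_sym D b ==> even_sym (C + D) (\<lambda>t. a t - b t)"
  unfolding even_sym_def by (auto intro!: order_trans[OF abs_triangle_ineq4] add_mono)

lemma norm_rmult_le: "even_sym C a ==> norm (rmult a x) <= C * norm x"
  unfolding rmult_def by (rule norm_fmult_le[OF even_sym_herm_sym])
lemma bounded_linear_rmult: "even_sym C a ==> bounded_linear (rmult a)"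
  unfolding rmult_def by (rule bounded_linear_fmult[OF even_sym_herm_sym])
lemma rmult_rmult: "even_sym C a ==> even_sym D b ==> rmult a (rmult b x) = rmult (\<lambda>t. a t * b t) x"
  unfolding rmult_def by (subst fmult_fmult[OF even_sym_herm_sym even_sym_herm_sym]) auto
lemma inner_rmult: "even_sym C a ==> inner (rmult a x) y = inner x (rmult a y)"
  unfolding rmult_def by (subst inner_fmult[OF even_sym_herm_sym]) auto
lemma rmult_cong: "(\<And>t. a t = b t) ==> rmult a x = rmult b x" by (metis ext)
lemma fun_of_rmult: "even_sym C a ==> AE t in lborel. fun_of (rmult a x) t = cx (a t) * fun_of x t"
  unfolding rmult_def by (rule fun_of_fmult[OF even_sym_herm_sym])

lemma rmult_eq_0D: "even_sym C a ==> (\<And>t. a t \<noteq> 0) ==> rmult a x = 0 ==> x = 0"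
  unfolding rmult_def by (rule fmult_eq_0D[OF even_sym_herm_sym]) auto

lemma rmult_const: "rmult (\<lambda>_. c) x = c *\<^sub>R x"
proof (rule hl2_eqI)
  show "AE t in lborel. fun_of (rmult (\<lambda>_. c) x) t = fun_of (c *\<^sub>R x) t"
    using fun_of_rmult[OF even_sym_const, of c x] fun_of_scale[of c x] by eventually_elim simp
qed

lemma rmult_one [simp]: "rmult (\<lambda>_. 1) x = x" by (simp add: rmult_const)

lemma rmult_diff_symbol:
  assumes "even_sym A a" "even_sym B b"
  shows "rmult (\<lambda>t. a t - b t) x = rmult a x - rmult b x"
proof (rule hl2_eqI)
  show "AE t in lborel. fun_of (rmult (\<lambda>t. a t - b t) x) t = fun_of (rmult a x - rmult b x) t"
    using fun_of_rmult[OF even_sym_diff[OF assms], of x] fun_of_rmult[OF assms(1), of x]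
      fun_of_rmult[OF assms(2), of x] fun_of_diff[of "rmult a x" "rmult b x"]
    by eventually_elim (simp add: left_diff_distrib)
qed

lemma integrable_mult_norm_sq_fun_of:
  assumes [measurable]: "b \<in> meas" and b: "\<And>t. \<bar>b t\<bar> <= C"
  shows "integrable lborel (\<lambda>t. b t * (cmod (fun_of x t))^2)"
proof (rule Bochner_Integration.integrable_bound)
  show "integrable lborel (\<lambda>t. C * (cmod (fun_of x t))^2)"
    using csq_int_fun_of[of x] by (simp add: csq_int_def)
  show "AE t in lborel. norm (b t * (cmod (fun_of x t))^2) <= norm (C * (cmod (fun_of x t))^2)"
    by (intro AE_I2) (auto simp: abs_mult intro!: mult_right_mono order_trans[OF b])
qed measurable

lemma norm_sq_rmult:
  assumes "even_sym C a" shows "(norm (rmult a x))^2 = (LBINT t. (a t)^2 * (cmod (fun_of x t))^2)"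
  unfolding norm_sq_fun_of
proof (rule integral_cong_AE)
  note [measurable] = even_sym_measurable[OF assms]
  show "(\<lambda>t. (a t)^2 * (cmod (fun_of x t))^2) \<in> borel_measurable lborel" by measurable
  show "AE t in lborel. (cmod (fun_of (rmult a x) t))^2 = (a t)^2 * (cmod (fun_of x t))^2"
    using fun_of_rmult[OF assms, of x] by eventually_elim (simp add: norm_mult power_mult_distrib)
qed measurable

lemma even_sym_sq_le: "even_sym C a ==> (a t)^2 <= C^2"
  using power_mono[OF even_sym_abs_le abs_ge_zero, of C a t 2] by simp

lemma norm_rmult_mono:
  assumes "even_sym C a" "even_sym D b" "\<And>t. (a t)^2 <= (b t)^2"
  shows "norm (rmult a x) <= norm (rmult b x)"
proof (rule power2_le_imp_le)
  note [measurable] = even_sym_measurable[OF assms(1)] even_sym_measurable[OF assms(2)]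
  show "(norm (rmult a x))^2 <= (norm (rmult b x))^2"
    unfolding norm_sq_rmult[OF assms(1)] norm_sq_rmult[OF assms(2)]
    by (intro integral_mono integrable_mult_norm_sq_fun_of mult_right_mono assms(3))
      (auto intro: even_sym_sq_le[OF assms(1)] even_sym_sq_le[OF assms(2)])
qed simp

lemma rmult_tendsto:
  fixes a :: "nat => real => real"
  assumes a: "\<And>k. even_sym C (a k)" and lim: "\<And>t. (\<lambda>k. a k t) \<longlonglongrightarrow> l t"
    and l: "even_sym C l"
  shows "(\<lambda>k. rmult (a k) x) \<longlonglongrightarrow> rmult l x"
proof -
  note [measurable] = even_sym_measurable[OF a] even_sym_measurable[OF l]
  have "(\<lambda>k. \<integral>t. (a k t - l t)^2 * (cmod (fun_of x t))^2 \<partial>lborel) \<longlonglongrightarrow> (LBINT t. (l t - l t)^2 * (cmod (fun_of x t))^2)"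
  proof (rule Bochner_Integration.integral_dominated_convergence)
    show "integrable lborel (\<lambda>t. (C + C)^2 * (cmod (fun_of x t))^2)"
      by (rule integrable_mult_norm_sq_fun_of[OF _ order_refl]) simp
    show "AE t in lborel. (\<lambda>k. (a k t - l t)^2 * (cmod (fun_of x t))^2) \<longlonglongrightarrow> (l t - l t)^2 * (cmod (fun_of x t))^2"
      by (intro AE_I2 tendsto_intros lim)
    show "AE t in lborel. norm ((a k t - l t)^2 * (cmod (fun_of x t))^2) <= (C + C)^2 * (cmod (fun_of x t))^2" for k
      using even_sym_sq_le[OF even_sym_diff[OF a l]] by (intro AE_I2) (auto simp: abs_mult intro: mult_right_mono)
  qed measurable
  then have "(\<lambda>k. (norm (rmult (a k) x - rmult l x))^2) \<longlonglongrightarrow> 0"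
    unfolding rmult_diff_symbol[OF a l, symmetric] norm_sq_rmult[OF even_sym_diff[OF a l]] by simp
  then have "(\<lambda>k. norm (rmult (a k) x - rmult l x)) \<longlonglongrightarrow> 0"
    using tendsto_real_sqrt by fastforce
  then show ?thesis by (simp add: LIM_zero_iff tendsto_norm_zero_iff)
qed

subsection \<open>Multipliers on pairs\<close>

type_synonym state = "hl2 \<times> hl2"

lemma norm_fst_le_norm: "norm (fst X) <= norm (X :: 'a::real_normed_vector \<times> 'b::real_normed_vector)"
  and norm_snd_le_norm: "norm (snd X) <= norm X"
  by (cases X; simp add: norm_fst_le norm_snd_le)+

lemma norm_Pair_mono:
  assumes "norm a' <= c * norm a" "norm b' <= c * norm b" "0 <= c"
  shows "norm (a', b') <= c * norm (a, b)"
proof -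
  have "(norm a')^2 + (norm b')^2 <= (c * norm a)^2 + (c * norm b)^2" using assms by (intro add_mono power_mono) auto
  also have "... = c^2 * ((norm a)^2 + (norm b)^2)" by (simp add: power_mult_distrib ring_distribs)
  finally have "sqrt ((norm a')^2 + (norm b')^2) <= sqrt (c^2 * ((norm a)^2 + (norm b)^2))" by (rule real_sqrt_le_mono)
  then show ?thesis using assms(3) by (simp add: norm_Pair real_sqrt_mult)
qed

definition rmult2 :: "(real => real) => state => state" where
  "rmult2 a X = (rmult a (fst X), rmult a (snd X))"

lemma rmult2_simps [simp]: "fst (rmult2 a X) = rmult a (fst X)" "snd (rmult2 a X) = rmult a (snd X)"
  by (simp_all add: rmult2_def)

lemma bounded_linear_rmult2: "even_sym C a ==> bounded_linear (rmult2 a)"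
  unfolding rmult2_def[abs_def]
  by (intro bounded_linear_Pair bounded_linear_compose[OF bounded_linear_rmult] bounded_linear_fst bounded_linear_snd)

lemma norm_rmult2_le: assumes "even_sym C a" shows "norm (rmult2 a X) <= C * norm X"
  using norm_Pair_mono[OF norm_rmult_le[OF assms] norm_rmult_le[OF assms] even_sym_nonneg[OF assms], of "fst X" "snd X"]
  by (simp add: rmult2_def)

lemma norm_rmult2_mono:
  assumes "even_sym C a" "even_sym D b" "\<And>t. (a t)^2 <= (b t)^2"
  shows "norm (rmult2 a X) <= norm (rmult2 b X)"
  using norm_Pair_mono[of "rmult a (fst X)" 1 "rmult b (fst X)" "rmult a (snd X)" "rmult b (snd X)"]
    norm_rmult_mono[OF assms] by (simp add: rmult2_def)

lemma rmult2_rmult2: "even_sym C a ==> even_sym D b ==> rmult2 a (rmult2 b X) = rmult2 (\<lambda>t. a t * b t) X"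
  by (simp add: rmult2_def rmult_rmult)
lemma inner_rmult2: "even_sym C a ==> inner (rmult2 a X) Y = inner X (rmult2 a Y)"
  by (simp add: rmult2_def inner_prod_def inner_rmult)
lemma rmult2_add: "even_sym C a ==> rmult2 a (X + Y) = rmult2 a X + rmult2 a Y"
  using bounded_linear_rmult2 by (rule linear_add[OF bounded_linear.linear])
lemma rmult2_diff: "even_sym C a ==> rmult2 a (X - Y) = rmult2 a X - rmult2 a Y"
  using bounded_linear_rmult2 by (rule linear_diff[OF bounded_linear.linear])
lemma rmult2_scaleR: "even_sym C a ==> rmult2 a (c *\<^sub>R X) = c *\<^sub>R rmult2 a X"
  using bounded_linear_rmult2 by (rule linear_scale[OF bounded_linear.linear])
lemma rmult2_cong: "(\<And>t. a t = b t) ==> rmult2 a X = rmult2 b X" by (metis ext)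
lemma rmult2_const: "rmult2 (\<lambda>_. c) X = c *\<^sub>R X" by (simp add: rmult2_def rmult_const scaleR_prod_def)
lemma rmult2_one [simp]: "rmult2 (\<lambda>_. 1) X = X" by (simp add: rmult2_def)
lemma rmult2_diff_symbol:
  "even_sym A a ==> even_sym B b ==> rmult2 (\<lambda>t. a t - b t) X = rmult2 a X - rmult2 b X"
  by (simp add: rmult2_def rmult_diff_symbol)
lemma rmult2_eq_0D: "even_sym C a ==> (\<And>t. a t \<noteq> 0) ==> rmult2 a X = 0 ==> X = 0"
  by (auto simp: rmult2_def prod_eq_iff intro: rmult_eq_0D)
lemma rmult2_has_vector_derivative:
  "even_sym C a ==> (x has_vector_derivative x') F ==> ((\<lambda>t. rmult2 a (x t)) has_vector_derivative rmult2 a x') F"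
  by (rule bounded_linear.has_vector_derivative[OF bounded_linear_rmult2])
lemma rmult2_tendsto:
  fixes a :: "nat => real => real"
  assumes "\<And>k. even_sym C (a k)" "\<And>t. (\<lambda>k. a k t) \<longlonglongrightarrow> l t" "even_sym C l"
  shows "(\<lambda>k. rmult2 (a k) X) \<longlonglongrightarrow> rmult2 l X"
  unfolding rmult2_def by (intro tendsto_Pair rmult_tendsto[OF assms])

subsection \<open>The frequency cutoff and the powers of the Japanese bracket\<close>

definition cut :: "real => real => real" where "cut n t = (if \<bar>t\<bar> <= n then 1 else 0)"

lemma cut_measurable [measurable]: "cut n \<in> meas"
  unfolding cut_def[abs_def] by measurable
lemma cut_01: "0 <= cut n t" "cut n t <= 1" "cut n t * cut n t = cut n t" by (auto simp: cut_def)
lemma cut_minus [simp]: "cut n (- t) = cut n t" by (simp add: cut_def)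
lemma even_sym_cut: "even_sym 1 (cut n)" by (auto simp: even_sym_def cut_def)

lemma cut_tendsto: "(\<lambda>k. cut (real k) t) \<longlonglongrightarrow> 1"
proof (rule tendsto_eventually)
  have "\<forall>\<^sub>F k in sequentially. \<bar>t\<bar> <= real k"
    using eventually_ge_at_top[of "nat \<lceil>\<bar>t\<bar>\<rceil>"]
    by eventually_elim linarith
  then show "\<forall>\<^sub>F k in sequentially. cut (real k) t = 1" by eventually_elim (simp add: cut_def)
qed

lemma rmult_cut_tendsto: "(\<lambda>k. rmult (cut (real k)) x) \<longlonglongrightarrow> x"
  using rmult_tendsto[OF even_sym_cut cut_tendsto even_sym_one, of x] by simp
lemma rmult2_cut_tendsto: "(\<lambda>k. rmult2 (cut (real k)) X) \<longlonglongrightarrow> X"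
  using rmult2_tendsto[OF even_sym_cut cut_tendsto even_sym_one, of X] by simp
lemma rmult2_cut_cut: "m <= n ==> rmult2 (cut n) (rmult2 (cut m) X) = rmult2 (cut m) X"
  unfolding rmult2_rmult2[OF even_sym_cut even_sym_cut] by (rule rmult2_cong) (auto simp: cut_def)

lemma jbr_ge_1: "jbr x \<ge> 1" by (simp add: jbr_def)
lemma jbr_pos [simp]: "jbr x > 0" using jbr_ge_1[of x] by linarith
lemma jbr_neq_0 [simp]: "jbr x \<noteq> 0" using jbr_pos[of x] by linarith
lemma jbr_nonneg [simp]: "jbr x \<ge> 0" using jbr_pos[of x] by linarith
lemma jbr_minus [simp]: "jbr (- x) = jbr x" by (simp add: jbr_def)
lemma jbr_measurable [measurable]: "jbr \<in> meas"
  unfolding jbr_def[abs_def] by measurable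
lemma abs_le_jbr: "\<bar>x\<bar> <= jbr x"
  unfolding jbr_def by (metis real_sqrt_abs real_sqrt_le_iff add_increasing order_refl zero_le_one)
lemma jbr_mono: "\<bar>x\<bar> <= \<bar>y\<bar> ==> jbr x <= jbr y"
  by (simp add: jbr_def abs_le_square_iff)
lemma jbr_le_1_abs: "jbr x <= 1 + \<bar>x\<bar>"
  unfolding jbr_def by (rule real_le_lsqrt) (auto simp: power2_eq_square algebra_simps)
lemma jbr_lipschitz: "\<bar>jbr x - jbr y\<bar> <= \<bar>x - y\<bar>"
proof -
  have sq_diff: "(jbr x)^2 - (jbr y)^2 = x^2 - y^2" by (simp add: jbr_def)
  have "\<bar>jbr x - jbr y\<bar> * (jbr x + jbr y) = \<bar>(jbr x)^2 - (jbr y)^2\<bar>"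
    by (simp add: power2_eq_square square_diff_square_factored abs_mult)
  also have "... = \<bar>x - y\<bar> * \<bar>x + y\<bar>"
    unfolding sq_diff by (simp add: power2_eq_square square_diff_square_factored abs_mult)
  also have "... <= \<bar>x - y\<bar> * (jbr x + jbr y)"
    using abs_le_jbr[of x] abs_le_jbr[of y] by (intro mult_left_mono) auto
  finally show ?thesis using jbr_pos[of x] jbr_pos[of y] by (simp add: mult_le_cancel_right)
qed

definition jpow :: "real => real => real" where "jpow r t = jbr t powr r"

lemma jpow_measurable [measurable]: "jpow r \<in> meas"
  unfolding jpow_def[abs_def] by measurable
lemma jpow_pos [simp]: "0 < jpow r t" by (simp add: jpow_def)
lemma jpow_nonneg [simp]: "0 <= jpow r t" by (simp add: less_imp_le)
lemma jpow_neq_0 [simp]: "jpow r t \<noteq> 0" using jpow_pos[of r t] by linarith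
lemma jpow_minus [simp]: "jpow r (- t) = jpow r t" by (simp add: jpow_def)
lemma jpow_0 [simp]: "jpow 0 t = 1" by (simp add: jpow_def)
lemma jpow_1: "jpow 1 t = jbr t" by (simp add: jpow_def)
lemma jpow_add: "jpow (a + b) t = jpow a t * jpow b t" by (simp add: jpow_def powr_add)
lemma jpow_uminus: "jpow (- a) t = 1 / jpow a t" by (simp add: jpow_def powr_minus divide_inverse)
lemma jpow_mono: "a <= b ==> jpow a t <= jpow b t"
  unfolding jpow_def by (rule powr_mono[OF _ jbr_ge_1])
lemma jpow_le_1: "a <= 0 ==> jpow a t <= 1" using jpow_mono[of a 0 t] by simp
lemma jpow_increasing: "0 <= a ==> \<bar>x\<bar> <= \<bar>y\<bar> ==> jpow a x <= jpow a y"
  unfolding jpow_def by (intro powr_mono2 jbr_mono) auto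
lemma jpow_decreasing: "a <= 0 ==> \<bar>x\<bar> <= \<bar>y\<bar> ==> jpow a y <= jpow a x"
  unfolding jpow_def by (intro powr_mono2' jbr_mono) auto

lemma even_sym_jpow: "r <= 0 ==> even_sym 1 (jpow r)"
  by (auto simp: even_sym_def jpow_le_1)

lemma integrable_jpow:
  assumes "r < -1" shows "integrable lborel (jpow r)"
proof (rule Bochner_Integration.integrable_bound)
  let ?tail = "\<lambda>x::real. indicator {1..} x *\<^sub>R (x powr r)"
  have "((\<lambda>x. x powr r) has_integral - (1 powr (r + 1)) / (r + 1)) {1..}"
    using assms by (intro has_integral_powr_to_inf) auto
  then have "(\<lambda>x::real. x powr r) absolutely_integrable_on {1..}"
    by (intro nonnegative_absolutely_integrable_1) (auto simp: has_integral_integrable)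
  then have tail: "integrable lborel ?tail"
    unfolding set_integrable_def by (subst (asm) integrable_completion) auto
  from lborel_integrable_real_affine[OF this, of "-1" 0]
  have "integrable lborel (\<lambda>x. ?tail (- x))" by simp
  with tail show "integrable lborel (\<lambda>x. ?tail x + ?tail (- x) + indicator {-1..1} x)" by simp
  show "AE x in lborel. norm (jpow r x) <= norm (?tail x + ?tail (- x) + indicator {-1..1} x)"
  proof (rule AE_I2)
    fix x :: real
    have "jpow r x <= \<bar>x\<bar> powr r" if "1 <= \<bar>x\<bar>"
      unfolding jpow_def using abs_le_jbr[of x] assms that by (intro powr_mono2') auto
    moreover have "jpow r x <= 1" using assms by (intro jpow_le_1) simp
    ultimately show "norm (jpow r x) <= norm (?tail x + ?tail (- x) + indicator {-1..1} x)"
      by (auto simp: indicator_def)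
  qed
qed measurable

lemma jpow_tendsto_0: assumes "r < 0" shows "(\<lambda>k. jpow r (real k)) \<longlonglongrightarrow> 0"
proof -
  have "filterlim (\<lambda>k. jbr (real k)) at_top sequentially"
    by (rule filterlim_at_top_mono[OF filterlim_real_sequentially]) (auto intro!: always_eventually order_trans[OF abs_ge_self abs_le_jbr])
  then show ?thesis unfolding jpow_def by (rule tendsto_neg_powr[OF assms])
qed

lemma norm_rmult2_cut_band_le:
  assumes r: "r <= 0" and km: "k <= m"
  shows "norm (rmult2 (jpow r) (rmult2 (cut (real m)) X - rmult2 (cut (real k)) X)) <= jpow r (real k) * norm X"
proof -
  note even = even_sym_mult[OF even_sym_jpow[OF r] even_sym_cut]
  let ?band = "\<lambda>t. jpow r t * cut (real m) t - jpow r t * cut (real k) t"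
  have "\<bar>?band t\<bar> <= jpow r (real k)" for t
    using km jpow_decreasing[OF r, of "real k" t] by (auto simp: cut_def)
  then have "even_sym (jpow r (real k)) ?band" by (auto simp: even_sym_def)
  from norm_rmult2_le[OF this] show ?thesis
    by (simp add: rmult2_diff_symbol[OF even even] rmult2_diff[OF even_sym_jpow[OF r]] rmult2_rmult2[OF even_sym_jpow[OF r] even_sym_cut])
qed

lemma norm_rmult2_cut_compl_le:
  assumes r: "r <= 0" shows "norm (rmult2 (jpow r) (rmult2 (cut (real k)) X - X)) <= jpow r (real k) * norm X"
proof -
  have "(\<lambda>m. norm (rmult2 (jpow r) (rmult2 (cut (real m)) X - rmult2 (cut (real k)) X)))
      \<longlonglongrightarrow> norm (rmult2 (jpow r) (X - rmult2 (cut (real k)) X))"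
    by (intro tendsto_intros bounded_linear.tendsto[OF bounded_linear_rmult2[OF even_sym_jpow[OF r]]] rmult2_cut_tendsto)
  then have "norm (rmult2 (jpow r) (X - rmult2 (cut (real k)) X)) <= jpow r (real k) * norm X"
    by (rule tendsto_upperbound) (auto intro: eventually_sequentiallyI[of k] norm_rmult2_cut_band_le[OF r])
  then show ?thesis by (simp add: rmult2_diff[OF even_sym_jpow[OF r]] norm_minus_commute)
qed

section \<open>Bilinear integral operators\<close>

lemma AE_lborel_reflect_shift:
  fixes c :: real
  assumes "AE t in lborel. P t" shows "AE t in lborel. P (c - t)"
proof -
  obtain N where N: "N \<in> null_sets lborel" "{t. \<not> P t} \<subseteq> N"
    using assms by (auto simp: eventually_ae_filter)
  have "AE t in lborel. c + (-1) * t \<notin> N"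
    by (rule AE_borel_affine[OF _ _ AE_not_in[OF N(1)]]) (use N(1) in \<open>auto simp: null_sets_def pred_def\<close>)
  then show ?thesis by eventually_elim (use N(2) in auto)
qed

lemma nn_integral_reflect_shift:
  fixes f :: "real => ennreal" and c :: real
  assumes "f \<in> meas"
  shows "(NN t. f (c - t)) = (NN t. f t)"
  using nn_integral_real_affine[OF assms, of "-1" c] by simp

lemma integral_reflect_shift:
  fixes f :: "real => complex" and c :: real
  shows "(LBINT t. f (c - t)) = (LBINT t. f t)"
  using lborel_integral_real_affine[of "-1" f c] by simp

lemma Young_nn:
  fixes p g :: "real => ennreal"
  assumes [measurable]: "p \<in> meas" "g \<in> meas"
  shows "(NN u. (NN v. p (u - v) * g v)^2) <= (NN t. p t)^2 * (NN t. (g t)^2)"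
proof -
  have "(NN v. p (u - v) * g v)^2 <= (NN t. p t) * (NN v. p (u - v) * (g v)^2)" for u
    using Cauchy_Schwarz_nn_integral[of "\<lambda>_. 1" "density lborel (\<lambda>v. p (u - v))" g]
    by (simp add: nn_integral_density nn_integral_reflect_shift emeasure_density)
  then have "(NN u. (NN v. p (u - v) * g v)^2)
      <= (NN u. (NN t. p t) * (NN v. p (u - v) * (g v)^2))"
    by (intro nn_integral_mono)
  also have "... = (NN t. p t) * (NN v. \<integral>\<^sup>+u. p (u - v) * (g v)^2 \<partial>lborel)"
    by (subst nn_integral_cmult, measurable) (subst lborel_pair.Fubini', auto)
  also have "(NN v. \<integral>\<^sup>+u. p (u - v) * (g v)^2 \<partial>lborel) = (NN v. (NN t. p t) * (g v)^2)"
  proof (intro nn_integral_cong)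
    fix v :: real
    have "(NN u. p (u - v) * (g v)^2) = (NN u. p (u - v)) * (g v)^2"
      by (rule nn_integral_multc) measurable
    also have "(NN u. p (u - v)) = (NN t. p t)"
      using nn_integral_real_affine[of p 1 "-v"] by simp
    finally show "(NN u. p (u - v) * (g v)^2) = (NN t. p t) * (g v)^2" .
  qed
  also have "... = (NN t. p t) * (NN t. (g t)^2)"
    by (rule nn_integral_cmult) measurable
  finally show ?thesis by (simp add: power2_eq_square mult.assoc)
qed

lemma ennreal_sq_less_top: "(a::ennreal)^2 < \<top> ==> a < \<top>"
  by (cases a) (auto simp: power2_eq_square)

lemma norm_integral_le_nn:
  fixes f :: "'a => complex"
  shows "ennreal (cmod (\<integral>x. f x \<partial>M)) <= (\<integral>\<^sup>+x. ennreal (cmod (f x)) \<partial>M)"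
  by (cases "integrable M f") (auto simp: integral_norm_bound_ennreal not_integrable_integral_eq)

locale sobolev_index =
  fixes s :: real
  assumes s_gt: "s > 3 / 2"
begin

abbreviation J :: "real => real" where "J \<equiv> jpow (1 - s)"

definition norm_J :: real where "norm_J = sqrt (LBINT t. (J t)^2)"
definition C_bil :: real where "C_bil = 3 * norm_J"

lemma norm_J_nonneg [simp]: "norm_J \<ge> 0" by (simp add: norm_J_def)
lemma C_bil_nonneg [simp]: "C_bil \<ge> 0" by (simp add: C_bil_def)

text \<open>This is where \<open>s > 3/2\<close> is needed.\<close>
lemma nn_integral_J_sq: "(NN t. ennreal ((J t)^2)) = ennreal (norm_J^2)"
proof -
  have "(J t)^2 = jpow (2 * (1 - s)) t" for t
    using jpow_add[of "1 - s" "1 - s" t] by (simp add: power2_eq_square)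
  then have "integrable lborel (\<lambda>t. (J t)^2)" using integrable_jpow[of "2 * (1 - s)"] s_gt by simp
  then show ?thesis unfolding norm_J_def by (subst nn_integral_eq_integral) auto
qed

definition kernel :: "real => (real => real => complex) => bool" where
  "kernel K k \<longleftrightarrow> (\<lambda>(u, v). k u v) \<in> meas2 \<and>
     (\<forall>u v. k (- u) (- v) = cnj (k u v)) \<and>
     (\<forall>u v. cmod (k u v) <= K * (J (u - v) + J v + J u))"

definition bilop_fun :: "(real => real => complex) => hl2 => hl2 => real => complex" where
  "bilop_fun k x y u = (LBINT v. k u v * fun_of x (u - v) * fun_of y v)"

definition bilop :: "(real => real => complex) => hl2 => hl2 => hl2" where
  "bilop k x y = L2_of (bilop_fun k x y)"

definition bilop_abs :: "(real => real => complex) => hl2 => hl2 => real => ennreal" where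
  "bilop_abs k x y u = (NN v. ennreal (cmod (k u v * fun_of x (u - v) * fun_of y v)))"

lemma kernel_nonneg: assumes "kernel K k" shows "K \<ge> 0"
proof -
  have "0 <= K * (J (0 - 0) + J 0 + J 0)" using assms norm_ge_zero order_trans unfolding kernel_def by blast
  moreover have "J (0 - 0) + J 0 + J 0 > 0" by (intro add_pos_pos jpow_pos)
  ultimately show ?thesis by (simp only: zero_le_mult_iff) linarith
qed

lemma kernel_measurable: "kernel K k ==> (\<lambda>(u, v). k u v) \<in> meas2"
  by (simp add: kernel_def)

lemma kernel_section_measurable: assumes "kernel K k" shows "k u \<in> meas"
proof -
  have "(\<lambda>v. (\<lambda>(u, v). k u v) (u, v)) \<in> meas"
    by (rule measurable_compose[OF _ kernel_measurable[OF assms]]) measurable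
  then show ?thesis by simp
qed

lemma integrand_measurable:
  assumes "kernel K k"
  shows "(\<lambda>(u, v). k u v * fun_of x (u - v) * fun_of y v) \<in> meas2"
proof -
  note [measurable] = kernel_measurable[OF assms]
  have "(\<lambda>p. (\<lambda>(u, v). k u v) p * fun_of x (fst p - snd p) * fun_of y (snd p)) \<in> meas2"
    by measurable
  then show ?thesis by (simp add: case_prod_beta')
qed

abbreviation "amp x t \<equiv> ennreal (cmod (fun_of x t))"

lemma nn_J_amp_le: "(NN t. ennreal (J t) * amp x t) <= ennreal (norm_J * norm x)"
proof (rule ennreal_sq_le_imp_le)
  have "(NN t. ennreal (J t) * amp x t)^2 <= (NN t. (ennreal (J t))^2) * (NN t. (amp x t)^2)"
    by (rule Cauchy_Schwarz_nn_integral) measurable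
  then show "(NN t. ennreal (J t) * amp x t)^2 <= (ennreal (norm_J * norm x))^2"
    by (simp add: ennreal_power nn_integral_J_sq nn_norm_fun_of ennreal_mult'[symmetric] power_mult_distrib)
qed simp

lemma nn_convolution_J_le:
  "(NN u. (NN v. ennreal (J (u - v)) * amp x (u - v) * amp y v)^2) <= ennreal ((norm_J * norm x * norm y)^2)"
proof -
  have "(NN u. (NN v. ennreal (J (u - v)) * amp x (u - v) * amp y v)^2)
      <= (NN t. ennreal (J t) * amp x t)^2 * (NN t. (amp y t)^2)"
    by (rule Young_nn) measurable
  also have "... <= (ennreal (norm_J * norm x))^2 * ennreal ((norm y)^2)"
    by (intro mult_mono power_mono nn_J_amp_le) (simp_all add: ennreal_power nn_norm_fun_of)
  finally show ?thesis by (simp add: ennreal_power ennreal_mult'[symmetric] power_mult_distrib)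
qed

lemma nn_J_convolution_le:
  "(NN u. (ennreal (J u) * (NN v. amp x (u - v) * amp y v))^2) <= ennreal ((norm_J * norm x * norm y)^2)"
proof -
  have "(NN v. amp x (u - v) * amp y v)^2 <= ennreal ((norm x)^2 * (norm y)^2)" for u
  proof -
    have "(NN v. amp x (u - v) * amp y v)^2 <= (NN v. (amp x (u - v))^2) * (NN v. (amp y v)^2)"
      by (rule Cauchy_Schwarz_nn_integral) measurable
    also have "(NN v. (amp x (u - v))^2) = (NN v. (amp x v)^2)" by (rule nn_integral_reflect_shift) measurable
    finally show ?thesis by (simp add: ennreal_power nn_norm_fun_of ennreal_mult'[symmetric])
  qed
  then have "(NN u. (ennreal (J u) * (NN v. amp x (u - v) * amp y v))^2)
      <= (NN u. ennreal ((J u)^2) * ennreal ((norm x)^2 * (norm y)^2))"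
    by (intro nn_integral_mono) (auto simp: power_mult_distrib ennreal_power intro!: mult_left_mono)
  also have "... = ennreal ((norm_J * norm x * norm y)^2)"
    by (subst nn_integral_multc) (auto simp: nn_integral_J_sq ennreal_mult'[symmetric] power_mult_distrib mult_ac)
  finally show ?thesis .
qed

lemma ennreal_sum3_sq_le: "(a + b + c)^2 <= 3 * (a^2 + b^2 + c^2)" for a b c :: ennreal
proof (cases "a = \<top> \<or> b = \<top> \<or> c = \<top>")
  case True then show ?thesis by (auto simp: ennreal_mult_top ennreal_top_mult power2_eq_square)
next
  case False
  then obtain x y z where xyz: "a = ennreal x" "b = ennreal y" "c = ennreal z" "x \<ge> 0" "y \<ge> 0" "z \<ge> 0"
    by (metis ennreal_cases)
  have "(x + y + z)^2 <= 3 * (x^2 + y^2 + z^2)"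
    using sum_squares_bound[of x y] sum_squares_bound[of x z] sum_squares_bound[of y z]
    by (simp add: power2_eq_square algebra_simps)
  then have "ennreal ((x + y + z)^2) <= ennreal (3 * (x^2 + y^2 + z^2))" by (rule ennreal_leI)
  also have "... = 3 * ennreal (x^2 + y^2 + z^2)" by (simp only: ennreal_mult' ennreal_numeral)
  finally show ?thesis using xyz by (simp add: ennreal_power ennreal_plus[symmetric] del: ennreal_plus)
qed

lemma bilop_abs_le:
  assumes "kernel K k"
  shows "bilop_abs k x y u <= ennreal K * ((NN v. ennreal (J (u - v)) * amp x (u - v) * amp y v)
    + (NN v. ennreal (J (u - v)) * amp y (u - v) * amp x v) + ennreal (J u) * (NN v. amp x (u - v) * amp y v))"
proof -
  have "bilop_abs k x y u <= (NN v. ennreal K * (ennreal (J (u - v)) * amp x (u - v) * amp y v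
      + amp x (u - v) * (ennreal (J v) * amp y v) + ennreal (J u) * (amp x (u - v) * amp y v)))"
    unfolding bilop_abs_def
  proof (intro nn_integral_mono)
    fix v :: real
    let ?x = "cmod (fun_of x (u - v))" and ?y = "cmod (fun_of y v)"
    have "cmod (k u v * fun_of x (u - v) * fun_of y v) <= K * (J (u - v) + J v + J u) * ?x * ?y"
      using assms unfolding norm_mult kernel_def by (intro mult_right_mono) auto
    also have "... = K * (J (u - v) * ?x * ?y + ?x * (J v * ?y) + J u * (?x * ?y))"
      by (simp add: algebra_simps)
    finally show "ennreal (cmod (k u v * fun_of x (u - v) * fun_of y v)) <= ennreal K * (ennreal (J (u - v)) * amp x (u - v) * amp y v
        + amp x (u - v) * (ennreal (J v) * amp y v) + ennreal (J u) * (amp x (u - v) * amp y v))"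
      using kernel_nonneg[OF assms]
      by (simp add: ennreal_mult'[symmetric] ennreal_plus[symmetric] ennreal_leI del: ennreal_plus)
  qed
  also have "... = ennreal K * ((NN v. ennreal (J (u - v)) * amp x (u - v) * amp y v)
      + (NN v. amp x (u - v) * (ennreal (J v) * amp y v)) + ennreal (J u) * (NN v. amp x (u - v) * amp y v))"
    by (simp add: nn_integral_cmult nn_integral_add)
  also have "(NN v. amp x (u - v) * (ennreal (J v) * amp y v)) = (NN v. ennreal (J (u - v)) * amp y (u - v) * amp x v)"
    using nn_integral_reflect_shift[of "\<lambda>v. amp x (u - v) * (ennreal (J v) * amp y v)" u] by (simp add: mult.commute)
  finally show ?thesis .
qed

lemma nn_bilop_abs_sq_le:
  assumes "kernel K k"
  shows "(NN u. (bilop_abs k x y u)^2) <= ennreal ((K * C_bil * norm x * norm y)^2)"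
proof -
  have K: "K \<ge> 0" by (rule kernel_nonneg[OF assms])
  let ?A = "\<lambda>u. NN v. ennreal (J (u - v)) * amp x (u - v) * amp y v"
  let ?B = "\<lambda>u. NN v. ennreal (J (u - v)) * amp y (u - v) * amp x v"
  let ?C = "\<lambda>u. ennreal (J u) * (NN v. amp x (u - v) * amp y v)"
  let ?N = "ennreal ((norm_J * norm x * norm y)^2)"
  have "(bilop_abs k x y u)^2 <= ennreal (3 * K^2) * ((?A u)^2 + (?B u)^2 + (?C u)^2)" for u
  proof -
    have "(bilop_abs k x y u)^2 <= (ennreal K * (?A u + ?B u + ?C u))^2" by (intro power_mono bilop_abs_le assms) auto
    also have "... <= ennreal (K^2) * (3 * ((?A u)^2 + (?B u)^2 + (?C u)^2))"
      unfolding power_mult_distrib[of "ennreal K"] ennreal_power[OF K] by (intro mult_left_mono ennreal_sum3_sq_le) auto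
    finally show ?thesis by (simp add: ennreal_mult' mult_ac del: distrib_left_numeral)
  qed
  then have "(NN u. (bilop_abs k x y u)^2) <= (NN u. ennreal (3 * K^2) * ((?A u)^2 + (?B u)^2 + (?C u)^2))"
    by (rule nn_integral_mono)
  also have "... = ennreal (3 * K^2) * ((NN u. (?A u)^2) + (NN u. (?B u)^2) + (NN u. (?C u)^2))"
    by (simp add: nn_integral_cmult nn_integral_add)
  also have "... <= ennreal (3 * K^2) * (?N + ?N + ?N)"
    using nn_convolution_J_le[of y x]
    by (intro mult_left_mono add_mono nn_convolution_J_le nn_J_convolution_le) (simp_all add: mult_ac)
  also have "... = ennreal ((K * C_bil * norm x * norm y)^2)"
    by (simp add: ennreal_plus[symmetric] ennreal_mult'[symmetric] C_bil_def power_mult_distrib del: ennreal_plus)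
  finally show ?thesis .
qed

lemma nn_bilop_fun_sq_le:
  assumes "kernel K k"
  shows "(NN u. ennreal ((cmod (bilop_fun k x y u))^2)) <= ennreal ((K * C_bil * norm x * norm y)^2)"
proof -
  have "(NN u. ennreal ((cmod (bilop_fun k x y u))^2)) <= (NN u. (bilop_abs k x y u)^2)"
    unfolding bilop_abs_def bilop_fun_def
    by (intro nn_integral_mono) (auto simp: ennreal_power[symmetric] intro!: power_mono norm_integral_le_nn)
  with nn_bilop_abs_sq_le[OF assms, of x y] show ?thesis by (rule order_trans[rotated])
qed

lemma bilop_abs_measurable: assumes "kernel K k" shows "bilop_abs k x y \<in> meas"
proof -
  note [measurable] = integrand_measurable[OF assms, of x y]
  have "(\<lambda>u. \<integral>\<^sup>+v. ennreal (cmod ((\<lambda>(u, v). k u v * fun_of x (u - v) * fun_of y v) (u, v))) \<partial>lborel) \<in> meas"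
    by measurable
  then show ?thesis by (simp add: bilop_abs_def[abs_def])
qed

lemma bilop_fun_measurable: assumes "kernel K k" shows "bilop_fun k x y \<in> meas"
proof -
  have "(\<lambda>(u, v). k u v * fun_of x (u - v) * fun_of y v) \<in> borel_measurable (borel \<Otimes>\<^sub>M lborel)"
    using integrand_measurable[OF assms, of x y] by (simp cong: measurable_cong_sets)
  from lborel.borel_measurable_lebesgue_integral[OF this]
  show ?thesis by (simp add: bilop_fun_def[abs_def])
qed

lemma bilop_fun_integrable_AE:
  assumes "kernel K k"
  shows "AE u in lborel. integrable lborel (\<lambda>v. k u v * fun_of x (u - v) * fun_of y v)"
proof -
  note [measurable] = bilop_abs_measurable[OF assms, of x y] kernel_section_measurable[OF assms]
  have "(NN u. (bilop_abs k x y u)^2) \<noteq> \<infinity>"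
    using nn_bilop_abs_sq_le[OF assms, of x y] by (auto simp: top_unique)
  then have "AE u in lborel. (bilop_abs k x y u)^2 \<noteq> \<infinity>"
    by (intro nn_integral_PInf_AE) auto
  then show ?thesis
  proof eventually_elim
    case (elim u)
    then have "bilop_abs k x y u < \<infinity>" using ennreal_sq_less_top by (simp add: less_top)
    then show ?case unfolding bilop_abs_def by (intro integrableI_bounded) auto
  qed
qed

lemma herm_sq_int_bilop_fun: assumes "kernel K k" shows "herm_sq_int (bilop_fun k x y)"
  unfolding herm_sq_int_def csq_int_iff_nn_integral
proof (intro conjI allI)
  show "(NN u. ennreal ((cmod (bilop_fun k x y u))^2)) < \<infinity>"
    by (rule le_less_trans[OF nn_bilop_fun_sq_le[OF assms]]) simp
  show "bilop_fun k x y \<in> borel_measurable lborel" using bilop_fun_measurable[OF assms] by simp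
  fix u :: real
  have "bilop_fun k x y (- u) = (LBINT v. k (- u) (0 - v) * fun_of x (- u - (0 - v)) * fun_of y (0 - v))"
    unfolding bilop_fun_def by (rule integral_reflect_shift[symmetric])
  also have "... = (LBINT v. cnj (k u v * fun_of x (u - v) * fun_of y v))"
  proof (intro Bochner_Integration.integral_cong refl)
    fix v :: real
    have "fun_of x (- u - (0 - v)) = cnj (fun_of x (u - v))" using fun_of_minus[of x "u - v"] by (simp add: algebra_simps)
    then show "k (- u) (0 - v) * fun_of x (- u - (0 - v)) * fun_of y (0 - v) = cnj (k u v * fun_of x (u - v) * fun_of y v)"
      using assms by (simp add: kernel_def)
  qed
  finally show "bilop_fun k x y (- u) = cnj (bilop_fun k x y u)" by (simp only: Bochner_Integration.integral_cnj bilop_fun_def)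
qed

lemma norm_bilop_le: assumes "kernel K k" shows "norm (bilop k x y) <= K * C_bil * norm x * norm y"
  unfolding bilop_def
  by (rule norm_L2_of_le[OF herm_sq_int_bilop_fun[OF assms] nn_bilop_fun_sq_le[OF assms]])
    (use kernel_nonneg[OF assms] in simp)

lemma bilop_eqI:
  assumes "kernel K k" "kernel L l"
    and "\<And>u. AE v in lborel. k u v * fun_of x (u - v) * fun_of y v = l u v * fun_of x' (u - v) * fun_of y' v"
  shows "bilop k x y = bilop l x' y'"
proof -
  have "bilop_fun k x y u = bilop_fun l x' y' u" for u
    unfolding bilop_fun_def
  proof (rule integral_cong_AE)
    note [measurable] = kernel_section_measurable[OF assms(1)] kernel_section_measurable[OF assms(2)]
    show "(\<lambda>v. k u v * fun_of x (u - v) * fun_of y v) \<in> borel_measurable lborel" by measurable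
    show "(\<lambda>v. l u v * fun_of x' (u - v) * fun_of y' v) \<in> borel_measurable lborel" by measurable
  qed (rule assms(3))
  then have "bilop_fun k x y = bilop_fun l x' y'" by (rule ext)
  then show ?thesis by (simp add: bilop_def)
qed

lemma bilop_sumI:
  assumes "kernel K k" "kernel L l" "kernel M m"
    and "\<And>u. AE v in lborel. k u v * fun_of x (u - v) * fun_of y v =
      l u v * fun_of x' (u - v) * fun_of y' v + m u v * fun_of x'' (u - v) * fun_of y'' v"
  shows "bilop k x y = bilop l x' y' + bilop m x'' y''"
  unfolding bilop_def L2_of_add[OF herm_sq_int_bilop_fun[OF assms(2)] herm_sq_int_bilop_fun[OF assms(3)]]
proof (rule L2_of_eqI[OF herm_sq_int_bilop_fun[OF assms(1)] herm_sq_int_add[OF herm_sq_int_bilop_fun[OF assms(2)] herm_sq_int_bilop_fun[OF assms(3)]]])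
  note [measurable] = kernel_section_measurable[OF assms(1)] kernel_section_measurable[OF assms(2)] kernel_section_measurable[OF assms(3)]
  show "AE u in lborel. bilop_fun k x y u = bilop_fun l x' y' u + bilop_fun m x'' y'' u"
    using bilop_fun_integrable_AE[OF assms(2), of x' y'] bilop_fun_integrable_AE[OF assms(3), of x'' y'']
  proof eventually_elim
    case (elim u)
    have "bilop_fun k x y u = (LBINT v. l u v * fun_of x' (u - v) * fun_of y' v + m u v * fun_of x'' (u - v) * fun_of y'' v)"
      unfolding bilop_fun_def by (rule integral_cong_AE[OF _ _ assms(4)]) measurable
    also have "... = bilop_fun l x' y' u + bilop_fun m x'' y'' u"
      unfolding bilop_fun_def by (rule Bochner_Integration.integral_add[OF elim])
    finally show ?case .
  qed
qed

lemma kernel_scale: "kernel K k ==> kernel (\<bar>c\<bar> * K) (\<lambda>u v. cx c * k u v)"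
  unfolding kernel_def by (auto simp: norm_mult case_prod_beta' mult.assoc intro!: mult_left_mono)

lemma kernel_add: assumes "kernel K k" "kernel L l" shows "kernel (K + L) (\<lambda>u v. k u v + l u v)"
  using assms unfolding kernel_def
  by (auto simp: case_prod_beta' ring_distribs(2) intro!: order_trans[OF norm_triangle_ineq] add_mono)

lemma kernel_swap: assumes "kernel K k" shows "kernel K (\<lambda>u v. k u (u - v))"
proof -
  have "(\<lambda>p. (\<lambda>(u, v). k u v) (fst p, fst p - snd p)) \<in> meas2"
    by (rule measurable_compose[OF _ kernel_measurable[OF assms]]) measurable
  moreover have "k (- u) (- u - - v) = cnj (k u (u - v))" for u v
  proof -
    have "k (- u) (- (u - v)) = cnj (k u (u - v))" using assms unfolding kernel_def by blast
    then show ?thesis by (simp add: algebra_simps)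
  qed
  moreover have "cmod (k u (u - v)) <= K * (J (u - v) + J v + J u)" for u v
  proof -
    have "cmod (k u (u - v)) <= K * (J (u - (u - v)) + J (u - v) + J u)" using assms unfolding kernel_def by blast
    then show ?thesis by (simp add: add_ac)
  qed
  ultimately show ?thesis unfolding kernel_def by (simp add: case_prod_beta')
qed

lemma kernel_adj: assumes "kernel K k" shows "kernel K (\<lambda>u v. cnj (k v u))"
proof -
  have "(\<lambda>p. (\<lambda>(u, v). k u v) (snd p, fst p)) \<in> meas2"
    by (rule measurable_compose[OF _ kernel_measurable[OF assms]]) measurable
  then have "(\<lambda>p. cnj (k (snd p) (fst p))) \<in> meas2"
    using measurable_compose[OF _ cnj_measurable] by simp
  moreover have "cmod (k v u) <= K * (J (u - v) + J v + J u)" for u v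
  proof -
    have "cmod (k v u) <= K * (J (v - u) + J u + J v)" using assms unfolding kernel_def by blast
    then show ?thesis using jpow_minus[of "1 - s" "u - v"] by (simp add: add_ac)
  qed
  ultimately show ?thesis using assms unfolding kernel_def by (simp add: case_prod_beta')
qed

lemma kernel_fmult:
  assumes "kernel K k" "herm_sym A a" "herm_sym B b" "herm_sym M m"
  shows "kernel (M * K * A * B) (\<lambda>u v. m u * k u v * a (u - v) * b v)"
proof -
  note [measurable] = kernel_measurable[OF assms(1)] herm_sym_measurable[OF assms(2)] herm_sym_measurable[OF assms(3)] herm_sym_measurable[OF assms(4)]
  have "(\<lambda>p. m (fst p) * (\<lambda>(u, v). k u v) p * a (fst p - snd p) * b (snd p)) \<in> meas2"
    by measurable
  moreover have "a (- u - - v) = cnj (a (u - v))" for u v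
  proof -
    have "a (- (u - v)) = cnj (a (u - v))" using assms(2) unfolding herm_sym_def by blast
    then show ?thesis by (simp add: algebra_simps)
  qed
  moreover have "cmod (m u * k u v * a (u - v) * b v) <= (M * K * A * B) * (J (u - v) + J v + J u)" for u v
  proof -
    have "cmod (m u * k u v * a (u - v) * b v) <= M * (K * (J (u - v) + J v + J u)) * A * B"
      unfolding norm_mult using assms kernel_nonneg[OF assms(1)] herm_sym_nonneg[OF assms(2)] herm_sym_nonneg[OF assms(3)] herm_sym_nonneg[OF assms(4)]
      by (intro mult_mono) (auto simp: kernel_def herm_sym_def intro!: mult_nonneg_nonneg add_nonneg_nonneg)
    then show ?thesis by (simp add: mult_ac)
  qed
  moreover have "m (- u) = cnj (m u)" "k (- u) (- v) = cnj (k u v)" "b (- v) = cnj (b v)" for u v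
    using assms(1,3,4) unfolding kernel_def herm_sym_def by blast+
  ultimately show ?thesis unfolding kernel_def by (simp only: case_prod_beta' complex_cnj_mult simp_thms prod.collapse)
qed

lemma bilop_kernel_add: "kernel K k ==> kernel L l ==> bilop (\<lambda>u v. k u v + l u v) x y = bilop k x y + bilop l x y"
  by (rule bilop_sumI[OF kernel_add]) (auto simp: ring_distribs)

lemma bilop_add_left: assumes "kernel K k" shows "bilop k (x + x') y = bilop k x y + bilop k x' y"
proof (rule bilop_sumI[OF assms assms assms])
  fix u :: real
  show "AE v in lborel. k u v * fun_of (x + x') (u - v) * fun_of y v = k u v * fun_of x (u - v) * fun_of y v + k u v * fun_of x' (u - v) * fun_of y v"
    using AE_lborel_reflect_shift[OF fun_of_add[of x x'], of u] by eventually_elim (simp add: ring_distribs)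
qed

lemma bilop_add_right: assumes "kernel K k" shows "bilop k x (y + y') = bilop k x y + bilop k x y'"
proof (rule bilop_sumI[OF assms assms assms])
  fix u :: real
  show "AE v in lborel. k u v * fun_of x (u - v) * fun_of (y + y') v = k u v * fun_of x (u - v) * fun_of y v + k u v * fun_of x (u - v) * fun_of y' v"
    using fun_of_add[of y y'] by eventually_elim (simp add: ring_distribs)
qed

lemma bilop_kernel_scale: assumes "kernel K k" shows "bilop (\<lambda>u v. cx c * k u v) x y = c *\<^sub>R bilop k x y"
  unfolding bilop_def L2_of_scale[OF herm_sq_int_bilop_fun[OF assms]]
  by (rule arg_cong[of _ _ L2_of]) (simp add: bilop_fun_def[abs_def] mult.assoc)

lemma bilop_scale_left: assumes "kernel K k" shows "bilop k (c *\<^sub>R x) y = c *\<^sub>R bilop k x y"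
  unfolding bilop_kernel_scale[OF assms, symmetric]
proof (rule bilop_eqI[OF assms kernel_scale[OF assms]])
  fix u :: real
  show "AE v in lborel. k u v * fun_of (c *\<^sub>R x) (u - v) * fun_of y v = cx c * k u v * fun_of x (u - v) * fun_of y v"
    using AE_lborel_reflect_shift[OF fun_of_scale[of c x], of u] by eventually_elim simp
qed

lemma bilop_scale_right: assumes "kernel K k" shows "bilop k x (c *\<^sub>R y) = c *\<^sub>R bilop k x y"
  unfolding bilop_kernel_scale[OF assms, symmetric]
proof (rule bilop_eqI[OF assms kernel_scale[OF assms]])
  fix u :: real
  show "AE v in lborel. k u v * fun_of x (u - v) * fun_of (c *\<^sub>R y) v = cx c * k u v * fun_of x (u - v) * fun_of y v"
    using fun_of_scale[of c y] by eventually_elim simp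
qed

lemma bounded_bilinear_bilop: "kernel K k ==> bounded_bilinear (bilop k)"
  by standard (auto simp: bilop_add_left bilop_add_right bilop_scale_left bilop_scale_right
      intro!: exI[of _ "K * C_bil"] order_trans[OF norm_bilop_le] simp: mult_ac)

lemma fmult_bilop_fmult:
  assumes "kernel K k" "herm_sym A a" "herm_sym B b" "herm_sym M m"
  shows "fmult m (bilop k (fmult a x) (fmult b y)) = bilop (\<lambda>u v. m u * k u v * a (u - v) * b v) x y"
proof -
  have kernel_ab: "kernel (1 * K * A * B) (\<lambda>u v. 1 * k u v * a (u - v) * b v)"
    by (rule kernel_fmult[OF assms(1-3)]) (simp add: herm_sym_def)
  have "bilop k (fmult a x) (fmult b y) = bilop (\<lambda>u v. 1 * k u v * a (u - v) * b v) x y"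
  proof (rule bilop_eqI[OF assms(1) kernel_ab])
    fix u :: real
    show "AE v in lborel. k u v * fun_of (fmult a x) (u - v) * fun_of (fmult b y) v = 1 * k u v * a (u - v) * b v * fun_of x (u - v) * fun_of y v"
      using AE_lborel_reflect_shift[OF fun_of_fmult[OF assms(2), of x], of u] fun_of_fmult[OF assms(3), of y]
      by eventually_elim simp
  qed
  then show ?thesis
    unfolding bilop_def using fmult_L2_of[OF assms(4) herm_sq_int_bilop_fun[OF kernel_ab, of x y]]
    by (simp add: bilop_fun_def[abs_def] mult.assoc)
qed

lemma bilop_swap: assumes "kernel K k" shows "bilop k x y = bilop (\<lambda>u v. k u (u - v)) y x"
proof -
  have "bilop_fun k x y u = bilop_fun (\<lambda>u v. k u (u - v)) y x u" for u
    unfolding bilop_fun_def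
    using integral_reflect_shift[of "\<lambda>v. k u v * fun_of x (u - v) * fun_of y v" u]
    by (simp add: mult_ac)
  then have "bilop_fun k x y = bilop_fun (\<lambda>u v. k u (u - v)) y x" by (rule ext)
  then show ?thesis by (simp add: bilop_def)
qed

lemma inner_bilop:
  assumes "kernel K k"
  shows "integrable (lborel \<Otimes>\<^sub>M lborel) (\<lambda>(u, v). cnj (fun_of z u) * (k u v * fun_of x (u - v) * fun_of y v))"
    and "inner z (bilop k x y) = Re (\<integral>p. (\<lambda>(u, v). cnj (fun_of z u) * (k u v * fun_of x (u - v) * fun_of y v)) p \<partial>(lborel \<Otimes>\<^sub>M lborel))"
proof -
  note [measurable] = integrand_measurable[OF assms, of x y] bilop_abs_measurable[OF assms, of x y] kernel_section_measurable[OF assms]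
  have "(\<lambda>p. cnj (fun_of z (fst p)) * (\<lambda>(u, v). k u v * fun_of x (u - v) * fun_of y v) p) \<in> meas2"
    by measurable
  then have measurable_prod: "(\<lambda>(u, v). cnj (fun_of z u) * (k u v * fun_of x (u - v) * fun_of y v)) \<in> borel_measurable (lborel \<Otimes>\<^sub>M lborel)"
    by (simp add: case_prod_beta' cong: measurable_cong_sets)
  have "(\<integral>\<^sup>+p. ennreal (cmod ((\<lambda>(u, v). cnj (fun_of z u) * (k u v * fun_of x (u - v) * fun_of y v)) p)) \<partial>(lborel \<Otimes>\<^sub>M lborel))
     = (NN u. \<integral>\<^sup>+v. ennreal (cmod (cnj (fun_of z u) * (k u v * fun_of x (u - v) * fun_of y v))) \<partial>lborel)"
    using measurable_prod by (subst lborel.nn_integral_fst[symmetric]) (auto cong: measurable_cong_sets)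
  also have "... = (NN u. ennreal (cmod (fun_of z u)) * bilop_abs k x y u)"
    unfolding bilop_abs_def norm_mult complex_mod_cnj
    by (intro nn_integral_cong) (auto simp: ennreal_mult' nn_integral_cmult[symmetric] intro!: nn_integral_cong)
  also have "... < \<infinity>"
  proof -
    have "(NN u. ennreal (cmod (fun_of z u)) * bilop_abs k x y u)^2 <= (NN u. (ennreal (cmod (fun_of z u)))^2) * (NN u. (bilop_abs k x y u)^2)"
      by (rule Cauchy_Schwarz_nn_integral) measurable
    also have "... <= ennreal ((norm z)^2) * ennreal ((K * C_bil * norm x * norm y)^2)"
      by (intro mult_mono nn_bilop_abs_sq_le[OF assms]) (auto simp: ennreal_power nn_norm_fun_of)
    also have "... < \<infinity>" by (simp add: ennreal_mult'[symmetric])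
    finally show ?thesis using ennreal_sq_less_top by simp
  qed
  finally show integrable_prod: "integrable (lborel \<Otimes>\<^sub>M lborel) (\<lambda>(u, v). cnj (fun_of z u) * (k u v * fun_of x (u - v) * fun_of y v))"
    using measurable_prod by (intro integrableI_bounded) auto
  have "inner z (bilop k x y) = inner (bilop k x y) (L2_of (fun_of z))" by (simp add: inner_commute)
  also have "... = Re (LBINT u. bilop_fun k x y u * cnj (fun_of z u))"
    unfolding bilop_def by (rule inner_L2_of[OF herm_sq_int_bilop_fun[OF assms] herm_sq_int_fun_of])
  also have "(LBINT u. bilop_fun k x y u * cnj (fun_of z u)) = (LBINT u. \<integral>v. cnj (fun_of z u) * (k u v * fun_of x (u - v) * fun_of y v) \<partial>lborel)"
    by (simp add: bilop_fun_def mult.commute)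
  also have "... = (\<integral>p. (\<lambda>(u, v). cnj (fun_of z u) * (k u v * fun_of x (u - v) * fun_of y v)) p \<partial>(lborel \<Otimes>\<^sub>M lborel))"
    using lborel_pair.integral_fst'[OF integrable_prod] by simp
  finally show "inner z (bilop k x y) = Re (\<integral>p. (\<lambda>(u, v). cnj (fun_of z u) * (k u v * fun_of x (u - v) * fun_of y v)) p \<partial>(lborel \<Otimes>\<^sub>M lborel))" .
qed

lemma bilop_adjoint:
  assumes "kernel K k"
  shows "inner z (bilop k x y) = inner y (bilop (\<lambda>u v. cnj (k v u)) x z)"
proof -
  let ?f = "\<lambda>(u, v). cnj (fun_of z u) * (k u v * fun_of x (u - v) * fun_of y v)"
  let ?g = "\<lambda>(u, v). cnj (fun_of y u) * (cnj (k v u) * fun_of x (u - v) * fun_of z v)"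
  have swap: "?g p = cnj (?f (snd p, fst p))" for p
    using fun_of_minus[of x "fst p - snd p"] by (cases p) (simp add: mult_ac)
  have "(\<integral>p. ?g p \<partial>(lborel \<Otimes>\<^sub>M lborel)) = (\<integral>p. cnj (?f (snd p, fst p)) \<partial>(lborel \<Otimes>\<^sub>M lborel))"
    by (intro Bochner_Integration.integral_cong refl swap)
  also have "... = cnj (\<integral>p. ?f (snd p, fst p) \<partial>(lborel \<Otimes>\<^sub>M lborel))"
    by (rule Bochner_Integration.integral_cnj)
  also have "(\<integral>p. ?f (snd p, fst p) \<partial>(lborel \<Otimes>\<^sub>M lborel)) = (\<integral>p. ?f p \<partial>(lborel \<Otimes>\<^sub>M lborel))"
    using lborel_pair.integral_product_swap[of ?f] borel_measurable_integrable[OF inner_bilop(1)[OF assms, of z x y]]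
    by (simp add: case_prod_beta')
  finally show ?thesis
    using inner_bilop(2)[OF assms, of z x y] inner_bilop(2)[OF kernel_adj[OF assms], of y x z] by simp
qed

end

section \<open>Slowly varying weights\<close>

text \<open>The exponent controls the logarithmic derivative, which is all that the commutator estimates use.\<close>
definition slow :: "nat => (real => real) => bool" where
  "slow K a \<longleftrightarrow> a \<in> meas \<and> (\<forall>x. 0 < a x) \<and>
     (\<forall>x y. \<bar>x\<bar> <= \<bar>y\<bar> \<longrightarrow> a x <= a y \<and> a y <= a x * (jbr y / jbr x) ^ K)"

lemma slow_pos: "slow K a ==> 0 < a x" by (simp add: slow_def)
lemma slow_measurable: "slow K a ==> a \<in> meas" by (simp add: slow_def)
lemma slow_mono: "slow K a ==> \<bar>x\<bar> <= \<bar>y\<bar> ==> a x <= a y" by (simp add: slow_def)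
lemma slow_growth: "slow K a ==> \<bar>x\<bar> <= \<bar>y\<bar> ==> a y <= a x * (jbr y / jbr x) ^ K" by (simp add: slow_def)
lemma slow_even: "slow K a ==> a (- x) = a x"
  using slow_mono[of K a x "-x"] slow_mono[of K a "-x" x] by auto

lemma even_sym_slow: "slow K w ==> (\<And>t. w t <= 1) ==> even_sym 1 w"
  using slow_pos[of K w] slow_even[of K w] slow_measurable[of K w] by (auto simp: even_sym_def less_imp_le)

lemma jbr_ratio_ge_1: "\<bar>x\<bar> <= \<bar>y\<bar> ==> 1 <= jbr y / jbr x"
  using jbr_mono[of x y] by simp

lemma slow_le_exponent: assumes "slow K a" "K <= L" shows "slow L a"
  unfolding slow_def
proof (intro conjI allI impI)
  fix x y :: real assume xy: "\<bar>x\<bar> <= \<bar>y\<bar>"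
  have "(jbr y / jbr x) ^ K <= (jbr y / jbr x) ^ L"
    by (intro power_increasing assms jbr_ratio_ge_1 xy)
  then have "a x * (jbr y / jbr x) ^ K <= a x * (jbr y / jbr x) ^ L"
    using slow_pos[OF assms(1), of x] by (intro mult_left_mono) auto
  then show "a y <= a x * (jbr y / jbr x) ^ L" using slow_growth[OF assms(1) xy] by linarith
qed (use assms(1) in \<open>auto simp: slow_def\<close>)

lemma slow_one: "slow 1 (\<lambda>_. 1)" by (auto simp: slow_def jbr_mono)

lemma slow_mult: assumes "slow K a" "slow L b" shows "slow (K + L) (\<lambda>x. a x * b x)"
  unfolding slow_def
proof (intro conjI allI impI)
  show "(\<lambda>x. a x * b x) \<in> meas"
    using assms by (intro borel_measurable_times) (auto simp: slow_def)
  fix x y :: real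
  show "0 < a x * b x" using assms by (simp add: slow_def)
  assume xy: "\<bar>x\<bar> <= \<bar>y\<bar>"
  show "a x * b x <= a y * b y"
    using slow_mono[OF assms(1) xy] slow_mono[OF assms(2) xy] slow_pos[OF assms(1)] slow_pos[OF assms(2)]
    by (intro mult_mono) (auto intro: less_imp_le)
  have "a y * b y <= (a x * (jbr y / jbr x) ^ K) * (b x * (jbr y / jbr x) ^ L)"
    using slow_growth[OF assms(1) xy] slow_growth[OF assms(2) xy] slow_pos[OF assms(1)] slow_pos[OF assms(2)]
    by (intro mult_mono) (auto intro: less_imp_le)
  then show "a y * b y <= a x * b x * (jbr y / jbr x) ^ (K + L)" by (simp add: power_add mult_ac)
qed

lemma slow_jpow: assumes "0 <= r" "r <= real K" shows "slow K (jpow r)"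
  unfolding slow_def
proof (intro conjI allI impI)
  fix x y :: real
  show "0 < jpow r x" by simp
  assume xy: "\<bar>x\<bar> <= \<bar>y\<bar>"
  show "jpow r x <= jpow r y" by (rule jpow_increasing[OF assms(1) xy])
  have "jpow r y = jpow r x * (jbr y / jbr x) powr r" by (simp add: jpow_def powr_divide)
  also have "... <= jpow r x * (jbr y / jbr x) powr (real K)"
    using jbr_ratio_ge_1[OF xy] assms by (intro mult_left_mono powr_mono) auto
  also have "(jbr y / jbr x) powr (real K) = (jbr y / jbr x) ^ K" by (rule powr_realpow) simp
  finally show "jpow r y <= jpow r x * (jbr y / jbr x) ^ K" .
qed measurable

lemma slow_min_1: assumes "R > 0" shows "slow 1 (\<lambda>x. min 1 (jbr x / R))"
  unfolding slow_def
proof (intro conjI allI impI)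
  fix x y :: real
  show "0 < min 1 (jbr x / R)" using assms by simp
  assume xy: "\<bar>x\<bar> <= \<bar>y\<bar>"
  show "min 1 (jbr x / R) <= min 1 (jbr y / R)"
    using jbr_mono[OF xy] assms by (intro min.mono divide_right_mono) auto
  have r: "1 <= jbr y / jbr x" by (rule jbr_ratio_ge_1[OF xy])
  show "min 1 (jbr y / R) <= min 1 (jbr x / R) * (jbr y / jbr x) ^ 1"
  proof (cases "jbr x / R <= 1")
    case True
    then have "min 1 (jbr x / R) * (jbr y / jbr x) ^ 1 = jbr y / R" by (simp add: min_def)
    then show ?thesis by simp
  next
    case False
    then have "min 1 (jbr x / R) * (jbr y / jbr x) ^ 1 = jbr y / jbr x" by (simp add: min_def)
    then show ?thesis using r by (simp only: min_le_iff_disj simp_thms)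
  qed
qed measurable

lemma slow_diff:
  assumes "slow K a" "\<bar>x\<bar> <= \<bar>y\<bar>"
  shows "a y - a x <= real K * a y * \<bar>y - x\<bar> / jbr y"
proof -
  define t where "t = jbr x / jbr y"
  have t: "0 < t" "t <= 1" using jbr_mono[OF assms(2)] by (auto simp: t_def)
  have "1 + real K * (t - 1) <= (1 + (t - 1)) ^ K" using t by (intro Bernoulli_inequality) auto
  then have B: "1 - real K * (1 - t) <= t ^ K" by (simp add: algebra_simps)
  have "a y * t ^ K <= a x * (jbr y / jbr x) ^ K * t ^ K"
    using slow_growth[OF assms] t by (intro mult_right_mono) auto
  also have "... = a x" by (simp add: t_def power_divide jbr_neq_0)
  finally have "a y - a x <= a y * (1 - t ^ K)" by (simp add: algebra_simps)
  also have "... <= a y * (real K * (1 - t))"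
    using B slow_pos[OF assms(1)] by (intro mult_left_mono) (auto intro: less_imp_le)
  also have "1 - t = (jbr y - jbr x) / jbr y" by (simp add: t_def field_simps jbr_neq_0)
  also have "a y * (real K * ((jbr y - jbr x) / jbr y)) <= a y * (real K * (\<bar>y - x\<bar> / jbr y))"
    using jbr_lipschitz[of y x] slow_pos[OF assms(1), of y]
    by (intro mult_left_mono divide_right_mono) (auto intro: less_imp_le)
  finally show ?thesis by (simp add: mult_ac)
qed

lemma slow_le_scale:
  assumes "slow K a" "\<bar>x\<bar> <= c * \<bar>y\<bar>" "c \<ge> 1"
  shows "a x <= c ^ K * a y"
proof (cases "\<bar>x\<bar> <= \<bar>y\<bar>")
  case True
  have "a x <= 1 * a y" using slow_mono[OF assms(1) True] by simp
  also have "... <= c ^ K * a y" using assms(3) slow_pos[OF assms(1), of y] by (intro mult_right_mono) auto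
  finally show ?thesis .
next
  case False
  have "jbr x <= c * jbr y"
  proof -
    have "\<bar>x\<bar>^2 <= (c * \<bar>y\<bar>)^2" using assms(2) by (intro power_mono) auto
    then have "x^2 <= (c * \<bar>y\<bar>)^2" by simp
    moreover have "1 <= c^2" using assms(3) by simp
    ultimately have "1 + x^2 <= c^2 * (1 + y^2)" by (simp add: power_mult_distrib algebra_simps)
    then have "sqrt (1 + x^2) <= sqrt (c^2 * (1 + y^2))" by simp
    then show ?thesis using assms(3) by (simp add: jbr_def real_sqrt_mult)
  qed
  then have "jbr x / jbr y <= c" by (simp add: field_simps)
  then have "(jbr x / jbr y) ^ K <= c ^ K" by (intro power_mono) auto
  then have "a y * (jbr x / jbr y) ^ K <= a y * c ^ K"
    using slow_pos[OF assms(1), of y] by (intro mult_left_mono) auto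
  then show ?thesis using slow_growth[OF assms(1), of y x] False by (simp add: mult.commute)
qed

lemma slow_le_max: assumes "slow K a" shows "a x <= 2 ^ K * max (a (x - y)) (a y)"
proof -
  have "\<bar>x\<bar> <= 2 * \<bar>x - y\<bar> \<or> \<bar>x\<bar> <= 2 * \<bar>y\<bar>"
    using abs_triangle_ineq[of "x - y" y] by auto
  then have "a x <= 2 ^ K * a (x - y) \<or> a x <= 2 ^ K * a y"
    using slow_le_scale[OF assms, of x 2] by auto
  then show ?thesis by (auto intro: order_trans[OF _ mult_left_mono])
qed

lemma slow_le_add: assumes "slow K a" shows "a x <= 2 ^ K * (a (x - y) + a y)"
  using slow_pos[OF assms, of "x - y"] slow_pos[OF assms, of y]
  by (intro order_trans[OF slow_le_max[OF assms, of x y] mult_left_mono]) auto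

lemma slow_le_mult: assumes "slow K a" "\<And>t. a t \<ge> 1" shows "a x <= 2 ^ K * (a (x - y) * a y)"
  using mult_left_mono[OF assms(2)[of y], of "a (x - y)"] mult_right_mono[OF assms(2)[of "x - y"], of "a y"]
    assms(2)[of "x - y"] assms(2)[of y]
  by (intro order_trans[OF slow_le_max[OF assms(1), of x y] mult_left_mono]) auto

lemma slow_bracket:
  assumes "slow K a"
  shows "\<bar>(a x)^2 * y - (a y)^2 * x\<bar> <= (2 * real K + 1) * (max (a x) (a y))^2 * \<bar>x - y\<bar>"
proof -
  have sq: "slow (K + K) (\<lambda>x. a x * a x)" by (rule slow_mult[OF assms assms])
  have main: "\<bar>(a x)^2 * y - (a y)^2 * x\<bar> <= (2 * real K + 1) * (a y)^2 * \<bar>x - y\<bar>" if xy: "\<bar>x\<bar> <= \<bar>y\<bar>" for x y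
  proof -
    have sq_diff_le: "(a y)^2 - (a x)^2 <= real (K + K) * (a y)^2 * \<bar>y - x\<bar> / jbr y"
      using slow_diff[OF sq xy] by (simp add: power2_eq_square)
    have sq_mono: "(a x)^2 <= (a y)^2" using slow_mono[OF assms xy] slow_pos[OF assms, of x] by (intro power_mono) auto
    have "\<bar>(a x)^2 * y - (a y)^2 * x\<bar> = \<bar>(a x)^2 * (y - x) - ((a y)^2 - (a x)^2) * x\<bar>"
      by (simp add: algebra_simps)
    also have "... <= (a x)^2 * \<bar>y - x\<bar> + ((a y)^2 - (a x)^2) * \<bar>x\<bar>"
      using abs_triangle_ineq4[of "(a x)^2 * (y - x)" "((a y)^2 - (a x)^2) * x"] sq_mono by (simp add: abs_mult)
    also have "((a y)^2 - (a x)^2) * \<bar>x\<bar> <= (real (K + K) * (a y)^2 * \<bar>y - x\<bar> / jbr y) * jbr y"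
      using sq_diff_le sq_mono xy abs_le_jbr[of y] by (intro mult_mono) (auto intro!: divide_nonneg_pos)
    also have "... = real (K + K) * (a y)^2 * \<bar>y - x\<bar>" by (simp add: jbr_neq_0)
    also have "(a x)^2 * \<bar>y - x\<bar> <= (a y)^2 * \<bar>y - x\<bar>" using sq_mono by (intro mult_right_mono) auto
    finally show ?thesis by (simp add: algebra_simps abs_minus_commute)
  qed
  show ?thesis
  proof (cases "\<bar>x\<bar> <= \<bar>y\<bar>")
    case True
    then show ?thesis using main[OF True] slow_mono[OF assms True] by (simp add: max_def)
  next
    case False
    then have yx: "\<bar>y\<bar> <= \<bar>x\<bar>" by simp
    have "max (a x) (a y) = a x" using slow_mono[OF assms yx] by (simp add: max_def)
    then show ?thesis using main[OF yx] by (simp add: abs_minus_commute)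
  qed
qed

section \<open>The dispersion symbol\<close>

lemma DERIV_nonneg_imp_le:
  fixes f :: "real => real"
  assumes "0 <= z" "\<And>x. 0 <= x ==> (f has_real_derivative f' x) (at x)" "\<And>x. 0 <= x ==> 0 <= f' x"
  shows "f 0 <= f z"
  using assms by (intro DERIV_nonneg_imp_nondecreasing[of 0 z f]) blast+

lemma tanh_sq_le_1: "(tanh (x::real))^2 <= 1"
  using tanh_real_bounds[of x] by (auto simp: abs_square_le_1 intro!: abs_leI)

lemma tanh_le_self: assumes "0 <= z" shows "tanh z <= (z::real)"
proof -
  have "0 - tanh 0 <= z - tanh z"
  proof (rule DERIV_nonneg_imp_le[OF assms])
    show "((\<lambda>z. z - tanh z) has_real_derivative (tanh x)^2) (at x)" for x :: real
      by (auto intro!: derivative_eq_intros)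
  qed simp
  then show ?thesis by simp
qed

lemma tanh_ge_sech: assumes "0 <= z" shows "z * (1 - (tanh z)^2) <= tanh (z::real)"
proof -
  have "tanh 0 - 0 * (1 - (tanh 0)^2) <= tanh z - z * (1 - (tanh z)^2)"
  proof (rule DERIV_nonneg_imp_le[OF assms])
    fix x :: real
    show "((\<lambda>z. tanh z - z * (1 - (tanh z)^2)) has_real_derivative 2 * x * tanh x * (1 - (tanh x)^2)) (at x)"
      by (auto intro!: derivative_eq_intros simp: algebra_simps power2_eq_square)
  qed (use tanh_sq_le_1 in auto)
  then show ?thesis by simp
qed

lemma le_tanh_linear: assumes "0 <= z" shows "z <= (1 + z) * tanh (z::real)"
proof -
  have "(1 + 0) * tanh 0 - 0 <= (1 + z) * tanh z - z"
  proof (rule DERIV_nonneg_imp_le[OF assms])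
    fix x :: real assume "0 <= x"
    show "((\<lambda>z. (1 + z) * tanh z - z) has_real_derivative tanh x * (1 - tanh x) + x * (1 - (tanh x)^2)) (at x)"
      by (auto intro!: derivative_eq_intros simp: algebra_simps power2_eq_square)
    show "0 <= tanh x * (1 - tanh x) + x * (1 - (tanh x)^2)"
      using \<open>0 <= x\<close> tanh_sq_le_1[of x] tanh_real_lt_1[of x] by (intro add_nonneg_nonneg mult_nonneg_nonneg) auto
  qed
  then show ?thesis by simp
qed

lemma le_tanh_quadratic: assumes "0 <= z" shows "z <= (1 + z^2) * tanh (z::real)"
proof -
  have "(1 + 0^2) * tanh 0 - 0 <= (1 + z^2) * tanh z - z"
  proof (rule DERIV_nonneg_imp_le[OF assms])
    fix x :: real assume "0 <= x"
    show "((\<lambda>z. (1 + z^2) * tanh z - z) has_real_derivative 2 * x * tanh x - (tanh x)^2 + x^2 * (1 - (tanh x)^2)) (at x)"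
      by (auto intro!: derivative_eq_intros simp: algebra_simps power2_eq_square)
    have "tanh x * tanh x <= (2 * x) * tanh x"
      using tanh_le_self[OF \<open>0 <= x\<close>] \<open>0 <= x\<close> by (intro mult_right_mono) auto
    then show "0 <= 2 * x * tanh x - (tanh x)^2 + x^2 * (1 - (tanh x)^2)"
      using tanh_sq_le_1[of x] by (intro add_nonneg_nonneg) (auto simp: power2_eq_square)
  qed
  then show ?thesis by simp
qed

context
  fixes m :: real assumes m: "0 < m" "m < 1"
begin

lemma tanh_quot_decreasing: assumes "0 < x" "x <= y" shows "tanh (m * y) / y <= tanh (m * x) / x"
proof (rule DERIV_nonpos_imp_nonincreasing[OF assms(2)])
  fix z assume "x <= z" "z <= y"
  then have z: "z > 0" using assms by linarith
  have "((\<lambda>z. tanh (m * z) / z) has_real_derivative ((m * z) * (1 - (tanh (m * z))^2) - tanh (m * z)) / (z * z)) (at z)"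
    using z by (auto intro!: derivative_eq_intros simp: algebra_simps power2_eq_square)
  moreover have "((m * z) * (1 - (tanh (m * z))^2) - tanh (m * z)) / (z * z) <= 0"
    using tanh_ge_sech[of "m * z"] z m by (intro divide_nonpos_pos) auto
  ultimately show "\<exists>d. ((\<lambda>z. tanh (m * z) / z) has_real_derivative d) (at z) \<and> d <= 0" by blast
qed

lemma tanh_quot_jbr_increasing:
  assumes "0 < x" "x <= y" shows "tanh (m * x) / x * (1 + x^2) <= tanh (m * y) / y * (1 + y^2)"
proof (rule DERIV_nonneg_imp_nondecreasing[OF assms(2)])
  fix z assume "x <= z" "z <= y"
  then have z: "z > 0" using assms by linarith
  define t where "t = tanh (m * z)"
  have t_bounds: "0 < t" "t <= m * z" "t^2 <= 1" using z m tanh_le_self[of "m * z"] tanh_sq_le_1[of "m * z"] by (auto simp: t_def)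
  have D: "((\<lambda>z. tanh (m * z) / z * (1 + z^2)) has_real_derivative (((m * z) * (1 - t^2)) * (1 + z^2) + t * (z^2 - 1)) / (z * z)) (at z)"
    using z unfolding t_def by (auto intro!: derivative_eq_intros simp: field_simps power2_eq_square)
  have "0 <= ((m * z) * (1 - t^2)) * (1 + z^2) + t * (z^2 - 1)"
  proof (cases "z \<ge> 1")
    case True
    then have "z^2 \<ge> 1" by simp
    then show ?thesis using t_bounds z m by (intro add_nonneg_nonneg mult_nonneg_nonneg) auto
  next
    case False
    have "m * z <= 1 * z" using m z by (intro mult_right_mono) auto
    then have "t <= z" using t_bounds(2) by linarith
    then have t_sq_le_z_sq: "t^2 <= z^2" using t_bounds by (intro power_mono) auto
    have z_sq_le_1: "z^2 <= 1" using False z by (simp add: power_le_one)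
    have "t * (1 - z^2) <= (m * z) * ((1 - t^2) * (1 + z^2))"
    proof (rule mult_mono)
      have "(1 - z^2) * 1 <= (1 - z^2) * (1 + z^2)" using z_sq_le_1 by (intro mult_left_mono) auto
      then have "1 - z^2 <= (1 - z^2) * (1 + z^2)" by simp
      also have "... <= (1 - t^2) * (1 + z^2)" using t_sq_le_z_sq by (intro mult_right_mono) auto
      finally show "1 - z^2 <= (1 - t^2) * (1 + z^2)" .
    qed (use t_bounds z m z_sq_le_1 in auto)
    then show ?thesis by (simp add: algebra_simps)
  qed
  then have "0 <= (((m * z) * (1 - t^2)) * (1 + z^2) + t * (z^2 - 1)) / (z * z)" by simp
  with D show "\<exists>d. ((\<lambda>z. tanh (m * z) / z * (1 + z^2)) has_real_derivative d) (at z) \<and> 0 <= d"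
    by blast
qed

end

locale whitham_boussinesq = sobolev_index +
  fixes \<mu> :: real
  assumes mu: "0 < \<mu>" "\<mu> < 1"
begin


lemma sqrt_mu: "0 < sqrt \<mu>" "sqrt \<mu> < 1" using mu by auto

lemma Tmu_abs: "Tmu \<mu> x = (if x = 0 then 1 else (1 / sqrt \<mu>) * (tanh (sqrt \<mu> * \<bar>x\<bar>) / \<bar>x\<bar>))"
  by (simp add: Tmu_def)

lemma Tmu_pos: "0 < Tmu \<mu> x"
  using sqrt_mu by (auto simp: Tmu_def)

lemma Tmu_le_1: "Tmu \<mu> x <= 1"
  using sqrt_mu tanh_le_self[of "sqrt \<mu> * \<bar>x\<bar>"] by (auto simp: Tmu_def divide_le_eq_1)

lemma Tmu_measurable [measurable]: "Tmu \<mu> \<in> meas"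
proof -
  have [measurable]: "(tanh :: real => real) \<in> meas"
    by (intro borel_measurable_continuous_onI continuous_intros) auto
  show ?thesis unfolding Tmu_def[abs_def] by measurable
qed

lemma Tmu_decreasing: assumes "\<bar>x\<bar> <= \<bar>y\<bar>" shows "Tmu \<mu> y <= Tmu \<mu> x"
proof (cases "x = 0")
  case True then show ?thesis using Tmu_le_1 by (simp add: Tmu_def[of \<mu> 0])
next
  case False
  then show ?thesis using tanh_quot_decreasing[OF sqrt_mu, of "\<bar>x\<bar>" "\<bar>y\<bar>"] assms sqrt_mu
    unfolding Tmu_abs by (auto simp del: times_divide_eq_right times_divide_eq_left intro!: mult_left_mono)
qed

lemma Tmu_growth: assumes "\<bar>x\<bar> <= \<bar>y\<bar>" shows "Tmu \<mu> x <= Tmu \<mu> y * (jbr y / jbr x)^2"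
proof -
  have "Tmu \<mu> x * (1 + x^2) <= Tmu \<mu> y * (1 + y^2)"
  proof -
    consider "y = 0" | "x = 0" "y \<noteq> 0" | "x \<noteq> 0" by blast
    then show ?thesis
    proof cases
      assume "y = 0"
      then show ?thesis using assms by simp
    next
      assume "x \<noteq> 0"
      then show ?thesis using tanh_quot_jbr_increasing[OF sqrt_mu, of "\<bar>x\<bar>" "\<bar>y\<bar>"] assms sqrt_mu
        unfolding Tmu_abs by (auto simp: divide_right_mono field_simps)
    next
      assume x: "x = 0" and y: "y \<noteq> 0"
      define z where "z = sqrt \<mu> * \<bar>y\<bar>"
      have z: "z > 0" "z <= \<bar>y\<bar>" using y sqrt_mu by (auto simp: z_def mult_le_cancel_right2)
      have "z^2 <= y^2" using z by (simp add: abs_le_square_iff[symmetric])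
      then have "(1 + z^2) * tanh z <= (1 + y^2) * tanh z" using z by (intro mult_right_mono) auto
      with le_tanh_quadratic[OF less_imp_le[OF z(1)]] have "z <= (1 + y^2) * tanh z" by (rule order_trans)
      then have "1 <= tanh z / z * (1 + y^2)" using z by (simp add: field_simps)
      then show ?thesis using x y by (simp add: Tmu_def z_def)
    qed
  qed
  moreover have "(jbr y / jbr x)^2 = (1 + y^2) / (1 + x^2)" by (simp add: jbr_def power_divide)
  moreover have "0 < 1 + x^2" by (simp add: add_pos_nonneg)
  ultimately show ?thesis by (simp add: pos_le_divide_eq)
qed

definition sqrtT :: "real => real" where "sqrtT x = sqrt (Tmu \<mu> x)"
definition rTinv :: "real => real" where "rTinv x = 1 / sqrtT x"

lemma sqrtT_pos [simp]: "0 < sqrtT x" using Tmu_pos by (simp add: sqrtT_def)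
lemma sqrtT_sq: "(sqrtT x)^2 = Tmu \<mu> x" using Tmu_pos[of x] by (simp add: sqrtT_def)
lemma sqrtT_eq: "sqrtT x = 1 / rTinv x" by (simp add: rTinv_def)
lemma rTinv_ge_1: "rTinv x \<ge> 1" using sqrtT_pos[of x] Tmu_le_1[of x] by (simp add: rTinv_def sqrtT_def)
lemma rTinv_pos [simp]: "0 < rTinv x" using rTinv_ge_1[of x] by linarith
lemma rTinv_nonneg [simp]: "0 <= rTinv x" using rTinv_pos[of x] by linarith
lemma rTinv_neq_0 [simp]: "rTinv x \<noteq> 0" using rTinv_pos[of x] by linarith

lemma slow_rTinv: "slow 1 rTinv"
  unfolding slow_def
proof (intro conjI allI impI)
  show "rTinv \<in> meas" unfolding rTinv_def[abs_def] sqrtT_def[abs_def] by measurable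
  fix x y :: real
  show "0 < rTinv x" by simp
  assume xy: "\<bar>x\<bar> <= \<bar>y\<bar>"
  show "rTinv x <= rTinv y"
    using Tmu_decreasing[OF xy] Tmu_pos[of x] Tmu_pos[of y] by (auto simp: rTinv_def sqrtT_def intro!: divide_left_mono)
  have "sqrtT x <= sqrt (Tmu \<mu> y * (jbr y / jbr x)^2)" using Tmu_growth[OF xy] by (simp add: sqrtT_def)
  also have "... = sqrtT y * (jbr y / jbr x)" by (simp add: real_sqrt_mult sqrtT_def)
  finally show "rTinv y <= rTinv x * (jbr y / jbr x) ^ 1"
    using sqrtT_pos[of x] sqrtT_pos[of y] by (simp add: rTinv_def field_simps)
qed

lemma rTinv_measurable [measurable]: "rTinv \<in> meas" using slow_rTinv by (rule slow_measurable)
lemma rTinv_minus [simp]: "rTinv (- x) = rTinv x" using slow_even[OF slow_rTinv] .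

lemma even_sym_sqrtT: "even_sym 1 sqrtT"
  unfolding even_sym_def sqrtT_eq[abs_def] using rTinv_ge_1 by (auto simp: abs_le_iff)

lemma sqrtT_bounds:
  "1 <= (1 + sqrt \<mu> * \<bar>x\<bar>) * (sqrtT x)^2" "(1 + sqrt \<mu> * \<bar>x\<bar>) * (sqrtT x)^2 <= 2"
proof -
  have "1 <= (1 + sqrt \<mu> * \<bar>x\<bar>) * Tmu \<mu> x \<and> (1 + sqrt \<mu> * \<bar>x\<bar>) * Tmu \<mu> x <= 2"
  proof (cases "x = 0")
    case False
    define z where "z = sqrt \<mu> * \<bar>x\<bar>"
    have z: "z > 0" using False sqrt_mu by (simp add: z_def)
    have "z * tanh z <= z * 1" using z tanh_real_lt_1[of z] by (intro mult_left_mono) auto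
    then have "z <= (1 + z) * tanh z" "(1 + z) * tanh z <= 2 * z"
      using z le_tanh_linear[of z] tanh_le_self[of z] unfolding distrib_right mult_1 mult_1_right by linarith+
    moreover have Tmu_z: "Tmu \<mu> x = tanh z / z" using False by (simp add: Tmu_def z_def)
    ultimately show ?thesis unfolding z_def[symmetric] Tmu_z using z by (simp add: field_simps)
  qed (simp add: Tmu_def)
  then show "1 <= (1 + sqrt \<mu> * \<bar>x\<bar>) * (sqrtT x)^2" "(1 + sqrt \<mu> * \<bar>x\<bar>) * (sqrtT x)^2 <= 2"
    by (simp_all add: sqrtT_sq)
qed

end

section \<open>The symmetrised system\<close>

definition ikernel :: "(real => real => real) => real => real => complex" where
  "ikernel r u v = - \<i> * cx (r u v)"

definition near :: "real => real => real" where
  "near u v = (if 2 * \<bar>u - v\<bar> <= \<bar>u\<bar> \<and> 2 * \<bar>u - v\<bar> <= \<bar>v\<bar> then 1 else 0)"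

lemma near_sym: "near v u = near u v" by (auto simp: near_def abs_minus_commute)
lemma near_minus: "near (- u) (- v) = near u v" by (auto simp: near_def abs_minus_commute)
lemma near_01: "0 <= near u v" "near u v <= 1" by (auto simp: near_def)
lemma near_measurable [measurable]: "(\<lambda>p. near (fst p) (snd p)) \<in> meas2"
  unfolding near_def by measurable

context sobolev_index
begin

lemma kernel_ikernel:
  assumes [measurable]: "(\<lambda>p. r (fst p) (snd p)) \<in> meas2"
    and r: "\<And>u v. r (- u) (- v) = - r u v" "\<And>u v. \<bar>r u v\<bar> <= K * (J (u - v) + J v + J u)"
  shows "kernel K (ikernel r)"
  unfolding kernel_def
proof (intro conjI allI)
  show "(\<lambda>(u, v). ikernel r u v) \<in> meas2" unfolding ikernel_def case_prod_beta' by measurable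
qed (use r in \<open>auto simp: ikernel_def norm_mult\<close>)

lemma kernel_ikernel_sum:
  assumes "(\<lambda>p. r (fst p) (snd p)) \<in> meas2" "\<And>u v. r (- u) (- v) = - r u v"
    and bound: "\<And>u v. \<bar>r u v\<bar> <= K * (J (u - v) + J v)"
  shows "kernel K (ikernel r)"
proof (rule kernel_ikernel[OF assms(1,2)])
  fix u v :: real
  have "0 <= K * (J (0 - 0) + J 0)" using bound[of 0 0] by (rule order_trans[OF abs_ge_zero])
  moreover have "0 < J (0 - 0) + J 0" by (intro add_pos_pos) simp_all
  ultimately have "0 <= K" by (simp only: zero_le_mult_iff) linarith
  then have "K * (J (u - v) + J v) <= K * (J (u - v) + J v + J u)" by (intro mult_left_mono) auto
  then show "\<bar>r u v\<bar> <= K * (J (u - v) + J v + J u)" using bound[of u v] by linarith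
qed

lemma
  assumes "(\<lambda>p. r (fst p) (snd p)) \<in> meas2" "\<And>u v. r (- u) (- v) = - r u v" "0 <= K"
  shows kernel_ikernel_diff: "(\<And>u v. \<bar>r u v\<bar> <= K * J (u - v)) ==> kernel K (ikernel r)"
    and kernel_ikernel_snd: "(\<And>u v. \<bar>r u v\<bar> <= K * J v) ==> kernel K (ikernel r)"
proof -
  have "K * J (u - v) <= K * (J (u - v) + J v)" "K * J v <= K * (J (u - v) + J v)" for u v
    using assms(3) by (auto intro!: mult_left_mono)
  then show "(\<And>u v. \<bar>r u v\<bar> <= K * J (u - v)) ==> kernel K (ikernel r)"
    "(\<And>u v. \<bar>r u v\<bar> <= K * J v) ==> kernel K (ikernel r)"
    by (blast intro: kernel_ikernel_sum[OF assms(1,2)] order_trans)+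
qed

lemma rmult_bilop_ikernel:
  assumes "kernel K (ikernel r)" "even_sym A a" "even_sym B b" "even_sym M m"
  shows "rmult m (bilop (ikernel r) (rmult a x) (rmult b y)) = bilop (ikernel (\<lambda>u v. m u * r u v * a (u - v) * b v)) x y"
proof -
  have "(\<lambda>u v. cx (m u) * ikernel r u v * cx (a (u - v)) * cx (b v))
     = ikernel (\<lambda>u v. m u * r u v * a (u - v) * b v)"
    by (intro ext) (simp add: ikernel_def)
  then show ?thesis
    unfolding rmult_def using fmult_bilop_fmult[OF assms(1) even_sym_herm_sym[OF assms(2)] even_sym_herm_sym[OF assms(3)] even_sym_herm_sym[OF assms(4)], of x y]
    by simp
qed

lemma kernel_ikernel_fmult:
  assumes "kernel K (ikernel r)" "even_sym A a" "even_sym B b" "even_sym M m"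
  shows "kernel (M * K * A * B) (ikernel (\<lambda>u v. m u * r u v * a (u - v) * b v))"
proof -
  have "(\<lambda>u v. cx (m u) * ikernel r u v * cx (a (u - v)) * cx (b v))
     = ikernel (\<lambda>u v. m u * r u v * a (u - v) * b v)"
    by (intro ext) (simp add: ikernel_def)
  then show ?thesis
    using kernel_fmult[OF assms(1) even_sym_herm_sym[OF assms(2)] even_sym_herm_sym[OF assms(3)] even_sym_herm_sym[OF assms(4)]] by simp
qed

lemma bilop_ikernel_cong: "(\<And>u v. r u v = r' u v) ==> bilop (ikernel r) x y = bilop (ikernel r') x y"
  by (metis ext)

text \<open>The two terms are adjoint to each other up to the sign of the factor i, so only the
  antisymmetric part of the kernel survives.\<close>
lemma inner_bilop_cross_cancel:
  assumes "kernel K (ikernel (\<lambda>u v. r u v * l v))" "kernel L (ikernel (\<lambda>u v. r u v * l u))"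
  shows "inner A (bilop (ikernel (\<lambda>u v. r u v * l v)) F B) + inner B (bilop (ikernel (\<lambda>u v. r u v * l u)) F A)
    = inner A (bilop (ikernel (\<lambda>u v. (r u v - r v u) * l v)) F B)"
proof -
  have "(\<lambda>u v. cnj (ikernel (\<lambda>u v. r u v * l u) v u)) = ikernel (\<lambda>u v. - (r v u * l v))"
    by (intro ext) (simp add: ikernel_def)
  then have "inner B (bilop (ikernel (\<lambda>u v. r u v * l u)) F A) = inner A (bilop (ikernel (\<lambda>u v. - (r v u * l v))) F B)"
    and k: "kernel L (ikernel (\<lambda>u v. - (r v u * l v)))"
    using bilop_adjoint[OF assms(2), of B F A] kernel_adj[OF assms(2)] by simp_all
  moreover have "(\<lambda>u v. ikernel (\<lambda>u v. r u v * l v) u v + ikernel (\<lambda>u v. - (r v u * l v)) u v) = ikernel (\<lambda>u v. (r u v - r v u) * l v)"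
    by (intro ext) (simp add: ikernel_def algebra_simps)
  ultimately show ?thesis
    using bilop_kernel_add[OF assms(1) k, of F B] by (simp add: inner_add_right)
qed

lemma inner_bilop_le: "kernel K k ==> \<bar>inner z (bilop k x y)\<bar> <= K * C_bil * norm x * norm y * norm z"
  using Cauchy_Schwarz_ineq2[of z "bilop k x y"] mult_left_mono[OF norm_bilop_le, of K k "norm z" x y] by (simp add: mult_ac)

end

definition ft_const :: real where "ft_const = 1 / sqrt (2 * pi)"

lemma ft_const: "0 < ft_const" "ft_const <= 1"
proof -
  show "0 < ft_const" by (simp add: ft_const_def)
  have "1 <= sqrt (2 * pi)" using pi_ge_two by simp
  then show "ft_const <= 1" by (simp add: ft_const_def)
qed

lemma bounded_bilinear_add:
  assumes "bounded_bilinear f" "bounded_bilinear g"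
  shows "bounded_bilinear (\<lambda>x y. f x y + g x y)"
proof -
  interpret f: bounded_bilinear f by fact
  interpret g: bounded_bilinear g by fact
  obtain K L where "\<And>x y. norm (f x y) <= norm x * norm y * K" "\<And>x y. norm (g x y) <= norm x * norm y * L"
    using f.bounded g.bounded by blast
  then have "norm (f x y + g x y) <= norm x * norm y * (K + L)" for x y
    unfolding distrib_left by (intro order_trans[OF norm_triangle_ineq] add_mono)
  then show ?thesis
    by unfold_locales (auto simp: f.add_left f.add_right f.scaleR_left f.scaleR_right
        g.add_left g.add_right g.scaleR_left g.scaleR_right scaleR_add_right)
qed

lemma bounded_bilinear_Pair:
  assumes "bounded_bilinear f" "bounded_bilinear g"
  shows "bounded_bilinear (\<lambda>x y. (f x y, g x y))"
proof -
  interpret f: bounded_bilinear f by fact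
  interpret g: bounded_bilinear g by fact
  obtain K L where "\<And>x y. norm (f x y) <= norm x * norm y * K" "\<And>x y. norm (g x y) <= norm x * norm y * L"
    using f.bounded g.bounded by blast
  then have "norm (f x y, g x y) <= norm x * norm y * (K + L)" for x y
    unfolding distrib_left by (intro order_trans[OF norm_Pair_le] add_mono)
  then show ?thesis
    by unfold_locales (auto simp: f.add_left f.add_right f.scaleR_left f.scaleR_right
        g.add_left g.add_right g.scaleR_left g.scaleR_right)
qed

context whitham_boussinesq
begin

abbreviation wgt :: "real => real" where "wgt \<equiv> jpow s"
abbreviation winv :: "real => real" where "winv \<equiv> jpow (- s)"
abbreviation jinv :: "real => real" where "jinv \<equiv> jpow (- 1)"

definition deg_s :: nat where "deg_s = nat \<lceil>s\<rceil> + 2"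

lemma s_nonneg: "0 <= s" "0 <= s - 1" "1 <= s" using s_gt by auto
lemma s_le_nat_ceiling: "s <= real (nat \<lceil>s\<rceil>)" by linarith

lemma even_sym_winv: "even_sym 1 winv" and even_sym_jinv: "even_sym 1 jinv" and even_sym_J: "even_sym 1 J"
  using s_gt by (auto intro: even_sym_jpow)

lemma winv_eq: "winv x = 1 / wgt x" by (rule jpow_uminus)
lemma jinv_eq: "jinv x = 1 / jbr x" by (simp add: jpow_uminus jpow_1)
lemma J_eq: "J x = jbr x / wgt x" using jpow_add[of 1 "- s" x] by (simp add: jpow_1 winv_eq)
lemmas weight_eqs = winv_eq jinv_eq J_eq
lemma wgt_eq: "wgt x = jbr x * jpow (s - 1) x" using jpow_add[of 1 "s - 1" x] by (simp add: jpow_1)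

lemma winv_le_J: "1 / wgt x <= J x"
  unfolding J_eq using jbr_ge_1[of x] by (intro divide_right_mono) auto
lemma abs_winv_le_J: "\<bar>x\<bar> / wgt x <= J x"
  unfolding J_eq using abs_le_jbr[of x] by (intro divide_right_mono) auto

lemma slow_wgt: "slow (nat \<lceil>s\<rceil>) wgt"
  using s_gt s_le_nat_ceiling by (intro slow_jpow) auto
lemma slow_jpow_s1: "slow deg_s (jpow (s - 1))"
  using s_gt s_le_nat_ceiling by (intro slow_jpow) (simp, unfold deg_s_def of_nat_add, linarith)

definition transport_kernel :: "real => real => real" where "transport_kernel u v = wgt u * v / (wgt (u - v) * wgt v)"
definition ker_q_vx :: "real => real => real" where "ker_q_vx u v = ft_const / 2 / rTinv v * transport_kernel u v"
definition ker_v_qx :: "real => real => real" where "ker_v_qx u v = ft_const / rTinv (u - v) * transport_kernel u v"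
definition ker_q_qx :: "real => real => real" where "ker_q_qx u v = ft_const / 2 / rTinv u * transport_kernel u v"
definition ker_v_vx :: "real => real => real" where
  "ker_v_vx u v = ft_const * (rTinv u / (rTinv (u - v) * rTinv v)) * transport_kernel u v"

lemmas ker_defs = ker_q_vx_def ker_v_qx_def ker_q_qx_def ker_v_vx_def transport_kernel_def

lemma diff_minus_minus: "- u - - v = - (u - v)" for u v :: real by simp

lemma transport_kernel_bound: "\<bar>transport_kernel u v\<bar> / jbr u <= 2 ^ deg_s * (J (u - v) + J v)"
proof -
  let ?w = "jpow (s - 1)"
  have "\<bar>transport_kernel u v\<bar> / jbr u = ?w u * (\<bar>v\<bar> / (wgt (u - v) * wgt v))"
    by (simp add: transport_kernel_def abs_mult wgt_eq[of u])
  also have "... <= (2 ^ deg_s * (?w (u - v) + ?w v)) * (\<bar>v\<bar> / (wgt (u - v) * wgt v))"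
    by (intro mult_right_mono slow_le_add[OF slow_jpow_s1]) simp
  also have "... = 2 ^ deg_s * ((?w (u - v) / wgt (u - v)) * (\<bar>v\<bar> / wgt v) + (1 / wgt (u - v)) * (?w v * \<bar>v\<bar> / wgt v))"
    by (simp add: field_simps)
  also have "... <= 2 ^ deg_s * (1 * J v + J (u - v) * 1)"
  proof (intro mult_left_mono add_mono mult_mono abs_winv_le_J winv_le_J)
    show "?w (u - v) / wgt (u - v) <= 1" using jbr_ge_1[of "u - v"] by (simp add: wgt_eq)
    show "?w v * \<bar>v\<bar> / wgt v <= 1" using abs_le_jbr[of v] by (simp add: wgt_eq)
  qed auto
  finally show ?thesis by (simp add: add.commute)
qed

definition coeff_kernel :: "(real => real => real) => bool" where
  "coeff_kernel r \<longleftrightarrow> (\<lambda>p. r (fst p) (snd p)) \<in> meas2 \<and> (\<forall>u v. r (- u) (- v) = - r u v) \<and>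
    (\<forall>u v. \<bar>r u v\<bar> <= 2 * \<bar>transport_kernel u v\<bar>)"

definition coeff_op :: "(real => real => real) => hl2 => hl2 => hl2" where
  "coeff_op r = bilop (ikernel (\<lambda>u v. r u v / jbr u))"

lemma coeff_kernel_measurable: "coeff_kernel r ==> (\<lambda>p. r (fst p) (snd p)) \<in> meas2" by (simp add: coeff_kernel_def)
lemma coeff_kernel_minus: "coeff_kernel r ==> r (- u) (- v) = - r u v" by (simp add: coeff_kernel_def)
lemma coeff_kernel_le: "coeff_kernel r ==> \<bar>r u v\<bar> <= 2 * \<bar>transport_kernel u v\<bar>"
  by (simp add: coeff_kernel_def)

lemma kernel_coeff:
  assumes r: "coeff_kernel r" shows "kernel (2 * 2 ^ deg_s) (ikernel (\<lambda>u v. r u v / jbr u))"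
proof (rule kernel_ikernel_sum)
  note [measurable] = coeff_kernel_measurable[OF r]
  show "(\<lambda>p. r (fst p) (snd p) / jbr (fst p)) \<in> meas2" by measurable
  fix u v :: real
  have "\<bar>r u v / jbr u\<bar> <= 2 * \<bar>transport_kernel u v\<bar> / jbr u"
    unfolding abs_divide by (simp add: divide_right_mono coeff_kernel_le[OF r])
  also have "... <= 2 * 2 ^ deg_s * (J (u - v) + J v)" using transport_kernel_bound[of u v] by simp
  finally show "\<bar>r u v / jbr u\<bar> <= 2 * 2 ^ deg_s * (J (u - v) + J v)" .
qed (auto simp: coeff_kernel_minus[OF r])

lemma coeff_kernelI:
  assumes [measurable]: "(\<lambda>p. m (fst p) (snd p)) \<in> meas2"
    and m: "\<And>u v. m (- u) (- v) = m u v" "\<And>u v. 0 <= m u v" "\<And>u v. m u v <= 2"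
  shows "coeff_kernel (\<lambda>u v. m u v * transport_kernel u v)"
  unfolding coeff_kernel_def
proof (intro conjI allI)
  show "(\<lambda>p. m (fst p) (snd p) * transport_kernel (fst p) (snd p)) \<in> meas2"
    unfolding transport_kernel_def by measurable
  fix u v
  show "m (- u) (- v) * transport_kernel (- u) (- v) = - (m u v * transport_kernel u v)"
    unfolding transport_kernel_def diff_minus_minus jpow_minus m by simp
  show "\<bar>m u v * transport_kernel u v\<bar> <= 2 * \<bar>transport_kernel u v\<bar>"
    unfolding abs_mult using m by (intro mult_right_mono) auto
qed

lemma rTinv_ratio_le: "rTinv u / (rTinv (u - v) * rTinv v) <= 2"
  using slow_le_mult[OF slow_rTinv rTinv_ge_1, of u v] by (simp add: field_simps)

lemma coeff_kernels:
  "coeff_kernel ker_q_vx" "coeff_kernel ker_v_qx" "coeff_kernel ker_q_qx" "coeff_kernel ker_v_vx"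
proof -
  have quotient: "0 <= c / rTinv x" "c / rTinv x <= 2" if "0 <= c" "c <= 1" for c x
    using that rTinv_ge_1[of x] by (auto simp: pos_divide_le_eq)
  have ratio: "0 <= ft_const * (rTinv u / (rTinv (u - v) * rTinv v))"
    "ft_const * (rTinv u / (rTinv (u - v) * rTinv v)) <= 2" for u v
    using mult_mono[OF ft_const(2) rTinv_ratio_le, of u v] ft_const by auto
  show "coeff_kernel ker_q_vx" unfolding ker_q_vx_def[abs_def]
    by (rule coeff_kernelI; (measurable)?) (use quotient[of "ft_const / 2"] ft_const in simp_all)
  show "coeff_kernel ker_v_qx" unfolding ker_v_qx_def[abs_def]
    by (rule coeff_kernelI; (measurable)?; (unfold diff_minus_minus rTinv_minus)?) (use quotient[of ft_const] ft_const in simp_all)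
  show "coeff_kernel ker_q_qx" unfolding ker_q_qx_def[abs_def]
    by (rule coeff_kernelI; (measurable)?) (use quotient[of "ft_const / 2"] ft_const in simp_all)
  show "coeff_kernel ker_v_vx" unfolding ker_v_vx_def[abs_def]
    by (rule coeff_kernelI; (measurable)?; (unfold diff_minus_minus rTinv_minus)?) (use ratio in simp_all)
qed

lemma bounded_bilinear_coeff_op: "coeff_kernel r ==> bounded_bilinear (coeff_op r)"
  unfolding coeff_op_def by (rule bounded_bilinear_bilop[OF kernel_coeff])

text \<open>The pair \<open>X = (F, G)\<close> stands for \<open>F = \<langle>D\<rangle>\<^sup>s q\<close>, \<open>G = \<langle>D\<rangle>\<^sup>s T\<^sup>-\<^sup>1\<^sup>/\<^sup>2 v\<close> on the Fourier side,
  where \<open>q + q\<^sup>2/4\<close> is the surface elevation; \<open>quad_op X Y\<close> puts the derivative on \<open>Y\<close>, and its values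
  carry the weight \<open>\<langle>D\<rangle>\<^sup>s\<^sup>-\<^sup>1\<close>.\<close>
definition quad_op :: "state => state => state" where
  "quad_op X Y = (coeff_op ker_q_vx (fst X) (snd Y) + coeff_op ker_v_qx (snd X) (fst Y),
     coeff_op ker_q_qx (fst X) (fst Y) + coeff_op ker_v_vx (snd X) (snd Y))"

definition lin_symbol :: "real => complex" where "lin_symbol u = - \<i> * cx (u / (rTinv u * jbr u))"
definition lin_op :: "state => state" where "lin_op X = (fmult lin_symbol (snd X), fmult lin_symbol (fst X))"

lemma herm_sym_lin_symbol: "herm_sym 1 lin_symbol"
  unfolding herm_sym_def
proof (intro conjI allI)
  show "lin_symbol \<in> meas" unfolding lin_symbol_def[abs_def] by measurable
  fix x
  show "lin_symbol (- x) = cnj (lin_symbol x)" by (simp add: lin_symbol_def)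
  have "\<bar>x\<bar> <= rTinv x * jbr x"
    using mult_mono[OF rTinv_ge_1 abs_le_jbr, of x x] rTinv_pos[of x] by simp
  moreover have "cmod (lin_symbol x) = \<bar>x\<bar> / (rTinv x * jbr x)"
    using abs_of_pos[OF rTinv_pos[of x]] by (simp add: lin_symbol_def norm_mult norm_divide)
  ultimately show "cmod (lin_symbol x) <= 1" using rTinv_pos[of x] by simp
qed

lemma bounded_linear_lin_op: "bounded_linear lin_op"
  unfolding lin_op_def[abs_def]
  by (intro bounded_linear_Pair bounded_linear_compose[OF bounded_linear_fmult[OF herm_sym_lin_symbol]] bounded_linear_fst bounded_linear_snd)

lemma bounded_bilinear_quad_op: "bounded_bilinear quad_op"
  unfolding quad_op_def[abs_def]
  by (intro bounded_bilinear_Pair bounded_bilinear_add bounded_bilinear.comp[OF bounded_bilinear_coeff_op]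
      coeff_kernels bounded_linear_fst bounded_linear_snd)

end

section \<open>Energy estimates\<close>

lemma abs_le_of_near: "near u v \<noteq> 0 ==> \<bar>u\<bar> <= 2 * \<bar>v\<bar> \<and> \<bar>v\<bar> <= 2 * \<bar>u\<bar>"
  using abs_triangle_ineq[of "u - v" v] abs_triangle_ineq[of "v - u" u] abs_minus_commute[of u v]
  by (auto simp: near_def split: if_splits)

lemma abs_le_of_not_near: "near u v \<noteq> 1 ==> \<bar>u\<bar> <= 3 * \<bar>u - v\<bar>"
  using abs_triangle_ineq[of "u - v" v] by (auto simp: near_def split: if_splits)

lemma max_sq_le:
  fixes x y :: real
  assumes "0 < x" "0 < y" "x <= C * y" "y <= C * x" shows "(max x y)^2 <= C * (x * y)"
proof -
  have "x^2 <= C * (x * y)" using mult_right_mono[of x "C * y" x] assms by (simp add: power2_eq_square mult_ac)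
  moreover have "y^2 <= C * (x * y)" using mult_right_mono[of y "C * x" y] assms by (simp add: power2_eq_square mult_ac)
  ultimately show ?thesis by (simp add: max_def)
qed

context whitham_boussinesq
begin

definition jcut :: "real => real => real" where "jcut n t = jbr t * cut n t"

lemma even_sym_jcut: "even_sym (1 + \<bar>n\<bar>) (jcut n)"
  unfolding even_sym_def
proof (intro conjI allI)
  show "jcut n \<in> meas" unfolding jcut_def[abs_def] by measurable
  fix x
  show "jcut n (- x) = jcut n x" by (simp add: jcut_def)
  show "\<bar>jcut n x\<bar> <= 1 + \<bar>n\<bar>" using jbr_le_1_abs[of x] by (auto simp: jcut_def cut_def abs_mult)
qed

lemma rmult_jcut_coeff_op:
  assumes r: "coeff_kernel r" and m: "even_sym M m" and b: "even_sym B b"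
  shows "rmult m (rmult (jcut n) (coeff_op r x (rmult b y)))
    = bilop (ikernel (\<lambda>u v. m u * cut n u * b v * r u v)) x y"
proof -
  have "rmult m (rmult (jcut n) (coeff_op r (rmult (\<lambda>_. 1) x) (rmult b y)))
    = bilop (ikernel (\<lambda>u v. (m u * jcut n u) * (r u v / jbr u) * 1 * b v)) x y"
    unfolding rmult_rmult[OF m even_sym_jcut] coeff_op_def
    by (rule rmult_bilop_ikernel[OF kernel_coeff[OF r] even_sym_one b even_sym_mult[OF m even_sym_jcut]])
  also have "... = bilop (ikernel (\<lambda>u v. m u * cut n u * b v * r u v)) x y"
    by (rule bilop_ikernel_cong) (simp add: jcut_def)
  finally show ?thesis by simp
qed

lemma bilop_ikernel_split:
  assumes p: "kernel P (ikernel p)" and q: "kernel Q (ikernel q)" and a: "even_sym A a" and b: "even_sym B b"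
    and k: "\<And>u v. k u v = p u v * a (u - v) + q u v * b v"
  shows "bilop (ikernel k) x y = bilop (ikernel p) (rmult a x) y + bilop (ikernel q) x (rmult b y)"
proof -
  let ?p = "\<lambda>u v. 1 * p u v * a (u - v) * 1" and ?q = "\<lambda>u v. 1 * q u v * 1 * b v"
  have "ikernel k = (\<lambda>u v. ikernel ?p u v + ikernel ?q u v)"
    by (intro ext) (simp add: ikernel_def k algebra_simps)
  then have "bilop (ikernel k) x y = bilop (ikernel ?p) x y + bilop (ikernel ?q) x y"
    using bilop_kernel_add[OF kernel_ikernel_fmult[OF p a even_sym_one even_sym_one]
        kernel_ikernel_fmult[OF q even_sym_one b even_sym_one]] by simp
  then show ?thesis
    using rmult_bilop_ikernel[OF p a even_sym_one even_sym_one, of x y]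
      rmult_bilop_ikernel[OF q even_sym_one b even_sym_one, of x y] by simp
qed

lemma abs_coeff_le:
  assumes "coeff_kernel r" shows "\<bar>r u v\<bar> <= 2 * (wgt u * \<bar>v\<bar> / (wgt (u - v) * wgt v))"
  using coeff_kernel_le[OF assms, of u v] by (simp add: transport_kernel_def abs_mult)

lemma inner_bilop_le_cubic:
  assumes k: "kernel K k" and norms: "norm x <= a \<and> norm y <= b \<or> norm x <= b \<and> norm y <= a" "norm z <= b"
  shows "\<bar>inner z (bilop k x y)\<bar> <= K * C_bil * a * b^2"
proof -
  have nonneg: "0 <= a" "0 <= b" using norms(1) order_trans[OF norm_ge_zero] by blast+
  have "norm x * norm y <= a * b"
    using norms(1) mult_mono[of "norm x" a "norm y" b] mult_mono[of "norm x" b "norm y" a] nonneg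
    by (auto simp: mult.commute)
  then have "norm x * norm y * norm z <= a * b * b" using norms(2) nonneg mult_mono[of "norm x * norm y" "a * b" "norm z" b]
    by simp
  then have "K * C_bil * (norm x * norm y * norm z) <= K * C_bil * (a * b * b)"
    using kernel_nonneg[OF k] by (intro mult_left_mono) auto
  with inner_bilop_le[OF k, of z x y] show ?thesis by (simp add: power2_eq_square mult.assoc)
qed

subsection \<open>Commutator kernels\<close>

lemma inner_bilop_cross_le:
  assumes R: "(\<lambda>p. R (fst p) (snd p)) \<in> meas2" "\<And>u v. R (- u) (- v) = - R u v"
    and N: "0 <= N" "\<And>u v. \<bar>R u v\<bar> <= N * J (u - v)"
    and C: "0 <= C" "\<And>u v. \<bar>R u v - R v u\<bar> <= C * J (u - v)"
    and l: "even_sym 1 l" and norms: "norm F <= a" "norm A <= b" "norm B <= b"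
  shows "\<bar>inner A (bilop (ikernel (\<lambda>u v. R u v * l v)) F B) + inner B (bilop (ikernel (\<lambda>u v. R u v * l u)) F A)\<bar>
    <= C * C_bil * a * b^2"
proof -
  have [measurable]: "(\<lambda>p. R (snd p) (fst p)) \<in> meas2"
    using measurable_compose[OF _ R(1), of "\<lambda>p. (snd p, fst p)"] by simp
  note [measurable] = R(1) even_sym_measurable[OF l]
  have times_l: "\<bar>x * l t\<bar> <= c" if "\<bar>x\<bar> <= c" for x c t
    using mult_mono[OF that even_sym_abs_le[OF l, of t]] that by (auto simp: abs_mult)
  have "kernel N (ikernel (\<lambda>u v. R u v * l v))" "kernel N (ikernel (\<lambda>u v. R u v * l u))"
    using times_l[OF N(2)] by (auto intro!: kernel_ikernel_diff N(1) simp: R(2) even_sym_minus[OF l])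
  note cancel = inner_bilop_cross_cancel[OF this]
  have "kernel C (ikernel (\<lambda>u v. (R u v - R v u) * l v))"
    using times_l[OF C(2)] by (auto intro!: kernel_ikernel_diff C(1) simp: R(2) even_sym_minus[OF l] algebra_simps)
  then show ?thesis unfolding cancel by (rule inner_bilop_le_cubic) (use norms in auto)
qed

definition comm_kernel :: "(real => real => real) => real => (real => real) => (real => real) => real => real => real" where
  "comm_kernel \<theta> n a c u v = \<theta> u v * cut n u * cut n v * (a u * v / a v) * c (u - v)"

context
  fixes \<theta> :: "real => real => real" and a c :: "real => real" and K :: nat and M :: real
  assumes a: "slow K a" and c: "c \<in> meas" "\<And>t. c (- t) = c t" "\<And>t. 0 <= c t"
    and \<theta>: "(\<lambda>p. \<theta> (fst p) (snd p)) \<in> meas2" "\<And>u v. \<theta> (- u) (- v) = \<theta> u v" "\<And>u v. \<theta> v u = \<theta> u v"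
      "\<And>u v. 0 <= \<theta> u v" "\<And>u v. \<theta> u v <= 1"
    and M: "0 <= M" "\<And>u v. \<theta> u v \<noteq> 0 ==> (max (a u) (a v))^2 * c (u - v) <= M * (a u * a v) / wgt (u - v)"
begin

lemma comm_kernel_measurable: "(\<lambda>p. comm_kernel \<theta> n a c (fst p) (snd p)) \<in> meas2"
proof -
  note [measurable] = slow_measurable[OF a] c(1) \<theta>(1)
  show ?thesis unfolding comm_kernel_def by measurable
qed

lemma comm_kernel_minus: "comm_kernel \<theta> n a c (- u) (- v) = - comm_kernel \<theta> n a c u v"
  unfolding comm_kernel_def diff_minus_minus c(2) \<theta>(2) cut_minus slow_even[OF a] by simp

lemma abs_comm_kernel_le: "\<bar>comm_kernel \<theta> n a c u v\<bar> <= M * \<bar>n\<bar> * J (u - v)"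
proof (cases "\<theta> u v = 0 \<or> cut n v = 0")
  case True then show ?thesis using M(1) by (auto simp: comm_kernel_def)
next
  case False
  then have v: "\<bar>v\<bar> <= \<bar>n\<bar>" by (auto simp: cut_def split: if_splits)
  have pos: "0 < a u" "0 < a v" using slow_pos[OF a] by auto
  have "(a u)^2 * c (u - v) <= (max (a u) (a v))^2 * c (u - v)"
    using pos c(3) by (intro mult_right_mono power_mono) auto
  also have "... <= M * (a u * a v) / wgt (u - v)" using M(2) False by blast
  finally have "a u * (a u * c (u - v)) <= a u * (M * a v * (1 / wgt (u - v)))" by (simp add: power2_eq_square mult_ac)
  then have "a u * c (u - v) <= M * a v * (1 / wgt (u - v))" using pos(1) by (simp only: mult_le_cancel_left_pos)
  also have "... <= M * a v * J (u - v)" using pos M(1) by (intro mult_left_mono winv_le_J) auto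
  finally have quotient: "a u * c (u - v) / a v <= M * J (u - v)" using pos by (simp add: pos_divide_le_eq mult_ac)
  have "\<bar>comm_kernel \<theta> n a c u v\<bar> = \<theta> u v * cut n u * cut n v * (\<bar>v\<bar> * (a u * c (u - v) / a v))"
    using pos c(3)[of "u - v"] cut_01 \<theta>(4)[of u v] by (simp add: comm_kernel_def abs_mult mult_ac)
  also have "... <= 1 * 1 * 1 * (\<bar>n\<bar> * (M * J (u - v)))"
    using pos c(3) cut_01[of n u] cut_01[of n v] \<theta>(4,5)[of u v] quotient v by (intro mult_mono) auto
  finally show ?thesis by (simp add: mult_ac)
qed

lemma comm_kernel_antisym_le:
  "\<bar>comm_kernel \<theta> n a c u v - comm_kernel \<theta> n a c v u\<bar> <= (2 * real K + 1) * M * J (u - v)"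
proof (cases "\<theta> u v = 0")
  case True then show ?thesis using M(1) by (simp add: comm_kernel_def \<theta>(3)[of v u])
next
  case False
  let ?D = "\<bar>(a u)^2 * v - (a v)^2 * u\<bar>" and ?C = "2 * real K + 1"
  have pos: "0 < a u" "0 < a v" using slow_pos[OF a] by auto
  have "c (u - v) * ?D <= c (u - v) * (?C * (max (a u) (a v))^2 * \<bar>u - v\<bar>)"
    by (intro mult_left_mono slow_bracket[OF a] c(3))
  also have "... = ?C * ((max (a u) (a v))^2 * c (u - v)) * \<bar>u - v\<bar>" by simp
  also have "... <= ?C * (M * (a u * a v) / wgt (u - v)) * \<bar>u - v\<bar>"
    by (intro mult_right_mono mult_left_mono M(2) False) auto
  finally have bracket: "c (u - v) * ?D / (a u * a v) <= ?C * M * (\<bar>u - v\<bar> / wgt (u - v))"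
    using pos by (subst pos_divide_le_eq) (auto simp: mult_ac)
  have "c (v - u) = c (u - v)" using c(2)[of "u - v"] by simp
  then have "comm_kernel \<theta> n a c u v - comm_kernel \<theta> n a c v u
      = \<theta> u v * cut n u * cut n v * (c (u - v) * ((a u)^2 * v - (a v)^2 * u) / (a u * a v))"
    using pos by (simp add: comm_kernel_def \<theta>(3)[of v u] field_simps power2_eq_square)
  then have "\<bar>comm_kernel \<theta> n a c u v - comm_kernel \<theta> n a c v u\<bar>
      = \<theta> u v * cut n u * cut n v * (c (u - v) * ?D / (a u * a v))"
    using pos cut_01 c(3) \<theta>(4) by (simp add: abs_mult)
  also have "... <= 1 * 1 * 1 * (?C * M * (\<bar>u - v\<bar> / wgt (u - v)))"
    using cut_01 \<theta>(4,5) c(3) pos bracket by (intro mult_mono) (auto intro!: divide_nonneg_pos)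
  also have "... <= ?C * M * J (u - v)" unfolding mult_1 using M(1) by (intro mult_left_mono abs_winv_le_J) auto
  finally show ?thesis .
qed

lemma comm_kernel_cross_le:
  assumes l: "even_sym 1 l" and norms: "norm F <= x" "norm A <= y" "norm B <= y"
  shows "\<bar>inner A (bilop (ikernel (\<lambda>u v. comm_kernel \<theta> n a c u v * l v)) F B)
      + inner B (bilop (ikernel (\<lambda>u v. comm_kernel \<theta> n a c u v * l u)) F A)\<bar> <= (2 * real K + 1) * M * C_bil * x * y^2"
  by (rule inner_bilop_cross_le[OF comm_kernel_measurable comm_kernel_minus _ abs_comm_kernel_le _ comm_kernel_antisym_le l norms])
    (use M(1) in auto)

lemma comm_kernel_self_le:
  assumes norms: "norm F <= x" "norm A <= y"
  shows "\<bar>2 * inner A (bilop (ikernel (comm_kernel \<theta> n a c)) F A)\<bar> <= (2 * real K + 1) * M * C_bil * x * y^2"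
  using comm_kernel_cross_le[OF even_sym_one norms(1) norms(2) norms(2)] by simp

end

subsection \<open>The weighted energy estimate\<close>

text \<open>Off the diagonal region the derivative can be put on the low frequency factor; on it the
  commutator with the weight gains the derivative back.\<close>
definition far_kernel :: "real => (real => real) => (real => real => real) => real => real => real" where
  "far_kernel n w r u v = (1 - near u v) * (w u * cut n u * cut n v * r u v) / w (u - v)"
definition near_kernel :: "real => (real => real) => (real => real => real) => real => real => real" where
  "near_kernel n w r u v = near u v * (w u * cut n u * cut n v * r u v) / w v"

definition C_comm :: real where "C_comm = (2 * real deg_s + 1) * 2 ^ deg_s"
definition C_energy :: real where "C_energy = (8 * 3 ^ deg_s + 3 * C_comm) * C_bil"

lemma C_comm_nonneg: "0 <= C_comm" by (simp add: C_comm_def)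
lemma C_energy_nonneg: "0 <= C_energy" using C_comm_nonneg by (simp add: C_energy_def)

lemma near_max_sq_le:
  assumes a: "slow K a" and c: "0 <= c (u - v)" "c (u - v) <= 1 / wgt (u - v)" and uv: "near u v \<noteq> 0"
  shows "(max (a u) (a v))^2 * c (u - v) <= 2 ^ K * (a u * a v) / wgt (u - v)"
proof -
  have "(max (a u) (a v))^2 <= 2 ^ K * (a u * a v)"
    using abs_le_of_near[OF uv] by (intro max_sq_le slow_pos[OF a] slow_le_scale[OF a]) auto
  then have "(max (a u) (a v))^2 * c (u - v) <= 2 ^ K * (a u * a v) * (1 / wgt (u - v))"
    using slow_pos[OF a] c by (intro mult_mono) (auto simp: less_imp_le)
  then show ?thesis by simp
qed

context
  fixes n :: real and w :: "real => real"
  assumes w: "slow 1 w" "\<And>t. w t <= 1"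
begin

lemma slow_weighted_wgt: "slow deg_s (\<lambda>t. w t * wgt t)"
  by (rule slow_le_exponent[OF slow_mult[OF w(1) slow_wgt]]) (unfold deg_s_def, linarith)

lemma slow_weighted_wgt_rTinv: "slow deg_s (\<lambda>t. w t * (wgt t * rTinv t))"
  by (rule slow_le_exponent[OF slow_mult[OF w(1) slow_mult[OF slow_wgt slow_rTinv]]]) (unfold deg_s_def, linarith)

lemma abs_weighted_coeff_le:
  assumes "coeff_kernel r"
  shows "\<bar>w u * cut n u * cut n v * r u v\<bar> <= 2 * ((w u * wgt u) * (\<bar>v\<bar> / wgt v) / wgt (u - v))"
proof -
  have "\<bar>w u * cut n u * cut n v * r u v\<bar> = cut n u * cut n v * (w u * \<bar>r u v\<bar>)"
    using slow_pos[OF w(1), of u] cut_01 by (simp add: abs_mult)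
  also have "... <= 1 * 1 * (w u * (2 * (wgt u * \<bar>v\<bar> / (wgt (u - v) * wgt v))))"
    using slow_pos[OF w(1), of u] cut_01 abs_coeff_le[OF assms] by (intro mult_mono) auto
  finally show ?thesis by (simp add: mult_ac)
qed

lemma kernel_far:
  assumes r: "coeff_kernel r" shows "kernel (2 * 3 ^ deg_s) (ikernel (far_kernel n w r))"
proof (rule kernel_ikernel_snd)
  note [measurable] = slow_measurable[OF w(1)] coeff_kernel_measurable[OF r]
  show "(\<lambda>p. far_kernel n w r (fst p) (snd p)) \<in> meas2" unfolding far_kernel_def by measurable
  fix u v :: real
  show "far_kernel n w r (- u) (- v) = - far_kernel n w r u v"
    unfolding far_kernel_def diff_minus_minus slow_even[OF w(1)] near_minus coeff_kernel_minus[OF r] cut_minus by simp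
  show "\<bar>far_kernel n w r u v\<bar> <= 2 * 3 ^ deg_s * J v"
  proof (cases "near u v = 1")
    case True then show ?thesis by (simp add: far_kernel_def)
  next
    case False
    have pos: "0 < w (u - v)" by (rule slow_pos[OF w(1)])
    have "\<bar>far_kernel n w r u v\<bar> = (1 - near u v) * \<bar>w u * cut n u * cut n v * r u v\<bar> / w (u - v)"
      using near_01[of u v] pos by (simp add: far_kernel_def abs_mult)
    also have "... <= 1 * (2 * ((w u * wgt u) * (\<bar>v\<bar> / wgt v) / wgt (u - v))) / w (u - v)"
      using near_01[of u v] pos by (intro divide_right_mono mult_mono abs_weighted_coeff_le r) auto
    also have "... <= 1 * (2 * ((3 ^ deg_s * (w (u - v) * wgt (u - v))) * J v / wgt (u - v))) / w (u - v)"
      using mult_mono[OF slow_le_scale[OF slow_weighted_wgt abs_le_of_not_near[OF False]] abs_winv_le_J[of v]] pos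
      by (intro divide_right_mono mult_left_mono) (simp_all add: less_imp_le)
    also have "... = 2 * 3 ^ deg_s * J v" using pos by simp
    finally show ?thesis .
  qed
qed simp

lemma kernel_near:
  assumes r: "coeff_kernel r" shows "kernel (2 * 2 ^ deg_s * \<bar>n\<bar>) (ikernel (near_kernel n w r))"
proof (rule kernel_ikernel_diff)
  note [measurable] = slow_measurable[OF w(1)] coeff_kernel_measurable[OF r]
  show "(\<lambda>p. near_kernel n w r (fst p) (snd p)) \<in> meas2" unfolding near_kernel_def by measurable
  fix u v :: real
  show "near_kernel n w r (- u) (- v) = - near_kernel n w r u v"
    unfolding near_kernel_def slow_even[OF w(1)] near_minus coeff_kernel_minus[OF r] cut_minus by simp
  show "\<bar>near_kernel n w r u v\<bar> <= 2 * 2 ^ deg_s * \<bar>n\<bar> * J (u - v)"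
  proof (cases "near u v = 0 \<or> cut n v = 0")
    case True then show ?thesis by (auto simp: near_kernel_def)
  next
    case False
    then have uv: "near u v \<noteq> 0" "\<bar>v\<bar> <= \<bar>n\<bar>" by (auto simp: cut_def split: if_splits)
    have pos: "0 < w v" by (rule slow_pos[OF w(1)])
    have weight_le: "w u * wgt u <= 2 ^ deg_s * (w v * wgt v)"
      using abs_le_of_near[OF uv(1)] by (intro slow_le_scale[OF slow_weighted_wgt]) auto
    have "\<bar>near_kernel n w r u v\<bar> = near u v * \<bar>w u * cut n u * cut n v * r u v\<bar> / w v"
      using near_01[of u v] pos by (simp add: near_kernel_def abs_mult)
    also have "... <= 1 * (2 * ((w u * wgt u) * (\<bar>v\<bar> / wgt v) / wgt (u - v))) / w v"
      using near_01[of u v] pos by (intro divide_right_mono mult_mono abs_weighted_coeff_le r) auto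
    also have "... = 2 * ((w u * wgt u) * (\<bar>v\<bar> * (1 / wgt (u - v)))) / (wgt v * w v)" by simp
    also have "... <= 2 * ((2 ^ deg_s * (w v * wgt v)) * (\<bar>n\<bar> * J (u - v))) / (wgt v * w v)"
      using uv(2) pos by (intro divide_right_mono mult_left_mono mult_mono weight_le winv_le_J) auto
    also have "... = 2 * 2 ^ deg_s * \<bar>n\<bar> * J (u - v)" using pos by simp
    finally show ?thesis .
  qed
qed simp

lemma coeff_op_far_near:
  assumes r: "coeff_kernel r" and y: "rmult (cut n) y = y"
  shows "rmult w (rmult (jcut n) (coeff_op r x y))
    = bilop (ikernel (far_kernel n w r)) (rmult w x) y + bilop (ikernel (near_kernel n w r)) x (rmult w y)"
proof -
  have nz: "w t \<noteq> 0" for t using slow_pos[OF w(1), of t] by simp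
  have "rmult w (rmult (jcut n) (coeff_op r x y)) = bilop (ikernel (\<lambda>u v. w u * cut n u * cut n v * r u v)) x y"
    using rmult_jcut_coeff_op[OF r even_sym_slow[OF w] even_sym_cut[of n], of n x y] y by simp
  also have "... = bilop (ikernel (far_kernel n w r)) (rmult w x) y + bilop (ikernel (near_kernel n w r)) x (rmult w y)"
    by (rule bilop_ikernel_split[OF kernel_far[OF r] kernel_near[OF r] even_sym_slow[OF w] even_sym_slow[OF w]])
      (simp add: far_kernel_def near_kernel_def nz left_diff_distrib diff_divide_distrib)
  finally show ?thesis .
qed

lemma near_kernel_eqs:
  "near_kernel n w ker_q_vx = (\<lambda>u v. comm_kernel near n (\<lambda>t. w t * wgt t) (\<lambda>t. ft_const / 2 / wgt t) u v * sqrtT v)"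
  "near_kernel n w ker_q_qx = (\<lambda>u v. comm_kernel near n (\<lambda>t. w t * wgt t) (\<lambda>t. ft_const / 2 / wgt t) u v * sqrtT u)"
  "near_kernel n w ker_v_qx = comm_kernel near n (\<lambda>t. w t * wgt t) (\<lambda>t. ft_const / (wgt t * rTinv t))"
  "near_kernel n w ker_v_vx = comm_kernel near n (\<lambda>t. w t * (wgt t * rTinv t)) (\<lambda>t. ft_const / (wgt t * rTinv t))"
proof -
  have w_neq_0: "w t \<noteq> 0" for t using slow_pos[OF w(1), of t] by simp
  note simps = near_kernel_def ker_defs comm_kernel_def sqrtT_eq w_neq_0 field_simps
  show "near_kernel n w ker_q_vx = (\<lambda>u v. comm_kernel near n (\<lambda>t. w t * wgt t) (\<lambda>t. ft_const / 2 / wgt t) u v * sqrtT v)"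
    "near_kernel n w ker_q_qx = (\<lambda>u v. comm_kernel near n (\<lambda>t. w t * wgt t) (\<lambda>t. ft_const / 2 / wgt t) u v * sqrtT u)"
    "near_kernel n w ker_v_qx = comm_kernel near n (\<lambda>t. w t * wgt t) (\<lambda>t. ft_const / (wgt t * rTinv t))"
    "near_kernel n w ker_v_vx = comm_kernel near n (\<lambda>t. w t * (wgt t * rTinv t)) (\<lambda>t. ft_const / (wgt t * rTinv t))"
    by (intro ext; simp add: simps)+
qed

end

lemma ft_const_div_wgt:
  "(\<lambda>t. ft_const / 2 / wgt t) \<in> meas" "0 <= ft_const / 2 / wgt t" "ft_const / 2 / wgt t <= 1 / wgt t"
  "(\<lambda>t. ft_const / (wgt t * rTinv t)) \<in> meas" "0 <= ft_const / (wgt t * rTinv t)"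
  "ft_const / (wgt t * rTinv t) <= 1 / wgt t"
proof -
  have "ft_const / rTinv t <= 1" using ft_const rTinv_ge_1[of t] by simp
  then show "ft_const / (wgt t * rTinv t) <= 1 / wgt t"
    using divide_right_mono[of "ft_const / rTinv t" 1 "wgt t"] by (simp add: mult.commute)
  show "ft_const / 2 / wgt t <= 1 / wgt t" using ft_const by (intro divide_right_mono) auto
qed (use ft_const in auto)

lemma near_kernel_cross_le:
  assumes w: "slow 1 w" "\<And>t. w t <= 1" and norms: "norm F <= x" "norm A <= y" "norm B <= y"
  shows "\<bar>inner A (bilop (ikernel (near_kernel n w ker_q_vx)) F B) + inner B (bilop (ikernel (near_kernel n w ker_q_qx)) F A)\<bar>
      <= C_comm * C_bil * x * y^2"
  unfolding near_kernel_eqs[OF w] C_comm_def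
  by (intro comm_kernel_cross_le near_max_sq_le slow_weighted_wgt w ft_const_div_wgt near_measurable near_minus
      near_sym near_01 even_sym_sqrtT norms) simp_all

lemma near_kernel_self_le:
  assumes w: "slow 1 w" "\<And>t. w t <= 1" and norms: "norm G <= x" "norm A <= y"
  shows "\<bar>2 * inner A (bilop (ikernel (near_kernel n w ker_v_qx)) G A)\<bar> <= C_comm * C_bil * x * y^2"
    and "\<bar>2 * inner A (bilop (ikernel (near_kernel n w ker_v_vx)) G A)\<bar> <= C_comm * C_bil * x * y^2"
  unfolding near_kernel_eqs[OF w] C_comm_def
  by (intro comm_kernel_self_le near_max_sq_le slow_weighted_wgt slow_weighted_wgt_rTinv w ft_const_div_wgt
      near_measurable near_minus near_sym near_01 norms; simp)+

theorem energy_estimate: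
  assumes w: "slow 1 w" "\<And>t. w t <= 1" and X: "rmult2 (cut n) X = X"
  shows "\<bar>inner (rmult2 w X) (rmult2 w (rmult2 (jcut n) (quad_op X X)))\<bar> <= C_energy * norm X * (norm (rmult2 w X))^2"
proof -
  obtain F G where FG: "X = (F, G)" by (cases X)
  have cutF: "rmult (cut n) F = F" and cutG: "rmult (cut n) G = G" using X by (auto simp: FG rmult2_def)
  define A B where "A = rmult w F" and "B = rmult w G"
  let ?far = "\<lambda>r. bilop (ikernel (far_kernel n w r))" and ?near = "\<lambda>r. bilop (ikernel (near_kernel n w r))"
  let ?x = "norm X" and ?y = "norm (rmult2 w X)"
  have norms: "norm F <= ?x" "norm G <= ?x" "norm A <= ?y" "norm B <= ?y"
    using norm_fst_le_norm[of X] norm_snd_le_norm[of X] norm_fst_le_norm[of "rmult2 w X"] norm_snd_le_norm[of "rmult2 w X"]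
    by (auto simp: FG A_def B_def)
  have lin: "rmult w (rmult (jcut n) (x + y)) = rmult w (rmult (jcut n) x) + rmult w (rmult (jcut n) y)" for x y
    using bounded_linear_rmult[OF even_sym_slow[OF w]] bounded_linear_rmult[OF even_sym_jcut] by (simp add: linear_simps)
  have "inner (rmult2 w X) (rmult2 w (rmult2 (jcut n) (quad_op X X)))
    = inner A (?far ker_q_vx A G) + inner A (?far ker_v_qx B F) + inner B (?far ker_q_qx A F) + inner B (?far ker_v_vx B G)
      + ((inner A (?near ker_q_vx F B) + inner B (?near ker_q_qx F A)) + inner A (?near ker_v_qx G A) + inner B (?near ker_v_vx G B))"
    by (simp add: FG rmult2_def quad_op_def inner_prod_def lin coeff_op_far_near[OF w coeff_kernels(1) cutG]
        coeff_op_far_near[OF w coeff_kernels(2) cutF] coeff_op_far_near[OF w coeff_kernels(3) cutF]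
        coeff_op_far_near[OF w coeff_kernels(4) cutG] inner_add_right A_def[symmetric] B_def[symmetric])
  moreover have "\<bar>inner z (?far r u v)\<bar> <= 2 * 3 ^ deg_s * C_bil * ?x * ?y^2"
    if "coeff_kernel r" "norm u <= ?y" "norm v <= ?x" "norm z <= ?y" for r u v z
    by (rule inner_bilop_le_cubic[OF kernel_far[OF w that(1)]]) (use that in auto)
  note far = this[OF coeff_kernels(1) norms(3,2,3)] this[OF coeff_kernels(2) norms(4,1,3)]
    this[OF coeff_kernels(3) norms(3,1,4)] this[OF coeff_kernels(4) norms(4,2,4)]
  note near = near_kernel_cross_le[OF w norms(1,3,4), of n] near_kernel_self_le(1)[OF w norms(2,3), of n]
    near_kernel_self_le(2)[OF w norms(2,4), of n]
  moreover have "0 <= C_comm * C_bil * ?x * ?y^2" using C_comm_nonneg by simp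
  ultimately have "\<bar>inner (rmult2 w X) (rmult2 w (rmult2 (jcut n) (quad_op X X)))\<bar>
    <= 4 * (2 * 3 ^ deg_s * C_bil * ?x * ?y^2) + 3 * (C_comm * C_bil * ?x * ?y^2)"
    using far near by linarith
  also have "... = C_energy * ?x * ?y^2" by (simp add: C_energy_def algebra_simps)
  finally show ?thesis .
qed

subsection \<open>The estimate for differences\<close>

lemma coeff_op_winv_snd:
  assumes r: "coeff_kernel r" and y: "rmult (cut n) y = y"
  shows "rmult winv (rmult (jcut n) (coeff_op r x y))
    = bilop (ikernel (\<lambda>u v. winv u * cut n u * cut n v * r u v * wgt v)) x (rmult winv y)" (is "_ = bilop (ikernel ?k) _ _")
proof -
  note [measurable] = coeff_kernel_measurable[OF r]
  have kernel: "kernel (2 * \<bar>n\<bar>) (ikernel ?k)"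
  proof (rule kernel_ikernel_diff)
    show "?k (- u) (- v) = - ?k u v" for u v by (simp add: coeff_kernel_minus[OF r])
    show "\<bar>?k u v\<bar> <= 2 * \<bar>n\<bar> * J (u - v)" for u v
    proof (cases "cut n v = 0")
      case False
      then have v: "\<bar>v\<bar> <= \<bar>n\<bar>" by (auto simp: cut_def split: if_splits)
      have "\<bar>?k u v\<bar> = cut n u * cut n v * (winv u * wgt v * \<bar>r u v\<bar>)"
        using cut_01 by (simp add: abs_mult)
      also have "... <= 1 * 1 * (winv u * wgt v * (2 * (wgt u * \<bar>v\<bar> / (wgt (u - v) * wgt v))))"
        using cut_01 abs_coeff_le[OF r] by (intro mult_mono) auto
      also have "... = 2 * \<bar>v\<bar> * (1 / wgt (u - v))" by (simp add: winv_eq)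
      also have "... <= 2 * \<bar>n\<bar> * J (u - v)" using v by (intro mult_mono winv_le_J) auto
      finally show ?thesis .
    qed simp
  qed simp_all
  have "bilop (ikernel ?k) x (rmult winv y) = bilop (ikernel (\<lambda>u v. 1 * ?k u v * 1 * winv v)) x y"
    using rmult_bilop_ikernel[OF kernel even_sym_one even_sym_winv even_sym_one, of x y] by simp
  also have "... = bilop (ikernel (\<lambda>u v. winv u * cut n u * cut n v * r u v)) x y"
    by (rule bilop_ikernel_cong) (simp add: winv_eq)
  also have "... = rmult winv (rmult (jcut n) (coeff_op r x y))"
    using rmult_jcut_coeff_op[OF r even_sym_winv even_sym_cut[of n], of n x y] y by simp
  finally show ?thesis by simp
qed

lemma coeff_op_winv_fst_le:
  assumes r: "coeff_kernel r" and norms: "norm (rmult winv x) <= b" "norm y <= a" "norm z <= b"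
  shows "\<bar>inner z (rmult winv (rmult (jcut n) (coeff_op r x y)))\<bar> <= 2 * C_bil * a * b^2"
proof -
  note [measurable] = coeff_kernel_measurable[OF r]
  let ?k = "\<lambda>u v. winv u * cut n u * r u v * wgt (u - v)"
  have kernel: "kernel 2 (ikernel ?k)"
  proof (rule kernel_ikernel_snd)
    fix u v :: real
    show "?k (- u) (- v) = - ?k u v"
      unfolding diff_minus_minus jpow_minus cut_minus coeff_kernel_minus[OF r] by simp
    have "\<bar>?k u v\<bar> = cut n u * (winv u * wgt (u - v) * \<bar>r u v\<bar>)" using cut_01 by (simp add: abs_mult)
    also have "... <= 1 * (winv u * wgt (u - v) * (2 * (wgt u * \<bar>v\<bar> / (wgt (u - v) * wgt v))))"
      using cut_01 abs_coeff_le[OF r] by (intro mult_mono) auto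
    also have "... = 2 * (\<bar>v\<bar> / wgt v)" by (simp add: winv_eq)
    also have "... <= 2 * J v" by (intro mult_left_mono abs_winv_le_J) auto
    finally show "\<bar>?k u v\<bar> <= 2 * J v" .
  qed simp_all
  have "bilop (ikernel ?k) (rmult winv x) y = bilop (ikernel (\<lambda>u v. 1 * ?k u v * winv (u - v) * 1)) x y"
    using rmult_bilop_ikernel[OF kernel even_sym_winv even_sym_one even_sym_one, of x y] by simp
  also have "... = bilop (ikernel (\<lambda>u v. winv u * cut n u * 1 * r u v)) x y"
    by (rule bilop_ikernel_cong) (simp add: winv_eq)
  also have "... = rmult winv (rmult (jcut n) (coeff_op r x y))"
    using rmult_jcut_coeff_op[OF r even_sym_winv even_sym_one, of n x y] by simp
  finally show ?thesis using inner_bilop_le_cubic[OF kernel, of "rmult winv x" a y b z] norms by simp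
qed

abbreviation "diff_kernel n a c \<equiv> comm_kernel (\<lambda>_ _. 1) n a c"

lemma winv_kernel_eqs:
  "(\<lambda>u v. winv u * cut n u * cut n v * ker_q_vx u v * wgt v) = (\<lambda>u v. diff_kernel n (\<lambda>_. 1) (\<lambda>t. ft_const / 2 / wgt t) u v * sqrtT v)"
  "(\<lambda>u v. winv u * cut n u * cut n v * ker_q_qx u v * wgt v) = (\<lambda>u v. diff_kernel n (\<lambda>_. 1) (\<lambda>t. ft_const / 2 / wgt t) u v * sqrtT u)"
  "(\<lambda>u v. winv u * cut n u * cut n v * ker_v_qx u v * wgt v) = diff_kernel n (\<lambda>_. 1) (\<lambda>t. ft_const / (wgt t * rTinv t))"
  "(\<lambda>u v. winv u * cut n u * cut n v * ker_v_vx u v * wgt v) = diff_kernel n rTinv (\<lambda>t. ft_const / (wgt t * rTinv t))"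
  by (intro ext; simp add: ker_defs comm_kernel_def winv_eq sqrtT_eq field_simps)+

lemma one_max_sq_le: "0 <= c ==> c <= 1 / wgt t ==> (max 1 1)^2 * c <= 2 * (1 * 1) / wgt t"
  using divide_right_mono[of 1 2 "wgt t"] by simp

lemma rTinv_max_sq_le:
  "(max (rTinv u) (rTinv v))^2 * (ft_const / (wgt (u - v) * rTinv (u - v))) <= 2 * (rTinv u * rTinv v) / wgt (u - v)"
proof -
  have "(max (rTinv u) (rTinv v))^2 <= 2 * rTinv (u - v) * (rTinv u * rTinv v)"
    using slow_le_mult[OF slow_rTinv rTinv_ge_1, of u v] slow_le_mult[OF slow_rTinv rTinv_ge_1, of v u] rTinv_minus[of "u - v"]
    by (intro max_sq_le) (simp_all add: mult.assoc)
  then have "(max (rTinv u) (rTinv v))^2 * (ft_const / (wgt (u - v) * rTinv (u - v)))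
      <= (2 * rTinv (u - v) * (rTinv u * rTinv v)) * (ft_const / (wgt (u - v) * rTinv (u - v)))"
    by (intro mult_right_mono ft_const_div_wgt)
  also have "... = ft_const * (2 * (rTinv u * rTinv v) / wgt (u - v))" by simp
  also have "... <= 1 * (2 * (rTinv u * rTinv v) / wgt (u - v))" using ft_const by (intro mult_right_mono) auto
  finally show ?thesis by simp
qed

lemma winv_kernel_cross_le:
  assumes "norm F <= x" "norm A <= y" "norm B <= y"
  shows "\<bar>inner A (bilop (ikernel (\<lambda>u v. winv u * cut n u * cut n v * ker_q_vx u v * wgt v)) F B)
    + inner B (bilop (ikernel (\<lambda>u v. winv u * cut n u * cut n v * ker_q_qx u v * wgt v)) F A)\<bar> <= 6 * C_bil * x * y^2"
  unfolding winv_kernel_eqs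
  using comm_kernel_cross_le[OF slow_one ft_const_div_wgt(1) _ ft_const_div_wgt(2) _ _ _ _ _ _ _ even_sym_sqrtT assms,
      of "\<lambda>_ _. 1" 2] one_max_sq_le[OF ft_const_div_wgt(2,3)] by simp

lemma winv_kernel_self_le:
  assumes "norm G <= x" "norm A <= y"
  shows "\<bar>2 * inner A (bilop (ikernel (\<lambda>u v. winv u * cut n u * cut n v * ker_v_qx u v * wgt v)) G A)\<bar> <= 6 * C_bil * x * y^2"
    and "\<bar>2 * inner A (bilop (ikernel (\<lambda>u v. winv u * cut n u * cut n v * ker_v_vx u v * wgt v)) G A)\<bar> <= 6 * C_bil * x * y^2"
  unfolding winv_kernel_eqs
  using comm_kernel_self_le[OF slow_one ft_const_div_wgt(4) _ ft_const_div_wgt(5) _ _ _ _ _ _ _ assms, of "\<lambda>_ _. 1" 2]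
    comm_kernel_self_le[OF slow_rTinv ft_const_div_wgt(4) _ ft_const_div_wgt(5) _ _ _ _ _ _ _ assms, of "\<lambda>_ _. 1" 2]
    one_max_sq_le[OF ft_const_div_wgt(5,6)] rTinv_max_sq_le by simp_all

theorem difference_estimate:
  assumes D: "rmult2 (cut n) D = D"
  shows "\<bar>inner (rmult2 winv D) (rmult2 winv (rmult2 (jcut n) (quad_op Y D + quad_op D Y)))\<bar>
    <= 26 * C_bil * norm Y * (norm (rmult2 winv D))^2"
proof -
  obtain F G where FG: "Y = (F, G)" by (cases Y)
  obtain P Q where PQ: "D = (P, Q)" by (cases D)
  have cutP: "rmult (cut n) P = P" and cutQ: "rmult (cut n) Q = Q" using D by (auto simp: PQ rmult2_def)
  define A B where "A = rmult winv P" and "B = rmult winv Q"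
  let ?k = "\<lambda>r. bilop (ikernel (\<lambda>u v. winv u * cut n u * cut n v * r u v * wgt v))"
  let ?T = "\<lambda>u. rmult winv (rmult (jcut n) u)"
  let ?x = "norm Y" and ?y = "norm (rmult2 winv D)"
  have norms: "norm F <= ?x" "norm G <= ?x" "norm A <= ?y" "norm B <= ?y"
    using norm_fst_le_norm[of Y] norm_snd_le_norm[of Y] norm_fst_le_norm[of "rmult2 winv D"] norm_snd_le_norm[of "rmult2 winv D"]
    by (auto simp: FG PQ A_def B_def)
  have lin: "?T (x + y) = ?T x + ?T y" for x y
    using bounded_linear_rmult[OF even_sym_winv] bounded_linear_rmult[OF even_sym_jcut] by (simp add: linear_simps)
  have "inner (rmult2 winv D) (rmult2 winv (rmult2 (jcut n) (quad_op Y D + quad_op D Y)))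
    = inner A (?T (coeff_op ker_q_vx P G)) + inner A (?T (coeff_op ker_v_qx Q F))
      + inner B (?T (coeff_op ker_q_qx P F)) + inner B (?T (coeff_op ker_v_vx Q G))
      + ((inner A (?k ker_q_vx F B) + inner B (?k ker_q_qx F A)) + inner A (?k ker_v_qx G A) + inner B (?k ker_v_vx G B))"
    by (simp add: FG PQ rmult2_def quad_op_def inner_prod_def lin coeff_op_winv_snd[OF coeff_kernels(1) cutQ, of F]
        coeff_op_winv_snd[OF coeff_kernels(2) cutP, of G] coeff_op_winv_snd[OF coeff_kernels(3) cutP, of F]
        coeff_op_winv_snd[OF coeff_kernels(4) cutQ, of G] inner_add_right A_def[symmetric] B_def[symmetric])
  moreover note coeff_op_winv_fst_le[OF coeff_kernels(1) norms(3,2,3)[unfolded A_def], of n]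
    coeff_op_winv_fst_le[OF coeff_kernels(2) norms(4,1,3)[unfolded B_def], of n]
    coeff_op_winv_fst_le[OF coeff_kernels(3) norms(3,1,4)[unfolded A_def], of n]
    coeff_op_winv_fst_le[OF coeff_kernels(4) norms(4,2,4)[unfolded B_def], of n]
  moreover note winv_kernel_cross_le[OF norms(1,3,4), of n] winv_kernel_self_le(1)[OF norms(2,3), of n]
    winv_kernel_self_le(2)[OF norms(2,4), of n]
  moreover have "0 <= C_bil * ?x * ?y^2" by simp
  ultimately show ?thesis unfolding A_def[symmetric] B_def[symmetric] by linarith
qed

end

section \<open>Solutions of the symmetric system\<close>

lemma norm_diff_le_of_deriv:
  fixes f :: "real => 'a::banach"
  assumes "\<And>t. t \<in> {0..T} ==> (f has_vector_derivative f' t) (at t within {0..T})"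
    and "\<And>t. t \<in> {0..T} ==> norm (f' t) <= B" and "0 <= B" and "t \<in> {0..T}"
  shows "norm (f t - f 0) <= B * t"
proof -
  have "(f' has_integral (f t - f 0)) {0..t}"
    using assms(4) by (intro fundamental_theorem_of_calculus)
      (auto intro: has_vector_derivative_within_subset[OF assms(1)])
  then have "norm (f t - f 0) <= B * measure lborel {0..t}"
    using assms by (intro has_integral_bound_real[where f = f' and S = "{}"]) auto
  then show ?thesis using assms(4) by simp
qed

lemma gronwall:
  fixes f f' :: "real => real"
  assumes d: "\<And>t. t \<in> {0..T} ==> (f has_real_derivative f' t) (at t within {0..T})"
    and deriv_le: "\<And>t. t \<in> {0..T} ==> f' t <= a * f t + b" and ab: "0 <= a" "0 <= b" and t: "t \<in> {0..T}"
  shows "f t <= exp (a * t) * (f 0 + b * t)"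
proof -
  define G where "G t = exp (- (a * t)) * f t - b * t" for t
  have G: "(G has_real_derivative exp (- (a * u)) * (f' u - a * f u) - b) (at u within {0..T})" if "u \<in> {0..T}" for u
    unfolding G_def by (rule derivative_eq_intros d[OF that] refl | simp add: algebra_simps)+
  have "G t <= G 0"
  proof (cases "t = 0")
    case False
    then have t_pos: "0 < t" using t by auto
    show ?thesis
    proof (rule DERIV_nonpos_imp_decreasing_open[OF less_imp_le[OF t_pos]])
      fix u assume u: "0 < u" "u < t"
      then have uT: "u \<in> {0..T}" "u \<in> interior {0..T}" using t by auto
      have "(G has_real_derivative exp (- (a * u)) * (f' u - a * f u) - b) (at u)"
        using G[OF uT(1)] at_within_interior[OF uT(2)] by simp
      moreover have "exp (- (a * u)) * (f' u - a * f u) - b <= 0"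
      proof -
        have "exp (- (a * u)) * (f' u - a * f u) <= exp (- (a * u)) * b" using deriv_le[OF uT(1)] by simp
        also have "... <= 1 * b" using ab u by (intro mult_right_mono) auto
        finally show ?thesis by simp
      qed
      ultimately show "\<exists>y. (G has_real_derivative y) (at u) \<and> y <= 0" by blast
    next
      show "continuous_on {0..t} G"
        by (rule continuous_on_subset[OF DERIV_continuous_on[OF G]]) (use t in auto)
    qed
  qed simp
  then have "exp (- (a * t)) * f t <= f 0 + b * t" by (simp add: G_def)
  then have "exp (a * t) * (exp (- (a * t)) * f t) <= exp (a * t) * (f 0 + b * t)" by (intro mult_left_mono) auto
  then show ?thesis by (simp add: mult.assoc[symmetric] exp_add[symmetric])
qed

lemma has_real_derivative_norm_sq:
  fixes x :: "real => 'a::real_inner"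
  assumes "(x has_vector_derivative x') (at t within S)"
  shows "((\<lambda>t. (norm (x t))^2) has_real_derivative 2 * inner (x t) x') (at t within S)"
proof -
  have "((\<lambda>t. inner (x t) (x t)) has_vector_derivative inner (x t) x' + inner x' (x t)) (at t within S)"
    by (rule bounded_bilinear.has_vector_derivative[OF bounded_bilinear_inner assms assms])
  then show ?thesis
    by (simp add: power2_norm_eq_inner has_real_derivative_iff_has_vector_derivative inner_commute)
qed

lemma has_vector_derivative_uniform_limit:
  fixes f :: "nat => real => 'a::banach"
  assumes S: "convex S" and f: "\<And>n x. x \<in> S ==> (f n has_vector_derivative f' n x) (at x within S)"
    and f': "uniform_limit S f' g' sequentially"
    and lim: "\<And>x. x \<in> S ==> (\<lambda>n. f n x) \<longlonglongrightarrow> g x" and t: "t \<in> S"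
  shows "(g has_vector_derivative g' t) (at t within S)"
proof -
  have "\<forall>\<^sub>F n in sequentially. \<forall>x\<in>S. \<forall>h. norm (h *\<^sub>R f' n x - h *\<^sub>R g' x) <= e * norm h" if "0 < e" for e
  proof -
    have "\<forall>\<^sub>F n in sequentially. \<forall>x\<in>S. dist (f' n x) (g' x) < e" using f' that
      by (simp add: uniform_limit_iff)
    then show ?thesis
      by eventually_elim (force simp: dist_norm scaleR_diff_right[symmetric] mult.commute[of e] intro: mult_left_mono less_imp_le)
  qed
  from has_derivative_sequence[OF S f[unfolded has_vector_derivative_def] this t lim[OF t]]
  obtain k where k: "\<And>x. x \<in> S ==> (\<lambda>n. f n x) \<longlonglongrightarrow> k x"
    "\<And>x. x \<in> S ==> (k has_vector_derivative g' x) (at x within S)"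
    by (auto simp: has_vector_derivative_def)
  show ?thesis
    using LIMSEQ_unique[OF lim k(1)] by (rule has_vector_derivative_transform[OF t _ k(2)[OF t]])
qed

subsection \<open>Global solutions of Lipschitz equations\<close>

context
  fixes V :: "'a::banach => 'a" and L T :: real and x0 :: 'a
  assumes L: "0 < L" and V: "\<And>x y. norm (V x - V y) <= L * norm (x - y)" and T: "0 <= T"
begin

text \<open>The unknown is rescaled by \<open>exp (- 2 L t)\<close>, which makes the Picard map a contraction on the whole interval.\<close>
definition picard_map :: "(real => 'a) => real => 'a" where
  "picard_map y t = x0 + integral {0..t} (\<lambda>u. V (exp (2 * L * u) *\<^sub>R y u))"

lemma continuous_on_picard_integrand:
  assumes "continuous_on UNIV y" shows "continuous_on A (\<lambda>u. V (exp (2 * L * u) *\<^sub>R y u))"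
proof -
  have "continuous_on UNIV V"
    by (rule lipschitz_on_continuous_on[of L]) (use L V in \<open>auto intro!: lipschitz_onI simp: dist_norm\<close>)
  then show ?thesis
    by (rule continuous_on_compose2) (auto intro!: continuous_intros intro: continuous_on_subset[OF assms])
qed

lemma picard_map_has_vector_derivative:
  assumes "continuous_on UNIV y" "t \<in> {0..T}"
  shows "(picard_map y has_vector_derivative V (exp (2 * L * t) *\<^sub>R y t)) (at t within {0..T})"
  using integral_has_vector_derivative[OF continuous_on_picard_integrand[OF assms(1)] assms(2)]
  unfolding picard_map_def[abs_def] by (auto intro!: derivative_eq_intros)

lemma picard_map_contraction:
  assumes y: "continuous_on UNIV y" and z: "continuous_on UNIV z" and d: "\<And>u. norm (y u - z u) <= d" and r: "0 <= r"
  shows "norm (picard_map y r - picard_map z r) <= exp (2 * L * r) * (d / 2)"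
proof -
  let ?h = "\<lambda>y u. V (exp (2 * L * u) *\<^sub>R y u)"
  have int: "?h y integrable_on {0..r}" "?h z integrable_on {0..r}"
    by (intro integrable_continuous_interval continuous_on_picard_integrand y z)+
  have bound: "((\<lambda>u. exp (2 * L * u) * (L * d)) has_integral (exp (2 * L * r) * (d / 2) - exp (2 * L * 0) * (d / 2))) {0..r}"
    by (rule fundamental_theorem_of_calculus[OF r])
      (auto intro!: derivative_eq_intros simp: has_real_derivative_iff_has_vector_derivative[symmetric])
  have "picard_map y r - picard_map z r = integral {0..r} (\<lambda>u. ?h y u - ?h z u)"
    unfolding picard_map_def by (simp add: integral_diff[OF int])
  also have "norm ... <= integral {0..r} (\<lambda>u. exp (2 * L * u) * (L * d))"
  proof (rule integral_norm_bound_integral[OF integrable_diff[OF int] has_integral_integrable[OF bound]])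
    fix u
    have "norm (?h y u - ?h z u) <= L * norm (exp (2 * L * u) *\<^sub>R y u - exp (2 * L * u) *\<^sub>R z u)" by (rule V)
    also have "... = exp (2 * L * u) * (L * norm (y u - z u))" by (simp add: scaleR_diff_right[symmetric])
    also have "... <= exp (2 * L * u) * (L * d)" using L d by (intro mult_left_mono) auto
    finally show "norm (?h y u - ?h z u) <= exp (2 * L * u) * (L * d)" .
  qed
  also have "... = exp (2 * L * r) * (d / 2) - d / 2" using integral_unique[OF bound] by simp
  finally show ?thesis using order_trans[OF norm_ge_zero d] by simp
qed

lemma picard_fixed_point:
  obtains y where "continuous_on UNIV y" "\<And>t. t \<in> {0..T} ==> exp (2 * L * t) *\<^sub>R y t = picard_map y t"
proof -
  define proj where "proj t = max 0 (min T t)" for t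
  have proj: "proj t \<in> {0..T}" for t using T by (auto simp: proj_def)
  let ?\<Phi> = "\<lambda>y t. exp (- (2 * L * proj t)) *\<^sub>R picard_map y (proj t)"
  have in_bcontfun: "?\<Phi> y \<in> bcontfun" if "continuous_on UNIV y" for y
  proof -
    have cont: "continuous_on {0..T} (\<lambda>t. exp (- (2 * L * t)) *\<^sub>R picard_map y t)"
      by (intro continuous_intros)
        (auto simp: continuous_on_eq_continuous_within intro!: has_vector_derivative_continuous[OF picard_map_has_vector_derivative[OF that]])
    have "continuous_on UNIV (?\<Phi> y)"
      by (rule continuous_on_compose2[OF cont]) (use proj in \<open>auto simp: proj_def intro!: continuous_intros\<close>)
    moreover have "bounded (range (?\<Phi> y))"
      using compact_imp_bounded[OF compact_continuous_image[OF cont compact_Icc]]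
      by (rule bounded_subset) (use proj in auto)
    ultimately show ?thesis by (auto simp: bcontfun_def)
  qed
  define F where "F y = Bcontfun (?\<Phi> (apply_bcontfun y))" for y
  have cont: "continuous_on UNIV (apply_bcontfun y)" for y :: "real \<Rightarrow>\<^sub>C 'a"
    using apply_bcontfun[of y] by (simp add: bcontfun_def)
  have F: "apply_bcontfun (F y) = ?\<Phi> (apply_bcontfun y)" for y
    unfolding F_def by (rule Bcontfun_inverse[OF in_bcontfun[OF cont]])
  have "dist (F y) (F z) <= 1 / 2 * dist y z" for y z
  proof (rule dist_bound)
    fix t
    have "norm (picard_map (apply_bcontfun y) (proj t) - picard_map (apply_bcontfun z) (proj t))
        <= exp (2 * L * proj t) * (dist y z / 2)"
      using dist_bounded[of y _ z] proj[of t] by (intro picard_map_contraction cont) (auto simp: dist_norm)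
    then have "exp (- (2 * L * proj t)) * norm (picard_map (apply_bcontfun y) (proj t) - picard_map (apply_bcontfun z) (proj t))
        <= exp (- (2 * L * proj t)) * (exp (2 * L * proj t) * (dist y z / 2))"
      by (rule mult_left_mono) simp
    then show "dist (apply_bcontfun (F y) t) (apply_bcontfun (F z) t) <= 1 / 2 * dist y z"
      unfolding F dist_norm scaleR_diff_right[symmetric] norm_scaleR mult.assoc[symmetric] exp_add[symmetric] by simp
  qed
  then obtain y where "F y = y" using banach_fix_type[of "1/2" F] by auto
  then have "apply_bcontfun y t = exp (- (2 * L * t)) *\<^sub>R picard_map (apply_bcontfun y) t" if "t \<in> {0..T}" for t
    using fun_cong[OF F[of y], of t] that by (simp add: proj_def)
  then show thesis by (intro that[OF cont[of y]]) (simp add: exp_minus)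
qed

theorem Lipschitz_ode_solution:
  obtains x where "x 0 = x0" "\<And>t. t \<in> {0..T} ==> (x has_vector_derivative V (x t)) (at t within {0..T})"
proof -
  obtain y where y: "continuous_on UNIV y" "\<And>t. t \<in> {0..T} ==> exp (2 * L * t) *\<^sub>R y t = picard_map y t"
    by (rule picard_fixed_point) blast
  have "picard_map y 0 = x0" by (simp add: picard_map_def)
  moreover have "(picard_map y has_vector_derivative V (picard_map y t)) (at t within {0..T})" if "t \<in> {0..T}" for t
    using picard_map_has_vector_derivative[OF y(1) that] by (simp add: y(2)[OF that])
  ultimately show thesis by (rule that)
qed

end

definition clamp_norm :: "real => 'a::real_normed_vector => 'a" where
  "clamp_norm M x = (M / max M (norm x)) *\<^sub>R x"

context
  fixes M :: real assumes M: "0 < M"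
begin

lemma clamp_norm_eq: "norm x <= M ==> clamp_norm M x = x"
  using M by (simp add: clamp_norm_def)

lemma clamp_norm_factor: "0 <= M / max M (norm x)" "M / max M (norm x) <= 1" "M / max M (norm x) * norm x <= M"
  using M mult_left_mono[of "norm x" "max M (norm x)" M] by (auto simp: pos_divide_le_eq max.strict_coboundedI1)

lemma norm_clamp_norm: "norm (clamp_norm M x) <= M"
  unfolding clamp_norm_def norm_scaleR using clamp_norm_factor[of x] by (simp only: real_norm_def abs_of_nonneg)

lemma clamp_norm_lipschitz: "norm (clamp_norm M x - clamp_norm M y) <= 2 * norm (x - y)"
proof -
  define a b where "a = max M (norm x)" and "b = max M (norm y)"
  have a: "0 < a" "M / a <= 1" and b: "0 < b" "norm y / b <= 1" using M by (auto simp: a_def b_def)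
  have "clamp_norm M x - clamp_norm M y = (M / a) *\<^sub>R (x - y) + (M / a - M / b) *\<^sub>R y"
    by (simp add: clamp_norm_def a_def b_def scaleR_diff_left scaleR_diff_right)
  moreover have "norm ((M / a) *\<^sub>R (x - y)) <= 1 * norm (x - y)"
    unfolding norm_scaleR by (rule mult_right_mono) (use M a in auto)
  moreover have "norm ((M / a - M / b) *\<^sub>R y) <= norm (x - y)"
  proof -
    have "M / a - M / b = M / a * ((b - a) / b)" using a b by (simp add: field_simps)
    then have "norm ((M / a - M / b) *\<^sub>R y) = M / a * (norm y / b) * \<bar>b - a\<bar>" using M a b by (simp add: abs_mult)
    also have "... <= 1 * 1 * \<bar>b - a\<bar>" using M a b by (intro mult_right_mono mult_mono) auto
    also have "... <= norm (x - y)" using norm_triangle_ineq3[of x y] by (auto simp: a_def b_def max_def split: if_splits)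
    finally show ?thesis .
  qed
  ultimately show ?thesis
    using norm_triangle_ineq[of "(M / a) *\<^sub>R (x - y)" "(M / a - M / b) *\<^sub>R y"] by simp
qed

end

lemma norm_mean_le:
  fixes x y :: "'a::real_normed_vector" shows "norm x <= M ==> norm y <= M ==> norm ((1/2) *\<^sub>R (x + y)) <= M"
  using norm_triangle_ineq[of x y] by simp

subsection \<open>The truncated systems\<close>

context whitham_boussinesq
begin

definition sym_rhs :: "state => state" where "sym_rhs X = lin_op X + quad_op X X"
definition lin_rhs :: "state => state => state" where "lin_rhs Y D = lin_op D + (quad_op Y D + quad_op D Y)"

sublocale quad_op: bounded_bilinear quad_op by (rule bounded_bilinear_quad_op)
sublocale lin_op: bounded_linear lin_op by (rule bounded_linear_lin_op)

lemma quad_op_bound: obtains K where "0 < K" "\<And>X Y. norm (quad_op X Y) <= K * norm X * norm Y"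
  using quad_op.pos_bounded by (metis mult.commute mult.assoc)

lemma norm_lin_op_le: "norm (lin_op X) <= norm X"
  using norm_Pair_mono[OF norm_fmult_le[OF herm_sym_lin_symbol] norm_fmult_le[OF herm_sym_lin_symbol], of "snd X" "fst X"]
  by (simp add: lin_op_def norm_Pair add.commute norm_prod_def)

lemma sym_rhs_diff: "sym_rhs X - sym_rhs Y = lin_rhs ((1/2) *\<^sub>R (X + Y)) (X - Y)"
proof -
  have "quad_op (X + Y) (X - Y) + quad_op (X - Y) (X + Y) = 2 *\<^sub>R (quad_op X X - quad_op Y Y)"
    by (simp add: quad_op.add_left quad_op.add_right quad_op.diff_left quad_op.diff_right scaleR_2 algebra_simps)
  then show ?thesis
    unfolding lin_rhs_def quad_op.scaleR_left quad_op.scaleR_right scaleR_add_right[symmetric]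
    by (simp add: sym_rhs_def lin_op.diff)
qed

lemma inner_lin_op:
  assumes "even_sym C a" "even_sym D b" shows "inner (rmult2 a X) (rmult2 b (lin_op X)) = 0"
proof -
  obtain F G where X: "X = (F, G)" by (cases X)
  note a = even_sym_herm_sym[OF assms(1)] and b = even_sym_herm_sym[OF assms(2)]
  define m where "m t = cx (a t) * (cx (b t) * lin_symbol t)" for t
  have herm_sym_m: "herm_sym (C * (D * 1)) m" unfolding m_def[abs_def] by (intro herm_sym_mult a b herm_sym_lin_symbol)
  have composite: "rmult a (rmult b (fmult lin_symbol x)) = fmult m x" for x
    unfolding rmult_def fmult_fmult[OF b herm_sym_lin_symbol] m_def[abs_def]
    by (rule fmult_fmult[OF a herm_sym_mult[OF b herm_sym_lin_symbol]])
  have "fmult (\<lambda>t. cnj (m t)) x = rmult (\<lambda>_. -1) (fmult m x)" for x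
    unfolding rmult_def fmult_fmult[OF even_sym_herm_sym[OF even_sym_const] herm_sym_m] by (simp add: m_def lin_symbol_def)
  then have "inner G (fmult m F) = - inner F (fmult m G)"
    using inner_fmult[OF herm_sym_m, of F G] by (simp add: inner_commute rmult_const)
  then show ?thesis
    unfolding X rmult2_def lin_op_def inner_prod_def fst_conv snd_conv inner_rmult[OF assms(1)] composite by simp
qed

definition clamped_rhs :: "real => real => state => state" where
  "clamped_rhs n M X = rmult2 (jcut n) (lin_op X + quad_op (clamp_norm M X) (clamp_norm M X))"

lemma clamped_rhs_eq: "0 < M ==> norm X <= M ==> clamped_rhs n M X = rmult2 (jcut n) (sym_rhs X)"
  by (simp add: clamped_rhs_def sym_rhs_def clamp_norm_eq)

lemma clamped_rhs_lipschitz: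
  assumes M: "0 < M"
  obtains L where "0 < L" "\<And>X Y. norm (clamped_rhs n M X - clamped_rhs n M Y) <= L * norm (X - Y)"
proof -
  obtain K where K: "0 < K" "\<And>X Y. norm (quad_op X Y) <= K * norm X * norm Y" by (rule quad_op_bound) blast
  have "norm (clamped_rhs n M X - clamped_rhs n M Y) <= ((1 + \<bar>n\<bar>) * (1 + 4 * K * M)) * norm (X - Y)" for X Y
  proof -
    let ?x = "clamp_norm M X" and ?y = "clamp_norm M Y" and ?d = "norm (X - Y)"
    have "norm (quad_op ?x (?x - ?y)) <= K * M * (2 * ?d)" "norm (quad_op (?x - ?y) ?y) <= K * (2 * ?d) * M"
      using K(1) M by (intro order_trans[OF K(2)] mult_mono norm_clamp_norm[OF M] clamp_norm_lipschitz[OF M]; simp)+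
    then have "norm (lin_op (X - Y) + (quad_op ?x (?x - ?y) + quad_op (?x - ?y) ?y))
        <= ?d + (K * M * (2 * ?d) + K * (2 * ?d) * M)"
      by (intro order_trans[OF norm_triangle_ineq] add_mono norm_lin_op_le)
    moreover have "clamped_rhs n M X - clamped_rhs n M Y
        = rmult2 (jcut n) (lin_op (X - Y) + (quad_op ?x (?x - ?y) + quad_op (?x - ?y) ?y))"
      unfolding clamped_rhs_def rmult2_diff[OF even_sym_jcut, symmetric]
      by (simp add: lin_op.diff quad_op.diff_left quad_op.diff_right algebra_simps)
    ultimately have "norm (clamped_rhs n M X - clamped_rhs n M Y)
        <= (1 + \<bar>n\<bar>) * (?d + (K * M * (2 * ?d) + K * (2 * ?d) * M))"
      by (simp only:) (rule order_trans[OF norm_rmult2_le[OF even_sym_jcut] mult_left_mono], auto)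
    then show ?thesis by (simp add: algebra_simps)
  qed
  moreover have "0 < (1 + \<bar>n\<bar>) * (1 + 4 * K * M)" using K(1) M by (intro mult_pos_pos add_pos_nonneg) auto
  ultimately show thesis using that by blast
qed

lemma clamped_rhs_energy:
  assumes w: "slow 1 w" "\<And>t. w t <= 1" and M: "0 < M" and X: "rmult2 (cut n) X = X"
  shows "2 * inner (rmult2 w X) (rmult2 w (clamped_rhs n M X)) <= 2 * C_energy * M * (norm (rmult2 w X))^2"
proof -
  define l where "l = M / max M (norm X)"
  have l: "0 <= l" "l <= 1" "l * norm X <= M" unfolding l_def by (rule clamp_norm_factor[OF M])+
  note even = even_sym_slow[OF w]
  have "clamped_rhs n M X = rmult2 (jcut n) (lin_op X) + (l * l) *\<^sub>R rmult2 (jcut n) (quad_op X X)"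
    by (simp add: clamped_rhs_def clamp_norm_def l_def[symmetric] rmult2_add[OF even_sym_jcut] rmult2_scaleR[OF even_sym_jcut]
        quad_op.scaleR_left quad_op.scaleR_right)
  then have "inner (rmult2 w X) (rmult2 w (clamped_rhs n M X))
      = (l * l) * inner (rmult2 w X) (rmult2 w (rmult2 (jcut n) (quad_op X X)))"
    by (simp add: rmult2_add[OF even] rmult2_scaleR[OF even] inner_add_right rmult2_rmult2[OF even even_sym_jcut]
        inner_lin_op[OF even even_sym_mult[OF even even_sym_jcut]])
  also have "... <= (l * l) * (C_energy * norm X * (norm (rmult2 w X))^2)"
    using energy_estimate[OF w X] by (intro mult_left_mono) auto
  also have "... = (l * (l * norm X)) * (C_energy * (norm (rmult2 w X))^2)" by simp
  also have "... <= (1 * M) * (C_energy * (norm (rmult2 w X))^2)"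
    using l C_energy_nonneg by (intro mult_right_mono mult_mono) auto
  finally show ?thesis by (simp add: mult_ac)
qed

definition c_sym :: real where "c_sym = ln 2 / (2 * C_energy + 1)"

lemma c_sym_pos: "0 < c_sym" using C_energy_nonneg by (simp add: c_sym_def add_nonneg_pos)

lemma exp_C_energy_le:
  assumes d: "0 < d" and t: "t <= c_sym / d" shows "exp (2 * C_energy * (2 * d) * t) <= 4"
proof -
  have "2 * C_energy * (2 * d) * t <= 2 * C_energy * (2 * d) * (c_sym / d)"
    using t d C_energy_nonneg by (intro mult_left_mono) auto
  also have "... <= 2 * ((2 * C_energy + 1) * c_sym)" using d c_sym_pos by (simp add: algebra_simps)
  also have "... = 2 * ln 2" using C_energy_nonneg by (simp add: c_sym_def)
  finally have "exp (2 * C_energy * (2 * d) * t) <= exp (2 * ln 2)" by simp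
  then show ?thesis by (simp add: exp_double)
qed

definition truncated_solution :: "real => real => state => (real => state) => bool" where
  "truncated_solution n T X0 X \<longleftrightarrow> X 0 = rmult2 (cut n) X0 \<and>
     (\<forall>t\<in>{0..T}. (X has_vector_derivative rmult2 (jcut n) (sym_rhs (X t))) (at t within {0..T}))"

definition weight_bound :: "real => state => (real => state) => bool" where
  "weight_bound T X0 X \<longleftrightarrow> (\<forall>t\<in>{0..T}. \<forall>w. slow 1 w \<longrightarrow> (\<forall>x. w x <= 1) \<longrightarrow> norm (rmult2 w (X t)) <= 2 * norm (rmult2 w X0))"

lemma weight_boundD:
  "weight_bound T X0 X ==> t \<in> {0..T} ==> slow 1 w ==> (\<And>x. w x <= 1) ==> norm (rmult2 w (X t)) <= 2 * norm (rmult2 w X0)"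
  by (simp add: weight_bound_def)

lemma weight_bound_norm: "weight_bound T X0 X ==> t \<in> {0..T} ==> norm X0 <= d ==> norm (X t) <= 2 * d"
  using weight_boundD[OF _ _ slow_one, of T X0 X t] by simp

lemma cut_supported:
  assumes "X 0 = rmult2 (cut n) X0" "t \<in> {0..T}"
    and deriv: "\<And>t. t \<in> {0..T} ==> (X has_vector_derivative rmult2 (jcut n) (Z t)) (at t within {0..T})"
  shows "rmult2 (cut n) (X t) = X t"
proof -
  have cut_jcut: "rmult2 (cut n) (rmult2 (jcut n) x) = rmult2 (jcut n) x" for x
    unfolding rmult2_rmult2[OF even_sym_cut even_sym_jcut] by (rule rmult2_cong) (simp add: jcut_def cut_def)
  have "norm ((rmult2 (cut n) (X t) - X t) - (rmult2 (cut n) (X 0) - X 0)) <= 0 * t"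
  proof (rule norm_diff_le_of_deriv[OF _ _ _ assms(2)])
    show "((\<lambda>t. rmult2 (cut n) (X t) - X t) has_vector_derivative rmult2 (cut n) (rmult2 (jcut n) (Z u)) - rmult2 (jcut n) (Z u)) (at u within {0..T})"
      if "u \<in> {0..T}" for u
      by (intro has_vector_derivative_diff rmult2_has_vector_derivative[OF even_sym_cut] deriv that)
  qed (simp_all add: cut_jcut)
  then show ?thesis by (simp add: assms(1) rmult2_cut_cut)
qed

lemma truncated_solution_supported: "truncated_solution n T X0 X ==> t \<in> {0..T} ==> rmult2 (cut n) (X t) = X t"
  by (rule cut_supported[where Z = "\<lambda>t. sym_rhs (X t)"]) (auto simp: truncated_solution_def)

lemma truncated_solution_exists:
  assumes d: "0 < d" "norm X0 <= d"
  obtains X where "truncated_solution n (c_sym / d) X0 X" "weight_bound (c_sym / d) X0 X"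
proof -
  let ?T = "c_sym / d" and ?V = "clamped_rhs n (2 * d)"
  have M: "0 < 2 * d" and T: "0 <= ?T" using d c_sym_pos by auto
  obtain L where "0 < L" "\<And>X Y. norm (?V X - ?V Y) <= L * norm (X - Y)" by (rule clamped_rhs_lipschitz[OF M]) blast
  from Lipschitz_ode_solution[OF this T] obtain X where init: "X 0 = rmult2 (cut n) X0"
    and deriv: "\<And>t. t \<in> {0..?T} ==> (X has_vector_derivative ?V (X t)) (at t within {0..?T})" by blast
  have supported: "rmult2 (cut n) (X t) = X t" if "t \<in> {0..?T}" for t
    by (rule cut_supported[where X = X, OF init that deriv[unfolded clamped_rhs_def]])
  have "norm (rmult2 w (X t)) <= 2 * norm (rmult2 w X0)"
    if t: "t \<in> {0..?T}" and w: "slow 1 w" "\<And>x. w x <= 1" for t w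
  proof (rule power2_le_imp_le)
    note even = even_sym_slow[OF w]
    have "(norm (rmult2 w (X t)))^2 <= exp ((2 * C_energy * (2 * d)) * t) * ((norm (rmult2 w (X 0)))^2 + 0 * t)"
    proof (rule gronwall[OF _ _ _ _ t])
      fix u assume u: "u \<in> {0..?T}"
      show "((\<lambda>t. (norm (rmult2 w (X t)))^2) has_real_derivative 2 * inner (rmult2 w (X u)) (rmult2 w (?V (X u)))) (at u within {0..?T})"
        by (intro has_real_derivative_norm_sq rmult2_has_vector_derivative[OF even] deriv u)
      show "2 * inner (rmult2 w (X u)) (rmult2 w (?V (X u))) <= (2 * C_energy * (2 * d)) * (norm (rmult2 w (X u)))^2 + 0"
        using clamped_rhs_energy[OF w M supported[OF u]] by simp
    qed (use C_energy_nonneg d in auto)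
    also have "... <= 4 * ((norm (rmult2 w X0))^2 + 0)"
      unfolding init rmult2_rmult2[OF even even_sym_cut] using exp_C_energy_le[OF d(1)] t
      by (intro mult_mono add_mono power_mono norm_rmult2_mono[OF even_sym_mult[OF even even_sym_cut] even]) (auto simp: cut_def less_imp_le[OF slow_pos[OF w(1)]])
    finally show "(norm (rmult2 w (X t)))^2 <= (2 * norm (rmult2 w X0))^2" by (simp add: power_mult_distrib)
  qed simp
  then have weight: "weight_bound ?T X0 X" by (simp add: weight_bound_def)
  have "?V (X t) = rmult2 (jcut n) (sym_rhs (X t))" if "t \<in> {0..?T}" for t
    using weight_bound_norm[OF weight that d(2)] by (rule clamped_rhs_eq[OF M])
  then show thesis using that[of X] init deriv weight by (simp add: truncated_solution_def)
qed

subsection \<open>Differences of solutions\<close>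

definition sym_solution :: "real => (real => state) => bool" where
  "sym_solution T X \<longleftrightarrow> continuous_on {0..T} X \<and>
     (\<forall>t\<in>{0..T}. ((\<lambda>t. rmult2 jinv (X t)) has_vector_derivative sym_rhs (X t)) (at t within {0..T}))"

lemma rmult2_winv_eq: "rmult2 winv X = rmult2 J (rmult2 jinv X)"
  unfolding rmult2_rmult2[OF even_sym_J even_sym_jinv] by (rule rmult2_cong) (simp add: weight_eqs)

lemma rmult2_winv_jcut: "rmult2 winv (rmult2 (jcut n) X) = rmult2 J (rmult2 (cut n) X)"
  unfolding rmult2_rmult2[OF even_sym_winv even_sym_jcut] rmult2_rmult2[OF even_sym_J even_sym_cut]
  by (rule rmult2_cong) (simp add: jcut_def weight_eqs)

lemma lin_rhs_estimate_cut:
  assumes "rmult2 (cut n) D = D"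
  shows "\<bar>inner (rmult2 winv D) (rmult2 winv (rmult2 (jcut n) (lin_rhs Y D)))\<bar> <= 26 * C_bil * norm Y * (norm (rmult2 winv D))^2"
  using difference_estimate[OF assms, of Y] inner_lin_op[OF even_sym_winv even_sym_mult[OF even_sym_winv even_sym_jcut], of D n]
  by (simp add: lin_rhs_def rmult2_add[OF even_sym_jcut] rmult2_add[OF even_sym_winv] inner_add_right
      rmult2_rmult2[OF even_sym_winv even_sym_jcut])

lemma lin_rhs_estimate:
  "\<bar>inner (rmult2 winv D) (rmult2 J (lin_rhs Y D))\<bar> <= 26 * C_bil * norm Y * (norm (rmult2 winv D))^2"
proof (rule LIMSEQ_le)
  let ?D = "\<lambda>k. rmult2 (cut (real k)) D"
  note lim = rmult2_cut_tendsto[of D] and winv = bounded_linear.tendsto[OF bounded_linear_rmult2[OF even_sym_winv]]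
    and J = bounded_linear.tendsto[OF bounded_linear_rmult2[OF even_sym_J]]
  show "(\<lambda>k. \<bar>inner (rmult2 winv (?D k)) (rmult2 J (lin_rhs Y (?D k)))\<bar>) \<longlonglongrightarrow> \<bar>inner (rmult2 winv D) (rmult2 J (lin_rhs Y D))\<bar>"
    unfolding lin_rhs_def by (intro tendsto_intros winv J lin_op.tendsto quad_op.tendsto lim)
  show "(\<lambda>k. 26 * C_bil * norm Y * (norm (rmult2 winv (?D k)))^2) \<longlonglongrightarrow> 26 * C_bil * norm Y * (norm (rmult2 winv D))^2"
    by (intro tendsto_intros winv lim)
  have "inner (rmult2 winv (rmult2 (cut n) D)) (rmult2 winv (rmult2 (jcut n) Z)) = inner (rmult2 winv (rmult2 (cut n) D)) (rmult2 J Z)" for n Z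
  proof -
    have "rmult2 winv (rmult2 (jcut n) Z) = rmult2 (cut n) (rmult2 J Z)"
      unfolding rmult2_winv_jcut
      by (simp add: rmult2_rmult2[OF even_sym_J even_sym_cut] rmult2_rmult2[OF even_sym_cut even_sym_J] mult.commute)
    moreover have "rmult2 (cut n) (rmult2 winv (rmult2 (cut n) D)) = rmult2 winv (rmult2 (cut n) D)"
      unfolding rmult2_rmult2[OF even_sym_winv even_sym_cut] rmult2_rmult2[OF even_sym_cut even_sym_mult[OF even_sym_winv even_sym_cut]]
      by (rule rmult2_cong) (simp add: cut_def)
    ultimately show ?thesis by (metis inner_rmult2[OF even_sym_cut])
  qed
  then show "\<exists>N. \<forall>k\<ge>N. \<bar>inner (rmult2 winv (?D k)) (rmult2 J (lin_rhs Y (?D k)))\<bar> <= 26 * C_bil * norm Y * (norm (rmult2 winv (?D k)))^2"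
    using lin_rhs_estimate_cut[OF rmult2_cut_cut[OF order_refl], of "real _" D Y] by simp
qed

lemma scale_C_bil_mono: "norm Y <= M ==> 26 * C_bil * norm Y * (norm Z)^2 <= 26 * C_bil * M * (norm Z)^2"
  by (intro mult_right_mono mult_left_mono) auto

lemma sym_solution_difference:
  assumes X: "sym_solution T X" and Y: "sym_solution T Y"
    and M: "\<And>t. t \<in> {0..T} ==> norm (X t) <= M \<and> norm (Y t) <= M" and t: "t \<in> {0..T}"
  shows "norm (rmult2 winv (X t - Y t)) <= exp (26 * C_bil * M * t) * norm (rmult2 winv (X 0 - Y 0))"
proof (rule power2_le_imp_le)
  let ?D = "\<lambda>u. rmult2 winv (X u - Y u)" and ?R = "\<lambda>u. rmult2 J (sym_rhs (X u) - sym_rhs (Y u))"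
  have M_nonneg: "0 <= M" using M[OF t] norm_ge_zero order_trans by blast
  have "(norm (?D t))^2 <= exp ((2 * (26 * C_bil * M)) * t) * ((norm (?D 0))^2 + 0 * t)"
  proof (rule gronwall[OF _ _ _ _ t])
    fix u assume u: "u \<in> {0..T}"
    have "((\<lambda>t. rmult2 J (rmult2 jinv (X t) - rmult2 jinv (Y t))) has_vector_derivative ?R u) (at u within {0..T})"
      using X Y u by (intro rmult2_has_vector_derivative[OF even_sym_J] has_vector_derivative_diff) (auto simp: sym_solution_def)
    then show "((\<lambda>t. (norm (?D t))^2) has_real_derivative 2 * inner (?D u) (?R u)) (at u within {0..T})"
      by (intro has_real_derivative_norm_sq) (simp add: rmult2_winv_eq rmult2_diff[OF even_sym_jinv])
    show "2 * inner (?D u) (?R u) <= (2 * (26 * C_bil * M)) * (norm (?D u))^2 + 0"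
      unfolding sym_rhs_diff using lin_rhs_estimate[of "X u - Y u" "(1/2) *\<^sub>R (X u + Y u)"]
        scale_C_bil_mono[OF norm_mean_le, of "X u" M "Y u" "?D u"] M[OF u] by linarith
  qed (use M_nonneg in auto)
  also have "... = (exp (26 * C_bil * M * t) * norm (?D 0))^2"
    by (simp add: power_mult_distrib exp_double[symmetric] mult_ac)
  finally show "(norm (?D t))^2 <= (exp (26 * C_bil * M * t) * norm (?D 0))^2" .
qed simp

subsection \<open>High frequency tails\<close>

definition tail_wgt :: "nat => real => real" where "tail_wgt k t = min 1 (jbr t / (real k + 1))"

lemma slow_tail_wgt: "slow 1 (tail_wgt k)" unfolding tail_wgt_def[abs_def] by (rule slow_min_1) simp
lemma tail_wgt_le_1: "tail_wgt k t <= 1" by (simp add: tail_wgt_def)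
lemmas even_sym_tail_wgt = even_sym_slow[OF slow_tail_wgt tail_wgt_le_1]

lemma norm_rmult2_tail_tendsto: "(\<lambda>k. norm (rmult2 (tail_wgt k) X)) \<longlonglongrightarrow> 0"
proof -
  have "even_sym 1 (\<lambda>_. 0)" by (simp add: even_sym_def)
  moreover have "(\<lambda>k. tail_wgt k t) \<longlonglongrightarrow> 0" for t
  proof -
    have "(\<lambda>k. jbr t / (real k + 1)) \<longlonglongrightarrow> 0"
      using tendsto_mult[OF tendsto_const[of "jbr t"] LIMSEQ_inverse_real_of_nat] by (simp add: divide_inverse add.commute)
    then show ?thesis unfolding tail_wgt_def using tendsto_min[OF tendsto_const[of 1]] by fastforce
  qed
  ultimately have "(\<lambda>k. rmult2 (tail_wgt k) X) \<longlonglongrightarrow> rmult2 (\<lambda>_. 0) X"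
    by (intro rmult2_tendsto[OF even_sym_tail_wgt])
  then show ?thesis by (simp add: rmult2_const tendsto_norm_zero)
qed

lemma norm_le_tail_winv: "norm X <= norm (rmult2 (tail_wgt k) X) + (real k + 1) powr s * norm (rmult2 winv X)"
proof -
  let ?R = "real k + 1" and ?low = "\<lambda>t. if jbr t <= real k + 1 then 1 else 0 :: real"
  have low: "even_sym 1 ?low" unfolding even_sym_def by auto
  note high = even_sym_diff[OF even_sym_one low]
  have winv: "even_sym (\<bar>?R powr s\<bar> * 1) (\<lambda>t. ?R powr s * winv t)"
    by (intro even_sym_mult even_sym_const even_sym_winv)
  have "norm X <= norm (rmult2 (\<lambda>t. 1 - ?low t) X) + norm (rmult2 ?low X)"
    using norm_triangle_ineq[of "rmult2 (\<lambda>t. 1 - ?low t) X" "rmult2 ?low X"] rmult2_diff_symbol[OF even_sym_one low, of X] by simp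
  also have "norm (rmult2 (\<lambda>t. 1 - ?low t) X) <= norm (rmult2 (tail_wgt k) X)"
    by (rule norm_rmult2_mono[OF high even_sym_tail_wgt]) (auto simp: tail_wgt_def min_def field_simps)
  also have "norm (rmult2 ?low X) <= norm (rmult2 (\<lambda>t. ?R powr s * winv t) X)"
  proof (rule norm_rmult2_mono[OF low winv])
    fix t
    have "1 <= ?R powr s * winv t" if "jbr t <= ?R"
      using powr_mono2[of s "jbr t" ?R] that s_gt by (simp add: winv_eq jpow_def[of s] pos_le_divide_eq del: jpow_uminus)
    then show "(?low t)^2 <= (?R powr s * winv t)^2" by (auto simp: one_le_power)
  qed
  also have "... = ?R powr s * norm (rmult2 winv X)"
    unfolding rmult2_rmult2[OF even_sym_const even_sym_winv, symmetric] rmult2_const by simp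
  finally show ?thesis by simp
qed

subsection \<open>Convergence of the truncated solutions\<close>

lemma sym_rhs_bounds:
  assumes M: "0 <= M"
  obtains K where "0 < K" "\<And>X Y. norm X <= M ==> norm Y <= M ==> norm (sym_rhs X - sym_rhs Y) <= K * norm (X - Y)"
    "\<And>X. norm X <= M ==> norm (sym_rhs X) <= K * M"
proof -
  obtain C where C: "0 < C" "\<And>X Y. norm (quad_op X Y) <= C * norm X * norm Y" by (rule quad_op_bound) blast
  have lipschitz: "norm (sym_rhs X - sym_rhs Y) <= (1 + 2 * C * M) * norm (X - Y)" if "norm X <= M" "norm Y <= M" for X Y
  proof -
    let ?m = "(1/2) *\<^sub>R (X + Y)"
    have "norm (quad_op ?m (X - Y)) <= C * M * norm (X - Y)" "norm (quad_op (X - Y) ?m) <= C * norm (X - Y) * M"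
      using C(1) M norm_mean_le[OF that] by (intro order_trans[OF C(2)] mult_mono; simp)+
    then have "norm (sym_rhs X - sym_rhs Y) <= norm (X - Y) + (C * M * norm (X - Y) + C * norm (X - Y) * M)"
      unfolding sym_rhs_diff lin_rhs_def by (intro order_trans[OF norm_triangle_ineq] add_mono norm_lin_op_le)
    then show ?thesis by (simp add: algebra_simps)
  qed
  moreover have pos: "0 < 1 + 2 * C * M" using C(1) M by (intro add_pos_nonneg) auto
  moreover have "norm (sym_rhs X) <= (1 + 2 * C * M) * M" if "norm X <= M" for X
    using lipschitz[OF that, of 0] M mult_left_mono[OF that less_imp_le[OF pos]]
    by (simp add: sym_rhs_def lin_op.zero quad_op.zero_left)
  ultimately show thesis using that by blast
qed

lemma inner_truncated_difference_le:
  fixes X Y :: state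
  assumes support: "rmult2 (cut (real m)) (X - Y) = X - Y" and km: "k <= m"
    and M: "norm X <= M" "norm Y <= M" and B: "norm (sym_rhs Y) <= B"
  shows "2 * inner (rmult2 winv (X - Y)) (rmult2 J (rmult2 (cut (real m)) (sym_rhs X) - rmult2 (cut (real k)) (sym_rhs Y)))
    <= (52 * C_bil * M + 1) * (norm (rmult2 winv (X - Y)))^2 + (J (real k) * B)^2"
proof -
  let ?D = "rmult2 winv (X - Y)" and ?cut = "\<lambda>n. rmult2 (cut (real n))"
  let ?E = "rmult2 J (?cut m (sym_rhs Y) - ?cut k (sym_rhs Y))"
  let ?S = "rmult2 winv (rmult2 (jcut (real m)) (sym_rhs X - sym_rhs Y))"
  have split: "rmult2 J (?cut m (sym_rhs X) - ?cut k (sym_rhs Y)) = ?S + ?E"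
    by (simp add: rmult2_winv_jcut rmult2_diff[OF even_sym_J] rmult2_diff[OF even_sym_cut])
  have "inner ?D ?S <= 26 * C_bil * M * (norm ?D)^2"
    unfolding sym_rhs_diff using lin_rhs_estimate_cut[OF support, of "(1/2) *\<^sub>R (X + Y)"]
      scale_C_bil_mono[OF norm_mean_le[OF M], of ?D] by linarith
  moreover have "2 * inner ?D ?E <= (norm ?D)^2 + (J (real k) * B)^2"
  proof -
    have "1 - s <= 0" using s_gt by simp
    then have "norm ?E <= J (real k) * B"
      by (rule order_trans[OF norm_rmult2_cut_band_le[OF _ km] mult_left_mono[OF B jpow_nonneg]])
    then have "inner ?D ?E <= norm ?D * (J (real k) * B)"
      using norm_cauchy_schwarz[of ?D ?E] mult_left_mono[of "norm ?E" "J (real k) * B" "norm ?D"] by simp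
    then show ?thesis using sum_squares_bound[of "norm ?D" "J (real k) * B"] by simp
  qed
  ultimately show ?thesis unfolding split by (simp add: inner_add_right algebra_simps)
qed

lemma truncated_solution_difference:
  assumes X: "truncated_solution (real m) T X0 X" and Y: "truncated_solution (real k) T X0 Y" and km: "k <= m"
    and M: "\<And>t. t \<in> {0..T} ==> norm (X t) <= M" "\<And>t. t \<in> {0..T} ==> norm (Y t) <= M"
    and B: "\<And>t. t \<in> {0..T} ==> norm (sym_rhs (Y t)) <= B" and t: "t \<in> {0..T}"
  shows "(norm (rmult2 winv (X t - Y t)))^2 <= exp ((52 * C_bil * M + 1) * T) * ((norm X0)^2 + B^2 * T) * (J (real k))^2"
proof -
  let ?D = "\<lambda>u. rmult2 winv (X u - Y u)" and ?cut = "\<lambda>n. rmult2 (cut (real n))" and ?e = "J (real k)"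
  let ?R = "\<lambda>u. rmult2 J (?cut m (sym_rhs (X u)) - ?cut k (sym_rhs (Y u)))" and ?a = "52 * C_bil * M + 1"
  have M_nonneg: "0 <= M" using M(1)[OF t] norm_ge_zero order_trans by blast
  have B_nonneg: "0 <= B" using B[OF t] norm_ge_zero order_trans by blast
  have s: "1 - s <= 0" using s_gt by simp
  have support: "?cut m (X u - Y u) = X u - Y u" if u: "u \<in> {0..T}" for u
    using truncated_solution_supported[OF X u] truncated_solution_supported[OF Y u] rmult2_cut_cut[of "real k" "real m" "Y u"] km
    by (simp add: rmult2_diff[OF even_sym_cut])
  have "(norm (?D t))^2 <= exp (?a * t) * ((norm (?D 0))^2 + (?e * B)^2 * t)"
  proof (rule gronwall[OF _ _ _ _ t])
    fix u assume u: "u \<in> {0..T}"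
    have "(?D has_vector_derivative ?R u) (at u within {0..T})"
      unfolding rmult2_diff[OF even_sym_J] rmult2_winv_jcut[symmetric] rmult2_diff[OF even_sym_winv, symmetric]
      using X Y u by (intro rmult2_has_vector_derivative[OF even_sym_winv] has_vector_derivative_diff) (auto simp: truncated_solution_def)
    then show "((\<lambda>t. (norm (?D t))^2) has_real_derivative 2 * inner (?D u) (?R u)) (at u within {0..T})"
      by (rule has_real_derivative_norm_sq)
    show "2 * inner (?D u) (?R u) <= ?a * (norm (?D u))^2 + (?e * B)^2"
      by (rule inner_truncated_difference_le[OF support[OF u] km M(1)[OF u] M(2)[OF u] B[OF u]])
  qed (use M_nonneg in auto)
  also have "... <= exp (?a * T) * ((?e * norm X0)^2 + (?e * B)^2 * T)"
  proof (intro mult_mono add_mono power_mono)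
    have "norm (?D 0) <= norm (rmult2 J (X 0 - Y 0))"
      by (rule norm_rmult2_mono[OF even_sym_winv even_sym_J]) (auto intro!: power_mono jpow_mono)
    also have "... <= ?e * norm X0"
      using norm_rmult2_cut_band_le[OF s km, of X0] X Y by (simp add: truncated_solution_def)
    finally show "norm (?D 0) <= ?e * norm X0" .
  qed (use t M_nonneg B_nonneg in \<open>auto intro!: mult_left_mono add_nonneg_nonneg\<close>)
  also have "... = exp (?a * T) * ((norm X0)^2 + B^2 * T) * ?e^2" by (simp add: power_mult_distrib algebra_simps)
  finally show ?thesis .
qed

lemma truncated_solutions_uniformly_Cauchy:
  assumes X: "\<And>k. truncated_solution (real k) T X0 (X k)" and w: "\<And>k. weight_bound T X0 (X k)" and T: "0 <= T"
  shows "uniformly_Cauchy_on {0..T} X"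
proof -
  let ?M = "2 * norm X0"
  have M: "norm (X k t) <= ?M" if "t \<in> {0..T}" for k t by (rule weight_bound_norm[OF w that order_refl])
  obtain K where K: "\<And>X. norm X <= ?M ==> norm (sym_rhs X) <= K * ?M" by (rule sym_rhs_bounds[of ?M]) auto
  define C where "C = sqrt (exp ((52 * C_bil * ?M + 1) * T) * ((norm X0)^2 + (K * ?M)^2 * T))"
  have low: "norm (rmult2 winv (X m t - X k t)) <= C * J (real k)" if "k <= m" "t \<in> {0..T}" for k m t
  proof (rule power2_le_imp_le)
    have "C^2 = exp ((52 * C_bil * ?M + 1) * T) * ((norm X0)^2 + (K * ?M)^2 * T)"
      unfolding C_def by (rule real_sqrt_pow2) (use T in auto)
    then show "(norm (rmult2 winv (X m t - X k t)))^2 <= (C * J (real k))^2"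
      using truncated_solution_difference[OF X X that(1) M M K[OF M] that(2)] by (simp add: power_mult_distrib)
  qed (use T in \<open>auto simp: C_def\<close>)
  show ?thesis
    unfolding uniformly_Cauchy_on_def
  proof (intro allI impI)
    fix e :: real assume e: "0 < e"
    have "\<forall>\<^sub>F j in sequentially. norm (rmult2 (tail_wgt j) X0) < e / 8"
      using e by (intro order_tendstoD(2)[OF norm_rmult2_tail_tendsto]) simp
    then obtain j where j: "norm (rmult2 (tail_wgt j) X0) < e / 8" by (auto simp: eventually_sequentially)
    let ?R = "(real j + 1) powr s"
    have "(\<lambda>k. ?R * (C * J (real k))) \<longlonglongrightarrow> 0" using s_gt
      by (intro tendsto_mult_right_zero jpow_tendsto_0) simp
    then have "\<forall>\<^sub>F k in sequentially. ?R * (C * J (real k)) < e / 2" by (rule order_tendstoD(2)) (use e in simp)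
    then obtain N where N: "\<And>k. N <= k ==> ?R * (C * J (real k)) < e / 2" by (auto simp: eventually_sequentially)
    have close: "norm (X m t - X k t) < e" if "N <= k" "k <= m" "t \<in> {0..T}" for k m t
    proof -
      have "norm (rmult2 (tail_wgt j) (X m t - X k t)) <= 4 * norm (rmult2 (tail_wgt j) X0)"
        unfolding rmult2_diff[OF even_sym_tail_wgt]
        using norm_triangle_ineq4[of "rmult2 (tail_wgt j) (X m t)" "rmult2 (tail_wgt j) (X k t)"]
          weight_boundD[OF w that(3) slow_tail_wgt tail_wgt_le_1, of j m] weight_boundD[OF w that(3) slow_tail_wgt tail_wgt_le_1, of j k] by linarith
      moreover have "?R * norm (rmult2 winv (X m t - X k t)) <= ?R * (C * J (real k))" by (intro mult_left_mono low that) auto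
      ultimately show ?thesis using norm_le_tail_winv[of "X m t - X k t" j] N[OF that(1)] j by linarith
    qed
    then have "dist (X m t) (X k t) < e" if "N <= m" "N <= k" "t \<in> {0..T}" for m k t
      using close[of k m t] close[of m k t] that by (cases "k <= m") (auto simp: dist_norm norm_minus_commute)
    then show "\<exists>M. \<forall>t\<in>{0..T}. \<forall>m\<ge>M. \<forall>n\<ge>M. dist (X m t) (X n t) < e" by blast
  qed
qed

lemma rmult2_jinv_has_vector_derivativeD:
  assumes "\<And>t. t \<in> {0..T} ==> ((\<lambda>t. rmult2 jinv (y t)) has_vector_derivative rmult2 jinv (g t)) (at t within {0..T})"
    and g: "continuous_on {0..T} g" and t: "t \<in> {0..T}"
  shows "(y has_vector_derivative g t) (at t within {0..T})"
proof (rule has_vector_derivative_transform[OF t])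
  let ?I = "\<lambda>t. integral {0..t} g"
  have deriv: "(?I has_vector_derivative g t) (at t within {0..T})" if "t \<in> {0..T}" for t
    by (rule integral_has_vector_derivative[OF g that])
  then show "((\<lambda>t. y 0 + ?I t) has_vector_derivative g t) (at t within {0..T})"
    using t by (auto intro!: derivative_eq_intros)
  fix t assume t: "t \<in> {0..T}"
  have "norm (rmult2 jinv (y t) - rmult2 jinv (?I t) - (rmult2 jinv (y 0) - rmult2 jinv (?I 0))) <= 0 * t"
    by (rule norm_diff_le_of_deriv[OF has_vector_derivative_diff[OF assms(1) rmult2_has_vector_derivative[OF even_sym_jinv deriv]] _ _ t]) auto
  then have "rmult2 jinv (y t - ?I t - y 0) = 0"
    by (simp add: rmult2_diff[OF even_sym_jinv] linear_0[OF bounded_linear.linear[OF bounded_linear_rmult2[OF even_sym_jinv]]])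
  then have "y t - ?I t - y 0 = 0" by (rule rmult2_eq_0D[OF even_sym_jinv, rotated]) simp
  then show "y t = y 0 + ?I t" by (simp add: algebra_simps)
qed

text \<open>The derivatives of the truncated solutions converge uniformly only after one more application of
  \<open>\<langle>D\<rangle>\<^sup>-\<^sup>1\<close>, which damps the frequencies removed by the cutoff.\<close>
lemma cut_sym_rhs_uniform_limit:
  assumes X: "\<And>k t. t \<in> S ==> norm (X k t) <= M" and Y: "\<And>t. t \<in> S ==> norm (Y t) <= M" and M: "0 <= M"
    and lim: "uniform_limit S X Y sequentially"
  shows "uniform_limit S (\<lambda>k t. rmult2 jinv (rmult2 (cut (real k)) (sym_rhs (X k t)))) (\<lambda>t. rmult2 jinv (sym_rhs (Y t))) sequentially"
  unfolding uniform_limit_iff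
proof (intro allI impI)
  fix e :: real assume e: "0 < e"
  obtain K where K: "0 < K" "\<And>X Y. norm X <= M ==> norm Y <= M ==> norm (sym_rhs X - sym_rhs Y) <= K * norm (X - Y)"
    "\<And>X. norm X <= M ==> norm (sym_rhs X) <= K * M" using sym_rhs_bounds[OF M] by metis
  let ?j = "rmult2 jinv" and ?z = "\<lambda>k t. sym_rhs (X k t)"
  have "\<forall>\<^sub>F k in sequentially. \<forall>t\<in>S. norm (X k t - Y t) < e / (2 * K)"
    using lim e K(1) by (auto simp: uniform_limit_iff dist_norm)
  moreover have "(\<lambda>k. jinv (real k) * (K * M)) \<longlonglongrightarrow> 0 * (K * M)"
    by (intro tendsto_intros jpow_tendsto_0) simp
  then have "\<forall>\<^sub>F k in sequentially. jinv (real k) * (K * M) < e / 2" using e by (intro order_tendstoD(2)) auto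
  ultimately show "\<forall>\<^sub>F k in sequentially. \<forall>t\<in>S. dist (?j (rmult2 (cut (real k)) (?z k t))) (?j (sym_rhs (Y t))) < e"
  proof eventually_elim
    case (elim k)
    show ?case
    proof
      fix t assume t: "t \<in> S"
      have "norm (?j (rmult2 (cut (real k)) (?z k t) - ?z k t)) <= jinv (real k) * (K * M)"
        by (rule order_trans[OF norm_rmult2_cut_compl_le mult_left_mono[OF K(3)[OF X[OF t]] jpow_nonneg]]) simp
      moreover have "norm (?j (?z k t - sym_rhs (Y t))) <= K * norm (X k t - Y t)"
        using norm_rmult2_le[OF even_sym_jinv, of "?z k t - sym_rhs (Y t)"] K(2)[OF X[OF t, of k] Y[OF t]] by simp
      moreover have "K * norm (X k t - Y t) < e / 2"
        using elim(1) t K(1) mult_strict_left_mono[of "norm (X k t - Y t)" "e / (2 * K)" K] by simp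
      ultimately show "dist (?j (rmult2 (cut (real k)) (?z k t))) (?j (sym_rhs (Y t))) < e"
        using elim(2) norm_triangle_ineq[of "?j (rmult2 (cut (real k)) (?z k t) - ?z k t)" "?j (?z k t - sym_rhs (Y t))"]
        by (simp add: rmult2_diff[OF even_sym_jinv] dist_norm)
    qed
  qed
qed

lemma truncated_solutions_limit:
  assumes X: "\<And>k. truncated_solution (real k) T X0 (X k)" and M: "\<And>k t. t \<in> {0..T} ==> norm (X k t) <= M"
    and lim: "uniform_limit {0..T} X Y sequentially" and T: "0 <= T"
  shows "sym_solution T Y" "Y 0 = X0"
proof -
  have tendsto: "(\<lambda>k. X k t) \<longlonglongrightarrow> Y t" if "t \<in> {0..T}" for t
    by (rule tendsto_uniform_limitI[OF lim that])
  then show "Y 0 = X0"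
    using LIMSEQ_unique[OF tendsto[of 0]] rmult2_cut_tendsto[of X0] X T by (simp add: truncated_solution_def)
  have Y: "norm (Y t) <= M" if "t \<in> {0..T}" for t
    by (rule tendsto_upperbound[OF tendsto_norm[OF tendsto[OF that]]]) (use M[OF that] in auto)
  have M_nonneg: "0 <= M" using Y[of 0] T order_trans[OF norm_ge_zero] by auto
  have deriv: "(X k has_vector_derivative rmult2 (jcut (real k)) (sym_rhs (X k t))) (at t within {0..T})" if "t \<in> {0..T}" for k t
    using X that by (simp add: truncated_solution_def)
  have cont: "continuous_on {0..T} Y"
    by (rule uniform_limit_theorem[OF _ lim])
      (auto intro!: always_eventually has_vector_derivative_continuous[OF deriv] simp: continuous_on_eq_continuous_within)
  have jinv: "bounded_linear (rmult2 jinv)" by (rule bounded_linear_rmult2[OF even_sym_jinv])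
  have jinv_jcut: "rmult2 jinv (rmult2 jinv (rmult2 (jcut n) Z)) = rmult2 jinv (rmult2 (cut n) Z)" for n Z
    unfolding rmult2_rmult2[OF even_sym_jinv even_sym_jcut]
    by (rule arg_cong[where f = "rmult2 jinv"], rule rmult2_cong) (simp add: jcut_def jinv_eq)
  have "((\<lambda>t. rmult2 jinv (rmult2 jinv (Y t))) has_vector_derivative rmult2 jinv (sym_rhs (Y t))) (at t within {0..T})"
    if t: "t \<in> {0..T}" for t
  proof (rule has_vector_derivative_uniform_limit[OF _ _ cut_sym_rhs_uniform_limit[OF M Y M_nonneg lim] _ t])
    show "((\<lambda>t. rmult2 jinv (rmult2 jinv (X k t))) has_vector_derivative rmult2 jinv (rmult2 (cut (real k)) (sym_rhs (X k u)))) (at u within {0..T})"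
      if "u \<in> {0..T}" for k u
      unfolding jinv_jcut[symmetric] by (intro rmult2_has_vector_derivative[OF even_sym_jinv] deriv that)
    show "(\<lambda>k. rmult2 jinv (rmult2 jinv (X k u))) \<longlonglongrightarrow> rmult2 jinv (rmult2 jinv (Y u))" if "u \<in> {0..T}" for u
      by (intro bounded_linear.tendsto[OF jinv] tendsto that)
  qed auto
  moreover have "continuous_on {0..T} (\<lambda>t. sym_rhs (Y t))"
    unfolding sym_rhs_def by (intro continuous_on_add lin_op.continuous_on quad_op.continuous_on cont)
  ultimately have "((\<lambda>t. rmult2 jinv (Y t)) has_vector_derivative sym_rhs (Y t)) (at t within {0..T})" if "t \<in> {0..T}" for t
    using that by (rule rmult2_jinv_has_vector_derivativeD)
  with cont show "sym_solution T Y" by (simp add: sym_solution_def)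
qed

theorem sym_solution_exists:
  assumes d: "0 < d" "norm X0 <= d"
  obtains X where "sym_solution (c_sym / d) X" "X 0 = X0" "weight_bound (c_sym / d) X0 X"
proof -
  let ?T = "c_sym / d"
  have T: "0 <= ?T" using d c_sym_pos by simp
  have "\<exists>X. truncated_solution (real k) ?T X0 X \<and> weight_bound ?T X0 X" for k :: nat
    by (rule truncated_solution_exists[OF d]) blast
  then obtain X where X: "\<And>k. truncated_solution (real k) ?T X0 (X k)" and w: "\<And>k. weight_bound ?T X0 (X k)" by metis
  obtain Y where lim: "uniform_limit {0..?T} X Y sequentially"
    using Cauchy_uniformly_convergent[OF truncated_solutions_uniformly_Cauchy[OF X w T]]
    by (auto simp: uniformly_convergent_on_def)
  note Y = truncated_solutions_limit[OF X weight_bound_norm[OF w _ d(2)] lim T]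
  have "weight_bound ?T X0 Y"
    unfolding weight_bound_def
  proof (intro ballI allI impI)
    fix t v assume t: "t \<in> {0..?T}" and v: "slow 1 v" "\<forall>x. v x <= 1"
    have "(\<lambda>k. norm (rmult2 v (X k t))) \<longlonglongrightarrow> norm (rmult2 v (Y t))"
      using v by (intro tendsto_norm bounded_linear.tendsto[OF bounded_linear_rmult2[OF even_sym_slow]] tendsto_uniform_limitI[OF lim t]) auto
    then show "norm (rmult2 v (Y t)) <= 2 * norm (rmult2 v X0)"
      by (rule tendsto_upperbound) (use weight_boundD[OF w t v(1)] v(2) in auto)
  qed
  with Y show thesis using that by blast
qed

end

section \<open>Plancherel theorem and Fourier transform of real functions\<close>

lemma integrable_product:
  fixes a b :: "real => complex"
  assumes a: "integrable lborel a" and b: "integrable lborel b"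
  shows "integrable (lborel \<Otimes>\<^sub>M lborel) (\<lambda>(x, y). a x * b y)"
  by (rule lborel_pair.Fubini_integrable) (use a b in \<open>auto simp: norm_mult case_prod_beta'\<close>)

lemma integrable_convolution_product:
  fixes a b :: "real => complex"
  assumes a: "integrable lborel a" and b: "integrable lborel b"
  shows "integrable (lborel \<Otimes>\<^sub>M lborel) (\<lambda>(x, z). a x * b (x - z))"
proof (rule lborel_pair.Fubini_integrable)
  have [measurable]: "a \<in> meas" "b \<in> meas" using a b by auto
  have "(\<lambda>p. a (fst p) * b (fst p - snd p)) \<in> meas2" by measurable
  then show "(\<lambda>(x, z). a x * b (x - z)) \<in> borel_measurable (lborel \<Otimes>\<^sub>M lborel)"
    by (simp add: case_prod_beta' cong: measurable_cong_sets)
  have "integrable lborel (\<lambda>z. b (x - z))" for x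
    using lborel_integrable_real_affine[OF b, of "-1" x] by simp
  then show "AE x in lborel. integrable lborel (\<lambda>z. case (x, z) of (x, z) \<Rightarrow> a x * b (x - z))" by simp
  have "(LBINT z. cmod (b (x - z))) = (LBINT z. cmod (b z))" for x
    using lborel_integral_real_affine[of "-1" "\<lambda>z. cmod (b z)" x] by simp
  then show "integrable lborel (\<lambda>x. LBINT z. norm (case (x, z) of (x, z) \<Rightarrow> a x * b (x - z)))"
    using a by (simp add: norm_mult)
qed

lemma Fubini_product_bounded:
  fixes a b :: "real => complex"
  assumes a: "integrable lborel a" and b: "integrable lborel b"
    and m: "(\<lambda>p. m (fst p) (snd p)) \<in> meas2" "\<And>x y. cmod (m x y) <= C"
  shows "(LBINT y. (LBINT x. a x * b y * m x y)) = (LBINT x. (LBINT y. a x * b y * m x y))"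
proof (rule lborel_pair.Fubini_integral, rule Bochner_Integration.integrable_bound)
  have [measurable]: "a \<in> meas" "b \<in> meas" using a b by auto
  note [measurable] = m(1)
  show "integrable (lborel \<Otimes>\<^sub>M lborel) (\<lambda>p. cx C * (case p of (x, y) \<Rightarrow> a x * b y))"
    by (intro integrable_mult_right integrable_product a b)
  have "(\<lambda>p. a (fst p) * b (snd p) * m (fst p) (snd p)) \<in> meas2" by measurable
  then show "(\<lambda>(x, y). a x * b y * m x y) \<in> borel_measurable (lborel \<Otimes>\<^sub>M lborel)"
    by (simp add: case_prod_beta' cong: measurable_cong_sets)
  have "cmod (a x * b y * m x y) <= cmod (cx C * (a x * b y))" for x y
    using mult_left_mono[OF order_trans[OF m(2)[of x y] abs_ge_self], of "cmod (a x) * cmod (b y)"]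
    by (simp add: norm_mult mult_ac)
  then show "AE p in lborel \<Otimes>\<^sub>M lborel. norm (case p of (x, y) \<Rightarrow> a x * b y * m x y) <= norm (cx C * (case p of (x, y) \<Rightarrow> a x * b y))"
    by (intro AE_I2) (simp add: case_prod_beta')
qed

subsection \<open>The Fourier transform of integrable functions\<close>

lemma cis_measurable [measurable]: "cis \<in> meas"
  unfolding cis_conv_exp by (intro borel_measurable_continuous_onI continuous_intros)

lemma integrable_mult_cis: "integrable lborel f ==> integrable lborel (\<lambda>x. f x * cis (- (x * u)))"
  by (rule Bochner_Integration.integrable_bound) (auto simp: norm_mult)

definition fourier :: "(real => complex) => real => complex" where
  "fourier f u = cx ft_const * (LBINT x. f x * cis (- (x * u)))"

lemma fourier_measurable: assumes [measurable]: "f \<in> meas" shows "fourier f \<in> meas"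
  unfolding fourier_def[abs_def] by measurable

lemma cmod_fourier_le: "cmod (fourier f u) <= (LBINT x. cmod (f x))"
proof -
  have "cmod (LBINT x. f x * cis (- (x * u))) <= (LBINT x. cmod (f x))"
    using integral_norm_bound[of lborel "\<lambda>x. f x * cis (- (x * u))"] by (simp add: norm_mult)
  then have "ft_const * cmod (LBINT x. f x * cis (- (x * u))) <= 1 * (LBINT x. cmod (f x))"
    using ft_const by (intro mult_mono) auto
  then show ?thesis using ft_const by (simp add: fourier_def norm_mult)
qed

lemma fourier_add: "integrable lborel f ==> integrable lborel g ==> fourier (\<lambda>x. f x + g x) t = fourier f t + fourier g t"
  unfolding fourier_def using integrable_mult_cis[of f t] integrable_mult_cis[of g t] by (simp add: ring_distribs)

lemma fourier_cmult: "fourier (\<lambda>x. c * f x) t = c * fourier f t"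
  unfolding fourier_def by (simp add: mult.assoc)

lemma fourier_diff: "integrable lborel f ==> integrable lborel g ==> fourier (\<lambda>x. f x - g x) t = fourier f t - fourier g t"
  using fourier_add[of f "\<lambda>x. -1 * g x" t] fourier_cmult[of "-1" g t] by simp

lemma fourier_cnj: "fourier (\<lambda>x. cnj (f x)) t = cnj (fourier f (- t))"
  unfolding fourier_def complex_cnj_mult Bochner_Integration.integral_cnj[symmetric] by (simp add: cis_cnj)

lemma fourier_reflect: "fourier (\<lambda>x. f (- x)) t = fourier f (- t)"
  unfolding fourier_def using integral_reflect_shift[of "\<lambda>x. f x * cis (- (x * - t))" 0] by simp

lemma fourier_hermitian_real:
  assumes "\<And>x. f (- x) = cnj (f x)" shows "cnj (fourier f t) = fourier f t"
  using fourier_cnj[of f "- t"] fourier_reflect[of f "- t"] by (simp add: assms)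

lemma integral_fourier_mult:
  assumes f: "integrable lborel f" and g: "integrable lborel g"
  shows "(LBINT t. fourier f t * g t) = (LBINT x. f x * fourier g x)"
proof -
  let ?m = "\<lambda>x t. cx ft_const * cis (- (x * t))"
  have "(LBINT t. fourier f t * g t) = (LBINT t. (LBINT x. f x * g t * ?m x t))"
  proof (intro Bochner_Integration.integral_cong refl)
    fix t
    have "fourier f t * g t = (LBINT x. f x * cis (- (x * t))) * (cx ft_const * g t)" by (simp add: fourier_def)
    then show "fourier f t * g t = (LBINT x. f x * g t * ?m x t)"
      by (subst (asm) integral_mult_left_zero[symmetric]) (simp add: mult_ac)
  qed
  also have "... = (LBINT x. (LBINT t. f x * g t * ?m x t))"
    by (rule Fubini_product_bounded[OF f g, where C = 1]) (use ft_const in \<open>auto simp: norm_mult\<close>)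
  also have "... = (LBINT x. f x * fourier g x)"
  proof (intro Bochner_Integration.integral_cong refl)
    fix x
    show "(LBINT t. f x * g t * ?m x t) = f x * fourier g x"
      unfolding fourier_def by (subst integral_mult_right_zero[symmetric])+ (simp add: mult_ac)
  qed
  finally show ?thesis .
qed

lemma fourier_mult_fourier:
  assumes x: "integrable lborel x" and g: "integrable lborel g"
  shows "fourier (\<lambda>t. g t * fourier x (- t)) u = cx ft_const * (LBINT v. x v * fourier g (u - v))"
proof -
  let ?h = "\<lambda>t. g (- t) * cis (t * u)"
  have [measurable]: "g \<in> meas" using g by auto
  have integrable_h: "integrable lborel ?h"
    using integrable_mult_cis[OF lborel_integrable_real_affine[OF g, of "-1" 0], of "- u"] by simp
  have "(LBINT t. g t * fourier x (- t) * cis (- (t * u))) = (LBINT t. fourier x t * ?h t)"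
    using integral_reflect_shift[of "\<lambda>t. g t * fourier x (- t) * cis (- (t * u))" 0] by (simp add: mult_ac)
  also have "... = (LBINT v. x v * fourier ?h v)" by (rule integral_fourier_mult[OF x integrable_h])
  also have "fourier ?h = (\<lambda>v. fourier g (u - v))"
    unfolding fourier_def using integral_reflect_shift[of "\<lambda>t. g t * cis (- (t * (u - _)))" 0]
    by (simp add: mult.assoc cis_mult right_diff_distrib)
  finally show ?thesis unfolding fourier_def[of "\<lambda>t. g t * fourier x (- t)"] by simp
qed

lemma integrable_gauss: "e \<noteq> 0 ==> integrable lborel (\<lambda>x::real. exp (- (e * x)\<^sup>2 / 2))"
proof -
  have "integrable lborel (\<lambda>x. sqrt (2 * pi) * std_normal_density x)" by simp
  then have "integrable lborel (\<lambda>x::real. exp (- x\<^sup>2 / 2))" by (simp add: std_normal_density_def)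
  then show "e \<noteq> 0 ==> ?thesis" using lborel_integrable_real_affine[of _ e 0] by simp
qed

lemma fourier_gauss:
  assumes e: "0 < e"
  shows "fourier (\<lambda>t. cx (exp (- (e * t)\<^sup>2 / 2))) z = cx (exp (- (z / e)\<^sup>2 / 2) / e)"
proof -
  have "cx (exp (- (w^2) / 2)) = (LBINT x. cx (std_normal_density x) * cis (w * x))" for w
  proof -
    have "cx (exp (- (w^2) / 2)) = char std_normal_distribution w" by (simp add: char_std_normal_distribution)
    also have "... = (LBINT x. std_normal_density x *\<^sub>R cis (w * x))"
      unfolding char_def cis_conv_exp[symmetric] by (subst integral_density) auto
    finally show ?thesis by (simp add: scaleR_conv_of_real)
  qed
  from this[of "- (z / e)"]
  have "cx (exp (- ((z / e)^2) / 2)) = (LBINT x. cx ft_const * (cis (- (z / e) * x) * cx (exp (- x\<^sup>2 / 2))))"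
    by (simp add: std_normal_density_def ft_const_def mult_ac)
  also have "... = cx ft_const * (LBINT x. cis (- (z / e) * x) * cx (exp (- x\<^sup>2 / 2)))"
    by (rule integral_mult_right_zero)
  also have "(LBINT x. cis (- (z / e) * x) * cx (exp (- x\<^sup>2 / 2)))
     = \<bar>e\<bar> *\<^sub>R (LBINT t. cis (- (z / e) * (0 + e * t)) * cx (exp (- (0 + e * t)\<^sup>2 / 2)))"
    by (rule lborel_integral_real_affine) (use e in simp)
  also have "cx ft_const * ... = cx e * fourier (\<lambda>t. cx (exp (- (e * t)\<^sup>2 / 2))) z"
    using e by (simp add: fourier_def scaleR_conv_of_real mult_ac)
  finally show ?thesis using e by (simp add: field_simps)
qed

subsection \<open>Approximation in the mean square\<close>

lemma L2norm_dominated_convergence: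
  fixes f :: "nat => real => complex"
  assumes h: "csq_int h" and f: "\<And>n. f n \<in> meas" and dominated: "\<And>n x. cmod (f n x) <= cmod (h x)"
    and lim: "AE x in lborel. (\<lambda>n. f n x) \<longlonglongrightarrow> 0"
  shows "(\<lambda>n. L2norm (f n)) \<longlonglongrightarrow> 0"
proof -
  note [measurable] = f
  have "(\<lambda>n. \<integral>x. (cmod (f n x))^2 \<partial>lborel) \<longlonglongrightarrow> integral\<^sup>L lborel (\<lambda>_::real. (cmod 0)^2)"
  proof (rule Bochner_Integration.integral_dominated_convergence)
    show "integrable lborel (\<lambda>x. (cmod (h x))^2)" using h by (simp add: csq_int_def)
    show "AE x in lborel. (\<lambda>n. (cmod (f n x))^2) \<longlonglongrightarrow> (cmod 0)^2"
      using lim by eventually_elim (intro tendsto_intros)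
    show "AE x in lborel. norm ((cmod (f n x))^2) <= (cmod (h x))^2" for n
      using dominated by (intro AE_I2) (auto intro: power_mono)
  qed auto
  then have "(\<lambda>n. sqrt (LBINT x. (cmod (f n x))^2)) \<longlonglongrightarrow> sqrt 0" by (intro tendsto_real_sqrt) simp
  then show ?thesis by (simp add: L2norm_def)
qed

lemma csq_int_shift: assumes "csq_int f" shows "csq_int (\<lambda>x. f (x - z))"
  using lborel_integrable_real_affine[of "\<lambda>x. (cmod (f x))^2" 1 "- z"] assms by (auto simp: csq_int_def)

lemma csq_int_reflect: assumes "csq_int f" shows "csq_int (\<lambda>x. f (- x))"
  using lborel_integrable_real_affine[of "\<lambda>x. (cmod (f x))^2" "-1" 0] assms by (auto simp: csq_int_def)

lemma L2norm_shift: "L2norm (\<lambda>x. f (x - z)) = L2norm f" and L2norm_reflect: "L2norm (\<lambda>x. f (- x)) = L2norm f"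
  using lborel_integral_real_affine[of 1 "\<lambda>x. (cmod (f x))^2" "- z"]
    lborel_integral_real_affine[of "-1" "\<lambda>x. (cmod (f x))^2" 0] by (simp_all add: L2norm_def)

lemma L2norm_cnj: "L2norm (\<lambda>x. cnj (f x)) = L2norm f"
  by (simp only: L2norm_def complex_mod_cnj)

lemma csq_int_indicator: "csq_int (\<lambda>x. cx (c * indicator {a..b} x))"
proof (rule csq_int_bound)
  show "integrable lborel (\<lambda>x. c^2 * indicator {a..b} x)"
    by (simp add: integrable_indicator_iff emeasure_lborel_Icc_eq)
qed (auto simp: indicator_def)

definition csq_supp :: "real => (real => complex) => bool" where
  "csq_supp R f \<longleftrightarrow> csq_int f \<and> (\<forall>x. \<bar>x\<bar> > R \<longrightarrow> f x = 0)"

lemma csq_supp_csq_int: "csq_supp R f ==> csq_int f" by (simp add: csq_supp_def)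
lemma csq_supp_0: "csq_supp R f ==> \<bar>x\<bar> > R ==> f x = 0" by (simp add: csq_supp_def)
lemma csq_supp_diff: "csq_supp R f ==> csq_supp S g ==> csq_supp (max R S) (\<lambda>x. f x - g x)"
  by (simp add: csq_supp_def csq_int_diff)

lemma csq_supp_bounded:
  assumes "h \<in> meas" "\<And>x. cmod (h x) <= B" "\<And>x. \<bar>x\<bar> > R ==> h x = 0" shows "csq_supp R h"
proof -
  have "cmod (h x) <= cmod (cx (B * indicator {-R..R} x))" for x
    using assms(2)[of x] assms(3)[of x] by (cases "\<bar>x\<bar> > R") (auto simp: indicator_def)
  then have "csq_int h"
    using csq_int_indicator[of B "-R" R] assms(1)
    by (intro csq_int_bound[where h = "\<lambda>x. (cmod (cx (B * indicator {-R..R} x)))^2"]) (auto simp: csq_int_def intro: power_mono)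
  then show ?thesis using assms(3) by (simp add: csq_supp_def)
qed

lemma csq_supp_integrable: assumes "csq_supp R f" shows "integrable lborel f"
proof -
  have "f x * cx (1 * indicator {-R..R} x) = f x" for x
    using csq_supp_0[OF assms, of x] by (cases "\<bar>x\<bar> > R") (auto simp: indicator_def)
  then show ?thesis
    using csq_int_mult_integrable[OF csq_supp_csq_int[OF assms] csq_int_indicator[of 1 "-R" R]] by (simp only:)
qed

lemma L2norm_clamp_norm_tendsto:
  assumes f: "csq_int f"
  shows "(\<lambda>k. L2norm (\<lambda>x. f x - clamp_norm (real (Suc k)) (f x))) \<longlonglongrightarrow> 0"
proof (rule L2norm_dominated_convergence[OF f])
  note [measurable] = csq_intD[OF f]
  show "(\<lambda>x. f x - clamp_norm (real (Suc k)) (f x)) \<in> meas" for k unfolding clamp_norm_def by measurable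
  show "cmod (f x - clamp_norm (real (Suc k)) (f x)) <= cmod (f x)" for k x
  proof -
    let ?l = "real (Suc k) / max (real (Suc k)) (cmod (f x))"
    have "f x - clamp_norm (real (Suc k)) (f x) = (1 - ?l) *\<^sub>R f x" by (simp add: clamp_norm_def scaleR_diff_left)
    moreover have "\<bar>1 - ?l\<bar> <= 1" using clamp_norm_factor(1,2)[of "real (Suc k)" "f x"] by simp
    ultimately show ?thesis by (simp only: norm_scaleR mult_left_le_one_le norm_ge_zero abs_ge_zero)
  qed
  show "AE x in lborel. (\<lambda>k. f x - clamp_norm (real (Suc k)) (f x)) \<longlonglongrightarrow> 0"
  proof (intro AE_I2 tendsto_eventually)
    fix x
    have "\<forall>\<^sub>F k in sequentially. cmod (f x) <= real (Suc k)"
      using eventually_ge_at_top[of "nat \<lceil>cmod (f x)\<rceil>"] by eventually_elim linarith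
    then show "\<forall>\<^sub>F k in sequentially. f x - clamp_norm (real (Suc k)) (f x) = 0"
      by eventually_elim (simp add: clamp_norm_eq)
  qed
qed

lemma measurable_AE_limit_continuous:
  fixes f :: "real => complex"
  assumes "f \<in> meas"
  obtains g where "\<And>n::nat. continuous_on UNIV (g n)" "AE x in lborel. (\<lambda>n. g n x) \<longlonglongrightarrow> f x"
proof -
  have "f \<in> borel_measurable lebesgue" by (rule measurable_completion) (use assms in simp)
  then have "f measurable_on UNIV" by (rule lebesgue_measurable_imp_measurable_on) simp
  then obtain N g where N: "negligible N"
    and g: "\<And>n::nat. continuous_on UNIV (g n)" "\<And>x. x \<notin> N ==> (\<lambda>n. g n x) \<longlonglongrightarrow> f x"
    unfolding measurable_on_def by auto
  obtain N' where N': "N' \<in> null_sets lborel" "N \<subseteq> N'"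
    using N by (auto simp: negligible_iff_null_sets null_sets_completion_iff2)
  have "AE x in lborel. (\<lambda>n. g n x) \<longlonglongrightarrow> f x"
    using AE_not_in[OF N'(1)] by eventually_elim (use N'(2) g(2) in auto)
  with g(1) show thesis by (rule that)
qed

lemma bounded_approximation_continuous:
  fixes F :: "real => complex"
  assumes [measurable]: "F \<in> meas" and M: "0 < M" "\<And>x. cmod (F x) <= M" and F: "csq_supp R F" and e: "0 < e"
  obtains G where "continuous_on UNIV G" "\<And>x. cmod (G x) <= M" "csq_supp (R + 1) G" "L2norm (\<lambda>x. F x - G x) < e"
proof -
  obtain g where g: "\<And>n::nat. continuous_on UNIV (g n)" "AE x in lborel. (\<lambda>n. g n x) \<longlonglongrightarrow> F x"
    by (rule measurable_AE_limit_continuous[OF assms(1)]) blast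
  define bump where "bump x = max 0 (min 1 (R + 1 - \<bar>x\<bar>))" for x :: real
  define G where "G n x = clamp_norm M (g n x) * cx (bump x)" for n x
  have clamp: "isCont (clamp_norm M) z" for z :: complex
    unfolding clamp_norm_def[abs_def] using M by (intro continuous_intros) (auto simp: max_def)
  have cont: "continuous_on UNIV (G n)" for n
    unfolding G_def bump_def
    by (intro continuous_intros continuous_on_compose2[OF continuous_at_imp_continuous_on[OF ballI[OF clamp]] g(1)]) auto
  have G_meas[measurable]: "G n \<in> meas" for n by (rule borel_measurable_continuous_onI[OF cont])
  have G: "cmod (G n x) <= M" for n x
    using mult_mono[OF norm_clamp_norm[OF M(1), of "g n x"], of "bump x" 1] M by (simp add: G_def bump_def norm_mult)
  have supp: "csq_supp (R + 1) (G n)" for n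
    by (rule csq_supp_bounded[OF G_meas G]) (simp add: G_def bump_def)
  have "(\<lambda>n. L2norm (\<lambda>x. F x - G n x)) \<longlonglongrightarrow> 0"
  proof (rule L2norm_dominated_convergence[OF csq_int_indicator])
    show "cmod (F x - G n x) <= cmod (cx (2 * M * indicator {-(R + 1)..R + 1} x))" for n x
      using norm_triangle_ineq4[of "F x" "G n x"] M(2)[of x] G[of n x] M(1)
        csq_supp_0[OF F, of x] csq_supp_0[OF supp, of x n] by (cases "\<bar>x\<bar> > R + 1") (auto simp: indicator_def)
    show "AE x in lborel. (\<lambda>n. F x - G n x) \<longlonglongrightarrow> 0"
      using g(2)
    proof eventually_elim
      case (elim x)
      have "clamp_norm M (F x) * cx (bump x) = F x"
        using csq_supp_0[OF F, of x] M(2)[of x]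
        by (cases "\<bar>x\<bar> > R") (auto simp: bump_def clamp_norm_eq[OF M(1)] clamp_norm_def[of M 0])
      moreover have "(\<lambda>n. G n x) \<longlonglongrightarrow> clamp_norm M (F x) * cx (bump x)"
        unfolding G_def by (intro tendsto_intros isCont_tendsto_compose[OF clamp elim])
      ultimately show ?case using tendsto_diff[OF tendsto_const, of "\<lambda>n. G n x" "F x" sequentially "F x"] by simp
    qed
  qed measurable
  then have "\<forall>\<^sub>F n in sequentially. L2norm (\<lambda>x. F x - G n x) < e" using e by (intro order_tendstoD(2)) auto
  then obtain n where "L2norm (\<lambda>x. F x - G n x) < e" by (auto simp: eventually_sequentially)
  then show thesis by (rule that[OF cont G supp])
qed

lemma L2_dense_continuous:
  assumes f: "csq_supp R f" and e: "0 < e"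
  obtains g B where "continuous_on UNIV g" "\<And>x. cmod (g x) <= B" "csq_supp (R + 1) g" "L2norm (\<lambda>x. f x - g x) < e"
proof -
  note [measurable] = csq_intD[OF csq_supp_csq_int[OF f]]
  have "\<forall>\<^sub>F k in sequentially. L2norm (\<lambda>x. f x - clamp_norm (real (Suc k)) (f x)) < e / 2"
    using e by (intro order_tendstoD(2)[OF L2norm_clamp_norm_tendsto[OF csq_supp_csq_int[OF f]]]) simp
  then obtain k where k: "L2norm (\<lambda>x. f x - clamp_norm (real (Suc k)) (f x)) < e / 2"
    by (auto simp: eventually_sequentially)
  define M where "M = real (Suc k)"
  define F where "F x = clamp_norm M (f x)" for x
  have M: "0 < M" by (simp add: M_def)
  have F_meas: "F \<in> meas" unfolding F_def clamp_norm_def by measurable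
  have bound: "cmod (F x) <= M" for x unfolding F_def by (rule norm_clamp_norm[OF M])
  have F: "csq_supp R F"
    by (rule csq_supp_bounded[OF F_meas bound]) (simp add: F_def clamp_norm_def csq_supp_0[OF f])
  obtain g where g: "continuous_on UNIV g" "\<And>x. cmod (g x) <= M" "csq_supp (R + 1) g" "L2norm (\<lambda>x. F x - g x) < e / 2"
    by (rule bounded_approximation_continuous[OF F_meas M bound F, of "e / 2"]) (use e in auto)
  have "L2norm (\<lambda>x. f x - g x) < e"
    using L2norm_triangle_diff[OF f[THEN csq_supp_csq_int] F[THEN csq_supp_csq_int] g(3)[THEN csq_supp_csq_int]] k g(4)
    by (simp add: F_def[abs_def] M_def)
  then show thesis by (rule that[OF g(1-3)])
qed

lemma L2norm_translation_continuous_bounded: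
  assumes g: "continuous_on UNIV g" "\<And>x. cmod (g x) <= B" "csq_supp R g" and z: "z \<longlonglongrightarrow> 0"
  shows "(\<lambda>n. L2norm (\<lambda>x. g (x - z n) - g x)) \<longlonglongrightarrow> 0"
proof -
  obtain Z where Z: "\<And>n. \<bar>z n\<bar> <= Z"
    using convergent_imp_Bseq[OF convergentI[OF z]] by (auto simp: Bseq_def)
  note [measurable] = borel_measurable_continuous_onI[OF g(1)]
  show ?thesis
  proof (rule L2norm_dominated_convergence[OF csq_int_indicator])
    show "cmod (g (x - z n) - g x) <= cmod (cx (2 * B * indicator {-(R + Z)..R + Z} x))" for n x
    proof (cases "\<bar>x\<bar> > R + Z")
      case True
      then have "\<bar>x - z n\<bar> > R" "\<bar>x\<bar> > R" using Z[of n] by linarith+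
      then show ?thesis by (simp add: csq_supp_0[OF g(3)])
    next
      case False
      then have "x \<in> {-(R + Z)..R + Z}" by auto
      then show ?thesis using norm_triangle_ineq4[of "g (x - z n)" "g x"] g(2)[of x] g(2)[of "x - z n"] by simp
    qed
    show "AE x in lborel. (\<lambda>n. g (x - z n) - g x) \<longlonglongrightarrow> 0"
    proof (rule AE_I2)
      fix x
      have "isCont g (x - 0)" using g(1) by (simp add: continuous_on_eq_continuous_at)
      then have "(\<lambda>n. g (x - z n)) \<longlonglongrightarrow> g (x - 0)"
        by (rule isCont_tendsto_compose) (intro tendsto_intros z)
      then show "(\<lambda>n. g (x - z n) - g x) \<longlonglongrightarrow> 0" by (simp add: LIM_zero)
    qed
  qed measurable
qed

lemma L2norm_translation_continuous:
  assumes f: "csq_supp R f" and z: "z \<longlonglongrightarrow> 0"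
  shows "(\<lambda>n. L2norm (\<lambda>x. f (x - z n) - f x)) \<longlonglongrightarrow> 0"
proof (rule LIMSEQ_I)
  fix e :: real assume e: "0 < e"
  obtain g B where g: "continuous_on UNIV g" "\<And>x. cmod (g x) <= B" "csq_supp (R + 1) g"
    and fg: "L2norm (\<lambda>x. f x - g x) < e / 3"
    by (rule L2_dense_continuous[OF f, of "e / 3"]) (use e in auto)
  have "\<forall>\<^sub>F n in sequentially. L2norm (\<lambda>x. g (x - z n) - g x) < e / 3"
    using e by (intro order_tendstoD(2)[OF L2norm_translation_continuous_bounded[OF g z]]) simp
  then obtain N where N: "\<And>n. n \<ge> N ==> L2norm (\<lambda>x. g (x - z n) - g x) < e / 3"
    by (auto simp: eventually_sequentially)
  note csq = csq_supp_csq_int[OF f] csq_supp_csq_int[OF g(3)]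
  have "L2norm (\<lambda>x. f (x - z n) - f x) < e" if "n \<ge> N" for n
    using L2norm_triangle_diff[OF csq_int_shift[OF csq(1)] csq_int_shift[OF csq(2)] csq(1), of "z n" "z n"]
      L2norm_triangle_diff[OF csq_int_shift[OF csq(2)] csq(2,1), of "z n"] L2norm_shift[of "\<lambda>x. f x - g x" "z n"]
      L2norm_minus_commute[of g f] fg N[OF that] by linarith
  then show "\<exists>N. \<forall>n\<ge>N. norm (L2norm (\<lambda>x. f (x - z n) - f x) - 0) < e" by auto
qed

subsection \<open>Plancherel's identity for compactly supported functions\<close>

definition autocorr :: "(real => complex) => real => complex" where
  "autocorr f z = (LBINT x. f x * cnj (f (x - z)))"

lemma cmod_autocorr_le: assumes "csq_int f" shows "cmod (autocorr f z) <= (L2norm f)^2"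
  using L2norm_Cauchy_Schwarz[OF assms csq_int_cnj[OF csq_int_shift[OF assms, of z]]]
  by (simp only: autocorr_def power2_eq_square L2norm_cnj L2norm_shift)

lemma autocorr_measurable: assumes "csq_int f" shows "autocorr f \<in> meas"
proof -
  note [measurable] = csq_intD[OF assms]
  show ?thesis unfolding autocorr_def[abs_def] by measurable
qed

lemma autocorr_tendsto:
  assumes f: "csq_supp R f" and z: "z \<longlonglongrightarrow> 0"
  shows "(\<lambda>n. autocorr f (z n)) \<longlonglongrightarrow> cx ((L2norm f)^2)"
proof -
  note csq = csq_supp_csq_int[OF f]
  have at_0: "cx ((L2norm f)^2) = (LBINT x. f x * cnj (f x))"
    unfolding L2norm_sq by (subst integral_complex_of_real[symmetric]) (simp add: complex_norm_square del: of_real_power)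
  have "norm (autocorr f (z n) - cx ((L2norm f)^2)) <= L2norm f * L2norm (\<lambda>x. f (x - z n) - f x)" for n
  proof -
    have "autocorr f (z n) - cx ((L2norm f)^2) = (LBINT x. f x * cnj (f (x - z n) - f x))"
      unfolding autocorr_def at_0
      by (subst Bochner_Integration.integral_diff[symmetric])
        (auto intro!: csq_int_mult_integrable csq_int_cnj csq_int_shift csq simp: right_diff_distrib)
    then show ?thesis
      using L2norm_Cauchy_Schwarz[OF csq csq_int_cnj[OF csq_int_diff[OF csq_int_shift[OF csq] csq]], of "z n"]
      by (simp only: L2norm_cnj)
  qed
  then have "\<forall>\<^sub>F n in sequentially. norm (autocorr f (z n) - cx ((L2norm f)^2)) <= L2norm f * L2norm (\<lambda>x. f (x - z n) - f x)"
    by (rule always_eventually[OF allI])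
  from Lim_null_comparison[OF this tendsto_mult_right_zero[OF L2norm_translation_continuous[OF f z]]]
  show ?thesis by (rule LIM_zero_cancel)
qed

lemma fourier_autocorr:
  assumes f: "integrable lborel f"
  shows "integrable lborel (autocorr f)" "fourier f t * cnj (fourier f t) = cx ft_const * fourier (autocorr f) t"
proof -
  have [measurable]: "f \<in> meas" using f by auto
  have cnj_f: "integrable lborel (\<lambda>x. cnj (f x))" using f by simp
  note int = integrable_convolution_product[OF f cnj_f]
  show "integrable lborel (autocorr f)"
    using lborel_pair.integrable_snd[OF int] by (simp add: autocorr_def[abs_def])
  have int_cis: "integrable (lborel \<Otimes>\<^sub>M lborel) (\<lambda>(x, z). f x * cnj (f (x - z)) * cis (- (z * t)))"
  proof (rule Bochner_Integration.integrable_bound[OF int])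
    have "(\<lambda>p. f (fst p) * cnj (f (fst p - snd p)) * cis (- (snd p * t))) \<in> meas2" by measurable
    then show "(\<lambda>(x, z). f x * cnj (f (x - z)) * cis (- (z * t))) \<in> borel_measurable (lborel \<Otimes>\<^sub>M lborel)"
      by (simp add: case_prod_beta' cong: measurable_cong_sets)
  qed (simp add: norm_mult case_prod_beta')
  have "fourier f t * cnj (fourier f t) = cx (ft_const^2) * (LBINT x. f x * cis (- (x * t)) * (LBINT y. cnj (f y) * cis (y * t)))"
    unfolding fourier_def complex_cnj_mult Bochner_Integration.integral_cnj[symmetric]
    by (simp add: cis_cnj power2_eq_square)
  also have "(LBINT x. f x * cis (- (x * t)) * (LBINT y. cnj (f y) * cis (y * t)))
      = (LBINT x. (LBINT z. f x * cnj (f (x - z)) * cis (- (z * t))))"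
  proof (intro Bochner_Integration.integral_cong refl)
    fix x
    have "f x * cis (- (x * t)) * (cnj (f (x - z)) * cis ((x - z) * t)) = f x * cnj (f (x - z)) * cis (- (z * t))" for z
    proof -
      have "f x * cis (- (x * t)) * (cnj (f (x - z)) * cis ((x - z) * t))
          = f x * cnj (f (x - z)) * (cis (- (x * t)) * cis ((x - z) * t))" by (simp only: mult_ac)
      then show ?thesis by (simp add: cis_mult left_diff_distrib)
    qed
    then have "(LBINT z. f x * cnj (f (x - z)) * cis (- (z * t)))
        = f x * cis (- (x * t)) * (LBINT z. cnj (f (x - z)) * cis ((x - z) * t))"
      by (simp only: integral_mult_right_zero[symmetric])
    also have "(LBINT z. cnj (f (x - z)) * cis ((x - z) * t)) = (LBINT y. cnj (f y) * cis (y * t))"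
      by (rule integral_reflect_shift)
    finally show "f x * cis (- (x * t)) * (LBINT y. cnj (f y) * cis (y * t)) = (LBINT z. f x * cnj (f (x - z)) * cis (- (z * t)))" ..
  qed
  also have "... = (LBINT z. (LBINT x. f x * cnj (f (x - z)) * cis (- (z * t))))"
    by (rule lborel_pair.Fubini_integral[symmetric]) (use int_cis in simp)
  also have "cx (ft_const^2) * ... = cx ft_const * fourier (autocorr f) t"
    by (simp add: fourier_def autocorr_def power2_eq_square)
  finally show "fourier f t * cnj (fourier f t) = cx ft_const * fourier (autocorr f) t" .
qed

lemma integral_fourier_sq_gauss:
  assumes f: "integrable lborel f" and e: "0 < e"
  shows "cx (LBINT t. (cmod (fourier f t))^2 * exp (- (e * t)\<^sup>2 / 2)) = (LBINT u. cx (std_normal_density u) * autocorr f (e * u))"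
proof -
  let ?w = "\<lambda>t. cx (exp (- (e * t)\<^sup>2 / 2))"
  have integrable_w: "integrable lborel ?w" using e by (intro integrable_of_real integrable_gauss) simp
  have "cx (LBINT t. (cmod (fourier f t))^2 * exp (- (e * t)\<^sup>2 / 2)) = (LBINT t. cx ft_const * (fourier (autocorr f) t * ?w t))"
    by (subst integral_complex_of_real[symmetric])
      (simp add: mult.assoc[symmetric] fourier_autocorr(2)[OF f, symmetric] complex_norm_square del: of_real_power)
  also have "... = cx ft_const * (LBINT x. autocorr f x * fourier ?w x)"
    by (simp only: integral_mult_right_zero integral_fourier_mult[OF fourier_autocorr(1)[OF f] integrable_w])
  also have "(LBINT x. autocorr f x * fourier ?w x)
      = \<bar>e\<bar> *\<^sub>R (LBINT u. autocorr f (0 + e * u) * fourier ?w (0 + e * u))"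
    by (rule lborel_integral_real_affine) (use e in simp)
  also have "cx ft_const * ... = (LBINT u. cx (std_normal_density u) * autocorr f (e * u))"
    unfolding scaleR_conv_of_real fourier_gauss[OF e] integral_mult_right_zero[symmetric]
    using e by (intro Bochner_Integration.integral_cong refl) (simp add: std_normal_density_def ft_const_def)
  finally show ?thesis .
qed

lemma integral_fourier_sq_gauss_tendsto:
  assumes f: "csq_supp R f"
  shows "(\<lambda>n. LBINT t. (cmod (fourier f t))^2 * exp (- (inverse (real (Suc n)) * t)\<^sup>2 / 2)) \<longlonglongrightarrow> (L2norm f)^2"
proof -
  note csq = csq_supp_csq_int[OF f]
  note [measurable] = autocorr_measurable[OF csq]
  let ?e = "\<lambda>n. inverse (real (Suc n))"
  have "(\<lambda>n. \<integral>u. cx (std_normal_density u) * autocorr f (?e n * u) \<partial>lborel)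
      \<longlonglongrightarrow> (LBINT u. cx (std_normal_density u) * cx ((L2norm f)^2))"
  proof (rule Bochner_Integration.integral_dominated_convergence[where w = "\<lambda>u. std_normal_density u * (L2norm f)^2"])
    have "(\<lambda>n. ?e n * u) \<longlonglongrightarrow> 0" for u by (intro tendsto_mult_left_zero LIMSEQ_inverse_real_of_nat)
    then show "AE u in lborel. (\<lambda>n. cx (std_normal_density u) * autocorr f (?e n * u)) \<longlonglongrightarrow> cx (std_normal_density u) * cx ((L2norm f)^2)"
      by (intro AE_I2 tendsto_intros autocorr_tendsto[OF f])
    show "AE u in lborel. norm (cx (std_normal_density u) * autocorr f (?e n * u)) <= std_normal_density u * (L2norm f)^2" for n
      using cmod_autocorr_le[OF csq] by (intro AE_I2) (auto simp: norm_mult intro!: mult_left_mono)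
  qed auto
  also have "(LBINT u. cx (std_normal_density u) * cx ((L2norm f)^2)) = cx ((LBINT u. std_normal_density u) * (L2norm f)^2)"
    by (simp only: integral_mult_left_zero integral_complex_of_real of_real_mult)
  also have "(LBINT u. std_normal_density u) = 1" by simp
  finally show ?thesis
    unfolding integral_fourier_sq_gauss[OF csq_supp_integrable[OF f] positive_imp_inverse_positive[OF of_nat_0_less_iff[THEN iffD2, OF zero_less_Suc]], symmetric]
    by (simp only: tendsto_of_real_iff mult_1)
qed

theorem Plancherel:
  assumes f: "csq_supp R f" shows "csq_int (fourier f)" "L2norm (fourier f) = L2norm f"
proof -
  note int = csq_supp_integrable[OF f]
  have [measurable]: "fourier f \<in> meas" using int by (auto intro: fourier_measurable)
  let ?w = "\<lambda>n t. exp (- (inverse (real (Suc n)) * t)\<^sup>2 / 2)"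
  have "integrable lborel (\<lambda>t. (cmod (fourier f t))^2 * ?w n t)" for n
  proof (rule Bochner_Integration.integrable_bound[OF integrable_mult_right[OF integrable_gauss]])
    show "AE t in lborel. norm ((cmod (fourier f t))^2 * ?w n t) <= norm ((LBINT x. cmod (f x))^2 * ?w n t)"
      using cmod_fourier_le[of f] by (intro AE_I2) (auto simp: abs_mult intro!: mult_right_mono power_mono)
  qed auto
  then have "(NN t. ennreal ((cmod (fourier f t))^2 * ?w n t)) = ennreal (LBINT t. (cmod (fourier f t))^2 * ?w n t)" for n
    by (intro nn_integral_eq_integral) auto
  then have "(\<lambda>n. \<integral>\<^sup>+t. ennreal ((cmod (fourier f t))^2 * ?w n t) \<partial>lborel) \<longlonglongrightarrow> ennreal ((L2norm f)^2)"
    using integral_fourier_sq_gauss_tendsto[OF f] by (simp add: tendsto_ennrealI)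
  moreover have "(\<lambda>n. \<integral>\<^sup>+t. ennreal ((cmod (fourier f t))^2 * ?w n t) \<partial>lborel) \<longlonglongrightarrow> (NN t. ennreal ((cmod (fourier f t))^2))"
  proof (rule nn_integral_LIMSEQ)
    have "(inverse (real (Suc (Suc n))) * t)\<^sup>2 <= (inverse (real (Suc n)) * t)\<^sup>2" for n t
      unfolding power_mult_distrib by (intro mult_right_mono power_mono le_imp_inverse_le) auto
    then show "incseq (\<lambda>n t. ennreal ((cmod (fourier f t))^2 * ?w n t))"
      by (intro incseq_SucI le_funI ennreal_leI mult_left_mono) simp_all
    fix t
    have "(\<lambda>n. (cmod (fourier f t))^2 * ?w n t) \<longlonglongrightarrow> (cmod (fourier f t))^2 * exp (- 0\<^sup>2 / 2)"
      by (intro tendsto_intros tendsto_mult_left_zero LIMSEQ_inverse_real_of_nat) auto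
    then show "(\<lambda>n. ennreal ((cmod (fourier f t))^2 * ?w n t)) \<longlonglongrightarrow> ennreal ((cmod (fourier f t))^2)"
      by (intro tendsto_ennrealI) simp
  qed measurable
  ultimately have nn_fourier: "(NN t. ennreal ((cmod (fourier f t))^2)) = ennreal ((L2norm f)^2)" by (rule LIMSEQ_unique[rotated])
  then show csq: "csq_int (fourier f)" by (simp add: csq_int_iff_nn_integral)
  show "L2norm (fourier f) = L2norm f" using nn_fourier unfolding nn_integral_csq[OF csq] by simp
qed

subsection \<open>The Fourier transform of square integrable real functions\<close>

lemma sq_int_iff_csq_int: "sq_int f \<longleftrightarrow> csq_int (\<lambda>x. cx (f x))"
proof
  assume "csq_int (\<lambda>x. cx (f x))"
  then show "sq_int f"
    using measurable_compose[OF csq_intD borel_measurable_Re, of "\<lambda>x. cx (f x)"] by (auto simp: sq_int_def csq_int_def)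
qed (auto simp: sq_int_def csq_int_def)

lemma sq_int_measurable: "sq_int f ==> f \<in> meas" by (simp add: sq_int_def)

lemma sq_int_add: "sq_int f ==> sq_int g ==> sq_int (\<lambda>x. f x + g x)"
  using csq_int_add[of "\<lambda>x. cx (f x)" "\<lambda>x. cx (g x)"] by (simp add: sq_int_iff_csq_int)
lemma sq_int_cmult: "sq_int f ==> sq_int (\<lambda>x. c * f x)"
  using csq_int_cmult[of "\<lambda>x. cx (f x)" "cx c"] by (simp add: sq_int_iff_csq_int)
lemma sq_int_mult_integrable: "sq_int f ==> sq_int g ==> integrable lborel (\<lambda>x. f x * g x)"
  using integrable_Re[OF csq_int_mult_integrable[of "\<lambda>x. cx (f x)" "\<lambda>x. cx (g x)"]]
  by (simp add: sq_int_iff_csq_int)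

definition trunc :: "(real => real) => real => real => real" where
  "trunc f R x = indicator {-R..R} x * f x"

lemma trunc_eq: "\<bar>x\<bar> <= R ==> trunc f R x = f x" and trunc_eq_0: "\<bar>x\<bar> > R ==> trunc f R x = 0"
  by (auto simp: trunc_def indicator_def)

lemma trunc_ft_fourier: "trunc_ft f R = fourier (\<lambda>x. cx (trunc f R x))"
proof
  fix t show "trunc_ft f R t = fourier (\<lambda>x. cx (trunc f R x)) t"
    unfolding trunc_ft_def fourier_def ft_const_def trunc_def set_lebesgue_integral_def
    by (simp add: scaleR_conv_of_real mult.assoc)
qed

lemma csq_supp_trunc: assumes "sq_int f" shows "csq_supp R (\<lambda>x. cx (trunc f R x))"
proof -
  have "csq_int (\<lambda>x. cx (indicator {-R..R} x) * cx (f x))"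
    by (rule csq_int_mult_bounded[where C = 1]) (use assms in \<open>auto simp: sq_int_iff_csq_int indicator_def\<close>)
  then have "csq_int (\<lambda>x. cx (trunc f R x))" by (simp add: trunc_def)
  then show ?thesis by (simp add: csq_supp_def trunc_eq_0)
qed

lemmas csq_int_trunc = csq_supp_csq_int[OF csq_supp_trunc] and integrable_trunc = csq_supp_integrable[OF csq_supp_trunc]

lemma sq_int_trunc: "sq_int f ==> sq_int (trunc f R)" by (simp add: sq_int_iff_csq_int csq_int_trunc)

lemma herm_sq_int_trunc_ft: assumes "sq_int f" shows "herm_sq_int (trunc_ft f R)"
proof -
  have "trunc_ft f R (- t) = cnj (trunc_ft f R t)" for t
    using fourier_cnj[of "\<lambda>x. cx (trunc f R x)" "- t"] by (simp add: trunc_ft_fourier)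
  then show ?thesis
    using Plancherel(1)[OF csq_supp_trunc[OF assms]] by (simp add: herm_sq_int_def trunc_ft_fourier)
qed

lemma L2norm_trunc_ft_diff:
  assumes "sq_int f"
  shows "L2norm (\<lambda>t. trunc_ft f R t - trunc_ft f S t) = L2norm (\<lambda>x. cx (trunc f R x) - cx (trunc f S x))"
  using Plancherel(2)[OF csq_supp_diff[OF csq_supp_trunc[OF assms] csq_supp_trunc[OF assms]]]
  by (simp add: trunc_ft_fourier fourier_diff[OF integrable_trunc[OF assms] integrable_trunc[OF assms], symmetric])

definition trunc_L2 :: "(real => real) => real => hl2" where "trunc_L2 f R = L2_of (trunc_ft f R)"

lemma norm_trunc_L2: "sq_int f ==> norm (trunc_L2 f R) = L2norm (\<lambda>x. cx (trunc f R x))"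
  by (simp add: trunc_L2_def norm_L2_of herm_sq_int_trunc_ft) (simp add: trunc_ft_fourier Plancherel(2)[OF csq_supp_trunc])

lemma norm_trunc_L2_diff_fun_of: "sq_int f ==> norm (trunc_L2 f R - x) = L2norm (\<lambda>t. trunc_ft f R t - fun_of x t)"
  using L2_of_diff[OF herm_sq_int_trunc_ft herm_sq_int_fun_of, of f R x]
    norm_L2_of[OF herm_sq_int_diff[OF herm_sq_int_trunc_ft herm_sq_int_fun_of], of f R x] by (simp add: trunc_L2_def)

lemma norm_trunc_L2_diff:
  "sq_int f ==> norm (trunc_L2 f R - trunc_L2 f S) = L2norm (\<lambda>x. cx (trunc f R x) - cx (trunc f S x))"
  unfolding trunc_L2_def
  by (simp add: L2_of_diff norm_L2_of herm_sq_int_diff herm_sq_int_trunc_ft L2norm_trunc_ft_diff)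

lemma trunc_L2_add: assumes "sq_int f" "sq_int g" shows "trunc_L2 (\<lambda>x. f x + g x) R = trunc_L2 f R + trunc_L2 g R"
proof -
  have "trunc_ft (\<lambda>x. f x + g x) R = (\<lambda>t. trunc_ft f R t + trunc_ft g R t)"
    unfolding trunc_ft_fourier using fourier_add[OF integrable_trunc[OF assms(1)] integrable_trunc[OF assms(2)], of R R]
    by (auto simp: trunc_def ring_distribs fun_eq_iff)
  then show ?thesis unfolding trunc_L2_def by (simp add: L2_of_add herm_sq_int_trunc_ft assms)
qed

lemma trunc_L2_cmult: assumes "sq_int f" shows "trunc_L2 (\<lambda>x. c * f x) R = c *\<^sub>R trunc_L2 f R"
proof -
  have "trunc_ft (\<lambda>x. c * f x) R = (\<lambda>t. cx c * trunc_ft f R t)"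
    unfolding trunc_ft_fourier fourier_cmult[symmetric] by (simp add: trunc_def mult_ac fun_eq_iff)
  then show ?thesis unfolding trunc_L2_def by (simp add: L2_of_scale herm_sq_int_trunc_ft assms)
qed

definition has_FT :: "(real => real) => hl2 => bool" where
  "has_FT f x \<longleftrightarrow> sq_int f \<and> (trunc_L2 f \<longlongrightarrow> x) at_top"

lemma has_FT_sq: "has_FT f x ==> sq_int f" by (simp add: has_FT_def)
lemma has_FT_csq_int: "has_FT f x ==> csq_int (\<lambda>t. cx (f t))" by (simp add: has_FT_def sq_int_iff_csq_int)

lemma has_FT_unique: "has_FT f x ==> has_FT f y ==> x = y"
  unfolding has_FT_def by (auto intro: tendsto_unique[OF trivial_limit_at_top_linorder])

lemma has_FT_add: "has_FT f x ==> has_FT g y ==> has_FT (\<lambda>t. f t + g t) (x + y)"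
  unfolding has_FT_def by (auto simp: trunc_L2_add sq_int_add intro!: Lim_transform_eventually[OF tendsto_add])
lemma has_FT_cmult: "has_FT f x ==> has_FT (\<lambda>t. c * f t) (c *\<^sub>R x)"
  unfolding has_FT_def
  by (auto simp: trunc_L2_cmult sq_int_cmult intro!: Lim_transform_eventually[OF tendsto_scaleR[OF tendsto_const]])
lemma has_FT_diff: "has_FT f x ==> has_FT g y ==> has_FT (\<lambda>t. f t - g t) (x - y)"
  using has_FT_add[OF _ has_FT_cmult, of f x g y "-1"] by simp

lemma L2norm_trunc_tendsto:
  assumes "sq_int f" shows "((\<lambda>R. L2norm (\<lambda>x. cx (f x) - cx (trunc f R x))) \<longlongrightarrow> 0) at_top"
proof (rule tendsto_at_topI_sequentially, rule L2norm_dominated_convergence)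
  fix R :: "nat => real" assume R: "filterlim R at_top sequentially"
  show "csq_int (\<lambda>x. cx (f x))" using assms by (simp add: sq_int_iff_csq_int)
  note [measurable] = sq_int_measurable[OF assms] sq_int_measurable[OF sq_int_trunc[OF assms]]
  show "(\<lambda>x. cx (f x) - cx (trunc f (R n) x)) \<in> meas" for n by measurable
  show "cmod (cx (f x) - cx (trunc f (R n) x)) <= cmod (cx (f x))" for n x by (auto simp: trunc_def indicator_def)
  show "AE x in lborel. (\<lambda>n. cx (f x) - cx (trunc f (R n) x)) \<longlonglongrightarrow> 0"
  proof (intro AE_I2 tendsto_eventually)
    fix x
    have "\<forall>\<^sub>F n in sequentially. \<bar>x\<bar> <= R n" using R by (auto simp: filterlim_at_top)
    then show "\<forall>\<^sub>F n in sequentially. cx (f x) - cx (trunc f (R n) x) = 0" by eventually_elim (simp add: trunc_eq)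
  qed
qed

lemma has_FT_exists: assumes f: "sq_int f" shows "\<exists>x. has_FT f x"
proof -
  let ?tail = "\<lambda>R. L2norm (\<lambda>x. cx (f x) - cx (trunc f R x))" and ?F = "\<lambda>n. trunc_L2 f (real n)"
  have tail_bound: "norm (trunc_L2 f S - trunc_L2 f R) <= ?tail R" if "R <= S" for R S
    unfolding norm_trunc_L2_diff[OF f] L2norm_def
  proof (intro real_sqrt_le_mono integral_mono)
    show "integrable lborel (\<lambda>x. (cmod (cx (trunc f S x) - cx (trunc f R x)))^2)" "integrable lborel (\<lambda>x. (cmod (cx (f x) - cx (trunc f R x)))^2)"
      using csq_int_diff[OF csq_int_trunc[OF f] csq_int_trunc[OF f]] csq_int_diff[OF _ csq_int_trunc[OF f], of "\<lambda>x. cx (f x)"] f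
      by (auto simp: csq_int_def sq_int_iff_csq_int)
    show "(cmod (cx (trunc f S x) - cx (trunc f R x)))^2 <= (cmod (cx (f x) - cx (trunc f R x)))^2" for x
      using that by (auto simp: trunc_def indicator_def)
  qed
  note tail = L2norm_trunc_tendsto[OF f]
  have "Cauchy ?F"
  proof (rule metric_CauchyI)
    fix e :: real assume e: "0 < e"
    have "\<forall>\<^sub>F n in sequentially. ?tail (real n) < e / 2"
      using e by (intro order_tendstoD(2)[OF filterlim_compose[OF tail filterlim_real_sequentially]]) simp
    then obtain N where N: "?tail (real N) < e / 2" by (auto simp: eventually_sequentially)
    have "dist (?F m) (?F n) < e" if "m \<ge> N" "n \<ge> N" for m n
      using dist_triangle[of "?F m" "?F n" "?F N"] tail_bound[of "real N" "real m"] tail_bound[of "real N" "real n"] N that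
      by (simp add: dist_norm norm_minus_commute)
    then show "\<exists>M. \<forall>m\<ge>M. \<forall>n\<ge>M. dist (?F m) (?F n) < e" by blast
  qed
  then obtain x where x: "?F \<longlonglongrightarrow> x" by (auto simp: Cauchy_convergent_iff convergent_def)
  have "norm (trunc_L2 f R - x) <= ?tail R" for R
  proof (rule tendsto_upperbound)
    show "(\<lambda>n. norm (trunc_L2 f R - ?F n)) \<longlonglongrightarrow> norm (trunc_L2 f R - x)" by (intro tendsto_intros x)
    have "\<forall>\<^sub>F n in sequentially. R <= real n" using filterlim_real_sequentially by (simp add: filterlim_at_top)
    then show "\<forall>\<^sub>F n in sequentially. norm (trunc_L2 f R - ?F n) <= ?tail R"
      by eventually_elim (subst norm_minus_commute, rule tail_bound)
  qed simp
  then have "((\<lambda>R. trunc_L2 f R - x) \<longlongrightarrow> 0) at_top"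
    by (intro Lim_null_comparison[OF _ tail] always_eventually) auto
  then show ?thesis using f by (auto simp: has_FT_def LIM_zero_iff)
qed

lemma norm_has_FT: assumes f: "has_FT f x" shows "norm x = L2norm (\<lambda>t. cx (f t))"
proof (rule tendsto_unique[OF trivial_limit_at_top_linorder])
  note sq = has_FT_sq[OF f]
  show "((\<lambda>R. norm (trunc_L2 f R)) \<longlongrightarrow> norm x) at_top" using f
    by (intro tendsto_norm) (simp add: has_FT_def)
  have "((\<lambda>R. norm (trunc_L2 f R) - L2norm (\<lambda>t. cx (f t))) \<longlongrightarrow> 0) at_top"
  proof (rule Lim_null_comparison[OF always_eventually L2norm_trunc_tendsto[OF sq]], rule allI)
    fix R
    show "norm (norm (trunc_L2 f R) - L2norm (\<lambda>t. cx (f t))) <= L2norm (\<lambda>x. cx (f x) - cx (trunc f R x))"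
      using L2norm_triangle_diff[OF has_FT_csq_int[OF f] csq_int_trunc[OF sq] csq_int_0, of R]
        L2norm_triangle_diff[OF csq_int_trunc[OF sq] has_FT_csq_int[OF f] csq_int_0, of R]
        L2norm_minus_commute[of "\<lambda>x. cx (f x)" "\<lambda>x. cx (trunc f R x)"] by (simp add: norm_trunc_L2[OF sq])
  qed
  then show "((\<lambda>R. norm (trunc_L2 f R)) \<longlongrightarrow> L2norm (\<lambda>t. cx (f t))) at_top"
    by (rule LIM_zero_cancel)
qed

lemma norm_has_FT_diff: "has_FT f x ==> has_FT g y ==> norm (x - y) = L2norm (\<lambda>t. cx (f t) - cx (g t))"
  using norm_has_FT[OF has_FT_diff, of f x g y] by simp

lemma has_FT_L2norm_limit:
  assumes f: "\<And>n. has_FT (f n) (X n)" "(\<lambda>n. L2norm (\<lambda>t. cx (f n t) - cx (g t))) \<longlonglongrightarrow> 0" "sq_int g" and X: "X \<longlonglongrightarrow> x"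
  shows "has_FT g x"
proof -
  obtain y where y: "has_FT g y" using has_FT_exists[OF f(3)] by blast
  have "(\<lambda>n. norm (X n - y)) \<longlonglongrightarrow> 0" using f(2) by (simp add: norm_has_FT_diff[OF f(1) y])
  then have "X \<longlonglongrightarrow> y" by (simp add: tendsto_norm_zero_iff LIM_zero_iff)
  with X y show ?thesis using LIMSEQ_unique by blast
qed

lemma has_FT_cong_AE:
  assumes f: "has_FT f x" and g: "g \<in> meas" "AE t in lborel. f t = g t" shows "has_FT g x"
proof (rule has_FT_L2norm_limit[of "\<lambda>_. f" "\<lambda>_. x", OF f])
  show "sq_int g"
    unfolding sq_int_iff_csq_int by (rule csq_int_cong_AE[OF has_FT_csq_int[OF f]]) (use g in auto)
  note [measurable] = g(1) sq_int_measurable[OF has_FT_sq[OF f]]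
  have "(LBINT t. (cmod (cx (f t) - cx (g t)))^2) = integral\<^sup>L lborel (\<lambda>_::real. 0)"
    using g(2) by (intro integral_cong_AE) auto
  then show "(\<lambda>n. L2norm (\<lambda>t. cx (f t) - cx (g t))) \<longlonglongrightarrow> 0" by (simp add: L2norm_def)
qed simp

lemma Parseval: assumes "has_FT f x" "has_FT g y" shows "(LBINT t. f t * g t) = inner x y"
proof -
  note sq = has_FT_sq[OF assms(1)] has_FT_sq[OF assms(2)]
  have norm_sq: "(norm z)^2 = (LBINT t. (h t)^2)" if "has_FT h z" for h z by (simp add: norm_has_FT[OF that] L2norm_sq)
  have "(norm (x + y))^2 = (LBINT t. (f t)^2 + (g t)^2 + 2 * (f t * g t))"
    unfolding norm_sq[OF has_FT_add[OF assms]] by (simp add: power2_sum mult.assoc)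
  also have "... = (norm x)^2 + (norm y)^2 + 2 * (LBINT t. f t * g t)"
    using sq sq_int_mult_integrable[OF sq] by (simp add: sq_int_def norm_sq[OF assms(1)] norm_sq[OF assms(2)])
  finally show ?thesis by (simp add: power2_norm_eq_inner inner_simps inner_commute)
qed

lemma has_FT_trunc: assumes "sq_int f" shows "has_FT (trunc f R) (trunc_L2 f R)"
proof -
  have "trunc_L2 (trunc f R) S = trunc_L2 f R" if "S \<ge> R" for S
  proof -
    have "trunc (trunc f R) S = trunc f R" using that by (auto simp: trunc_def indicator_def fun_eq_iff)
    then show ?thesis by (simp add: trunc_L2_def trunc_ft_fourier)
  qed
  then have "\<forall>\<^sub>F S in at_top. trunc_L2 (trunc f R) S = trunc_L2 f R"
    using eventually_ge_at_top[of R] by (rule eventually_mono[rotated])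
  then show ?thesis by (simp add: has_FT_def sq_int_trunc assms tendsto_eventually)
qed

lemma is_FT_iff_L2norm:
  "is_FT f g \<longleftrightarrow> sq_int f \<and> csq_int g \<and> ((\<lambda>R. L2norm (\<lambda>t. trunc_ft f R t - g t)) \<longlongrightarrow> 0) at_top"
proof -
  have "((\<lambda>R. \<integral>\<^sup>+t. ennreal ((cmod (trunc_ft f R t - g t))\<^sup>2) \<partial>lborel) \<longlongrightarrow> 0) at_top
      \<longleftrightarrow> ((\<lambda>R. L2norm (\<lambda>t. trunc_ft f R t - g t)) \<longlongrightarrow> 0) at_top" if "sq_int f" "csq_int g"
  proof -
    have "csq_int (\<lambda>t. trunc_ft f R t - g t)" for R
      using herm_sq_int_trunc_ft[OF that(1), of R] that(2) by (simp add: herm_sq_int_def csq_int_diff)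
    then have "((\<lambda>R. \<integral>\<^sup>+t. ennreal ((cmod (trunc_ft f R t - g t))\<^sup>2) \<partial>lborel) \<longlongrightarrow> ennreal 0) at_top
        \<longleftrightarrow> ((\<lambda>R. (L2norm (\<lambda>t. trunc_ft f R t - g t))^2) \<longlongrightarrow> 0) at_top"
      by (simp only: nn_integral_csq) (rule tendsto_ennreal_iff, auto)
    moreover have "((\<lambda>R. (h R)^2) \<longlongrightarrow> 0) at_top \<longleftrightarrow> (h \<longlongrightarrow> 0) at_top" if "\<And>R. 0 <= h R" for h :: "real => real"
      using tendsto_real_sqrt[of "\<lambda>R. (h R)^2" 0 at_top] tendsto_power[of h 0 at_top 2] that by auto
    ultimately show ?thesis by simp
  qed
  then show ?thesis by (auto simp: is_FT_def)
qed

lemma has_FT_is_FT: assumes "has_FT f x" shows "is_FT f (fun_of x)"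
proof -
  have "((\<lambda>R. norm (trunc_L2 f R - x)) \<longlongrightarrow> 0) at_top"
    using assms by (simp add: has_FT_def tendsto_norm_zero_iff LIM_zero_iff)
  then show ?thesis
    using has_FT_sq[OF assms] by (simp add: is_FT_iff_L2norm csq_int_fun_of norm_trunc_L2_diff_fun_of)
qed

theorem is_FT_iff: "is_FT f g \<longleftrightarrow> csq_int g \<and> (\<exists>x. has_FT f x \<and> (AE t in lborel. g t = fun_of x t))"
proof
  assume g: "is_FT f g"
  then have f: "sq_int f" and csq: "csq_int g" by (auto simp: is_FT_iff_L2norm)
  obtain x where x: "has_FT f x" using has_FT_exists[OF f] by blast
  have "((\<lambda>R. L2norm (\<lambda>t. trunc_ft f R t - g t) + L2norm (\<lambda>t. trunc_ft f R t - fun_of x t)) \<longlongrightarrow> 0 + 0) at_top"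
    using g has_FT_is_FT[OF x] unfolding is_FT_iff_L2norm by (intro tendsto_add) auto
  moreover have "L2norm (\<lambda>t. g t - fun_of x t) <= L2norm (\<lambda>t. trunc_ft f R t - g t) + L2norm (\<lambda>t. trunc_ft f R t - fun_of x t)" for R
    using L2norm_triangle_diff[OF csq _ csq_int_fun_of, of "trunc_ft f R" x] herm_sq_int_trunc_ft[OF f, of R]
      L2norm_minus_commute[of g "trunc_ft f R"] by (simp add: herm_sq_int_def)
  ultimately have "L2norm (\<lambda>t. g t - fun_of x t) <= 0 + 0"
    by (rule tendsto_lowerbound[OF _ always_eventually[OF allI]]) simp
  then have "L2norm (\<lambda>t. g t - fun_of x t) = 0" by (simp add: order_antisym)
  from L2norm_eq_0[OF csq_int_diff[OF csq csq_int_fun_of] this]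
  show "csq_int g \<and> (\<exists>x. has_FT f x \<and> (AE t in lborel. g t = fun_of x t))" using csq x by auto
next
  assume "csq_int g \<and> (\<exists>x. has_FT f x \<and> (AE t in lborel. g t = fun_of x t))"
  then obtain x where csq: "csq_int g" and x: "has_FT f x" "AE t in lborel. g t = fun_of x t" by blast
  have "(NN u. ennreal ((cmod (trunc_ft f R u - g u))^2)) = (NN u. ennreal ((cmod (trunc_ft f R u - fun_of x u))^2))" for R
    using x(2) by (intro nn_integral_cong_AE) (auto elim: eventually_mono)
  then show "is_FT f g" using has_FT_is_FT[OF x(1)] csq by (simp add: is_FT_def)
qed

lemma FT_AE: assumes "has_FT f x" shows "AE t in lborel. FT f t = fun_of x t"
proof -
  have "is_FT f (FT f)" unfolding FT_def by (rule someI[of "is_FT f"]) (rule has_FT_is_FT[OF assms])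
  then show ?thesis using has_FT_unique[OF assms] by (auto simp: is_FT_iff)
qed

subsection \<open>Fourier inversion\<close>

definition inv_FT :: "hl2 => real => real => real" where
  "inv_FT x S t = Re (fourier (\<lambda>u. cx (cut S u) * fun_of x u) (- t))"

lemma csq_supp_cut_fun_of: "csq_supp S (\<lambda>u. cx (cut S u) * fun_of x u)"
  using csq_int_mult_bounded[OF csq_int_fun_of, of "\<lambda>u. cx (cut S u)" 1 x] by (simp add: csq_supp_def cut_def)

lemma inv_FT_complex: "cx (inv_FT x S t) = fourier (\<lambda>u. cx (cut S u) * fun_of x u) (- t)"
proof -
  have "cnj (fourier (\<lambda>u. cx (cut S u) * fun_of x u) (- t)) = fourier (\<lambda>u. cx (cut S u) * fun_of x u) (- t)"
    by (rule fourier_hermitian_real) simp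
  then show ?thesis unfolding inv_FT_def by (simp add: complex_eq_iff)
qed

lemma sq_int_inv_FT: "sq_int (inv_FT x S)"
  unfolding sq_int_iff_csq_int inv_FT_complex by (rule csq_int_reflect[OF Plancherel(1)[OF csq_supp_cut_fun_of]])

lemma L2norm_inv_FT: "L2norm (\<lambda>t. cx (inv_FT x S t)) = norm (rmult (cut S) x)"
  unfolding inv_FT_complex L2norm_reflect Plancherel(2)[OF csq_supp_cut_fun_of] rmult_def fmult_def
  by (rule norm_L2_of[symmetric]) (intro herm_sq_int_herm_sym[OF even_sym_herm_sym[OF even_sym_cut]] herm_sq_int_fun_of)

lemma inner_trunc_L2_cut:
  assumes f: "sq_int f" shows "inner (trunc_L2 f R) (rmult (cut S) x) = (LBINT t. trunc f R t * inv_FT x S t)"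
proof -
  let ?x = "\<lambda>u. cx (cut S u) * fun_of x u"
  have "integrable lborel (\<lambda>u. cnj (?x u))"
    using csq_supp_integrable[OF csq_supp_cut_fun_of, of S x] by (simp only: integrable_cnj)
  then have "(LBINT u. trunc_ft f R u * cnj (?x u)) = (LBINT t. cx (trunc f R t) * fourier (\<lambda>u. cnj (?x u)) t)"
    unfolding trunc_ft_fourier by (rule integral_fourier_mult[OF integrable_trunc[OF f]])
  also have "... = (LBINT t. cx (trunc f R t * inv_FT x S t))"
    unfolding fourier_cnj inv_FT_complex[symmetric] by simp
  also have "... = cx (LBINT t. trunc f R t * inv_FT x S t)" by (rule integral_complex_of_real)
  finally show ?thesis
    unfolding trunc_L2_def rmult_def fmult_def
    by (subst inner_L2_of[OF herm_sq_int_trunc_ft[OF f] herm_sq_int_herm_sym[OF even_sym_herm_sym[OF even_sym_cut] herm_sq_int_fun_of]]) simp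
qed

lemma has_FT_inv_FT: "has_FT (inv_FT x S) (rmult (cut S) x)"
proof -
  let ?X = "rmult (cut S) x"
  obtain y where y: "has_FT (inv_FT x S) y" using has_FT_exists[OF sq_int_inv_FT] by blast
  have "inner (trunc_L2 (inv_FT x S) R) (?X - y) = 0" for R
    unfolding inner_diff_right inner_trunc_L2_cut[OF sq_int_inv_FT] Parseval[OF has_FT_trunc[OF sq_int_inv_FT] y] by simp
  moreover have "((\<lambda>R. inner (trunc_L2 (inv_FT x S) R) (?X - y)) \<longlongrightarrow> inner y (?X - y)) at_top"
    using y by (intro tendsto_intros) (simp add: has_FT_def)
  ultimately have "inner y (?X - y) = 0" by (simp add: tendsto_const_iff)
  then have "inner y ?X = (norm y)^2" by (simp add: inner_diff_right power2_norm_eq_inner)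
  moreover have "norm y = norm ?X" by (simp add: norm_has_FT[OF y] L2norm_inv_FT)
  ultimately have "(norm (?X - y))^2 = 0"
    by (simp add: power2_norm_eq_inner inner_simps inner_commute norm_eq_sqrt_inner)
  with y show ?thesis by simp
qed

theorem has_FT_surj: obtains f where "has_FT f x"
proof -
  let ?X = "\<lambda>n. rmult (cut (real n)) x" and ?f = "\<lambda>n t. cx (inv_FT x (real n) t)"
  have X: "?X \<longlonglongrightarrow> x" by (rule rmult_cut_tendsto)
  have "L2norm (\<lambda>t. ?f m t - ?f n t) = dist (?X m) (?X n)" for m n
    by (simp add: norm_has_FT_diff[OF has_FT_inv_FT has_FT_inv_FT, symmetric] dist_norm)
  then have "\<exists>N. \<forall>m\<ge>N. \<forall>n\<ge>N. L2norm (\<lambda>t. ?f m t - ?f n t) < e" if "0 < e" for e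
    using metric_CauchyD[OF LIMSEQ_imp_Cauchy[OF X] that] by simp
  then obtain g where g: "csq_int g" "(\<lambda>n. L2norm (\<lambda>t. ?f n t - g t)) \<longlonglongrightarrow> 0"
    by (rule Riesz_Fischer[OF has_FT_csq_int[OF has_FT_inv_FT]])
  have [measurable]: "g \<in> meas" "inv_FT x S \<in> meas" for S
    using csq_intD[OF g(1)] sq_int_measurable[OF sq_int_inv_FT] by auto
  have "(cmod (cx (Re (g t))))^2 <= (cmod (g t))^2" for t by (rule power_mono) (simp_all add: abs_Re_le_cmod)
  then have Re_g: "csq_int (\<lambda>t. cx (Re (g t)))"
    using g(1) by (intro csq_int_bound[where h = "\<lambda>t. (cmod (g t))^2"]) (auto simp: csq_int_def)
  have "L2norm (\<lambda>t. ?f n t - cx (Re (g t))) <= L2norm (\<lambda>t. ?f n t - g t)" for n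
    unfolding L2norm_def
  proof (intro real_sqrt_le_mono integral_mono)
    note csq = has_FT_csq_int[OF has_FT_inv_FT]
    show "integrable lborel (\<lambda>t. (cmod (?f n t - cx (Re (g t))))^2)" "integrable lborel (\<lambda>t. (cmod (?f n t - g t))^2)"
      using csq_int_diff[OF csq Re_g] csq_int_diff[OF csq g(1)] by (auto simp: csq_int_def)
    show "(cmod (?f n t - cx (Re (g t))))^2 <= (cmod (?f n t - g t))^2" for t
      using abs_Re_le_cmod[of "?f n t - g t"] by (intro power_mono) (auto simp flip: of_real_diff)
  qed
  then have "(\<lambda>n. L2norm (\<lambda>t. ?f n t - cx (Re (g t)))) \<longlonglongrightarrow> 0"
    by (intro Lim_null_comparison[OF always_eventually g(2)]) simp
  from has_FT_L2norm_limit[OF has_FT_inv_FT this _ X] Re_g show thesis using that by (simp add: sq_int_iff_csq_int)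
qed

lemma Fourier_inversion:
  assumes f: "has_FT f x" and x: "integrable lborel (fun_of x)"
  shows "AE t in lborel. cx (f t) = fourier (fun_of x) (- t)"
proof -
  let ?h = "\<lambda>n t. cx (f t) - cx (inv_FT x (real n) t)" and ?g = "\<lambda>t. cx (f t) - fourier (fun_of x) (- t)"
  have [measurable]: "f \<in> meas" "fourier (fun_of x) \<in> meas"
    using sq_int_measurable[OF has_FT_sq[OF f]] by (auto intro: fourier_measurable)
  have csq_int_h: "csq_int (?h n)" for n by (intro csq_int_diff has_FT_csq_int[OF f] has_FT_csq_int[OF has_FT_inv_FT])
  have "(\<lambda>n. norm (x - rmult (cut (real n)) x)) \<longlonglongrightarrow> norm (x - x)"
    by (intro tendsto_intros rmult_cut_tendsto)
  then have lim: "(\<lambda>n. L2norm (?h n)) \<longlonglongrightarrow> 0" by (simp add: norm_has_FT_diff[OF f has_FT_inv_FT])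
  have "(\<lambda>n. cx (inv_FT x (real n) t)) \<longlonglongrightarrow> fourier (fun_of x) (- t)" for t
    unfolding inv_FT_complex fourier_def
  proof (intro tendsto_mult tendsto_const Bochner_Integration.integral_dominated_convergence)
    show "integrable lborel (\<lambda>u. cmod (fun_of x u))" using x by simp
    have "(\<lambda>n. cx (cut (real n) u) * fun_of x u * cis (- (u * - t))) \<longlonglongrightarrow> cx 1 * fun_of x u * cis (- (u * - t))" for u
      by (intro tendsto_intros cut_tendsto)
    then show "AE u in lborel. (\<lambda>n. cx (cut (real n) u) * fun_of x u * cis (- (u * - t))) \<longlonglongrightarrow> fun_of x u * cis (- (u * - t))"
      by simp
  qed (auto simp: norm_mult cut_def)
  then have "AE t in lborel. (\<lambda>n. ?h n t) \<longlonglongrightarrow> ?g t" by (intro AE_I2 tendsto_intros)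
  note Fatou = L2norm_Fatou[OF csq_int_h _ this]
  have "\<forall>\<^sub>F n in sequentially. L2norm (?h n) <= e" if "0 < e" for e
    using order_tendstoD(2)[OF lim that] by (rule eventually_mono) simp
  then have arbitrarily_small: "csq_int ?g" "L2norm ?g <= e" if "0 < e" for e using Fatou[of e] that by auto
  have "L2norm ?g = 0" using field_le_epsilon[of "L2norm ?g" 0] arbitrarily_small(2) by (simp add: order_antisym)
  from L2norm_eq_0[OF arbitrarily_small(1)[OF zero_less_one] this] show ?thesis by simp
qed

subsection \<open>Products\<close>

lemma fourier_cong_AE:
  assumes [measurable]: "f \<in> meas" "g \<in> meas" and "AE x in lborel. f x = g x" shows "fourier f u = fourier g u"
  unfolding fourier_def using assms(3) by (intro arg_cong[where f = "(*) (cx ft_const)"] integral_cong_AE) auto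

context whitham_boussinesq
begin

lemma integrable_fun_of_winv: "integrable lborel (fun_of (rmult winv x))"
proof (rule integrableI_bounded)
  have "(NN t. ennreal (cmod (fun_of (rmult winv x) t))) <= (NN t. ennreal (J t) * amp x t)"
  proof (rule nn_integral_mono_AE)
    show "AE t in lborel. ennreal (cmod (fun_of (rmult winv x) t)) <= ennreal (J t) * amp x t"
      using fun_of_rmult[OF even_sym_winv, of x]
      by eventually_elim (auto simp: norm_mult ennreal_mult'[symmetric] intro!: ennreal_leI mult_right_mono jpow_mono)
  qed
  also have "... <= ennreal (norm_J * norm x)" by (rule nn_J_amp_le)
  also have "... < \<infinity>" by simp
  finally show "(NN t. ennreal (cmod (fun_of (rmult winv x) t))) < \<infinity>" .
qed simp

definition conv_kernel :: "real => real => complex" where "conv_kernel u v = cx (ft_const * winv (u - v))"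

lemma kernel_conv_kernel: "kernel 1 conv_kernel"
  unfolding kernel_def
proof (intro conjI allI)
  show "(\<lambda>(u, v). conv_kernel u v) \<in> meas2" unfolding conv_kernel_def by measurable
  fix u v :: real
  show "conv_kernel (- u) (- v) = cnj (conv_kernel u v)" unfolding conv_kernel_def diff_minus_minus jpow_minus by simp
  have "ft_const * winv (u - v) <= 1 * J (u - v)" using ft_const by (intro mult_mono jpow_mono) auto
  moreover have "0 <= ft_const * winv (u - v)" using ft_const by simp
  ultimately show "cmod (conv_kernel u v) <= 1 * (J (u - v) + J v + J u)"
    unfolding conv_kernel_def norm_of_real mult_1 using jpow_nonneg[of "1 - s" u] jpow_nonneg[of "1 - s" v] by linarith
qed

lemma trunc_ft_mult:
  assumes f: "has_FT f (rmult winv x)" and g: "sq_int g"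
  shows "trunc_ft (\<lambda>t. f t * g t) R u = bilop_fun conv_kernel x (trunc_L2 g R) u"
proof -
  let ?x = "fun_of (rmult winv x)"
  have AE_f: "AE t in lborel. cx (f t) = fourier ?x (- t)" by (rule Fourier_inversion[OF f integrable_fun_of_winv])
  have [measurable]: "f \<in> meas" "g \<in> meas" "trunc g R \<in> meas" "fourier ?x \<in> meas" "trunc_ft g R \<in> meas"
    using sq_int_measurable[OF has_FT_sq[OF f]] sq_int_measurable[OF g] sq_int_measurable[OF sq_int_trunc[OF g]]
    by (auto simp: trunc_ft_fourier intro!: fourier_measurable)
  have "trunc_ft (\<lambda>t. f t * g t) R u = fourier (\<lambda>t. cx (trunc g R t) * fourier ?x (- t)) u"
    unfolding trunc_ft_fourier
  proof (rule fourier_cong_AE)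
    show "AE t in lborel. cx (trunc (\<lambda>t. f t * g t) R t) = cx (trunc g R t) * fourier ?x (- t)"
      using AE_f by eventually_elim (simp add: trunc_def[of "\<lambda>t. f t * g t"] trunc_def[of g] mult_ac)
  qed (unfold trunc_def, measurable)
  also have "... = cx ft_const * (LBINT v. ?x v * trunc_ft g R (u - v))"
    unfolding trunc_ft_fourier by (rule fourier_mult_fourier[OF integrable_fun_of_winv integrable_trunc[OF g]])
  also have "(LBINT v. ?x v * trunc_ft g R (u - v)) = (LBINT v. ?x (u - v) * trunc_ft g R (u - (u - v)))"
    by (rule integral_reflect_shift[symmetric])
  also have "... = (LBINT v. cx (winv (u - v)) * fun_of x (u - v) * fun_of (trunc_L2 g R) v)"
  proof (rule integral_cong_AE)
    show "AE v in lborel. ?x (u - v) * trunc_ft g R (u - (u - v)) = cx (winv (u - v)) * fun_of x (u - v) * fun_of (trunc_L2 g R) v"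
      using AE_lborel_reflect_shift[OF fun_of_rmult[OF even_sym_winv, of x], of u] fun_of_L2_of[OF herm_sq_int_trunc_ft[OF g, of R]]
      unfolding trunc_L2_def by eventually_elim simp
  qed measurable
  finally show ?thesis by (simp add: bilop_fun_def conv_kernel_def mult.assoc)
qed

theorem has_FT_mult:
  assumes f: "has_FT f (rmult winv x)" and g: "has_FT g y"
  shows "has_FT (\<lambda>t. f t * g t) (bilop conv_kernel x y)"
proof -
  note sq_g = has_FT_sq[OF g]
  have [measurable]: "f \<in> meas" "g \<in> meas" "fourier (fun_of (rmult winv x)) \<in> meas"
    using sq_int_measurable[OF has_FT_sq[OF f]] sq_int_measurable[OF sq_g] by (auto intro: fourier_measurable)
  have "csq_int (\<lambda>t. fourier (fun_of (rmult winv x)) (- t) * cx (g t))"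
    by (rule csq_int_mult_bounded[OF has_FT_csq_int[OF g]]) (auto intro: cmod_fourier_le)
  then have "csq_int (\<lambda>t. cx (f t * g t))"
    by (rule csq_int_cong_AE) (use Fourier_inversion[OF f integrable_fun_of_winv] in auto)
  moreover have "trunc_L2 (\<lambda>t. f t * g t) = (\<lambda>R. bilop conv_kernel x (trunc_L2 g R))"
    unfolding trunc_L2_def[of "\<lambda>t. f t * g t"] bilop_def trunc_ft_mult[OF f sq_g, abs_def] ..
  moreover have "((\<lambda>R. bilop conv_kernel x (trunc_L2 g R)) \<longlongrightarrow> bilop conv_kernel x y) at_top"
    using g by (intro bounded_bilinear.tendsto[OF bounded_bilinear_bilop[OF kernel_conv_kernel]]) (auto simp: has_FT_def)
  ultimately show ?thesis by (simp add: has_FT_def sq_int_iff_csq_int)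
qed

end

subsection \<open>Test functions\<close>

lemma test_fun_continuous: "test_fun \<phi> \<phi>' ==> continuous_on UNIV \<phi>"
  unfolding test_fun_def by (blast intro: continuous_at_imp_continuous_on DERIV_isCont)

lemma test_fun_vanish:
  assumes "test_fun \<phi> \<phi>'"
  obtains R where "0 < R" "\<And>x. \<bar>x\<bar> > R ==> \<phi> x = 0" "\<And>x. \<bar>x\<bar> > R ==> \<phi>' x = 0"
proof -
  obtain R where R: "\<And>x. \<bar>x\<bar> > R ==> \<phi> x = 0" using assms by (auto simp: test_fun_def)
  have "\<phi>' x = 0" if "\<bar>x\<bar> > R" for x
  proof -
    have "open {y::real. R < \<bar>y\<bar>}" by (intro open_Collect_less continuous_intros)
    then have "\<forall>\<^sub>F y in nhds x. R < \<bar>y\<bar>" using that by (auto simp: eventually_nhds)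
    then have "\<forall>\<^sub>F y in nhds x. \<phi> y = 0" by (rule eventually_mono) (rule R)
    then have "(\<phi> has_real_derivative 0) (at x)" by (subst DERIV_cong_ev[where g = "\<lambda>_. 0" and y = x]) auto
    moreover have "(\<phi> has_real_derivative \<phi>' x) (at x)" using assms by (simp add: test_fun_def)
    ultimately show ?thesis by (rule DERIV_unique[rotated])
  qed
  with R show thesis by (intro that[of "max R 1"]) auto
qed

lemma csq_supp_continuous:
  fixes u :: "real => real"
  assumes "continuous_on UNIV u" "\<And>x. \<bar>x\<bar> > R ==> u x = 0" shows "csq_supp R (\<lambda>x. cx (u x))"
proof -
  have "integrable lborel (\<lambda>x. indicator {-R..R} x *\<^sub>R (u x)^2)"
    by (intro borel_integrable_compact continuous_intros continuous_on_subset[OF assms(1)]) auto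
  also have "(\<lambda>x. indicator {-R..R} x *\<^sub>R (u x)^2) = (\<lambda>x. (u x)^2)"
  proof
    fix x show "indicator {-R..R} x *\<^sub>R (u x)^2 = (u x)^2"
      using assms(2)[of x] by (cases "\<bar>x\<bar> > R") (auto simp: indicator_def)
  qed
  finally show ?thesis
    using assms(2) borel_measurable_continuous_onI[OF assms(1)] by (simp add: csq_supp_def csq_int_def)
qed

lemma fourier_deriv:
  fixes \<phi> \<phi>' :: "real => real"
  assumes d: "\<And>x. (\<phi> has_real_derivative \<phi>' x) (at x)"
    and cont: "continuous_on UNIV \<phi>" "continuous_on UNIV \<phi>'"
    and R: "0 < R" and supp: "csq_supp R (\<lambda>x. cx (\<phi> x))" "csq_supp R (\<lambda>x. cx (\<phi>' x))"
  shows "fourier (\<lambda>x. cx (\<phi>' x)) p = \<i> * cx p * fourier (\<lambda>x. cx (\<phi> x)) p"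
proof -
  let ?F = "\<lambda>x. cx (\<phi> x) * cis (- (x * p))" and ?I = "{- (R + 1)..R + 1}"
  let ?f = "\<lambda>x. cx (\<phi>' x) * cis (- (x * p)) + - \<i> * cx p * (cx (\<phi> x) * cis (- (x * p)))"
  have cis: "((\<lambda>x. cis (- (x * p))) has_vector_derivative - \<i> * cx p * cis (- (x * p))) (at x within A)" for x A
    using exp_scaleR_has_vector_derivative_right[of "- \<i> * cx p" x A]
    by (simp add: cis_conv_exp scaleR_conv_of_real mult_ac)
  have "(LBINT x. indicator ?I x *\<^sub>R ?f x) = ?F (R + 1) - ?F (- (R + 1))"
  proof (rule integral_FTC_Icc)
    show "(?F has_vector_derivative ?f x) (at x within ?I)" for x
      using has_vector_derivative_mult[OF has_vector_derivative_of_real[OF has_field_derivative_at_within[OF d]] cis, of x ?I]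
      by (simp add: mult_ac)
    show "continuous_on ?I ?f"
      by (intro continuous_intros continuous_on_subset[OF cont(1)] continuous_on_subset[OF cont(2)]) auto
  qed (use R in simp)
  moreover have "indicator ?I x *\<^sub>R ?f x = ?f x" for x
    using csq_supp_0[OF supp(1), of x] csq_supp_0[OF supp(2), of x] by (cases "\<bar>x\<bar> > R") (auto simp: indicator_def)
  ultimately have zero: "(LBINT x. ?f x) = 0"
    using R csq_supp_0[OF supp(1), of "R + 1"] csq_supp_0[OF supp(1), of "- (R + 1)"] by simp
  note int = integrable_mult_cis[OF csq_supp_integrable[OF supp(2)], of p] integrable_mult_cis[OF csq_supp_integrable[OF supp(1)], of p]
  have "(LBINT x. cx (\<phi>' x) * cis (- (x * p))) = \<i> * cx p * (LBINT x. cx (\<phi> x) * cis (- (x * p)))"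
    using zero Bochner_Integration.integral_add[OF int(1) integrable_mult_right[OF int(2)], of "- \<i> * cx p"] by simp
  then show ?thesis by (simp add: fourier_def)
qed

lemma has_FT_compact:
  assumes "csq_supp R (\<lambda>x. cx (f x))"
  shows "has_FT f (L2_of (fourier (\<lambda>x. cx (f x))))" "herm_sq_int (fourier (\<lambda>x. cx (f x)))"
proof -
  have f: "sq_int f" using csq_supp_csq_int[OF assms] by (simp add: sq_int_iff_csq_int)
  have "trunc f R x = f x" for x using csq_supp_0[OF assms, of x] by (cases "\<bar>x\<bar> > R") (auto simp: trunc_eq trunc_eq_0)
  then have "trunc f R = f" by (rule ext)
  then show "has_FT f (L2_of (fourier (\<lambda>x. cx (f x))))" "herm_sq_int (fourier (\<lambda>x. cx (f x)))"
    using has_FT_trunc[OF f, of R] herm_sq_int_trunc_ft[OF f, of R] by (simp_all add: trunc_L2_def trunc_ft_fourier)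
qed

lemma test_fun_has_FT:
  assumes "test_fun \<phi> \<phi>'"
  obtains P P' where "has_FT \<phi> P" "has_FT \<phi>' P'" "AE p in lborel. fun_of P' p = \<i> * cx p * fun_of P p"
proof -
  have d: "\<And>x. (\<phi> has_real_derivative \<phi>' x) (at x)"
    and cont: "continuous_on UNIV \<phi>" "continuous_on UNIV \<phi>'"
    using assms test_fun_continuous[OF assms] by (auto simp: test_fun_def)
  obtain R where R: "0 < R" "\<And>x. \<bar>x\<bar> > R ==> \<phi> x = 0" "\<And>x. \<bar>x\<bar> > R ==> \<phi>' x = 0"
    by (rule test_fun_vanish[OF assms]) blast
  have supp: "csq_supp R (\<lambda>x. cx (\<phi> x))" "csq_supp R (\<lambda>x. cx (\<phi>' x))"
    using csq_supp_continuous[OF cont(1)] csq_supp_continuous[OF cont(2)] R(2,3) by blast+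
  note FT = has_FT_compact[OF supp(1)] and FT' = has_FT_compact[OF supp(2)]
  have "AE p in lborel. fun_of (L2_of (fourier (\<lambda>x. cx (\<phi>' x)))) p = \<i> * cx p * fun_of (L2_of (fourier (\<lambda>x. cx (\<phi> x)))) p"
    using fun_of_L2_of[OF FT(2)] fun_of_L2_of[OF FT'(2)]
    by eventually_elim (simp add: fourier_deriv[OF d cont R(1) supp])
  with FT(1) FT'(1) show thesis by (rule that)
qed

lemma continuous_antiderivative:
  fixes g :: "real => real"
  assumes "continuous_on UNIV g" obtains G where "\<And>x. (G has_real_derivative g x) (at x)"
proof -
  have "\<exists>F. \<forall>x::real. (-\<infinity>) < ereal x \<longrightarrow> ereal x < \<infinity> \<longrightarrow> (F has_vector_derivative g x) (at x)"
    using assms by (intro einterval_antiderivative) (auto simp: continuous_on_eq_continuous_at)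
  then show thesis using that by (auto simp: has_real_derivative_iff_has_vector_derivative)
qed

text \<open>The approximations are the difference quotients of an antiderivative.\<close>
lemma test_fun_approximation:
  fixes g :: "real => real"
  assumes g: "continuous_on UNIV g" "\<And>x. \<bar>g x\<bar> <= B" "\<And>x. \<bar>x\<bar> > R ==> g x = 0"
  obtains p p' where "\<And>n::nat. test_fun (p n) (p' n)" "\<And>n x. \<bar>p n x\<bar> <= B"
    "\<And>n x. \<bar>x\<bar> > R + 1 ==> p n x = 0" "\<And>x. (\<lambda>n. p n x) \<longlonglongrightarrow> g x"
proof -
  obtain G where G: "\<And>x. (G has_real_derivative g x) (at x)" by (rule continuous_antiderivative[OF g(1)]) blast
  define e where "e n = inverse (real (Suc n))" for n
  have e: "0 < e n" "e n <= 1" for n by (auto simp: e_def inverse_le_1_iff)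
  define p p' where "p n x = (G (x + e n) - G x) / e n" and "p' n x = (g (x + e n) - g x) / e n" for n x
  have "\<forall>n x. \<exists>z. x < z \<and> z < x + e n \<and> p n x = g z"
  proof (intro allI)
    fix n x
    obtain z where "x < z" "z < x + e n" "G (x + e n) - G x = (x + e n - x) * g z"
      using MVT2[of x "x + e n" G g] G e(1)[of n] by auto
    then show "\<exists>z. x < z \<and> z < x + e n \<and> p n x = g z" using e(1)[of n] by (auto simp: p_def)
  qed
  then obtain z where z: "\<And>x n. x < z n x \<and> z n x < x + e n \<and> p n x = g (z n x)" by metis
  have vanish: "p n x = 0" if "\<bar>x\<bar> > R + 1" for n x
    using z[of x n] e(2)[of n] that by (auto intro!: g(3))
  have test: "test_fun (p n) (p' n)" for n
    unfolding test_fun_def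
  proof (intro conjI allI)
    show "(p n has_real_derivative p' n x) (at x)" for x
      unfolding p_def p'_def using G[of "x + e n"] by (intro DERIV_cdivide DERIV_diff G) (simp add: DERIV_shift)
    show "continuous_on UNIV (p' n)"
      using e(1)[of n] unfolding p'_def by (intro continuous_intros g(1) continuous_on_compose2[OF g(1)]) auto
    show "\<exists>R. \<forall>x. R < \<bar>x\<bar> \<longrightarrow> p n x = 0" using vanish by blast
  qed
  have "(\<lambda>n. p n x) \<longlonglongrightarrow> g x" for x
  proof -
    have "(\<lambda>n. x + e n) \<longlonglongrightarrow> x" unfolding e_def
      using tendsto_add[OF tendsto_const LIMSEQ_inverse_real_of_nat, of x] by simp
    then have "(\<lambda>n. z n x) \<longlonglongrightarrow> x"
      by (rule tendsto_sandwich[OF _ _ tendsto_const, rotated 2]) (use z in \<open>auto intro!: always_eventually less_imp_le\<close>)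
    moreover have "isCont g x" using g(1) by (simp add: continuous_on_eq_continuous_at)
    ultimately have "(\<lambda>n. g (z n x)) \<longlonglongrightarrow> g x" by (rule isCont_tendsto_compose[rotated])
    then show ?thesis using z by simp
  qed
  moreover have "\<bar>p n x\<bar> <= B" for n x using z[of x n] g(2) by simp
  ultimately show thesis by (intro that[of p p'] test vanish)
qed

context
  fixes d :: "real => real"
  assumes d: "sq_int d" and orthogonal: "\<And>\<phi> \<phi>'. test_fun \<phi> \<phi>' ==> (LBINT x. d x * \<phi> x) = 0"
begin

lemma integral_mult_continuous_eq_0:
  fixes g :: "real => real"
  assumes g: "continuous_on UNIV g" "\<And>x. \<bar>g x\<bar> <= B" "\<And>x. \<bar>x\<bar> > R ==> g x = 0"
  shows "(LBINT x. d x * g x) = 0"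
proof -
  obtain p p' where p: "\<And>n::nat. test_fun (p n) (p' n)" "\<And>n x. \<bar>p n x\<bar> <= B"
    "\<And>n x. \<bar>x\<bar> > R + 1 ==> p n x = 0" "\<And>x. (\<lambda>n. p n x) \<longlonglongrightarrow> g x"
      by (rule test_fun_approximation[OF g(1,2), of R]) (blast intro: g(3), blast)
  have [measurable]: "d \<in> meas" "g \<in> meas" "p n \<in> meas" for n
    using sq_int_measurable[OF d] borel_measurable_continuous_onI[OF g(1)] borel_measurable_continuous_onI[OF test_fun_continuous[OF p(1)]] by auto
  have "(\<lambda>n. \<integral>x. d x * p n x \<partial>lborel) \<longlonglongrightarrow> (LBINT x. d x * g x)"
  proof (rule Bochner_Integration.integral_dominated_convergence)
    show "integrable lborel (\<lambda>x. \<bar>trunc d (R + 1) x\<bar> * B)"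
      using integrable_norm[OF integrable_trunc[OF d, of "R + 1"]] by simp
    have "\<bar>d x * p n x\<bar> <= \<bar>trunc d (R + 1) x\<bar> * B" for n x
      using p(2)[of n x] p(3)[of x n] by (cases "\<bar>x\<bar> > R + 1") (auto simp: trunc_eq trunc_eq_0 abs_mult mult_left_mono)
    then show "AE x in lborel. norm (d x * p n x) <= \<bar>trunc d (R + 1) x\<bar> * B" for n by simp
    show "AE x in lborel. (\<lambda>n. d x * p n x) \<longlonglongrightarrow> d x * g x" by (intro AE_I2 tendsto_intros p(4))
  qed measurable
  then show ?thesis using orthogonal[OF p(1)] by (simp add: LIMSEQ_const_iff)
qed

lemma L2norm_trunc_eq_0: "L2norm (\<lambda>x. cx (trunc d R x)) = 0"
proof -
  let ?u = "\<lambda>x. cx (trunc d R x)"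
  note u = csq_int_trunc[OF d, of R]
  have csq_d: "csq_int (\<lambda>x. cx (d x))" using d by (simp add: sq_int_iff_csq_int)
  have "(L2norm ?u)^2 <= L2norm (\<lambda>x. cx (d x)) * e" if e: "0 < e" for e
  proof -
    obtain g B where g: "continuous_on UNIV g" "\<And>x. cmod (g x) <= B" "csq_supp (R + 1) g"
      and close: "L2norm (\<lambda>x. ?u x - g x) < e"
      by (rule L2_dense_continuous[OF csq_supp_trunc[OF d, of R] e]) blast
    note csq_g = csq_supp_csq_int[OF g(3)]
    have "(LBINT x. d x * Re (g x)) = 0" "(LBINT x. d x * Im (g x)) = 0"
      by (rule integral_mult_continuous_eq_0[where B = B and R = "R + 1"];
          use g csq_supp_0[OF g(3)] in \<open>auto intro!: continuous_intros order_trans[OF abs_Re_le_cmod] order_trans[OF abs_Im_le_cmod]\<close>)+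
    then have "(LBINT x. cx (d x) * g x) = 0"
      using csq_int_mult_integrable[OF csq_d csq_g]
      by (intro complex_eqI) (simp_all add: integral_Re[symmetric] integral_Im[symmetric])
    moreover have "cx (d x) * ?u x = cx ((cmod (?u x))^2)" for x
      unfolding norm_of_real power2_abs by (auto simp: trunc_def indicator_def power2_eq_square)
    then have "(LBINT x. cx (d x) * ?u x) = cx ((L2norm ?u)^2)"
      by (simp only: L2norm_sq integral_complex_of_real)
    ultimately have "cx ((L2norm ?u)^2) = (LBINT x. cx (d x) * (?u x - g x))"
      using csq_int_mult_integrable[OF csq_d u] csq_int_mult_integrable[OF csq_d csq_g] by (simp add: right_diff_distrib)
    then have "(L2norm ?u)^2 = cmod (LBINT x. cx (d x) * (?u x - g x))" by (metis norm_of_real abs_power2)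
    also have "... <= L2norm (\<lambda>x. cx (d x)) * e"
      using close by (intro order_trans[OF L2norm_Cauchy_Schwarz[OF csq_d csq_int_diff[OF u csq_g]]] mult_left_mono) auto
    finally show ?thesis .
  qed
  moreover have "((\<lambda>e. L2norm (\<lambda>x. cx (d x)) * e) \<longlongrightarrow> L2norm (\<lambda>x. cx (d x)) * 0) (at_right 0)" by (intro tendsto_intros)
  ultimately have "(L2norm ?u)^2 <= L2norm (\<lambda>x. cx (d x)) * 0"
    by (intro tendsto_lowerbound) (auto simp: eventually_at_right_less intro: eventually_at_rightI[of 0 1])
  then show ?thesis by simp
qed

theorem du_Bois_Reymond: "AE x in lborel. d x = 0"
proof -
  have "AE x in lborel. \<forall>n. trunc d (real n) x = 0"
    using L2norm_eq_0[OF csq_int_trunc[OF d] L2norm_trunc_eq_0] by (simp add: AE_all_countable)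
  then show ?thesis
  proof eventually_elim
    case (elim x)
    obtain n where "\<bar>x\<bar> <= real n" using real_arch_simple by blast
    then show ?case using elim trunc_eq[of x "real n" d] by simp
  qed
qed

end

section \<open>Products and the change of unknown\<close>

lemma has_vector_derivative_iff_quotient:
  "(f has_vector_derivative D) (at t within S) \<longleftrightarrow> ((\<lambda>y. (1 / (y - t)) *\<^sub>R (f y - f t)) \<longlongrightarrow> D) (at t within S)"
proof -
  have quotient: "norm (f y - f t - (y - t) *\<^sub>R D) / norm (y - t) = norm ((1 / (y - t)) *\<^sub>R (f y - f t) - D)" if "y \<noteq> t" for y
  proof -
    have "(1 / (y - t)) *\<^sub>R (f y - f t) - D = (1 / (y - t)) *\<^sub>R (f y - f t - (y - t) *\<^sub>R D)"
      using that by (simp add: scaleR_diff_right)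
    then show ?thesis by (simp add: divide_inverse mult.commute)
  qed
  have "(f has_vector_derivative D) (at t within S)
      \<longleftrightarrow> ((\<lambda>y. norm (f y - f t - (y - t) *\<^sub>R D) / norm (y - t)) \<longlongrightarrow> 0) (at t within S)"
    unfolding has_vector_derivative_def has_derivative_iff_norm by (simp add: bounded_linear_scaleR_left)
  also have "... \<longleftrightarrow> ((\<lambda>y. norm ((1 / (y - t)) *\<^sub>R (f y - f t) - D)) \<longlongrightarrow> 0) (at t within S)"
    using quotient by (intro filterlim_cong refl) (simp add: eventually_at_filter del: real_norm_def)
  also have "... \<longleftrightarrow> ((\<lambda>y. (1 / (y - t)) *\<^sub>R (f y - f t)) \<longlongrightarrow> D) (at t within S)"
    by (simp add: tendsto_norm_zero_iff LIM_zero_iff)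
  finally show ?thesis .
qed

lemma tendsto_within_norm_diff_le:
  fixes f :: "'a::topological_space => 'b::real_normed_vector"
  assumes "(h \<longlongrightarrow> 0) (at t within S)" "\<And>y. y \<in> S ==> norm (f y - l) <= C * norm (h y)"
  shows "(f \<longlongrightarrow> l) (at t within S)"
proof -
  have "((\<lambda>y. C * norm (h y)) \<longlongrightarrow> 0) (at t within S)" using assms(1)
    by (intro tendsto_mult_right_zero tendsto_norm_zero)
  moreover have "\<forall>\<^sub>F y in at t within S. norm (f y - l) <= C * norm (h y)"
    using assms(2) by (simp add: eventually_at_filter always_eventually)
  ultimately have "((\<lambda>y. f y - l) \<longlongrightarrow> 0) (at t within S)" by (rule Lim_null_comparison[rotated])
  then show ?thesis by (rule LIM_zero_cancel)
qed

lemma continuous_bootstrap: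
  fixes f :: "real => real"
  assumes cont: "continuous_on {0..T} f" and ab: "a < b" and init: "f 0 <= b"
    and step: "\<And>S. S \<in> {0..T} ==> (\<And>t. t \<in> {0..S} ==> f t <= b) ==> f S <= a" and t: "t \<in> {0..T}"
  shows "f t <= b"
proof (rule ccontr)
  assume "\<not> f t <= b"
  let ?B = "{t \<in> {0..T}. f t = b}"
  have hit: "\<exists>u\<in>{0..t}. f u = b" if "t \<in> {0..T}" "b < f t" for t
    using IVT'[of f 0 b t] that init continuous_on_subset[OF cont, of "{0..t}"] by auto
  have "closed ?B"
    using continuous_closed_preimage[OF cont closed_atLeastAtMost closed_singleton[of b]] by (simp add: vimage_def Int_def)
  moreover have "?B \<noteq> {}" "bdd_below ?B" using hit[OF t] t \<open>\<not> f t <= b\<close>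
    by (fastforce, auto intro!: bdd_belowI[of _ 0])
  ultimately have S: "Inf ?B \<in> ?B" by (intro closed_contains_Inf)
  have "f u <= b" if u: "u \<in> {0..Inf ?B}" for u
  proof (rule ccontr)
    assume "\<not> f u <= b"
    then obtain w where w: "w \<in> {0..u}" "f w = b" using hit[of u] u S by auto
    then have "Inf ?B <= w" using u S by (intro cInf_lower bdd_belowI[of _ 0]) auto
    then have "w = u" using w u by auto
    then show False using w \<open>\<not> f u <= b\<close> by simp
  qed
  then have "f (Inf ?B) <= a" using S by (intro step) auto
  then show False using S ab by simp
qed

lemma rmult_inj: "even_sym C a ==> (\<And>t. a t \<noteq> 0) ==> rmult a x = rmult a y ==> x = y"
  using rmult_eq_0D[of C a "x - y"] linear_diff[OF bounded_linear.linear[OF bounded_linear_rmult], of C a x y] by simp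

lemma herm_sym_one: "herm_sym 1 (\<lambda>_. 1)" by (simp add: herm_sym_def)

context whitham_boussinesq
begin

text \<open>Multiplication of physical functions on the Fourier side, for a first factor represented at level \<open>s\<close>
  and a second factor and product represented at level \<open>r\<close>.\<close>
definition prod_kernel :: "real => real => real => complex" where
  "prod_kernel r u v = cx (ft_const * jpow r u / (wgt (u - v) * jpow r v))"
definition prod_at :: "real => hl2 => hl2 => hl2" where "prod_at r = bilop (prod_kernel r)"
abbreviation "prod_s \<equiv> prod_at s"
abbreviation "prod_s1 \<equiv> prod_at (s - 1)"

definition C_prod :: real where "C_prod = 2 ^ deg_s * C_bil + 1"

lemma C_prod: "1 <= C_prod" "0 < C_prod" by (auto simp: C_prod_def add_nonneg_pos)

lemma kernel_prod_kernel:
  assumes r: "s - 1 <= r" "r <= s" shows "kernel (2 ^ deg_s) (prod_kernel r)"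
  unfolding kernel_def
proof (intro conjI allI)
  show "(\<lambda>(u, v). prod_kernel r u v) \<in> meas2" unfolding prod_kernel_def by measurable
  fix u v :: real
  show "prod_kernel r (- u) (- v) = cnj (prod_kernel r u v)"
    unfolding prod_kernel_def diff_minus_minus jpow_minus by simp
  have slow: "slow deg_s (jpow r)"
    using r s_nonneg(2) s_le_nat_ceiling by (intro slow_jpow) (simp, unfold deg_s_def of_nat_add, linarith)
  have weights_le: "jpow r (u - v) / wgt (u - v) <= 1" "1 / jpow r v <= J v"
    using r jpow_mono[of r s "u - v"] jpow_mono[of "- r" "1 - s" v] by (simp_all add: jpow_uminus)
  have "cmod (prod_kernel r u v) = ft_const * (jpow r u / (wgt (u - v) * jpow r v))"
    unfolding prod_kernel_def norm_of_real using ft_const(1) by simp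
  also have "... <= 1 * ((2 ^ deg_s * (jpow r (u - v) + jpow r v)) / (wgt (u - v) * jpow r v))"
    using ft_const slow_le_add[OF slow, of u v] by (intro mult_mono divide_right_mono) auto
  also have "... = 2 ^ deg_s * (1 / wgt (u - v) + jpow r (u - v) / wgt (u - v) * (1 / jpow r v))" by (simp add: field_simps)
  also have "... <= 2 ^ deg_s * (J (u - v) + 1 * J v)"
    by (intro mult_left_mono add_mono mult_mono winv_le_J weights_le) auto
  also have "... <= 2 ^ deg_s * (J (u - v) + J v + J u)" by simp
  finally show "cmod (prod_kernel r u v) <= 2 ^ deg_s * (J (u - v) + J v + J u)" .
qed

lemma kernel_prod_s: "kernel (2 ^ deg_s) (prod_kernel s)" and kernel_prod_s1: "kernel (2 ^ deg_s) (prod_kernel (s - 1))"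
  by (rule kernel_prod_kernel; simp)+

lemma bilinear_prod_s: "bounded_bilinear prod_s" and bilinear_prod_s1: "bounded_bilinear prod_s1"
  unfolding prod_at_def by (rule bounded_bilinear_bilop[OF kernel_prod_s] bounded_bilinear_bilop[OF kernel_prod_s1])+

sublocale prod_s: bounded_bilinear prod_s by (rule bilinear_prod_s)
sublocale prod_s1: bounded_bilinear prod_s1 by (rule bilinear_prod_s1)

lemma norm_prod_at_le: assumes "s - 1 <= r" "r <= s" shows "norm (prod_at r x y) <= C_prod * norm x * norm y"
proof -
  have "2 ^ deg_s * C_bil * norm x * norm y <= C_prod * norm x * norm y" by (intro mult_right_mono) (auto simp: C_prod_def)
  then show ?thesis unfolding prod_at_def using norm_bilop_le[OF kernel_prod_kernel[OF assms], of x y] by linarith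
qed

lemma prod_s_commute: "prod_s x y = prod_s y x"
  unfolding prod_at_def bilop_swap[OF kernel_prod_s, of x y]
  by (rule arg_cong2[of _ _ _ _ "\<lambda>k z. bilop k z x"]) (auto simp: prod_kernel_def fun_eq_iff mult.commute)

lemma fmult_prod_s1:
  assumes "herm_sym M m" "herm_sym A a" "herm_sym B b"
  shows "fmult m (prod_s1 (fmult a x) (fmult b y)) = bilop (\<lambda>u v. m u * prod_kernel (s - 1) u v * a (u - v) * b v) x y"
  unfolding prod_at_def by (rule fmult_bilop_fmult[OF kernel_prod_s1 assms(2,3,1)])

lemma rmult_bilop_rmult_cong:
  assumes "kernel K k" "even_sym A a" "kernel L l" "even_sym B b" "\<And>u v. cx (a u) * k u v = l u v * cx (b v)"
  shows "rmult a (bilop k x y) = bilop l x (rmult b y)"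
proof -
  have "rmult a (bilop k x y) = bilop (\<lambda>u v. cx (a u) * k u v * 1 * 1) x y"
    using fmult_bilop_fmult[OF assms(1) herm_sym_one herm_sym_one even_sym_herm_sym[OF assms(2)], of x y]
    by (simp add: fmult_one rmult_def)
  also have "... = bilop (\<lambda>u v. 1 * l u v * 1 * cx (b v)) x y" by (simp add: assms(5))
  also have "... = bilop l x (rmult b y)"
    using fmult_bilop_fmult[OF assms(3) herm_sym_one even_sym_herm_sym[OF assms(4)] herm_sym_one, of x y]
    by (simp add: fmult_one rmult_def)
  finally show ?thesis .
qed

lemma jinv_prod_s: "rmult jinv (prod_s x y) = prod_s1 x (rmult jinv y)"
  unfolding prod_at_def
  by (rule rmult_bilop_rmult_cong[OF kernel_prod_s even_sym_jinv kernel_prod_s1 even_sym_jinv])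
    (simp add: prod_kernel_def jinv_eq wgt_eq)

lemma rmult_prod_at:
  assumes r: "s - 1 <= r" "r <= s" shows "rmult (jpow (- r)) (prod_at r x y) = bilop conv_kernel x (rmult (jpow (- r)) y)"
  unfolding prod_at_def
  using r s_nonneg by (intro rmult_bilop_rmult_cong[OF kernel_prod_kernel[OF r] even_sym_jpow kernel_conv_kernel even_sym_jpow])
    (simp_all add: prod_kernel_def conv_kernel_def jpow_uminus)

lemma has_FT_prod_s:
  "has_FT f (rmult winv x) ==> has_FT g (rmult winv y) ==> has_FT (\<lambda>t. f t * g t) (rmult winv (prod_s x y))"
  using rmult_prod_at[of s x y] has_FT_mult[of f x g "rmult winv y"] by simp

lemma has_FT_prod_s1:
  "has_FT f (rmult winv x) ==> has_FT g (rmult J y) ==> has_FT (\<lambda>t. f t * g t) (rmult J (prod_s1 x y))"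
  using rmult_prod_at[of "s - 1" x y] has_FT_mult[of f x g "rmult J y"] by simp

lemma prod_s1_assoc: "prod_s1 x (prod_s1 y z) = prod_s1 (prod_s x y) z"
proof (rule rmult_inj[OF even_sym_J])
  obtain f where f: "has_FT f (rmult winv x)" by (rule has_FT_surj)
  obtain g where g: "has_FT g (rmult winv y)" by (rule has_FT_surj)
  obtain h where h: "has_FT h (rmult J z)" by (rule has_FT_surj)
  show "rmult J (prod_s1 x (prod_s1 y z)) = rmult J (prod_s1 (prod_s x y) z)"
    using has_FT_unique[OF has_FT_prod_s1[OF f has_FT_prod_s1[OF g h]]] has_FT_prod_s1[OF has_FT_prod_s[OF f g] h]
    by (simp add: mult.assoc)
qed simp

lemma prod_s1_left_commute: "prod_s1 x (prod_s1 y z) = prod_s1 y (prod_s1 x z)"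
  unfolding prod_s1_assoc prod_s_commute[of x y] ..

subsection \<open>The equations in terms of products\<close>

definition deriv_symbol :: "real => complex" where "deriv_symbol u = - \<i> * cx (u / jbr u)"
definition Dx :: "hl2 => hl2" where "Dx = fmult deriv_symbol"
definition sqrtT_op :: "hl2 => hl2" where "sqrtT_op = rmult sqrtT"
definition burgers_term :: "hl2 => hl2" where "burgers_term G = coeff_op ker_v_vx G G"

lemma herm_sym_deriv_symbol: "herm_sym 1 deriv_symbol"
  unfolding herm_sym_def
proof (intro conjI allI)
  show "deriv_symbol \<in> meas" unfolding deriv_symbol_def[abs_def] by measurable
  show "deriv_symbol (- x) = cnj (deriv_symbol x)" for x by (simp add: deriv_symbol_def)
  show "cmod (deriv_symbol x) <= 1" for x using abs_le_jbr[of x] by (simp add: deriv_symbol_def norm_mult norm_divide)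
qed

sublocale Dx: bounded_linear Dx unfolding Dx_def by (rule bounded_linear_fmult[OF herm_sym_deriv_symbol])
sublocale sqrtT_op: bounded_linear sqrtT_op unfolding sqrtT_op_def by (rule bounded_linear_rmult[OF even_sym_sqrtT])
sublocale rmult_jinv: bounded_linear "rmult jinv" by (rule bounded_linear_rmult[OF even_sym_jinv])

lemma sqrtT_op_inj: "sqrtT_op x = sqrtT_op y ==> x = y"
  unfolding sqrtT_op_def by (rule rmult_inj[OF even_sym_sqrtT]) (simp add: less_imp_neq[OF sqrtT_pos, symmetric])

lemma prod_s1_Dx: "prod_s1 x (Dx y) = bilop (\<lambda>u v. 1 * prod_kernel (s - 1) u v * 1 * deriv_symbol v) x y"
  using fmult_prod_s1[OF herm_sym_one herm_sym_one herm_sym_deriv_symbol, of x y] by (simp add: fmult_one Dx_def)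

lemma Leibniz: "Dx (prod_s x y) = prod_s1 x (Dx y) + prod_s1 y (Dx x)"
proof -
  note kernel = kernel_fmult[OF kernel_prod_s1 herm_sym_one herm_sym_deriv_symbol herm_sym_one]
  have "prod_s1 y (Dx x) = bilop (\<lambda>u v. 1 * prod_kernel (s - 1) u (u - v) * 1 * deriv_symbol (u - v)) x y"
    unfolding prod_s1_Dx by (rule bilop_swap[OF kernel])
  then have "prod_s1 x (Dx y) + prod_s1 y (Dx x)
      = bilop (\<lambda>u v. 1 * prod_kernel (s - 1) u v * 1 * deriv_symbol v + 1 * prod_kernel (s - 1) u (u - v) * 1 * deriv_symbol (u - v)) x y"
    unfolding prod_s1_Dx[of x y] by (simp only: bilop_kernel_add[OF kernel kernel_swap[OF kernel]])
  also have "... = bilop (\<lambda>u v. deriv_symbol u * prod_kernel s u v * 1 * 1) x y"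
  proof (rule arg_cong[of _ _ "\<lambda>k. bilop k x y"], intro ext)
    fix u v :: real
    have level: "prod_kernel (s - 1) u v * deriv_symbol v = - \<i> * cx (ft_const * wgt u / (jbr u * wgt (u - v) * wgt v) * v)" for u v
      by (simp add: prod_kernel_def deriv_symbol_def wgt_eq mult_ac)
    show "1 * prod_kernel (s - 1) u v * 1 * deriv_symbol v + 1 * prod_kernel (s - 1) u (u - v) * 1 * deriv_symbol (u - v)
        = deriv_symbol u * prod_kernel s u v * 1 * 1"
      unfolding mult_1_left mult_1_right level by (simp add: prod_kernel_def deriv_symbol_def field_simps)
  qed
  also have "... = Dx (prod_s x y)"
    using fmult_bilop_fmult[OF kernel_prod_s herm_sym_one herm_sym_one herm_sym_deriv_symbol, of x y]
    by (simp add: fmult_one prod_at_def Dx_def)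
  finally show ?thesis ..
qed

lemma fmult_lin_symbol: "fmult lin_symbol x = Dx (sqrtT_op x)" "fmult lin_symbol x = sqrtT_op (Dx x)"
proof -
  note sqrtT = even_sym_herm_sym[OF even_sym_sqrtT]
  have symbols: "deriv_symbol t * cx (sqrtT t) = lin_symbol t" "cx (sqrtT t) * deriv_symbol t = lin_symbol t" for t
    by (simp_all add: lin_symbol_def deriv_symbol_def sqrtT_eq)
  show "fmult lin_symbol x = Dx (sqrtT_op x)"
    unfolding Dx_def sqrtT_op_def rmult_def fmult_fmult[OF herm_sym_deriv_symbol sqrtT] symbols ..
  show "fmult lin_symbol x = sqrtT_op (Dx x)"
    unfolding Dx_def sqrtT_op_def rmult_def fmult_fmult[OF sqrtT herm_sym_deriv_symbol] symbols ..
qed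

lemma coeff_op_eq_prod_s1:
  "coeff_op ker_q_vx x y = (1/2) *\<^sub>R prod_s1 x (Dx (sqrtT_op y))"
  "coeff_op ker_v_qx x y = prod_s1 (sqrtT_op x) (Dx y)"
  "coeff_op ker_q_qx x y = (1/2) *\<^sub>R sqrtT_op (prod_s1 x (Dx y))"
  "sqrtT_op (coeff_op ker_v_vx x y) = prod_s1 (sqrtT_op x) (Dx (sqrtT_op y))"
proof -
  note sqrtT = even_sym_herm_sym[OF even_sym_sqrtT] and half = even_sym_herm_sym[OF even_sym_const[of "1/2"]]
  note half_sqrtT = even_sym_herm_sym[OF even_sym_mult[OF even_sym_const[of "1/2"] even_sym_sqrtT]]
  note defs = ikernel_def ker_defs transport_kernel_def prod_kernel_def lin_symbol_def deriv_symbol_def sqrtT_eq wgt_eq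
  have scale: "(1/2) *\<^sub>R z = fmult (\<lambda>_. cx (1/2)) z" "(1/2) *\<^sub>R sqrtT_op z = fmult (\<lambda>t. cx (1/2 * sqrtT t)) z" for z
    using rmult_rmult[OF even_sym_const even_sym_sqrtT, of "1/2" z] rmult_const[of "1/2"]
    by (simp_all add: rmult_def sqrtT_op_def)
  have "coeff_op ker_q_vx x y = fmult (\<lambda>_. cx (1/2)) (prod_s1 (fmult (\<lambda>_. 1) x) (fmult lin_symbol y))"
    unfolding fmult_prod_s1[OF half herm_sym_one herm_sym_lin_symbol] coeff_op_def
    by (rule arg_cong[of _ _ "\<lambda>k. bilop k x y"]) (simp add: defs fun_eq_iff mult_ac)
  then show "coeff_op ker_q_vx x y = (1/2) *\<^sub>R prod_s1 x (Dx (sqrtT_op y))"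
    by (simp only: fmult_one scale(1) fmult_lin_symbol(1))
  have "coeff_op ker_v_qx x y = fmult (\<lambda>_. 1) (prod_s1 (fmult (\<lambda>t. cx (sqrtT t)) x) (fmult deriv_symbol y))"
    unfolding fmult_prod_s1[OF herm_sym_one sqrtT herm_sym_deriv_symbol] coeff_op_def
    by (rule arg_cong[of _ _ "\<lambda>k. bilop k x y"]) (simp add: defs fun_eq_iff mult_ac)
  then show "coeff_op ker_v_qx x y = prod_s1 (sqrtT_op x) (Dx y)" by (simp only: fmult_one sqrtT_op_def rmult_def Dx_def)
  have "coeff_op ker_q_qx x y = fmult (\<lambda>t. cx (1/2 * sqrtT t)) (prod_s1 (fmult (\<lambda>_. 1) x) (fmult deriv_symbol y))"
    unfolding fmult_prod_s1[OF half_sqrtT herm_sym_one herm_sym_deriv_symbol] coeff_op_def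
    by (rule arg_cong[of _ _ "\<lambda>k. bilop k x y"]) (simp add: defs fun_eq_iff mult_ac)
  then show "coeff_op ker_q_qx x y = (1/2) *\<^sub>R sqrtT_op (prod_s1 x (Dx y))" by (simp only: fmult_one scale(2) Dx_def)
  have "sqrtT_op (coeff_op ker_v_vx x y) = fmult (\<lambda>t. cx (sqrtT t)) (coeff_op ker_v_vx (fmult (\<lambda>_. 1) x) (fmult (\<lambda>_. 1) y))"
    by (simp add: sqrtT_op_def rmult_def fmult_one)
  also have "... = fmult (\<lambda>_. 1) (prod_s1 (fmult (\<lambda>t. cx (sqrtT t)) x) (fmult lin_symbol y))"
    unfolding fmult_prod_s1[OF herm_sym_one sqrtT herm_sym_lin_symbol] coeff_op_def
      fmult_bilop_fmult[OF kernel_coeff[OF coeff_kernels(4)] herm_sym_one herm_sym_one sqrtT]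
    by (rule arg_cong[of _ _ "\<lambda>k. bilop k x y"]) (simp add: defs fun_eq_iff mult_ac)
  finally show "sqrtT_op (coeff_op ker_v_vx x y) = prod_s1 (sqrtT_op x) (Dx (sqrtT_op y))"
    by (simp only: fmult_one fmult_lin_symbol(1)) (simp only: sqrtT_op_def rmult_def)
qed

lemma sqrtT_op_burgers_term: "sqrtT_op (burgers_term G) = (1/2) *\<^sub>R Dx (prod_s (sqrtT_op G) (sqrtT_op G))"
  unfolding burgers_term_def coeff_op_eq_prod_s1 Leibniz by (simp add: scaleR_2[symmetric])

definition elevation :: "hl2 => hl2" where "elevation Q = Q + (1/4) *\<^sub>R prod_s Q Q"
definition elev_deriv :: "hl2 => hl2 => hl2" where "elev_deriv Q z = z + (1/2) *\<^sub>R prod_s1 Q z"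
definition elev_pair :: "state => state" where "elev_pair X = (elevation (fst X), snd X)"
definition wb_rhs :: "state => state" where
  "wb_rhs W = (Dx (sqrtT_op (snd W) + prod_s (sqrtT_op (snd W)) (fst W)), sqrtT_op (Dx (fst W)) + burgers_term (snd W))"

text \<open>With \<open>\<zeta> = q + q\<^sup>2/4\<close> one has \<open>d\<zeta>/dq = 1 + q/2\<close> and \<open>1 + \<zeta> = (1 + q/2)\<^sup>2\<close>.\<close>
lemma wb_rhs_elev_pair: "wb_rhs (elev_pair X) = (elev_deriv (fst X) (fst (sym_rhs X)), snd (sym_rhs X))"
proof -
  obtain Q G where X: "X = (Q, G)" by (cases X)
  let ?g = "sqrtT_op G"
  have rhs: "sym_rhs X = (Dx ?g + ((1/2) *\<^sub>R prod_s1 Q (Dx ?g) + prod_s1 ?g (Dx Q)),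
      sqrtT_op (Dx Q) + ((1/2) *\<^sub>R sqrtT_op (prod_s1 Q (Dx Q)) + burgers_term G))"
    unfolding X sym_rhs_def lin_op_def quad_op_def burgers_term_def
    by (simp add: coeff_op_eq_prod_s1(1-3) fmult_lin_symbol(1)[of G] fmult_lin_symbol(2)[of Q])
  have "Dx (prod_s Q Q) = 2 *\<^sub>R prod_s1 Q (Dx Q)" unfolding Leibniz by (simp add: scaleR_2)
  then have "snd (wb_rhs (elev_pair X)) = snd (sym_rhs X)"
    unfolding rhs by (simp add: X wb_rhs_def elev_pair_def elevation_def Dx.add Dx.scaleR sqrtT_op.add sqrtT_op.scaleR)
  moreover have "fst (wb_rhs (elev_pair X)) = elev_deriv (fst X) (fst (sym_rhs X))"
    unfolding rhs unfolding X wb_rhs_def elev_pair_def elevation_def elev_deriv_def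
    by (simp add: Dx.add Dx.scaleR prod_s.add_right prod_s.scaleR_right prod_s1.add_right prod_s1.scaleR_right
        prod_s1.add_left prod_s1.scaleR_left Leibniz prod_s1_assoc[symmetric] prod_s1_left_commute[of ?g Q] scaleR_add_right)
      (simp add: algebra_simps flip: scaleR_add_left)
  ultimately show ?thesis by (simp add: prod_eq_iff)
qed

subsection \<open>Inverting the change of unknown\<close>

lemma elevation_zero [simp]: "elevation 0 = 0" by (simp add: elevation_def prod_s.zero_left)
lemma elev_pair_zero [simp]: "elev_pair 0 = 0" by (simp add: elev_pair_def zero_prod_def)

lemma elevation_diff: "elevation x - elevation y = (x - y) + (1/4) *\<^sub>R prod_s (x + y) (x - y)"
proof -
  have "prod_s x x - prod_s y y = prod_s (x + y) (x - y)"
    by (simp add: prod_s.add_left prod_s.diff_right prod_s_commute[of y x])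
  then show ?thesis unfolding elevation_def by (simp add: algebra_simps flip: scaleR_diff_right)
qed

lemma norm_half_prod_at_le:
  assumes "s - 1 <= r" "r <= s" "norm q <= 1 / C_prod" shows "norm ((1/2) *\<^sub>R prod_at r q z) <= norm z / 2"
proof -
  have "norm (prod_at r q z) <= C_prod * (1 / C_prod) * norm z"
    using assms C_prod by (intro order_trans[OF norm_prod_at_le] mult_right_mono mult_left_mono) auto
  then show ?thesis using C_prod by simp
qed

lemma norm_quarter_prod_s_le:
  assumes "norm x <= 1 / C_prod" "norm y <= 1 / C_prod" shows "norm ((1/4) *\<^sub>R prod_s (x + y) z) <= norm z / 2"
  using norm_half_prod_at_le[of s "(1/2) *\<^sub>R (x + y)" z] norm_mean_le[OF assms] by (simp add: prod_s.scaleR_left)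

lemma norm_elev_deriv_ge: assumes "norm q <= 1 / C_prod" shows "norm z <= 2 * norm (elev_deriv q z)"
  using norm_half_prod_at_le[of "s - 1" q z] assms norm_triangle_ineq4[of "elev_deriv q z" "(1/2) *\<^sub>R prod_s1 q z"]
  by (simp add: elev_deriv_def)

lemma elevation_bounds:
  assumes "norm x <= 1 / C_prod" "norm y <= 1 / C_prod"
  shows "norm (elevation x - elevation y) <= 2 * norm (x - y)" "norm (x - y) <= 2 * norm (elevation x - elevation y)"
proof -
  let ?d = "(1/4) *\<^sub>R prod_s (x + y) (x - y)"
  have small: "norm ?d <= norm (x - y) / 2" by (rule norm_quarter_prod_s_le[OF assms])
  show "norm (elevation x - elevation y) <= 2 * norm (x - y)"
    unfolding elevation_diff using norm_triangle_ineq[of "x - y" ?d] small norm_ge_zero[of "x - y"] by linarith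
  show "norm (x - y) <= 2 * norm (elevation x - elevation y)"
    unfolding elevation_diff using norm_triangle_ineq4[of "(x - y) + ?d" ?d] small by (simp only: add_diff_cancel_right')
qed

lemma elevation_inverse:
  assumes F: "norm F <= 1 / (2 * C_prod)" obtains Q where "elevation Q = F" "norm Q <= 2 * norm F"
proof -
  let ?S = "cball 0 (2 * norm F) :: hl2 set" and ?f = "\<lambda>Q. F - (1/4) *\<^sub>R prod_s Q Q"
  have ball_le: "norm Q <= 1 / C_prod" if "Q \<in> ?S" for Q using that mult_left_mono[OF F, of 2] by simp
  have maps: "?f ` ?S \<subseteq> ?S"
  proof clarify
    fix Q assume Q: "Q \<in> ?S"
    have "norm ((1/4) *\<^sub>R prod_s (Q + 0) Q) <= norm Q / 2" using ball_le[OF Q] C_prod by (intro norm_quarter_prod_s_le) auto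
    then have "norm (?f Q) <= 2 * norm F" using norm_triangle_ineq4[of F "(1/4) *\<^sub>R prod_s Q Q"] Q by simp
    then show "?f Q \<in> ?S" by simp
  qed
  have lipschitz: "dist (?f x) (?f y) <= 1/2 * dist x y" if "x \<in> ?S" "y \<in> ?S" for x y
  proof -
    have "?f x - ?f y = - ((elevation x - elevation y) - (x - y))" by (simp add: elevation_def)
    then have "norm (?f x - ?f y) = norm ((1/4) *\<^sub>R prod_s (x + y) (x - y))"
      unfolding elevation_diff by (simp only: norm_minus_cancel add_diff_cancel_left')
    then show ?thesis using norm_quarter_prod_s_le[OF ball_le[OF that(1)] ball_le[OF that(2)], of "x - y"]
      by (simp only: dist_norm)
  qed
  have "\<exists>!Q\<in>?S. ?f Q = Q"
    by (rule Banach_fix[OF complete_eq_closed[THEN iffD2, OF closed_cball] _ _ _ maps lipschitz]) auto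
  then obtain Q where "norm Q <= 2 * norm F" "?f Q = Q" by auto
  then show thesis by (intro that[of Q]) (simp_all add: elevation_def algebra_simps)
qed

lemma elev_pair_bounds:
  assumes "norm X <= 1 / C_prod" "norm Y <= 1 / C_prod"
  shows "norm (elev_pair X - elev_pair Y) <= 2 * norm (X - Y)" "norm (X - Y) <= 2 * norm (elev_pair X - elev_pair Y)"
proof -
  have "norm (fst X) <= 1 / C_prod" "norm (fst Y) <= 1 / C_prod"
    using assms norm_fst_le_norm[of X] norm_fst_le_norm[of Y] by linarith+
  note bounds = elevation_bounds[OF this]
  have components: "elev_pair X - elev_pair Y = (elevation (fst X) - elevation (fst Y), snd X - snd Y)"
    "X - Y = (fst X - fst Y, snd X - snd Y)" by (simp_all add: elev_pair_def prod_eq_iff)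
  show "norm (elev_pair X - elev_pair Y) <= 2 * norm (X - Y)" "norm (X - Y) <= 2 * norm (elev_pair X - elev_pair Y)"
    unfolding components using bounds by (intro norm_Pair_mono; simp)+
qed

lemma norm_elev_pair_le: "norm X <= 1 / C_prod ==> norm (elev_pair X) <= 2 * norm X"
  using elev_pair_bounds(1)[of X 0] C_prod by simp

subsection \<open>Equivalence of the two systems\<close>

definition wb_solution :: "real => (real => state) => bool" where
  "wb_solution T W \<longleftrightarrow> continuous_on {0..T} W \<and>
     (\<forall>t\<in>{0..T}. ((\<lambda>t. rmult2 jinv (W t)) has_vector_derivative wb_rhs (W t)) (at t within {0..T}))"

lemma has_vector_derivative_rmult2_iff:
  "((\<lambda>t. rmult2 a (W t)) has_vector_derivative (D, E)) (at t within S) \<longleftrightarrow>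
    ((\<lambda>t. rmult a (fst (W t))) has_vector_derivative D) (at t within S) \<and>
    ((\<lambda>t. rmult a (snd (W t))) has_vector_derivative E) (at t within S)" (is "_ \<longleftrightarrow> ?components")
proof
  assume deriv: "((\<lambda>t. rmult2 a (W t)) has_vector_derivative (D, E)) (at t within S)"
  show ?components
    using bounded_linear.has_vector_derivative[OF bounded_linear_fst deriv]
      bounded_linear.has_vector_derivative[OF bounded_linear_snd deriv] by simp
qed (auto simp: rmult2_def intro: has_vector_derivative_Pair)

lemma jinv_elevation_quotient:
  "c *\<^sub>R (rmult jinv (elevation x) - rmult jinv (elevation y))
    = elev_deriv ((1/2) *\<^sub>R (x + y)) (c *\<^sub>R (rmult jinv x - rmult jinv y))"
proof -
  have "rmult jinv (elevation x) - rmult jinv (elevation y)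
      = rmult jinv x - rmult jinv y + (1/4) *\<^sub>R prod_s1 (x + y) (rmult jinv x - rmult jinv y)"
    unfolding rmult_jinv.diff[symmetric] elevation_diff rmult_jinv.add rmult_jinv.scaleR jinv_prod_s ..
  then show ?thesis by (simp add: elev_deriv_def prod_s1.scaleR_left prod_s1.scaleR_right scaleR_add_right[of c])
qed

lemma elev_deriv_diff: "elev_deriv q (x - y) = elev_deriv q x - elev_deriv q y"
  by (simp add: elev_deriv_def prod_s1.diff_right scaleR_diff_right)

lemma jinv_elevation_has_vector_derivative_iff:
  assumes lim: "(Q \<longlongrightarrow> Q t) (at t within S)" and small: "\<And>y. y \<in> S ==> norm (Q y) <= 1 / C_prod"
    and t: "t \<in> S"
  shows "((\<lambda>t. rmult jinv (elevation (Q t))) has_vector_derivative elev_deriv (Q t) N) (at t within S)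
    \<longleftrightarrow> ((\<lambda>t. rmult jinv (Q t)) has_vector_derivative N) (at t within S)" (is "?elev \<longleftrightarrow> ?sym")
proof -
  let ?F = "at t within S" and ?m = "\<lambda>y. (1/2) *\<^sub>R (Q y + Q t)"
  let ?d = "\<lambda>y. (1 / (y - t)) *\<^sub>R (rmult jinv (Q y) - rmult jinv (Q t))"
  have "(?m \<longlongrightarrow> (1/2) *\<^sub>R (Q t + Q t)) ?F" by (intro tendsto_intros lim)
  then have mean: "(?m \<longlongrightarrow> Q t) ?F" by (simp add: scaleR_2[symmetric])
  have tendsto: "((\<lambda>y. elev_deriv (?m y) (f y)) \<longlongrightarrow> elev_deriv (Q t) N) ?F" if "(f \<longlongrightarrow> N) ?F" for f
    unfolding elev_deriv_def by (intro tendsto_add tendsto_scaleR tendsto_const prod_s1.tendsto mean that)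
  have "(?d \<longlongrightarrow> N) ?F" if elev: "((\<lambda>y. elev_deriv (?m y) (?d y)) \<longlongrightarrow> elev_deriv (Q t) N) ?F"
  proof -
    have "((\<lambda>y. elev_deriv (?m y) (?d y) - elev_deriv (?m y) N) \<longlongrightarrow> 0) ?F"
      using tendsto_diff[OF elev tendsto[OF tendsto_const]] by simp
    moreover have "norm (?d y - N) <= 2 * norm (elev_deriv (?m y) (?d y) - elev_deriv (?m y) N)" if "y \<in> S" for y
      unfolding elev_deriv_diff[symmetric] by (rule norm_elev_deriv_ge[OF norm_mean_le[OF small[OF that] small[OF t]]])
    ultimately show ?thesis by (rule tendsto_within_norm_diff_le)
  qed
  then show ?thesis unfolding has_vector_derivative_iff_quotient jinv_elevation_quotient using tendsto by blast
qed

lemma continuous_on_elev_pair_iff: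
  assumes small: "\<And>t. t \<in> S ==> norm (X t) <= 1 / C_prod"
  shows "continuous_on S (\<lambda>t. elev_pair (X t)) \<longleftrightarrow> continuous_on S X"
proof
  assume elev: "continuous_on S (\<lambda>t. elev_pair (X t))"
  show "continuous_on S X"
    unfolding continuous_on_def
  proof
    fix t assume t: "t \<in> S"
    have "((\<lambda>y. elev_pair (X y) - elev_pair (X t)) \<longlongrightarrow> 0) (at t within S)"
      using elev t by (intro LIM_zero) (simp add: continuous_on_def)
    then show "(X \<longlongrightarrow> X t) (at t within S)"
      by (rule tendsto_within_norm_diff_le) (rule elev_pair_bounds(2)[OF small small[OF t]])
  qed
qed (unfold elev_pair_def elevation_def, intro continuous_intros prod_s.continuous_on)

theorem wb_solution_elev_pair_iff:
  assumes small: "\<And>t. t \<in> {0..T} ==> norm (X t) <= 1 / C_prod"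
  shows "wb_solution T (\<lambda>t. elev_pair (X t)) \<longleftrightarrow> sym_solution T X"
proof -
  have deriv_iff: "((\<lambda>t. rmult2 jinv (elev_pair (X t))) has_vector_derivative wb_rhs (elev_pair (X t))) (at t within {0..T})
      \<longleftrightarrow> ((\<lambda>t. rmult2 jinv (X t)) has_vector_derivative sym_rhs (X t)) (at t within {0..T})"
    if cont: "continuous_on {0..T} X" and t: "t \<in> {0..T}" for t
  proof -
    have "((\<lambda>y. fst (X y)) \<longlongrightarrow> fst (X t)) (at t within {0..T})"
      using cont t by (intro tendsto_fst) (simp add: continuous_on_def)
    note iff = jinv_elevation_has_vector_derivative_iff[OF this order_trans[OF norm_fst_le_norm small] t]
    show ?thesis
      unfolding wb_rhs_elev_pair has_vector_derivative_rmult2_iff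
        has_vector_derivative_rmult2_iff[of jinv X "fst (sym_rhs (X t))" "snd (sym_rhs (X t))", unfolded prod.collapse]
      using iff by (simp add: elev_pair_def)
  qed
  have "continuous_on {0..T} (\<lambda>t. elev_pair (X t)) \<longleftrightarrow> continuous_on {0..T} X"
    by (rule continuous_on_elev_pair_iff[OF small])
  then show ?thesis unfolding wb_solution_def sym_solution_def using deriv_iff by blast
qed

lemma wb_solution_cong:
  assumes W: "wb_solution T W" and eq: "\<And>t. t \<in> {0..T} ==> W t = V t" shows "wb_solution T V"
  unfolding wb_solution_def
proof (intro conjI ballI)
  show "continuous_on {0..T} V" using W continuous_on_cong[of "{0..T}" "{0..T}" W V] eq by (auto simp: wb_solution_def)
  fix t assume t: "t \<in> {0..T}"
  have "((\<lambda>t. rmult2 jinv (W t)) has_vector_derivative wb_rhs (V t)) (at t within {0..T})"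
    using W eq t by (auto simp: wb_solution_def)
  then show "((\<lambda>t. rmult2 jinv (V t)) has_vector_derivative wb_rhs (V t)) (at t within {0..T})"
    by (rule has_vector_derivative_transform[OF t, rotated]) (simp add: eq)
qed

lemma sym_solution_mono: assumes X: "sym_solution T X" and T: "T' <= T" shows "sym_solution T' X"
proof -
  have sub: "{0..T'} \<subseteq> {0..T}" using T by auto
  show ?thesis
    using X continuous_on_subset[OF _ sub] sub unfolding sym_solution_def
    by (blast intro: has_vector_derivative_within_subset[OF _ sub])
qed

lemma wb_solution_mono: assumes W: "wb_solution T W" and T: "T' <= T" shows "wb_solution T' W"
proof -
  have sub: "{0..T'} \<subseteq> {0..T}" using T by auto
  show ?thesis
    using W continuous_on_subset[OF _ sub] sub unfolding wb_solution_def
    by (blast intro: has_vector_derivative_within_subset[OF _ sub])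
qed

lemma weight_bound_mono: "weight_bound T X0 X ==> T' <= T ==> weight_bound T' X0 X"
  by (auto simp: weight_bound_def)

subsection \<open>Existence, uniqueness and continuous dependence\<close>

definition c_wb :: real where "c_wb = min (c_sym / 2) (1 / (32 * C_prod))"

lemma c_wb: "0 < c_wb" "c_wb <= c_sym / 2" "16 * c_wb <= 1 / (2 * C_prod)" "16 * c_wb <= 1 / C_prod"
proof -
  show "0 < c_wb" "c_wb <= c_sym / 2" using c_sym_pos C_prod by (auto simp: c_wb_def)
  have "c_wb <= 1 / (32 * C_prod)" by (simp add: c_wb_def)
  then show "16 * c_wb <= 1 / (2 * C_prod)" using C_prod by (simp add: field_simps)
  also have "... <= 1 / C_prod" using C_prod by (simp add: field_simps)
  finally show "16 * c_wb <= 1 / C_prod" .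
qed

theorem wb_solution_exists:
  assumes d: "0 < d" "norm W0 <= d" "d <= c_wb"
  obtains X where "sym_solution (c_wb / d) X" "elev_pair (X 0) = W0" "weight_bound (c_wb / d) (X 0) X"
    "\<And>t. t \<in> {0..c_wb / d} ==> norm (X t) <= 4 * norm W0"
proof -
  have "norm (fst W0) <= 1 / (2 * C_prod)" using norm_fst_le_norm[of W0] d c_wb(1,3) by linarith
  then obtain Q where Q: "elevation Q = fst W0" "norm Q <= 2 * norm (fst W0)" by (rule elevation_inverse)
  have init_le: "norm (Q, snd W0) <= 2 * norm W0" using norm_Pair_mono[of Q 2 "fst W0" "snd W0" "snd W0"] Q by simp
  then obtain X where X: "sym_solution (c_sym / (2 * d)) X" "X 0 = (Q, snd W0)" "weight_bound (c_sym / (2 * d)) (Q, snd W0) X"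
    using sym_solution_exists[of "2 * d" "(Q, snd W0)"] d by auto
  have T: "c_wb / d <= c_sym / (2 * d)" using c_wb(2) d by (simp add: field_simps)
  note weight = weight_bound_mono[OF X(3) T]
  show thesis
    using that[OF sym_solution_mono[OF X(1) T]] Q X(2) weight weight_bound_norm[OF weight _ init_le] by (simp add: elev_pair_def)
qed

lemma wb_solution_unique_small:
  assumes T: "0 <= T" and X: "sym_solution T X" "\<And>t. t \<in> {0..T} ==> norm (X t) <= 4 * c_wb"
    and W: "wb_solution T W" "W 0 = elev_pair (X 0)" "\<And>t. t \<in> {0..T} ==> norm (W t) <= 1 / (2 * C_prod)"
  shows "W T = elev_pair (X T)"
proof -
  have "\<exists>Y. elev_pair Y = W t \<and> norm Y <= 1 / C_prod" if t: "t \<in> {0..T}" for t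
  proof -
    obtain Q where Q: "elevation Q = fst (W t)" "norm Q <= 2 * norm (fst (W t))"
      using elevation_inverse[of "fst (W t)"] norm_fst_le_norm[of "W t"] W(3)[OF t] by auto
    have "norm (Q, snd (W t)) <= 2 * norm (W t)" using norm_Pair_mono[of Q 2 "fst (W t)" "snd (W t)" "snd (W t)"] Q by simp
    also have "... <= 1 / C_prod" using W(3)[OF t] by simp
    finally show ?thesis using Q(1) by (intro exI[of _ "(Q, snd (W t))"]) (simp add: elev_pair_def)
  qed
  then obtain Y where Y: "\<And>t. t \<in> {0..T} ==> elev_pair (Y t) = W t \<and> norm (Y t) <= 1 / C_prod" by metis
  have sym: "sym_solution T Y"
    using wb_solution_elev_pair_iff[of T Y] wb_solution_cong[OF W(1), of "\<lambda>t. elev_pair (Y t)"] Y by simp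
  have small: "norm (X t) <= 1 / C_prod" if "t \<in> {0..T}" for t using X(2)[OF that] c_wb(1,4) by linarith
  have "norm (X 0 - Y 0) <= 2 * norm (elev_pair (X 0) - elev_pair (Y 0))" by (rule elev_pair_bounds(2)) (use small Y T in auto)
  moreover have "elev_pair (Y 0) = elev_pair (X 0)" unfolding W(2)[symmetric] using Y T by simp
  ultimately have init: "X 0 = Y 0" by simp
  have "norm (rmult2 winv (X T - Y T)) <= exp (26 * C_bil * (1 / C_prod) * T) * norm (rmult2 winv (X 0 - Y 0))"
    by (rule sym_solution_difference[OF X(1) sym]) (use small Y T in auto)
  then have "rmult2 winv (X T - Y T) = 0" unfolding rmult2_diff[OF even_sym_winv] init by simp
  then have "X T - Y T = 0" by (rule rmult2_eq_0D[OF even_sym_winv, rotated]) simp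
  then show ?thesis using Y[of T] T by simp
qed

theorem wb_solution_unique:
  assumes X: "sym_solution T X" "\<And>t. t \<in> {0..T} ==> norm (X t) <= 4 * c_wb"
    and W: "wb_solution T W" "W 0 = elev_pair (X 0)" and t: "t \<in> {0..T}"
  shows "W t = elev_pair (X t)"
proof -
  have elev: "norm (elev_pair (X t)) <= 8 * c_wb" if "t \<in> {0..T}" for t
    using norm_elev_pair_le[of "X t"] X(2)[OF that] c_wb(1,4) by linarith
  have local_eq: "W S = elev_pair (X S)"
    if S: "S \<in> {0..T}" and small: "\<And>t. t \<in> {0..S} ==> norm (W t) <= 1 / (2 * C_prod)" for S
    by (rule wb_solution_unique_small[OF _ sym_solution_mono[OF X(1)] X(2) wb_solution_mono[OF W(1)] W(2) small]) (use S in auto)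
  have "norm (W t) <= 1 / (2 * C_prod)" if t: "t \<in> {0..T}" for t
  proof (rule continuous_bootstrap[OF _ _ _ _ t])
    show "continuous_on {0..T} (\<lambda>t. norm (W t))" using W(1) by (auto simp: wb_solution_def intro: continuous_intros)
    show "8 * c_wb < 1 / (2 * C_prod)" using c_wb(1,3) by linarith
    show "norm (W 0) <= 1 / (2 * C_prod)" using elev[of 0] t W(2) c_wb(1,3) by auto
    show "norm (W S) <= 8 * c_wb" if "S \<in> {0..T}" "\<And>t. t \<in> {0..S} ==> norm (W t) <= 1 / (2 * C_prod)" for S
      using local_eq[OF that] elev[OF that(1)] by simp
  qed
  then show ?thesis using t by (intro local_eq) auto
qed

lemma sym_solution_dependence:
  assumes X: "sym_solution T X" "weight_bound T (X 0) X" and Y: "sym_solution T Y" "weight_bound T (Y 0) Y"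
    and M: "\<And>t. t \<in> {0..T} ==> norm (X t) <= M \<and> norm (Y t) <= M" and t: "t \<in> {0..T}"
  shows "norm (X t - Y t) <= 4 * norm (rmult2 (tail_wgt k) (Y 0))
    + (2 + (real k + 1) powr s * exp (26 * C_bil * M * t)) * norm (X 0 - Y 0)"
proof -
  let ?w = "rmult2 (tail_wgt k)" and ?E = "exp (26 * C_bil * M * t)"
  note diff = rmult2_diff[OF even_sym_tail_wgt]
  have "norm (?w (X 0)) <= norm (?w (Y 0)) + norm (X 0 - Y 0)"
    using norm_triangle_ineq[of "?w (Y 0)" "?w (X 0 - Y 0)"] norm_rmult2_le[OF even_sym_tail_wgt, of k "X 0 - Y 0"]
    by (simp add: diff)
  then have "norm (?w (X t - Y t)) <= 4 * norm (?w (Y 0)) + 2 * norm (X 0 - Y 0)"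
    unfolding diff using norm_triangle_ineq4[of "?w (X t)" "?w (Y t)"] weight_boundD[OF X(2) t slow_tail_wgt tail_wgt_le_1, of k]
      weight_boundD[OF Y(2) t slow_tail_wgt tail_wgt_le_1, of k] by linarith
  moreover have "norm (rmult2 winv (X t - Y t)) <= ?E * norm (X 0 - Y 0)"
    using norm_rmult2_le[OF even_sym_winv, of "X 0 - Y 0"]
    by (intro order_trans[OF sym_solution_difference[OF X(1) Y(1) M t]] mult_left_mono) auto
  then have "(real k + 1) powr s * norm (rmult2 winv (X t - Y t)) <= (real k + 1) powr s * (?E * norm (X 0 - Y 0))"
    by (rule mult_left_mono) simp
  ultimately show ?thesis using norm_le_tail_winv[of "X t - Y t" k] unfolding distrib_right mult.assoc by linarith
qed

lemma elev_pair_dependence: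
  assumes X: "sym_solution T X" "weight_bound T (X 0) X" and Y: "sym_solution T Y" "weight_bound T (Y 0) Y"
    and small: "\<And>t. t \<in> {0..T} ==> norm (X t) <= 4 * c_wb \<and> norm (Y t) <= 4 * c_wb" and t: "t \<in> {0..T}"
  shows "norm (elev_pair (X t) - elev_pair (Y t)) <= 8 * norm (rmult2 (tail_wgt k) (Y 0))
    + 4 * (2 + (real k + 1) powr s * exp (26 * C_bil * (4 * c_wb) * t)) * norm (elev_pair (X 0) - elev_pair (Y 0))"
proof -
  let ?K = "2 + (real k + 1) powr s * exp (26 * C_bil * (4 * c_wb) * t)"
  have in_range: "norm (X u) <= 1 / C_prod" "norm (Y u) <= 1 / C_prod" if "u \<in> {0..T}" for u
    using small[OF that] c_wb(1,4) by simp_all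
  have zero: "0 \<in> {0..T}" using t by simp
  have "?K * norm (X 0 - Y 0) <= ?K * (2 * norm (elev_pair (X 0) - elev_pair (Y 0)))"
    using elev_pair_bounds(2)[OF in_range[OF zero]] by (intro mult_left_mono) auto
  then show ?thesis
    using elev_pair_bounds(1)[OF in_range[OF t]] sym_solution_dependence[OF X Y small t, of k] by linarith
qed

theorem wb_solution_dependence:
  assumes X: "sym_solution (c_wb / d) X" "weight_bound (c_wb / d) (X 0) X"
    and Xn: "\<And>t. t \<in> {0..c_wb / d} ==> norm (X t) <= 4 * c_wb" and e: "0 < e"
  obtains \<delta> where "0 < \<delta>"
    "\<And>d' W t. 0 < d' ==> d' <= c_wb ==> norm (W 0) <= d' ==> norm (W 0 - elev_pair (X 0)) < \<delta> ==> wb_solution (c_wb / d') W ==>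
      t \<in> {0..min (c_wb / d) (c_wb / d')} ==> norm (W t - elev_pair (X t)) <= e"
proof -
  have "\<forall>\<^sub>F k in sequentially. norm (rmult2 (tail_wgt k) (X 0)) < e / 16"
    using e by (intro order_tendstoD(2)[OF norm_rmult2_tail_tendsto]) simp
  then obtain k where k: "norm (rmult2 (tail_wgt k) (X 0)) < e / 16" by (auto simp: eventually_sequentially)
  define K where "K t = 2 + (real k + 1) powr s * exp (26 * C_bil * (4 * c_wb) * t)" for t
  have K: "0 < K t" for t by (simp add: K_def add_pos_nonneg)
  have K_mono: "K t <= K u" if "t <= u" for t u
    unfolding K_def using that c_wb(1)
    by (intro add_left_mono mult_left_mono iffD2[OF exp_le_cancel_iff]) auto
  show thesis
  proof (rule that[of "e / (8 * K (c_wb / d))"])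
    show "0 < e / (8 * K (c_wb / d))" using e K by simp
    fix d' W t
    assume d': "0 < d'" "d' <= c_wb" and W0: "norm (W 0) <= d'" "norm (W 0 - elev_pair (X 0)) < e / (8 * K (c_wb / d))"
      and W: "wb_solution (c_wb / d') W" and t: "t \<in> {0..min (c_wb / d) (c_wb / d')}"
    obtain Y where Y: "sym_solution (c_wb / d') Y" "elev_pair (Y 0) = W 0" "weight_bound (c_wb / d') (Y 0) Y"
      and Y_le: "\<And>t. t \<in> {0..c_wb / d'} ==> norm (Y t) <= 4 * norm (W 0)"
      by (rule wb_solution_exists[OF d'(1) W0(1) d'(2)]) blast
    have Yn: "norm (Y t) <= 4 * c_wb" if "t \<in> {0..c_wb / d'}" for t
      using Y_le[OF that] W0(1) d'(2) by linarith
    have W_eq: "W t = elev_pair (Y t)" by (rule wb_solution_unique[OF Y(1) Yn W]) (use Y(2) t in auto)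
    have "norm (W t - elev_pair (X t)) <= 8 * norm (rmult2 (tail_wgt k) (X 0)) + 4 * K t * norm (W 0 - elev_pair (X 0))"
      unfolding W_eq Y(2)[symmetric] K_def
      by (rule elev_pair_dependence[OF sym_solution_mono[OF Y(1)] weight_bound_mono[OF Y(3)] sym_solution_mono[OF X(1)] weight_bound_mono[OF X(2)] _ t])
        (use Xn Yn in auto)
    also have "... <= 8 * (e / 16) + 4 * K (c_wb / d) * (e / (8 * K (c_wb / d)))"
      using k W0(2) t K by (intro add_mono mult_mono mult_left_mono K_mono) (auto simp: less_imp_le)
    also have "... = e" using K[of "c_wb / d"] by simp
    finally show "norm (W t - elev_pair (X t)) <= e" .
  qed
qed

end

section \<open>Sobolev representations and well-posedness\<close>

lemma wint_has_FT: assumes "has_FT f x" shows "wint w f = (NN u. ennreal (w u * (cmod (fun_of x u))^2))"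
  unfolding wint_def using FT_AE[OF assms] by (intro nn_integral_cong_AE) (auto elim: eventually_mono)

lemma is_FT_FT: "has_FT f x ==> is_FT f (FT f)"
  unfolding FT_def by (rule someI[of "is_FT f"]) (rule has_FT_is_FT)

lemma is_FT_iff_has_FT:
  assumes g: "csq_int g" and eq: "AE t in lborel. fun_of y t = g t" shows "is_FT f g \<longleftrightarrow> has_FT f y"
proof
  assume "is_FT f g"
  then obtain x where x: "has_FT f x" "AE t in lborel. g t = fun_of x t" by (auto simp: is_FT_iff)
  have "y = x" by (rule hl2_eqI) (use x(2) eq in \<open>eventually_elim, simp\<close>)
  with x(1) show "has_FT f y" by simp
next
  assume "has_FT f y"
  moreover have "AE t in lborel. g t = fun_of y t" using eq by eventually_elim simp
  ultimately show "is_FT f g" unfolding is_FT_iff using g by blast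
qed

lemma jpow_sq: "(jpow r t)^2 = jbr t powr (2 * r)"
  by (simp add: jpow_def power2_eq_square flip: powr_add)

lemma wint_jpow:
  assumes r: "0 <= r" and f: "has_FT f (rmult (jpow (- r)) y)"
  shows "wint (\<lambda>p. jbr p powr (2 * r) * c p) f = (NN p. ennreal (c p * (cmod (fun_of y p))^2))"
  unfolding wint_has_FT[OF f]
proof (rule nn_integral_cong_AE)
  have "even_sym 1 (jpow (- r))" using r by (intro even_sym_jpow) simp
  from fun_of_rmult[OF this, of y]
  show "AE p in lborel. ennreal (jbr p powr (2 * r) * c p * (cmod (fun_of (rmult (jpow (- r)) y) p))^2)
      = ennreal (c p * (cmod (fun_of y p))^2)"
    by eventually_elim (simp add: norm_mult norm_divide jpow_uminus power_mult_distrib power_divide jpow_sq[symmetric])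
qed

lemma nn_integral_sq_rmult:
  assumes "even_sym C a"
  shows "(NN t. ennreal ((a t)^2 * (cmod (fun_of x t))^2)) = ennreal ((norm (rmult a x))^2)"
  unfolding nn_norm_fun_of[symmetric]
proof (rule nn_integral_cong_AE)
  show "AE t in lborel. ennreal ((a t)^2 * (cmod (fun_of x t))^2) = ennreal ((cmod (fun_of (rmult a x) t))^2)"
    using fun_of_rmult[OF assms, of x] by eventually_elim (simp add: norm_mult power_mult_distrib)
qed

lemma rmult_divide:
  assumes a: "even_sym 1 a" "\<And>t. 0 < a t" and f: "(NN t. ennreal ((cmod (fun_of x t) / a t)^2)) < \<infinity>"
  obtains y where "x = rmult a y"
proof -
  note [measurable] = even_sym_measurable[OF a(1)]
  let ?f = "\<lambda>t. fun_of x t / cx (a t)"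
  have quotient: "herm_sq_int ?f" unfolding herm_sq_int_def csq_int_iff_nn_integral
  proof (intro conjI allI)
    show "(NN t. ennreal ((cmod (?f t))^2)) < \<infinity>" using f less_imp_le[OF a(2)] by (simp add: norm_divide)
    show "?f (- t) = cnj (?f t)" for t by (simp add: even_sym_minus[OF a(1)])
  qed measurable
  have "x = rmult a (L2_of ?f)"
  proof (rule hl2_eqI)
    show "AE t in lborel. fun_of x t = fun_of (rmult a (L2_of ?f)) t"
      using fun_of_rmult[OF a(1), of "L2_of ?f"] fun_of_L2_of[OF quotient]
      by eventually_elim (use a(2) in \<open>simp add: less_imp_neq[symmetric]\<close>)
  qed
  then show thesis by (rule that)
qed

lemma Hs_obtain:
  assumes r: "0 <= r" and f: "Hs r f" obtains y where "has_FT f (rmult (jpow (- r)) y)"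
proof -
  obtain x where x: "has_FT f x" using f by (auto simp: Hs_def is_FT_iff)
  have "(NN t. ennreal ((cmod (fun_of x t) / jpow (- r) t)^2)) = wint (\<lambda>t. jbr t powr (2 * r)) f"
    unfolding wint_has_FT[OF x] by (simp add: jpow_uminus power_mult_distrib jpow_sq mult.commute)
  then have "(NN t. ennreal ((cmod (fun_of x t) / jpow (- r) t)^2)) < \<infinity>" using f by (simp add: Hs_def)
  from rmult_divide[OF even_sym_jpow jpow_pos this] r obtain y where "x = rmult (jpow (- r)) y" by auto
  with x show thesis by (intro that) simp
qed

lemma even_sym_of_sq_le:
  assumes "a \<in> meas" "\<And>t. a (- t) = a t" "\<And>t. (a t)^2 <= C^2" "0 <= C" shows "even_sym C a"
  unfolding even_sym_def using assms abs_le_square_iff[of "a _" C] by auto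

context whitham_boussinesq
begin

subsection \<open>The Sobolev norms\<close>

definition V_wgt :: "real => real" where "V_wgt t = sqrt (1 + sqrt \<mu> * \<bar>t\<bar>) * sqrtT t"
definition Dhalf_wgt :: "real => real" where "Dhalf_wgt t = sqrt \<bar>t\<bar> * sqrtT t"

lemma V_wgt_sq: "(V_wgt t)^2 = (1 + sqrt \<mu> * \<bar>t\<bar>) * (sqrtT t)^2"
  and Dhalf_wgt_sq: "(Dhalf_wgt t)^2 = \<bar>t\<bar> * (sqrtT t)^2"
  using mu by (simp_all add: V_wgt_def Dhalf_wgt_def power_mult_distrib)

lemma even_sym_V_wgt: "even_sym 2 V_wgt" and even_sym_Dhalf_wgt: "even_sym (sqrt (2 / sqrt \<mu>)) Dhalf_wgt"
proof -
  note [measurable] = even_sym_measurable[OF even_sym_sqrtT]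
  note [simp] = even_sym_minus[OF even_sym_sqrtT]
  show "even_sym 2 V_wgt"
  proof (rule even_sym_of_sq_le)
    show "V_wgt \<in> meas" unfolding V_wgt_def[abs_def] by measurable
    show "(V_wgt t)^2 <= 2^2" for t using sqrtT_bounds(2)[of t] by (simp add: V_wgt_sq)
  qed (simp_all add: V_wgt_def)
  show "even_sym (sqrt (2 / sqrt \<mu>)) Dhalf_wgt"
  proof (rule even_sym_of_sq_le)
    show "Dhalf_wgt \<in> meas" unfolding Dhalf_wgt_def[abs_def] by measurable
    have "sqrt \<mu> * (\<bar>t\<bar> * (sqrtT t)^2) <= 2" for t
      using sqrtT_bounds(2)[of t] zero_le_power2[of "sqrtT t"] unfolding distrib_right mult_1 mult.assoc by linarith
    then show "(Dhalf_wgt t)^2 <= (sqrt (2 / sqrt \<mu>))^2" for t using mu by (simp add: Dhalf_wgt_sq field_simps)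
  qed (use mu in \<open>simp_all add: Dhalf_wgt_def\<close>)
qed

lemma norm_sq_V_wgt:
  "(norm (rmult V_wgt x))^2 = (norm (sqrtT_op x))^2 + sqrt \<mu> * (norm (rmult Dhalf_wgt x))^2"
proof -
  have integrable: "integrable lborel (\<lambda>t. (a t)^2 * (cmod (fun_of x t))^2)" if "even_sym C a" for C a
  proof -
    note [measurable] = even_sym_measurable[OF that]
    show ?thesis by (rule integrable_mult_norm_sq_fun_of[where C = "C^2"]) (auto intro: even_sym_sq_le[OF that])
  qed
  note int = integrable[OF even_sym_sqrtT] integrable_mult_right[OF integrable[OF even_sym_Dhalf_wgt], of "sqrt \<mu>"]
  show ?thesis
    unfolding sqrtT_op_def norm_sq_rmult[OF even_sym_V_wgt] norm_sq_rmult[OF even_sym_sqrtT] norm_sq_rmult[OF even_sym_Dhalf_wgt]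
      integral_mult_right_zero[symmetric] Bochner_Integration.integral_add[OF int, symmetric]
    by (rule Bochner_Integration.integral_cong) (simp_all add: V_wgt_sq Dhalf_wgt_sq algebra_simps)
qed

definition represents :: "real => (real => real) => (real => real) => state => bool" where
  "represents r \<zeta> v W \<longleftrightarrow>
     has_FT \<zeta> (rmult (jpow (- r)) (fst W)) \<and> has_FT v (rmult (jpow (- r)) (sqrtT_op (snd W)))"

lemma represents_V_space: assumes r: "0 <= r" and W: "represents r \<zeta> v W" shows "V_space r \<mu> \<zeta> v"
  and represents_V_norm: "V_norm r \<mu> \<zeta> v = norm (fst W, rmult V_wgt (snd W))"
proof -
  have \<zeta>: "has_FT \<zeta> (rmult (jpow (- r)) (fst W))" and v: "has_FT v (rmult (jpow (- r)) (sqrtT_op (snd W)))"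
    using W by (auto simp: represents_def)
  have Hs: "wint (\<lambda>p. jbr p powr (2 * r)) f = ennreal ((norm y)^2)" if "has_FT f (rmult (jpow (- r)) y)" for f y
    using wint_jpow[OF r that, of "\<lambda>_. 1"] by (simp add: nn_norm_fun_of)
  have Dhalf: "wint (\<lambda>p. jbr p powr (2 * r) * \<bar>p\<bar>) v = ennreal ((norm (rmult Dhalf_wgt (snd W)))^2)"
    unfolding wint_jpow[OF r v] nn_integral_sq_rmult[OF even_sym_Dhalf_wgt, symmetric]
  proof (rule nn_integral_cong_AE)
    show "AE p in lborel. ennreal (\<bar>p\<bar> * (cmod (fun_of (sqrtT_op (snd W)) p))^2)
        = ennreal ((Dhalf_wgt p)^2 * (cmod (fun_of (snd W) p))^2)"
      using fun_of_rmult[OF even_sym_sqrtT, of "snd W"]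
      by eventually_elim (simp add: sqrtT_op_def norm_mult power_mult_distrib Dhalf_wgt_sq mult.assoc)
  qed
  show "V_space r \<mu> \<zeta> v"
    unfolding V_space_def Hs_def Dhalf Hs[OF \<zeta>] Hs[OF v] using has_FT_is_FT[OF \<zeta>] has_FT_is_FT[OF v] by auto
  show "V_norm r \<mu> \<zeta> v = norm (fst W, rmult V_wgt (snd W))"
    unfolding V_norm_def Hs_norm_def Dhalf_Hs_norm_def Dhalf Hs[OF \<zeta>] Hs[OF v] norm_Pair norm_sq_V_wgt
    by (simp add: add.assoc)
qed

lemma represents_norm_le: assumes r: "0 <= r" and W: "represents r \<zeta> v W" shows "norm W <= V_norm r \<mu> \<zeta> v"
  and represents_V_norm_le: "V_norm r \<mu> \<zeta> v <= 2 * norm W"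
proof -
  have "1 <= (V_wgt t)^2" for t using sqrtT_bounds(1) by (simp add: V_wgt_sq)
  then have "norm (snd W) <= norm (rmult V_wgt (snd W))"
    using norm_rmult_mono[OF even_sym_one even_sym_V_wgt, of "snd W"] by simp
  then show "norm W <= V_norm r \<mu> \<zeta> v"
    unfolding represents_V_norm[OF assms] using norm_Pair_mono[of "fst W" 1 "fst W" "snd W" "rmult V_wgt (snd W)"] by simp
  show "V_norm r \<mu> \<zeta> v <= 2 * norm W"
    unfolding represents_V_norm[OF assms]
    using norm_Pair_mono[of "fst W" 2 "fst W" "rmult V_wgt (snd W)" "snd W"] norm_rmult_le[OF even_sym_V_wgt] by simp
qed

lemma sqrtT_op_divide:
  assumes f: "(NN t. ennreal (\<bar>t\<bar> * (cmod (fun_of y t))^2)) < \<infinity>" obtains x where "y = sqrtT_op x"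
proof -
  let ?a = "\<lambda>t. (cmod (fun_of y t))^2"
  have "(cmod (fun_of y t) / sqrtT t)^2 <= ?a t + sqrt \<mu> * (\<bar>t\<bar> * ?a t)" for t
  proof -
    have "(cmod (fun_of y t) / sqrtT t)^2 = ?a t * (1 / (sqrtT t)^2)" by (simp add: power_divide)
    also have "... <= ?a t * (1 + sqrt \<mu> * \<bar>t\<bar>)"
      using sqrtT_bounds(1)[of t] zero_less_power[OF sqrtT_pos, of t 2]
      by (intro mult_left_mono) (simp_all only: pos_divide_le_eq zero_le_power2)
    finally show ?thesis by (simp add: algebra_simps)
  qed
  then have "ennreal ((cmod (fun_of y t) / sqrtT t)^2) <= ennreal (?a t) + ennreal (sqrt \<mu>) * ennreal (\<bar>t\<bar> * ?a t)" for t
    using mu by (simp add: ennreal_leI flip: ennreal_plus ennreal_mult'')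
  then have "(NN t. ennreal ((cmod (fun_of y t) / sqrtT t)^2)) <= (NN t. ennreal (?a t) + ennreal (sqrt \<mu>) * ennreal (\<bar>t\<bar> * ?a t))"
    by (rule nn_integral_mono)
  also have "... = ennreal ((norm y)^2) + ennreal (sqrt \<mu>) * (NN t. ennreal (\<bar>t\<bar> * ?a t))"
    by (subst nn_integral_add) (auto simp: nn_integral_cmult nn_norm_fun_of)
  also have "... < \<infinity>" using f by (simp add: ennreal_mult_less_top)
  finally obtain x where "y = rmult sqrtT x" by (rule rmult_divide[OF even_sym_sqrtT sqrtT_pos])
  then show thesis by (intro that) (simp add: sqrtT_op_def)
qed

lemma V_space_represents:
  assumes r: "0 <= r" and V: "V_space r \<mu> \<zeta> v" obtains W where "represents r \<zeta> v W"
proof -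
  have "Hs r \<zeta>" "Hs r v" using V by (auto simp: V_space_def)
  obtain F where F: "has_FT \<zeta> (rmult (jpow (- r)) F)" by (rule Hs_obtain[OF r \<open>Hs r \<zeta>\<close>])
  obtain y where y: "has_FT v (rmult (jpow (- r)) y)" by (rule Hs_obtain[OF r \<open>Hs r v\<close>])
  have "(NN t. ennreal (\<bar>t\<bar> * (cmod (fun_of y t))^2)) < \<infinity>"
    using V unfolding V_space_def wint_jpow[OF r y] by simp
  then obtain G where "y = sqrtT_op G" by (rule sqrtT_op_divide)
  then show thesis using F y by (intro that[of "(F, G)"]) (simp add: represents_def)
qed

lemma represents_exists: obtains \<zeta> v where "\<And>t. represents r (\<zeta> t) (v t) (W t)"
proof -
  have "\<forall>t. \<exists>\<zeta> v. represents r \<zeta> v (W t)" unfolding represents_def by (meson has_FT_surj)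
  then show thesis using that by metis
qed

lemma represents_diff:
  assumes r: "0 <= r" and W: "represents r \<zeta> v W" and W': "represents r \<zeta>' v' W'"
  shows "represents r (\<lambda>x. \<zeta> x - \<zeta>' x) (\<lambda>x. v x - v' x) (W - W')"
proof -
  have "bounded_linear (rmult (jpow (- r)))" using r by (intro bounded_linear_rmult[OF even_sym_jpow]) simp
  note diff = linear_diff[OF bounded_linear.linear[OF this]]
  show ?thesis using W W' unfolding represents_def by (auto simp: diff sqrtT_op.diff intro: has_FT_diff)
qed

lemma represents_cmult:
  assumes r: "0 <= r" and W: "represents r \<zeta> v W"
  shows "represents r (\<lambda>x. c * \<zeta> x) (\<lambda>x. c * v x) (c *\<^sub>R W)"
proof -
  have "bounded_linear (rmult (jpow (- r)))" using r by (intro bounded_linear_rmult[OF even_sym_jpow]) simp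
  note scale = linear_scale[OF bounded_linear.linear[OF this]]
  show ?thesis using W unfolding represents_def by (auto simp: scale sqrtT_op.scaleR intro: has_FT_cmult)
qed

lemma represents_unique:
  assumes r: "0 <= r" and W: "represents r \<zeta> v W" and W': "represents r \<zeta> v W'" shows "W = W'"
proof -
  have inj: "x = y" if "rmult (jpow (- r)) x = rmult (jpow (- r)) y" for x y
    by (rule rmult_inj[OF even_sym_jpow jpow_neq_0 that]) (use r in simp)
  have "fst W = fst W'" "sqrtT_op (snd W) = sqrtT_op (snd W')"
    using W W' unfolding represents_def by (auto intro: inj has_FT_unique)
  then show ?thesis by (simp add: prod_eq_iff sqrtT_op_inj)
qed

lemma V_norm_nonneg: "0 <= V_norm r \<mu> \<zeta> v" using mu by (simp add: V_norm_def)

lemma V_norm_diff_le: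
  assumes r: "0 <= r" and W: "represents r \<zeta> v W" and W': "represents r \<zeta>' v' W'"
  shows "V_norm r \<mu> (\<lambda>x. \<zeta> x - \<zeta>' x) (\<lambda>x. v x - v' x) <= 2 * norm (W - W')"
    and "norm (W - W') <= V_norm r \<mu> (\<lambda>x. \<zeta> x - \<zeta>' x) (\<lambda>x. v x - v' x)"
  using represents_V_norm_le[OF r represents_diff[OF assms]] represents_norm_le[OF r represents_diff[OF assms]] by auto

lemma V_norm_tendsto_iff:
  assumes r: "0 <= r" and U: "\<And>y. y \<in> S ==> represents r (f y) (u y) (U y)"
  shows "((\<lambda>y. V_norm r \<mu> (f y) (u y)) \<longlongrightarrow> 0) (at t within S) \<longleftrightarrow> (U \<longlongrightarrow> 0) (at t within S)"
proof
  assume lim: "((\<lambda>y. V_norm r \<mu> (f y) (u y)) \<longlongrightarrow> 0) (at t within S)"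
  show "(U \<longlongrightarrow> 0) (at t within S)"
    by (rule tendsto_within_norm_diff_le[OF lim, where C = 1]) (use represents_norm_le[OF r U] V_norm_nonneg in simp)
next
  assume lim: "(U \<longlongrightarrow> 0) (at t within S)"
  show "((\<lambda>y. V_norm r \<mu> (f y) (u y)) \<longlongrightarrow> 0) (at t within S)"
    by (rule tendsto_within_norm_diff_le[OF lim, where C = 2]) (use represents_V_norm_le[OF r U] V_norm_nonneg in simp)
qed

lemma V_norm_continuous_iff:
  assumes r: "0 <= r" and W: "\<And>t. t \<in> S ==> represents r (\<zeta> t) (v t) (W t)"
  shows "(\<forall>t\<in>S. ((\<lambda>y. V_norm r \<mu> (\<lambda>x. \<zeta> y x - \<zeta> t x) (\<lambda>x. v y x - v t x)) \<longlongrightarrow> 0) (at t within S)) \<longleftrightarrow> continuous_on S W"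
  unfolding continuous_on_def
proof (rule ball_cong[OF refl])
  fix t assume t: "t \<in> S"
  have "((\<lambda>y. V_norm r \<mu> (\<lambda>x. \<zeta> y x - \<zeta> t x) (\<lambda>x. v y x - v t x)) \<longlongrightarrow> 0) (at t within S)
      \<longleftrightarrow> ((\<lambda>y. W y - W t) \<longlongrightarrow> 0) (at t within S)"
    by (rule V_norm_tendsto_iff[OF r]) (rule represents_diff[OF r W W[OF t]])
  then show "((\<lambda>y. V_norm r \<mu> (\<lambda>x. \<zeta> y x - \<zeta> t x) (\<lambda>x. v y x - v t x)) \<longlongrightarrow> 0) (at t within S)
      \<longleftrightarrow> (W \<longlongrightarrow> W t) (at t within S)" by (simp add: LIM_zero_iff)
qed

lemma represents_jinv: assumes "represents s \<zeta> v W" shows "represents (s - 1) \<zeta> v (rmult2 jinv W)"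
proof -
  have "rmult J (rmult jinv x) = rmult winv x" for x
    unfolding rmult_rmult[OF even_sym_J even_sym_jinv] by (rule rmult_cong) (simp flip: jpow_add)
  moreover have "sqrtT_op (rmult jinv x) = rmult jinv (sqrtT_op x)" for x
    unfolding sqrtT_op_def rmult_rmult[OF even_sym_sqrtT even_sym_jinv] rmult_rmult[OF even_sym_jinv even_sym_sqrtT]
    by (rule rmult_cong) simp
  ultimately show ?thesis using assms by (simp add: represents_def)
qed

lemma V_norm_derivative_iff:
  assumes W: "\<And>t. t \<in> S ==> represents s (\<zeta> t) (v t) (W t)" and N: "represents (s - 1) \<zeta>' v' N"
    and t: "t \<in> S"
  shows "((\<lambda>y. V_norm (s - 1) \<mu> (\<lambda>x. (\<zeta> y x - \<zeta> t x) / (y - t) - \<zeta>' x) (\<lambda>x. (v y x - v t x) / (y - t) - v' x)) \<longlongrightarrow> 0) (at t within S)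
    \<longleftrightarrow> ((\<lambda>t. rmult2 jinv (W t)) has_vector_derivative N) (at t within S)"
proof -
  have s1_nonneg: "0 <= s - 1" by (rule s_nonneg(2))
  have quotient: "represents (s - 1) (\<lambda>x. (\<zeta> y x - \<zeta> t x) / (y - t) - \<zeta>' x) (\<lambda>x. (v y x - v t x) / (y - t) - v' x)
      ((1 / (y - t)) *\<^sub>R (rmult2 jinv (W y) - rmult2 jinv (W t)) - N)" if "y \<in> S" for y
    using represents_diff[OF s1_nonneg represents_cmult[OF s1_nonneg represents_diff[OF s1_nonneg represents_jinv[OF W[OF that]] represents_jinv[OF W[OF t]]]] N,
        of "1 / (y - t)"] by simp
  show ?thesis unfolding has_vector_derivative_iff_quotient
    by (subst LIM_zero_iff[symmetric]) (rule V_norm_tendsto_iff[OF s1_nonneg quotient])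
qed

subsection \<open>The equations on the Fourier side\<close>

lemma inner_Dx:
  assumes "AE u in lborel. fun_of P' u = \<i> * cx u * fun_of P u"
  shows "inner (rmult winv x) P' = inner (rmult J (Dx x)) P"
proof -
  have "(LBINT t. fun_of (rmult winv x) t * cnj (fun_of P' t)) = (LBINT t. fun_of (rmult J (Dx x)) t * cnj (fun_of P t))"
  proof (rule integral_cong_AE)
    show "AE t in lborel. fun_of (rmult winv x) t * cnj (fun_of P' t) = fun_of (rmult J (Dx x)) t * cnj (fun_of P t)"
      using fun_of_rmult[OF even_sym_winv, of x] fun_of_rmult[OF even_sym_J, of "Dx x"] fun_of_fmult[OF herm_sym_deriv_symbol, of x] assms
      unfolding Dx_def by eventually_elim (simp add: deriv_symbol_def weight_eqs mult_ac)
  qed measurable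
  then show ?thesis by (simp add: inner_fun_of)
qed

lemma weak_derivative_iff:
  assumes p: "has_FT p (rmult winv P)" and p': "has_FT p' (rmult J N)"
  shows "(\<forall>\<phi> \<phi>'. test_fun \<phi> \<phi>' \<longrightarrow> (LBINT x. p' x * \<phi> x) = (LBINT x. p x * \<phi>' x)) \<longleftrightarrow> N = Dx P"
proof
  assume N: "N = Dx P"
  show "\<forall>\<phi> \<phi>'. test_fun \<phi> \<phi>' \<longrightarrow> (LBINT x. p' x * \<phi> x) = (LBINT x. p x * \<phi>' x)"
  proof (intro allI impI)
    fix \<phi> \<phi>' assume "test_fun \<phi> \<phi>'"
    then obtain U U' where U: "has_FT \<phi> U" "has_FT \<phi>' U'" "AE u in lborel. fun_of U' u = \<i> * cx u * fun_of U u"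
      by (rule test_fun_has_FT)
    show "(LBINT x. p' x * \<phi> x) = (LBINT x. p x * \<phi>' x)"
      unfolding Parseval[OF p' U(1)] Parseval[OF p U(2)] inner_Dx[OF U(3)] N ..
  qed
next
  assume weak: "\<forall>\<phi> \<phi>'. test_fun \<phi> \<phi>' \<longrightarrow> (LBINT x. p' x * \<phi> x) = (LBINT x. p x * \<phi>' x)"
  obtain r where r: "has_FT r (rmult J (Dx P))" by (rule has_FT_surj)
  have d: "has_FT (\<lambda>x. p' x - r x) (rmult J N - rmult J (Dx P))" by (rule has_FT_diff[OF p' r])
  have "AE x in lborel. p' x - r x = 0"
  proof (rule du_Bois_Reymond[OF has_FT_sq[OF d]])
    fix \<phi> \<phi>' assume t: "test_fun \<phi> \<phi>'"
    then obtain U U' where U: "has_FT \<phi> U" "has_FT \<phi>' U'" "AE u in lborel. fun_of U' u = \<i> * cx u * fun_of U u"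
      by (rule test_fun_has_FT)
    have "inner (rmult J N) U = inner (rmult J (Dx P)) U"
      using weak t unfolding Parseval[OF p' U(1), symmetric] inner_Dx[OF U(3), symmetric] Parseval[OF p U(2), symmetric] by blast
    then show "(LBINT x. (p' x - r x) * \<phi> x) = 0" unfolding Parseval[OF d U(1)] by (simp add: inner_diff_left)
  qed
  then have "AE x in lborel. p' x = r x" by eventually_elim simp
  from has_FT_cong_AE[OF p' sq_int_measurable[OF has_FT_sq[OF r]] this] have "rmult J N = rmult J (Dx P)"
    by (rule has_FT_unique[OF _ r])
  then show "N = Dx P" by (rule rmult_inj[OF even_sym_J jpow_neq_0])
qed

lemma burgers_term_scale: "burgers_term (c *\<^sub>R x) = c^2 *\<^sub>R burgers_term x"
  unfolding burgers_term_def bounded_bilinear.scaleR_left[OF bounded_bilinear_coeff_op[OF coeff_kernels(4)]]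
    bounded_bilinear.scaleR_right[OF bounded_bilinear_coeff_op[OF coeff_kernels(4)]] by (simp add: power2_eq_square)

lemma is_FT_dispersion_iff:
  assumes \<zeta>: "has_FT \<zeta> (rmult winv F)"
  shows "is_FT w (\<lambda>u. \<i> * cx (u * Tmu \<mu> u) * FT \<zeta> u) \<longleftrightarrow> has_FT w (- rmult J (sqrtT_op (sqrtT_op (Dx F))))"
proof (rule is_FT_iff_has_FT)
  note [measurable] = Tmu_measurable
  have [measurable]: "FT \<zeta> \<in> meas" using is_FT_FT[OF \<zeta>] by (simp add: is_FT_def csq_int_def)
  let ?F = "sqrtT_op (sqrtT_op (Dx F))"
  show symbol_AE: "AE u in lborel. fun_of (- rmult J ?F) u = \<i> * cx (u * Tmu \<mu> u) * FT \<zeta> u"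
    using FT_AE[OF \<zeta>] fun_of_rmult[OF even_sym_winv, of F] fun_of_rmult[OF even_sym_J, of ?F]
      fun_of_rmult[OF even_sym_sqrtT, of "sqrtT_op (Dx F)"] fun_of_rmult[OF even_sym_sqrtT, of "Dx F"]
      fun_of_fmult[OF herm_sym_deriv_symbol, of F] fun_of_scale[of "-1" "rmult J ?F"]
    unfolding sqrtT_op_def Dx_def
  proof eventually_elim
    case (elim u)
    have symbol: "- (cx (J u) * deriv_symbol u) = \<i> * cx u * cx (winv u)" by (simp add: deriv_symbol_def weight_eqs)
    have T: "Tmu \<mu> u = sqrtT u * sqrtT u" by (simp only: sqrtT_sq[symmetric] power2_eq_square)
    have "fun_of (- rmult J (rmult sqrtT (rmult sqrtT (fmult deriv_symbol F)))) u
        = - (cx (J u) * deriv_symbol u) * (cx (sqrtT u) * cx (sqrtT u) * fun_of F u)" using elim by simp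
    also have "... = \<i> * cx (u * Tmu \<mu> u) * FT \<zeta> u" unfolding symbol T using elim by simp
    finally show ?case .
  qed
  show "csq_int (\<lambda>u. \<i> * cx (u * Tmu \<mu> u) * FT \<zeta> u)"
    by (rule csq_int_cong_AE[OF csq_int_fun_of _ symbol_AE]) measurable
qed

lemma mass_equation_iff:
  assumes \<zeta>: "has_FT \<zeta> (rmult winv F)" and v: "has_FT v (rmult winv H)" and \<zeta>': "has_FT \<zeta>' (rmult J N)"
  shows "(\<forall>\<phi> \<phi>'. test_fun \<phi> \<phi>' \<longrightarrow> (LBINT x. \<zeta>' x * \<phi> x) = (LBINT x. (v x + \<epsilon> * \<zeta> x * v x) * \<phi>' x))
    \<longleftrightarrow> N = Dx (H + \<epsilon> *\<^sub>R prod_s F H)"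
proof (rule weak_derivative_iff[OF _ \<zeta>'])
  note linear = bounded_linear.linear[OF bounded_linear_rmult[OF even_sym_winv]]
  have "has_FT (\<lambda>x. v x + \<epsilon> * (\<zeta> x * v x)) (rmult winv H + \<epsilon> *\<^sub>R rmult winv (prod_s F H))"
    by (intro has_FT_add has_FT_cmult has_FT_prod_s \<zeta> v)
  then show "has_FT (\<lambda>x. v x + \<epsilon> * \<zeta> x * v x) (rmult winv (H + \<epsilon> *\<^sub>R prod_s F H))"
    by (simp add: linear_add[OF linear] linear_scale[OF linear] mult.assoc)
qed

lemma momentum_equation_iff:
  assumes v: "has_FT v (rmult winv (sqrtT_op G))" and v': "has_FT v' (rmult J (sqrtT_op N))"
    and w: "has_FT w (- rmult J (sqrtT_op (sqrtT_op (Dx F))))"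
  shows "(\<forall>\<phi> \<phi>'. test_fun \<phi> \<phi>' \<longrightarrow> (LBINT x. v' x * \<phi> x) = - (LBINT x. w x * \<phi> x) + \<epsilon> * (LBINT x. ((v x)^2 / 2) * \<phi>' x))
    \<longleftrightarrow> N = sqrtT_op (Dx F) + \<epsilon> *\<^sub>R burgers_term G" (is "?weak \<longleftrightarrow> _")
proof -
  let ?g = "sqrtT_op G" and ?F = "sqrtT_op (sqrtT_op (Dx F))"
  note linear_winv = bounded_linear.linear[OF bounded_linear_rmult[OF even_sym_winv]]
  note linear_J = bounded_linear.linear[OF bounded_linear_rmult[OF even_sym_J]]
  have "has_FT (\<lambda>x. (\<epsilon> / 2) * (v x * v x)) ((\<epsilon> / 2) *\<^sub>R rmult winv (prod_s ?g ?g))"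
    by (intro has_FT_cmult has_FT_prod_s v)
  then have flux: "has_FT (\<lambda>x. \<epsilon> * ((v x)^2 / 2)) (rmult winv ((\<epsilon> / 2) *\<^sub>R prod_s ?g ?g))"
    by (simp add: linear_scale[OF linear_winv] power2_eq_square)
  have rate: "has_FT (\<lambda>x. v' x + w x) (rmult J (sqrtT_op N - ?F))" using has_FT_add[OF v' w]
    by (simp add: linear_diff[OF linear_J])
  have "(LBINT x. v' x * \<phi> x) = - (LBINT x. w x * \<phi> x) + \<epsilon> * (LBINT x. ((v x)^2 / 2) * \<phi>' x) \<longleftrightarrow>
      (LBINT x. (v' x + w x) * \<phi> x) = (LBINT x. \<epsilon> * ((v x)^2 / 2) * \<phi>' x)" if test: "test_fun \<phi> \<phi>'" for \<phi> \<phi>'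
  proof -
    obtain U U' where U: "has_FT \<phi> U" "has_FT \<phi>' U'" using test by (rule test_fun_has_FT)
    have "(LBINT x. (v' x + w x) * \<phi> x) = (LBINT x. v' x * \<phi> x) + (LBINT x. w x * \<phi> x)"
      using sq_int_mult_integrable[OF has_FT_sq[OF v'] has_FT_sq[OF U(1)]] sq_int_mult_integrable[OF has_FT_sq[OF w] has_FT_sq[OF U(1)]]
      by (simp add: distrib_right)
    moreover have "(LBINT x. \<epsilon> * ((v x)^2 / 2) * \<phi>' x) = \<epsilon> * (LBINT x. ((v x)^2 / 2) * \<phi>' x)"
      unfolding mult.assoc by (rule integral_mult_right_zero)
    ultimately show ?thesis by linarith
  qed
  then have "?weak \<longleftrightarrow> sqrtT_op N - ?F = Dx ((\<epsilon> / 2) *\<^sub>R prod_s ?g ?g)"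
    unfolding weak_derivative_iff[OF flux rate, symmetric] by blast
  also have "Dx ((\<epsilon> / 2) *\<^sub>R prod_s ?g ?g) = sqrtT_op (\<epsilon> *\<^sub>R burgers_term G)"
    by (simp add: Dx.scaleR sqrtT_op.scaleR sqrtT_op_burgers_term)
  also have "sqrtT_op N - ?F = sqrtT_op (\<epsilon> *\<^sub>R burgers_term G) \<longleftrightarrow> sqrtT_op N = sqrtT_op (sqrtT_op (Dx F) + \<epsilon> *\<^sub>R burgers_term G)"
    unfolding sqrtT_op.add by (auto simp: algebra_simps)
  also have "... \<longleftrightarrow> N = sqrtT_op (Dx F) + \<epsilon> *\<^sub>R burgers_term G" using sqrtT_op_inj by blast
  finally show ?thesis .
qed

definition weak_equations ::
  "real => (real => real) => (real => real) => (real => real) => (real => real) => bool" where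
  "weak_equations \<epsilon> \<zeta> v \<zeta>' v' \<longleftrightarrow> (\<exists>w. is_FT w (\<lambda>u. \<i> * cx (u * Tmu \<mu> u) * FT \<zeta> u) \<and>
     (\<forall>\<phi> \<phi>'. test_fun \<phi> \<phi>' \<longrightarrow>
        (LBINT x. \<zeta>' x * \<phi> x) = (LBINT x. (v x + \<epsilon> * \<zeta> x * v x) * \<phi>' x) \<and>
        (LBINT x. v' x * \<phi> x) = - (LBINT x. w x * \<phi> x) + \<epsilon> * (LBINT x. ((v x)^2 / 2) * \<phi>' x)))"

lemma wb_rhs_scale:
  "wb_rhs (\<epsilon> *\<^sub>R W) = \<epsilon> *\<^sub>R (Dx (sqrtT_op (snd W) + \<epsilon> *\<^sub>R prod_s (fst W) (sqrtT_op (snd W))),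
     sqrtT_op (Dx (fst W)) + \<epsilon> *\<^sub>R burgers_term (snd W))"
  unfolding wb_rhs_def
  by (simp add: Dx.add Dx.scaleR sqrtT_op.scaleR prod_s.scaleR_left prod_s.scaleR_right burgers_term_scale power2_eq_square
      scaleR_add_right prod_s_commute[of "sqrtT_op (snd W)"])

lemma weak_equations_iff:
  assumes W: "represents s \<zeta> v W" and N: "represents (s - 1) \<zeta>' v' N" and e: "0 < \<epsilon>"
  shows "weak_equations \<epsilon> \<zeta> v \<zeta>' v' \<longleftrightarrow> N = (1 / \<epsilon>) *\<^sub>R wb_rhs (\<epsilon> *\<^sub>R W)"
proof -
  have W: "has_FT \<zeta> (rmult winv (fst W))" "has_FT v (rmult winv (sqrtT_op (snd W)))"
    and N: "has_FT \<zeta>' (rmult J (fst N))" "has_FT v' (rmult J (sqrtT_op (snd N)))"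
    using W N by (auto simp: represents_def)
  obtain w where w: "has_FT w (- rmult J (sqrtT_op (sqrtT_op (Dx (fst W)))))" by (rule has_FT_surj)
  have "weak_equations \<epsilon> \<zeta> v \<zeta>' v' \<longleftrightarrow> fst N = Dx (sqrtT_op (snd W) + \<epsilon> *\<^sub>R prod_s (fst W) (sqrtT_op (snd W))) \<and>
      snd N = sqrtT_op (Dx (fst W)) + \<epsilon> *\<^sub>R burgers_term (snd W)"
    unfolding weak_equations_def is_FT_dispersion_iff[OF W(1)] mass_equation_iff[OF W N(1), symmetric]
    using momentum_equation_iff[OF W(2) N(2)] w by blast
  also have "... \<longleftrightarrow> N = (1 / \<epsilon>) *\<^sub>R wb_rhs (\<epsilon> *\<^sub>R W)" using e
    unfolding wb_rhs_scale by (simp add: prod_eq_iff)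
  finally show ?thesis .
qed

lemma continuous_on_wb_rhs: "continuous_on A W ==> continuous_on A (\<lambda>t. wb_rhs (W t))"
  unfolding wb_rhs_def burgers_term_def
  by (intro continuous_intros Dx.continuous_on sqrtT_op.continuous_on prod_s.continuous_on
      bounded_bilinear.continuous_on[OF bounded_bilinear_coeff_op[OF coeff_kernels(4)]])

lemma wb_solution_scaleR_iff:
  assumes e: "0 < \<epsilon>"
  shows "wb_solution T (\<lambda>t. \<epsilon> *\<^sub>R W t) \<longleftrightarrow> continuous_on {0..T} W \<and>
    (\<forall>t\<in>{0..T}. ((\<lambda>t. rmult2 jinv (W t)) has_vector_derivative (1 / \<epsilon>) *\<^sub>R wb_rhs (\<epsilon> *\<^sub>R W t)) (at t within {0..T}))"
proof -
  note scale = bounded_linear.has_vector_derivative[OF bounded_linear_scaleR_right]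
  have "((\<lambda>t. rmult2 jinv (\<epsilon> *\<^sub>R W t)) has_vector_derivative D) F
      \<longleftrightarrow> ((\<lambda>t. rmult2 jinv (W t)) has_vector_derivative (1 / \<epsilon>) *\<^sub>R D) F" for D F
    unfolding rmult2_scaleR[OF even_sym_jinv]
    using scale[of "\<lambda>t. rmult2 jinv (W t)" "(1 / \<epsilon>) *\<^sub>R D" F \<epsilon>] scale[of "\<lambda>t. \<epsilon> *\<^sub>R rmult2 jinv (W t)" D F "1 / \<epsilon>"] e by auto
  moreover have "continuous_on {0..T} (\<lambda>t. \<epsilon> *\<^sub>R W t) \<longleftrightarrow> continuous_on {0..T} W"
    using continuous_on_scaleR[OF continuous_on_const, of "{0..T}" "\<lambda>t. \<epsilon> *\<^sub>R W t" "1 / \<epsilon>"]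
      continuous_on_scaleR[OF continuous_on_const, of "{0..T}" W \<epsilon>] e by auto
  ultimately show ?thesis unfolding wb_solution_def by simp
qed

theorem is_solution_iff:
  assumes e: "0 < \<epsilon>" and W: "\<And>t. t \<in> {0..T} ==> represents s (\<zeta> t) (v t) (W t)"
  shows "is_solution s \<mu> \<epsilon> T \<zeta>0 v0 \<zeta> v \<longleftrightarrow> \<zeta> 0 = \<zeta>0 \<and> v 0 = v0 \<and> wb_solution T (\<lambda>t. \<epsilon> *\<^sub>R W t)"
    (is "?sol \<longleftrightarrow> ?init \<and> ?init' \<and> ?wb")
proof -
  let ?N = "\<lambda>t. (1 / \<epsilon>) *\<^sub>R wb_rhs (\<epsilon> *\<^sub>R W t)"
  have cont_iff: "(\<forall>t\<in>{0..T}. ((\<lambda>y. V_norm s \<mu> (\<lambda>x. \<zeta> y x - \<zeta> t x) (\<lambda>x. v y x - v t x)) \<longlongrightarrow> 0) (at t within {0..T}))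
      \<longleftrightarrow> continuous_on {0..T} W" by (rule V_norm_continuous_iff[OF s_nonneg(1) W])
  show ?thesis
  proof
    assume ?sol
    then have init: ?init ?init' and cont: "continuous_on {0..T} W"
      unfolding is_solution_def cont_iff by simp_all
    obtain \<zeta>' v' where V': "\<And>t. t \<in> {0..T} ==> V_space (s - 1) \<mu> (\<zeta>' t) (v' t)"
      and lim: "\<And>t. t \<in> {0..T} ==> ((\<lambda>y. V_norm (s - 1) \<mu> (\<lambda>x. (\<zeta> y x - \<zeta> t x) / (y - t) - \<zeta>' t x)
        (\<lambda>x. (v y x - v t x) / (y - t) - v' t x)) \<longlongrightarrow> 0) (at t within {0..T})"
      and eqs: "\<And>t. t \<in> {0..T} ==> weak_equations \<epsilon> (\<zeta> t) (v t) (\<zeta>' t) (v' t)"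
      using \<open>?sol\<close> unfolding is_solution_def weak_equations_def by blast
    have "((\<lambda>t. rmult2 jinv (W t)) has_vector_derivative ?N t) (at t within {0..T})" if t: "t \<in> {0..T}" for t
    proof -
      obtain N where N: "represents (s - 1) (\<zeta>' t) (v' t) N" by (rule V_space_represents[OF s_nonneg(2) V'[OF t]])
      have "((\<lambda>t. rmult2 jinv (W t)) has_vector_derivative N) (at t within {0..T})"
        using V_norm_derivative_iff[of "{0..T}" \<zeta> v W, OF W N t] lim[OF t] by blast
      then show ?thesis using weak_equations_iff[OF W[OF t] N e] eqs[OF t] by simp
    qed
    then show "?init \<and> ?init' \<and> ?wb" using init cont unfolding wb_solution_scaleR_iff[OF e] by blast
  next
    assume "?init \<and> ?init' \<and> ?wb"
    then have init: ?init ?init' and cont: "continuous_on {0..T} W"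
      and deriv: "\<And>t. t \<in> {0..T} ==> ((\<lambda>t. rmult2 jinv (W t)) has_vector_derivative ?N t) (at t within {0..T})"
      unfolding wb_solution_scaleR_iff[OF e] by blast+
    obtain \<zeta>' v' where N: "\<And>t. represents (s - 1) (\<zeta>' t) (v' t) (?N t)"
      by (rule represents_exists[of "s - 1" ?N]) blast
    have "continuous_on {0..T} ?N" by (intro continuous_intros continuous_on_wb_rhs cont)
    then have cont': "\<forall>t\<in>{0..T}. ((\<lambda>y. V_norm (s - 1) \<mu> (\<lambda>x. \<zeta>' y x - \<zeta>' t x) (\<lambda>x. v' y x - v' t x)) \<longlongrightarrow> 0) (at t within {0..T})"
      using V_norm_continuous_iff[of "s - 1" "{0..T}" \<zeta>' v' ?N] s_nonneg(2) N by blast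
    have lim: "((\<lambda>y. V_norm (s - 1) \<mu> (\<lambda>x. (\<zeta> y x - \<zeta> t x) / (y - t) - \<zeta>' t x)
        (\<lambda>x. (v y x - v t x) / (y - t) - v' t x)) \<longlongrightarrow> 0) (at t within {0..T})" if "t \<in> {0..T}" for t
      using V_norm_derivative_iff[of "{0..T}" \<zeta> v W, OF W N that] deriv[OF that] by blast
    have eqs: "weak_equations \<epsilon> (\<zeta> t) (v t) (\<zeta>' t) (v' t)" if "t \<in> {0..T}" for t
      using weak_equations_iff[OF W[OF that] N e] by simp
    show ?sol
      unfolding is_solution_def cont_iff weak_equations_def[symmetric]
      using init cont cont' lim eqs represents_V_space[OF s_nonneg(1) W] represents_V_space[OF s_nonneg(2) N] by blast
  qed
qed

subsection \<open>Well-posedness\<close>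

definition sym_lift :: "real => real => (real => real => real) => (real => real => real) => (real => state) => bool" where
  "sym_lift \<epsilon> T \<zeta> v X \<longleftrightarrow> sym_solution T X \<and> weight_bound T (X 0) X \<and>
     (\<forall>t\<in>{0..T}. norm (X t) <= 4 * c_wb \<and> represents s (\<zeta> t) (v t) ((1 / \<epsilon>) *\<^sub>R elev_pair (X t)))"

lemma sym_liftD:
  assumes "sym_lift \<epsilon> T \<zeta> v X"
  shows "sym_solution T X" "weight_bound T (X 0) X" "\<And>t. t \<in> {0..T} ==> norm (X t) <= 4 * c_wb"
    "\<And>t. t \<in> {0..T} ==> represents s (\<zeta> t) (v t) ((1 / \<epsilon>) *\<^sub>R elev_pair (X t))"
  using assms by (auto simp: sym_lift_def)

lemma sym_lift_is_solution:
  assumes lift: "sym_lift \<epsilon> T \<zeta> v X" and e: "0 < \<epsilon>"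
  shows "is_solution s \<mu> \<epsilon> T (\<zeta> 0) (v 0) \<zeta> v"
proof -
  have small: "norm (X t) <= 1 / C_prod" if "t \<in> {0..T}" for t using sym_liftD(3)[OF lift that] c_wb(1,4) by linarith
  have wb: "wb_solution T (\<lambda>t. elev_pair (X t))"
    by (rule iffD2[OF wb_solution_elev_pair_iff[of T X, OF small] sym_liftD(1)[OF lift]])
  have scale: "\<epsilon> *\<^sub>R (1 / \<epsilon>) *\<^sub>R elev_pair (X t) = elev_pair (X t)" for t using e by simp
  show ?thesis
    by (rule iffD2[OF is_solution_iff[OF e, of T \<zeta> v "\<lambda>t. (1 / \<epsilon>) *\<^sub>R elev_pair (X t)"]])
      (simp_all only: sym_liftD(4)[OF lift] scale wb)
qed

lemma is_solution_represents:
  assumes e: "0 < \<epsilon>" and sol: "is_solution s \<mu> \<epsilon> T \<zeta>0 v0 \<zeta> v"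
  obtains W where "\<And>t. t \<in> {0..T} ==> represents s (\<zeta> t) (v t) (W t)" "wb_solution T (\<lambda>t. \<epsilon> *\<^sub>R W t)"
proof -
  have "\<forall>t\<in>{0..T}. V_space s \<mu> (\<zeta> t) (v t)" using sol by (simp add: is_solution_def)
  then have "\<forall>t\<in>{0..T}. \<exists>W. represents s (\<zeta> t) (v t) W" using V_space_represents[OF s_nonneg(1)]
    by metis
  then obtain W where W: "\<And>t. t \<in> {0..T} ==> represents s (\<zeta> t) (v t) (W t)" by metis
  have "wb_solution T (\<lambda>t. \<epsilon> *\<^sub>R W t)" using sol is_solution_iff[OF e, of T \<zeta> v W, OF W] by blast
  with W show thesis by (rule that)
qed

lemma sym_lift_exists:
  assumes V0: "V_space s \<mu> \<zeta>0 v0" and e: "0 < \<epsilon>"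
    and d: "0 < d" "d <= c_wb" "\<epsilon> * V_norm s \<mu> \<zeta>0 v0 <= d"
  obtains \<zeta> v X where "sym_lift \<epsilon> (c_wb / d) \<zeta> v X" "\<zeta> 0 = \<zeta>0" "v 0 = v0"
    "\<And>t. t \<in> {0..c_wb / d} ==> V_norm s \<mu> (\<zeta> t) (v t) <= 16 * V_norm s \<mu> \<zeta>0 v0"
proof -
  obtain W0 where W0: "represents s \<zeta>0 v0 W0" by (rule V_space_represents[OF s_nonneg(1) V0])
  have W0_le: "norm W0 <= V_norm s \<mu> \<zeta>0 v0" by (rule represents_norm_le[OF s_nonneg(1) W0])
  then have "norm (\<epsilon> *\<^sub>R W0) <= \<epsilon> * V_norm s \<mu> \<zeta>0 v0" using e by simp
  then have small: "norm (\<epsilon> *\<^sub>R W0) <= d" using d(3) by (rule order_trans)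
  obtain X where X: "sym_solution (c_wb / d) X" "elev_pair (X 0) = \<epsilon> *\<^sub>R W0" "weight_bound (c_wb / d) (X 0) X"
    and X_le: "\<And>t. t \<in> {0..c_wb / d} ==> norm (X t) <= 4 * norm (\<epsilon> *\<^sub>R W0)"
    by (rule wb_solution_exists[OF d(1) small d(2)]) blast
  let ?W = "\<lambda>t. (1 / \<epsilon>) *\<^sub>R elev_pair (X t)"
  obtain \<zeta> v where rep: "\<And>t. represents s (\<zeta> t) (v t) (?W t)" by (rule represents_exists[of s ?W]) blast
  let ?\<zeta> = "\<zeta>(0 := \<zeta>0)" and ?v = "v(0 := v0)"
  have W: "represents s (?\<zeta> t) (?v t) (?W t)" for t using rep[of t] W0 X(2) e by simp
  have X_small: "norm (X t) <= 4 * c_wb" if "t \<in> {0..c_wb / d}" for t using X_le[OF that] small d(2) by linarith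
  have "V_norm s \<mu> (?\<zeta> t) (?v t) <= 16 * V_norm s \<mu> \<zeta>0 v0" if t: "t \<in> {0..c_wb / d}" for t
  proof -
    have "norm (elev_pair (X t)) <= 2 * norm (X t)" using X_small[OF t] c_wb(1,4) by (intro norm_elev_pair_le) linarith
    then have "norm (?W t) <= 8 * norm W0" using X_le[OF t] e by (simp add: field_simps)
    then show ?thesis using represents_V_norm_le[OF s_nonneg(1) W[of t]] W0_le by linarith
  qed
  moreover have "sym_lift \<epsilon> (c_wb / d) ?\<zeta> ?v X" using X X_small W unfolding sym_lift_def by blast
  ultimately show thesis by (intro that[of ?\<zeta> ?v X]) simp_all
qed

lemma sym_lift_unique:
  assumes lift: "sym_lift \<epsilon> T \<zeta> v X" and e: "0 < \<epsilon>"
    and sol: "is_solution s \<mu> \<epsilon> T (\<zeta> 0) (v 0) \<zeta>b vb" and t: "t \<in> {0..T}"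
  shows "V_norm s \<mu> (\<lambda>x. \<zeta>b t x - \<zeta> t x) (\<lambda>x. vb t x - v t x) = 0"
proof -
  obtain W where W: "\<And>t. t \<in> {0..T} ==> represents s (\<zeta>b t) (vb t) (W t)"
    and wb: "wb_solution T (\<lambda>t. \<epsilon> *\<^sub>R W t)"
    by (rule is_solution_represents[OF e sol]) blast
  have zero: "0 \<in> {0..T}" using t by simp
  have "\<zeta>b 0 = \<zeta> 0" "vb 0 = v 0" using sol by (auto simp: is_solution_def)
  then have "W 0 = (1 / \<epsilon>) *\<^sub>R elev_pair (X 0)"
    using represents_unique[OF s_nonneg(1) W[OF zero]] sym_liftD(4)[OF lift zero] by simp
  then have "\<epsilon> *\<^sub>R W 0 = elev_pair (X 0)" using e by simp
  then have lifted: "\<epsilon> *\<^sub>R W t = elev_pair (X t)"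
    using wb_solution_unique[of T X "\<lambda>t. \<epsilon> *\<^sub>R W t" t] sym_liftD(1,3)[OF lift] wb t by blast
  have "W t = (1 / \<epsilon>) *\<^sub>R elev_pair (X t)" unfolding lifted[symmetric] using e by simp
  then show ?thesis
    using V_norm_diff_le(1)[OF s_nonneg(1) W[OF t] sym_liftD(4)[OF lift t]] V_norm_nonneg by (simp add: order_antisym)
qed

lemma sym_lift_dependence:
  assumes lift: "sym_lift \<epsilon> (c_wb / d) \<zeta> v X" and e: "0 < \<epsilon>" and \<eta>: "0 < \<eta>"
  obtains \<delta> where "0 < \<delta>"
    "\<And>d' \<zeta>1 v1 \<zeta>b vb t. 0 < d' ==> d' <= c_wb ==> \<epsilon> * V_norm s \<mu> \<zeta>1 v1 <= d' ==>
      V_norm s \<mu> (\<lambda>x. \<zeta>1 x - \<zeta> 0 x) (\<lambda>x. v1 x - v 0 x) < \<delta> ==> is_solution s \<mu> \<epsilon> (c_wb / d') \<zeta>1 v1 \<zeta>b vb ==>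
      t \<in> {0..min (c_wb / d) (c_wb / d')} ==> V_norm s \<mu> (\<lambda>x. \<zeta>b t x - \<zeta> t x) (\<lambda>x. vb t x - v t x) <= \<eta>"
proof -
  let ?W = "\<lambda>t. (1 / \<epsilon>) *\<^sub>R elev_pair (X t)"
  have norm_scale: "norm (\<epsilon> *\<^sub>R U - elev_pair (X t)) = \<epsilon> * norm (U - ?W t)" for U t
  proof -
    have factor: "\<epsilon> *\<^sub>R U - elev_pair (X t) = \<epsilon> *\<^sub>R (U - ?W t)" using e
      by (simp add: scaleR_diff_right)
    show ?thesis unfolding factor norm_scaleR using e by simp
  qed
  have pos: "0 < \<epsilon> * \<eta> / 2" using e \<eta> by simp
  obtain \<delta> where \<delta>: "0 < \<delta>"
    and close: "\<And>d' W t. 0 < d' ==> d' <= c_wb ==> norm (W 0) <= d' ==> norm (W 0 - elev_pair (X 0)) < \<delta> ==> wb_solution (c_wb / d') W ==>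
      t \<in> {0..min (c_wb / d) (c_wb / d')} ==> norm (W t - elev_pair (X t)) <= \<epsilon> * \<eta> / 2"
    by (rule wb_solution_dependence[of d X "\<epsilon> * \<eta> / 2", OF sym_liftD(1-3)[OF lift] pos]) (assumption, rule that, assumption, blast)
  show thesis
  proof (rule that[of "\<delta> / \<epsilon>"])
    show "0 < \<delta> / \<epsilon>" using \<delta> e by simp
    fix d' \<zeta>1 v1 \<zeta>b vb t
    assume d': "0 < d'" "d' <= c_wb" "\<epsilon> * V_norm s \<mu> \<zeta>1 v1 <= d'"
      and init: "V_norm s \<mu> (\<lambda>x. \<zeta>1 x - \<zeta> 0 x) (\<lambda>x. v1 x - v 0 x) < \<delta> / \<epsilon>"
      and sol: "is_solution s \<mu> \<epsilon> (c_wb / d') \<zeta>1 v1 \<zeta>b vb"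
      and t: "t \<in> {0..min (c_wb / d) (c_wb / d')}"
    obtain U where U: "\<And>t. t \<in> {0..c_wb / d'} ==> represents s (\<zeta>b t) (vb t) (U t)"
      and wb: "wb_solution (c_wb / d') (\<lambda>t. \<epsilon> *\<^sub>R U t)"
      by (rule is_solution_represents[OF e sol]) blast
    have times: "0 \<in> {0..c_wb / d}" "0 \<in> {0..c_wb / d'}" "t \<in> {0..c_wb / d}" "t \<in> {0..c_wb / d'}" using t by auto
    have "\<zeta>b 0 = \<zeta>1" "vb 0 = v1" using sol by (auto simp: is_solution_def)
    then have U0: "represents s \<zeta>1 v1 (U 0)" using U[OF times(2)] by simp
    have "norm (\<epsilon> *\<^sub>R U 0) <= \<epsilon> * V_norm s \<mu> \<zeta>1 v1"
      using represents_norm_le[OF s_nonneg(1) U0] e by simp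
    then have small: "norm (\<epsilon> *\<^sub>R U 0) <= d'" using d'(3) by (rule order_trans)
    have "norm (U 0 - ?W 0) < \<delta> / \<epsilon>"
      using V_norm_diff_le(2)[OF s_nonneg(1) U0 sym_liftD(4)[OF lift times(1)]] init by linarith
    then have "norm (\<epsilon> *\<^sub>R U 0 - elev_pair (X 0)) < \<delta>" using e unfolding norm_scale
      by (simp add: pos_less_divide_eq mult.commute)
    then have "\<epsilon> * norm (U t - ?W t) <= \<epsilon> * (\<eta> / 2)"
      using close[OF d'(1,2) small _ wb t] unfolding norm_scale by simp
    then have "norm (U t - ?W t) <= \<eta> / 2" using e by simp
    then show "V_norm s \<mu> (\<lambda>x. \<zeta>b t x - \<zeta> t x) (\<lambda>x. vb t x - v t x) <= \<eta>"
      using V_norm_diff_le(1)[OF s_nonneg(1) U[OF times(4)] sym_liftD(4)[OF lift times(3)]] by linarith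
  qed
qed

abbreviation lifespan :: "(real => real) => (real => real) => real" where
  "lifespan \<zeta> v \<equiv> c_wb * inverse (V_norm s \<mu> \<zeta> v)"

lemma lifespan_scale:
  assumes "0 < \<epsilon>" "\<epsilon> <= lifespan \<zeta> v"
  shows "0 < \<epsilon> * V_norm s \<mu> \<zeta> v" "\<epsilon> * V_norm s \<mu> \<zeta> v <= c_wb" "lifespan \<zeta> v / \<epsilon> = c_wb / (\<epsilon> * V_norm s \<mu> \<zeta> v)"
proof -
  have "V_norm s \<mu> \<zeta> v \<noteq> 0" using assms by auto
  then have "0 < V_norm s \<mu> \<zeta> v" using V_norm_nonneg[of s \<zeta> v] by linarith
  then show "0 < \<epsilon> * V_norm s \<mu> \<zeta> v" "\<epsilon> * V_norm s \<mu> \<zeta> v <= c_wb" "lifespan \<zeta> v / \<epsilon> = c_wb / (\<epsilon> * V_norm s \<mu> \<zeta> v)"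
    using assms by (simp_all add: field_simps)
qed

theorem well_posed:
  assumes V0: "V_space s \<mu> \<zeta>0 v0" and e: "0 < \<epsilon>" and small: "\<epsilon> <= lifespan \<zeta>0 v0"
  shows "\<exists>\<zeta> v. is_solution s \<mu> \<epsilon> (lifespan \<zeta>0 v0 / \<epsilon>) \<zeta>0 v0 \<zeta> v \<and>
    (\<forall>t\<in>{0..lifespan \<zeta>0 v0 / \<epsilon>}. V_norm s \<mu> (\<zeta> t) (v t) <= 16 * V_norm s \<mu> \<zeta>0 v0) \<and>
    (\<forall>\<zeta>b vb. is_solution s \<mu> \<epsilon> (lifespan \<zeta>0 v0 / \<epsilon>) \<zeta>0 v0 \<zeta>b vb \<longrightarrow>
      (\<forall>t\<in>{0..lifespan \<zeta>0 v0 / \<epsilon>}. V_norm s \<mu> (\<lambda>x. \<zeta>b t x - \<zeta> t x) (\<lambda>x. vb t x - v t x) = 0)) \<and>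
    (\<forall>\<eta>>0. \<exists>\<delta>>0. \<forall>\<zeta>1 v1 \<zeta>b vb. V_norm s \<mu> (\<lambda>x. \<zeta>1 x - \<zeta>0 x) (\<lambda>x. v1 x - v0 x) < \<delta> \<longrightarrow>
      \<epsilon> <= lifespan \<zeta>1 v1 \<longrightarrow> is_solution s \<mu> \<epsilon> (lifespan \<zeta>1 v1 / \<epsilon>) \<zeta>1 v1 \<zeta>b vb \<longrightarrow>
      (\<forall>t\<in>{0..min (lifespan \<zeta>0 v0) (lifespan \<zeta>1 v1) / \<epsilon>}. V_norm s \<mu> (\<lambda>x. \<zeta>b t x - \<zeta> t x) (\<lambda>x. vb t x - v t x) <= \<eta>))"
proof -
  note d = lifespan_scale[OF e small]
  obtain \<zeta> v X where lift: "sym_lift \<epsilon> (lifespan \<zeta>0 v0 / \<epsilon>) \<zeta> v X"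
    and init: "\<zeta> 0 = \<zeta>0" "v 0 = v0"
    and bound: "\<And>t. t \<in> {0..lifespan \<zeta>0 v0 / \<epsilon>} ==> V_norm s \<mu> (\<zeta> t) (v t) <= 16 * V_norm s \<mu> \<zeta>0 v0"
    unfolding d(3) by (rule sym_lift_exists[OF V0 e d(1,2) order_refl]) blast
  have "\<exists>\<delta>>0. \<forall>\<zeta>1 v1 \<zeta>b vb. V_norm s \<mu> (\<lambda>x. \<zeta>1 x - \<zeta>0 x) (\<lambda>x. v1 x - v0 x) < \<delta> \<longrightarrow>
      \<epsilon> <= lifespan \<zeta>1 v1 \<longrightarrow> is_solution s \<mu> \<epsilon> (lifespan \<zeta>1 v1 / \<epsilon>) \<zeta>1 v1 \<zeta>b vb \<longrightarrow>
      (\<forall>t\<in>{0..min (lifespan \<zeta>0 v0) (lifespan \<zeta>1 v1) / \<epsilon>}. V_norm s \<mu> (\<lambda>x. \<zeta>b t x - \<zeta> t x) (\<lambda>x. vb t x - v t x) <= \<eta>)"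
    if \<eta>: "0 < \<eta>" for \<eta>
  proof -
    obtain \<delta> where "0 < \<delta>" and close: "\<And>d' \<zeta>1 v1 \<zeta>b vb t. 0 < d' ==> d' <= c_wb ==> \<epsilon> * V_norm s \<mu> \<zeta>1 v1 <= d' ==>
        V_norm s \<mu> (\<lambda>x. \<zeta>1 x - \<zeta>0 x) (\<lambda>x. v1 x - v0 x) < \<delta> ==> is_solution s \<mu> \<epsilon> (c_wb / d') \<zeta>1 v1 \<zeta>b vb ==>
        t \<in> {0..min (lifespan \<zeta>0 v0 / \<epsilon>) (c_wb / d')} ==> V_norm s \<mu> (\<lambda>x. \<zeta>b t x - \<zeta> t x) (\<lambda>x. vb t x - v t x) <= \<eta>"
      using sym_lift_dependence[OF lift[unfolded d(3)] e \<eta>] unfolding init d(3) by blast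
    show ?thesis
    proof (intro exI[of _ \<delta>] conjI allI impI ballI \<open>0 < \<delta>\<close>)
      fix \<zeta>1 v1 \<zeta>b vb t
      assume near: "V_norm s \<mu> (\<lambda>x. \<zeta>1 x - \<zeta>0 x) (\<lambda>x. v1 x - v0 x) < \<delta>"
        and small: "\<epsilon> <= lifespan \<zeta>1 v1"
        and sol: "is_solution s \<mu> \<epsilon> (lifespan \<zeta>1 v1 / \<epsilon>) \<zeta>1 v1 \<zeta>b vb"
        and t: "t \<in> {0..min (lifespan \<zeta>0 v0) (lifespan \<zeta>1 v1) / \<epsilon>}"
      note d' = lifespan_scale[OF e small]
      show "V_norm s \<mu> (\<lambda>x. \<zeta>b t x - \<zeta> t x) (\<lambda>x. vb t x - v t x) <= \<eta>"
        by (rule close[OF d'(1,2) order_refl near]) (use sol t e in \<open>simp_all only: d'(3) min_divide_distrib_right if_True less_imp_le\<close>)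
    qed
  qed
  then show ?thesis
    using sym_lift_is_solution[OF lift e] sym_lift_unique[OF lift e] bound unfolding init by blast
qed

end

theorem mainTheorem2:
  fixes s h0 :: real
  assumes "s > 3 / 2" and "0 < h0" and "h0 < 1"
  shows "\<exists>c>0. \<exists>C>0. \<forall>\<mu>::real. 0 < \<mu> \<longrightarrow> \<mu> < 1 \<longrightarrow>
    (\<forall>\<zeta>0 v0 \<epsilon>. V_space s \<mu> \<zeta>0 v0 \<longrightarrow> (\<forall>x. 1 + \<epsilon> * \<zeta>0 x \<ge> h0) \<longrightarrow>
       0 < \<epsilon> \<longrightarrow> \<epsilon> \<le> c * inverse (V_norm s \<mu> \<zeta>0 v0) \<longrightarrow>
       (let T = c * inverse (V_norm s \<mu> \<zeta>0 v0) in
        \<exists>\<zeta> v. is_solution s \<mu> \<epsilon> (T / \<epsilon>) \<zeta>0 v0 \<zeta> v \<and>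
          (\<forall>t\<in>{0..T / \<epsilon>}. V_norm s \<mu> (\<zeta> t) (v t) \<le> C * V_norm s \<mu> \<zeta>0 v0) \<and>
          (\<forall>\<zeta>b vb. is_solution s \<mu> \<epsilon> (T / \<epsilon>) \<zeta>0 v0 \<zeta>b vb \<longrightarrow>
             (\<forall>t\<in>{0..T / \<epsilon>}. V_norm s \<mu> (\<lambda>x. \<zeta>b t x - \<zeta> t x) (\<lambda>x. vb t x - v t x) = 0)) \<and>
          (\<forall>\<eta>>0. \<exists>\<delta>>0. \<forall>\<zeta>1 v1 \<zeta>b vb.
             V_space s \<mu> \<zeta>1 v1 \<longrightarrow>
             V_norm s \<mu> (\<lambda>x. \<zeta>1 x - \<zeta>0 x) (\<lambda>x. v1 x - v0 x) < \<delta> \<longrightarrow>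
             (\<forall>x. 1 + \<epsilon> * \<zeta>1 x \<ge> h0) \<longrightarrow>
             \<epsilon> \<le> c * inverse (V_norm s \<mu> \<zeta>1 v1) \<longrightarrow>
             is_solution s \<mu> \<epsilon> (c * inverse (V_norm s \<mu> \<zeta>1 v1) / \<epsilon>) \<zeta>1 v1 \<zeta>b vb \<longrightarrow>
             (\<forall>t\<in>{0..min T (c * inverse (V_norm s \<mu> \<zeta>1 v1)) / \<epsilon>}.
                V_norm s \<mu> (\<lambda>x. \<zeta>b t x - \<zeta> t x) (\<lambda>x. vb t x - v t x) \<le> \<eta>))))"
proof -
  have whitham_boussinesq: "whitham_boussinesq s \<mu>" if "0 < \<mu>" "\<mu> < 1" for \<mu> using assms(1) that
    by unfold_locales auto
  have c_pos: "0 < whitham_boussinesq.c_wb s" by (rule whitham_boussinesq.c_wb(1)[OF whitham_boussinesq[of "1/2"]]) simp_all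
  show ?thesis
  proof (rule exI[of _ "whitham_boussinesq.c_wb s"], rule conjI[OF c_pos], rule exI[of _ 16], intro conjI allI impI, goal_cases)
    case (2 \<mu> \<zeta>0 v0 \<epsilon>)
    show ?case
      unfolding Let_def using whitham_boussinesq.well_posed[OF whitham_boussinesq[OF 2(1,2)] 2(3,5,6)]
      by (elim exE conjE, intro exI conjI) (assumption+, meson)
  qed simp
qed

end
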